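(* Let $M_k=G_k/K_k$ and $M_n=G_n/K_n$ be symmetric spaces of compact or noncompact type, and assume that $M_k$ propagates $M_n$, with $\mathfrak a_n\subseteq\mathfrak a_k$ as in the context. (1) If $M_n$ does not contain any irreducible factor with $\Psi_{1/2}(\mathfrak g_n,\mathfrak a_n)$ of type $D$, then $$W_{\mathfrak a_n}(\mathfrak g_k,\mathfrak a_k)|_{\mathfrak a_n}=W(\mathfrak g_n,\mathfrak a_n),$$ and the restriction map $\mathrm I_{W(\mathfrak g_k,\mathfrak a_k)}(\mathfrak a_k)\to \mathrm I_{W(\mathfrak g_n,\mathfrak a_n)}(\mathfrak a_n)$ is surjective. (2) If $\Psi_{1/2}(\mathfrak g_n,\mathfrak a_n)$ is of type $D$, then $$W(\mathfrak g_n,\mathfrak a_n)\subsetneqq W_{\mathfrak a_n}(\mathfrak g_k,\mathfrak a_k)|_{\mathfrak a_n}\quad\text{and}\quad \mathrm I_{W(\mathfrak g_k,\mathfrak a_k)}(\mathfrak a_k)|_{\mathfrak a_n}\subsetneqq \mathrm I_{W(\mathfrak g_n,\mathfrak a_n)}(\mathfrak a_n).$$ On the other hand, $\widetilde W(\mathfrak g_n,\mathfrak a_n)=\widetilde W_{\mathfrak a_n}(\mathfrak g_k,\mathfrak a_k)|_{\mathfrak a_n}$ and $\mathrm I_{\widetilde W(\mathfrak g_n,\mathfrak a_n)}(\mathfrak a_n)=\mathrm I_{\widetilde W(\mathfrak g_k,\mathfrak a_k)}(\mathfrak a_k)|_{\mathfrak a_n}$. (3) In all cases $\widetilde W(\mathfrak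 g_n,\mathfrak a_n)=\widetilde W_{\mathfrak a_n}(\mathfrak g_k,\mathfrak a_k)|_{\mathfrak a_n}$ and $\mathrm I_{\widetilde W(\mathfrak g_k,\mathfrak a_k)}(\mathfrak a_k)|_{\mathfrak a_n}=\mathrm I_{\widetilde W(\mathfrak g_n,\mathfrak a_n)}(\mathfrak a_n)$.
   Context: **Setting.** For a Riemannian symmetric space $M=G/K$ of compact or noncompact type, $G$ is a connected semisimple Lie group with involution $\theta$, $(G^\theta)_o\subseteq K\subseteq G^\theta$; $\mathfrak g=\mathfrak k\oplus\mathfrak s$ is the decomposition into $\pm1$ eigenspaces of $\theta$, $\mathfrak a\subset\mathfrak s$ is maximal abelian, $\Sigma(\mathfrak g,\mathfrak a)$ the restricted root system, $W(\mathfrak g,\mathfrak a)$ its Weyl group, $\Sigma_{1/2}(\mathfrak g,\mathfrak a)=\{\alpha\in\Sigma(\mathfrak g,\mathfrak a)\mid\frac12\alpha\notin\Sigma(\mathfrak g,\mathfrak a)\}$ (a reduced root system with the same Weyl group), and $\Psi_{1/2}(\mathfrak g,\mathfrak a)$ the simple roots of a positive system of $\Sigma_{1/2}(\mathfrak g,\mathfrak a)$. **Propagation.** Classical Dynkin diagrams $A_r$ ($r\ge1$), $B_r$ ($r\ge2$), $C_r$ ($r\ge3$), $D_r$ ($r\ge4$) are numbered with $\alpha_1$ at the right end (in types $B,C$ the node $\alpha_1$ is the end node attached by the double bond; in type $D$, $\alpha_1,\alpha_2$ are the two ends of the fork). In standard coordinates $x=(x_s,\dots,x_1)$ with functionals $f_j(x)=x_j$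 the simple roots are $\alpha_1=f_1$ (type $B$), $2f_1$ (type $C$), $f_1+f_2$ (type $D$), and $\alpha_j=f_j-f_{j-1}$ for $2\le j\le r$ in types $B,C,D$; in type $A_r$ they are $f_j-f_{j-1}$, $2\le j\le r+1$, on $\{x\in\mathbb R^{r+1}\mid\sum x_j=0\}$. For irreducible $M_k,M_n$, $M_k$ propagates $M_n$ if $G_n\subseteq G_k$, $K_n=K_k\cap G_n$ (with $\theta_k|_{\mathfrak g_n}=\theta_n$), and either $\mathfrak a_n=\mathfrak a_k$ with the same restricted root system $\Sigma_{1/2}$, or, choosing $\mathfrak a_n\subseteq\mathfrak a_k$, the Dynkin diagram of $\Psi_{1/2}(\mathfrak g_k,\mathfrak a_k)$ is obtained from that of $\Psi_{1/2}(\mathfrak g_n,\mathfrak a_n)$ by only adding simple roots at the left end; in particular both are of the same type. In standard coordinates $\mathfrak a_n\subseteq\mathfrak a_k$ is the embedding $x\mapsto(0,\dots,0,x)$ adding zeros on the left (up to multiplication by $i$ in the compact case). In general, $M_k$ propagates $M_n$ if the irreducible factors of the universal coverings can be enumerated as $\widetilde M_k=M_k^1\times\cdots\times M_k^j$, $\widetilde M_n=M_n^1\times\cdots\times M_n^i$, $i\le j$, so that $M_k^s$ propagates $M_n^s$ for $s=1,\dots,i$; then $\mathfrak a_n=\bigoplus_{s\le i}\mathfrak a_n^s\subseteq\mathfrak a_k=\bigoplus_{s\le j}\mathfrak a_k^s$. **Extended Weyl groups.** $\widetilde W(\mathfrak g,\mathfrak a)$ is the product over the irreducible factors of the following groups: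 the Weyl group $W$ of the factor if its $\Sigma_{1/2}$ is not of type $D$; and, if $\Sigma_{1/2}$ is of type $D_r$, the group $W\rtimes\{1,\sigma\}=\mathfrak S_r\rtimes\{1,-1\}^r$ of all permutations and all sign changes of the standard coordinates, where $\sigma$ is the Dynkin diagram involution exchanging $\alpha_1=f_1+f_2$ and $\alpha_2=f_2-f_1$ and fixing the other simple roots. (The Weyl group of type $D_r$ consists of permutations with an even number of sign changes.) **Notation.** $W_{\mathfrak a_n}(\mathfrak g_k,\mathfrak a_k)=\{w\in W(\mathfrak g_k,\mathfrak a_k)\mid w(\mathfrak a_n)=\mathfrak a_n\}$, and $\widetilde W_{\mathfrak a_n}(\mathfrak g_k,\mathfrak a_k)$ is defined in the same way from $\widetilde W(\mathfrak g_k,\mathfrak a_k)$. $|_{\mathfrak a_n}$ denotes the set of restrictions to $\mathfrak a_n$. $\mathrm I_W(V)$ is the algebra of $W$-invariant polynomial functions on $V$.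
   Formalization: In (2) the strict inclusions are claimed only if a_n differs from the flat a_k^1 of the factor of M_k that propagates M_n; if they coincide (e.g. M_k = M_n of type D, which the definition allows) the two sides are equal and the strict claims fail. Non-strict inclusions are always claimed. *)

theory Defs
  imports "HOL-Analysis.Analysis" "HOL-Algebra.Coset"
begin

section \<open>Lie algebras carried by subspaces\<close>

text \<open>
  A finite-dimensional real Lie algebra is a subspace of an arbitrary Euclidean space together with
  a bracket on that subspace. The inner product of the ambient type is never used; only the
  topology and the linear structure are.
\<close>

definition lie_algebra :: "'v::euclidean_space set \<Rightarrow> ('v \<Rightarrow> 'v \<Rightarrow> 'v) \<Rightarrow> bool" where
  "lie_algebra g br \<longleftrightarrow> subspace g \<and>
     (\<forall>X\<in>g. \<forall>Y\<in>g. br X Y \<in> g) \<and>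
     (\<forall>X\<in>g. \<forall>Y\<in>g. \<forall>Z\<in>g. \<forall>c d. br (c *\<^sub>R X + d *\<^sub>R Y) Z = c *\<^sub>R br X Z + d *\<^sub>R br Y Z) \<and>
     (\<forall>X\<in>g. \<forall>Y\<in>g. \<forall>Z\<in>g. \<forall>c d. br Z (c *\<^sub>R X + d *\<^sub>R Y) = c *\<^sub>R br Z X + d *\<^sub>R br Z Y) \<and>
     (\<forall>X\<in>g. br X X = 0) \<and>
     (\<forall>X\<in>g. \<forall>Y\<in>g. \<forall>Z\<in>g. br X (br Y Z) + br Y (br Z X) + br Z (br X Y) = 0)"

text \<open>The trace of an endomorphism of a subspace; it does not depend on the chosen basis.\<close>

definition trace_on :: "'v::euclidean_space set \<Rightarrow> ('v \<Rightarrow> 'v) \<Rightarrow> real" where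
  "trace_on V h = (let B = (SOME B. independent B \<and> span B = V)
                   in \<Sum>b\<in>B. representation B (h b) b)"

section \<open>Lie groups\<close>

primrec C_k_on :: "nat \<Rightarrow> 'a::real_normed_vector set \<Rightarrow> ('a \<Rightarrow> 'b::real_normed_vector) \<Rightarrow> bool" where
  "C_k_on 0 S f \<longleftrightarrow> continuous_on S f"
| "C_k_on (Suc k) S f \<longleftrightarrow> (\<forall>x\<in>S. f differentiable (at x)) \<and>
     (\<forall>v. C_k_on k S (\<lambda>x. frechet_derivative f (at x) v))"

text \<open>A group with a topology, its Lie algebra, and its exponential map.\<close>

record ('x, 'v) lie_group = "'x monoid" +
  gtop :: "'x topology"
  lalg :: "'v set"
  lbracket :: "'v \<Rightarrow> 'v \<Rightarrow> 'v"
  gexp :: "'v \<Rightarrow> 'x"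

text \<open>
  Connected Lie groups, presented by canonical coordinates of the first kind: \<open>gexp\<close> consists of
  one-parameter subgroups and is a homeomorphism from a neighbourhood of \<open>0\<close> in the Lie algebra onto
  a neighbourhood of the identity, and in this chart multiplication is given near the identity by
  a smooth map \<open>\<mu>\<close>. The left translates of the chart then form a smooth atlas for which the group
  operations are smooth (the group being connected, every element is a product of elements
  from the chart domain). By Baker-Campbell-Hausdorff \<open>\<mu> (X, Y) = X + Y + [X, Y] / 2 + \<dots>\<close>,
  so the mixed second derivative of \<open>\<mu>\<close> at the origin is half the bracket.
\<close>

definition connected_lie_group :: "('x, 'v::euclidean_space, 'm) lie_group_scheme \<Rightarrow> bool" where
  "connected_lie_group L \<longleftrightarrow>
     group L \<and>
     topspace (gtop L) = carrier L \<and> Hausdorff_space (gtop L) \<and> connected_space (gtop L) \<and>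
     continuous_map (prod_topology (gtop L) (gtop L)) (gtop L) (\<lambda>(x, y). x \<otimes>\<^bsub>L\<^esub> y) \<and>
     continuous_map (gtop L) (gtop L) (\<lambda>x. inv\<^bsub>L\<^esub> x) \<and>
     lie_algebra (lalg L) (lbracket L) \<and>
     (\<forall>X\<in>lalg L. gexp L X \<in> carrier L) \<and>
     (\<forall>X\<in>lalg L. \<forall>s t. gexp L ((s + t) *\<^sub>R X) = gexp L (s *\<^sub>R X) \<otimes>\<^bsub>L\<^esub> gexp L (t *\<^sub>R X)) \<and>
     (\<exists>U V \<mu>. open U \<and> 0 \<in> U \<and> open V \<and> 0 \<in> V \<and>
        openin (gtop L) (gexp L ` (U \<inter> lalg L)) \<and>
        homeomorphic_map (top_of_set (U \<inter> lalg L))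
          (subtopology (gtop L) (gexp L ` (U \<inter> lalg L))) (gexp L) \<and>
        (\<forall>k. C_k_on k (V \<times> V) \<mu>) \<and>
        (\<forall>X\<in>V \<inter> lalg L. \<forall>Y\<in>V \<inter> lalg L.
           \<mu> (X, Y) \<in> U \<inter> lalg L \<and> gexp L X \<otimes>\<^bsub>L\<^esub> gexp L Y = gexp L (\<mu> (X, Y))) \<and>
        (\<forall>X\<in>lalg L. \<forall>Y\<in>lalg L.
           ((\<lambda>s. vector_derivative (\<lambda>t. \<mu> (s *\<^sub>R X, t *\<^sub>R Y)) (at 0))
              has_vector_derivative (1 / 2) *\<^sub>R lbracket L X Y) (at 0)))"

text \<open>
  \<open>G\<close> is a Lie subgroup of \<open>H\<close>: the inclusion is a smooth homomorphism whose derivative is the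
  inclusion of the Lie algebras.
\<close>

definition lie_subgroup ::
    "('x, 'v::euclidean_space, 'm) lie_group_scheme \<Rightarrow> ('x, 'v, 'n) lie_group_scheme \<Rightarrow> bool" where
  "lie_subgroup G H \<longleftrightarrow>
     carrier G \<subseteq> carrier H \<and>
     (\<forall>x\<in>carrier G. \<forall>y\<in>carrier G. x \<otimes>\<^bsub>G\<^esub> y = x \<otimes>\<^bsub>H\<^esub> y) \<and>
     continuous_map (gtop G) (gtop H) (\<lambda>x. x) \<and>
     lalg G \<subseteq> lalg H \<and>
     (\<forall>X\<in>lalg G. \<forall>Y\<in>lalg G. lbracket G X Y = lbracket H X Y) \<and>
     (\<forall>X\<in>lalg G. gexp G X = gexp H X)"

definition killing :: "('x, 'v::euclidean_space, 'm) lie_group_scheme \<Rightarrow> 'v \<Rightarrow> 'v \<Rightarrow> real" where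
  "killing L X Y = trace_on (lalg L) (\<lambda>Z. lbracket L X (lbracket L Y Z))"

definition semisimple :: "('x, 'v::euclidean_space, 'm) lie_group_scheme \<Rightarrow> bool" where
  "semisimple L \<longleftrightarrow> (\<forall>X\<in>lalg L. (\<forall>Y\<in>lalg L. killing L X Y = 0) \<longrightarrow> X = 0)"

section \<open>Symmetric spaces\<close>

text \<open>\<open>M = G/K\<close>, where \<open>Theta\<close> is the involution of \<open>G\<close> and \<open>theta\<close> is its derivative.\<close>

record ('x, 'v) symm_space = "('x, 'v) lie_group" +
  Theta :: "'x \<Rightarrow> 'x"
  theta :: "'v \<Rightarrow> 'v"
  Kgrp :: "'x set"

definition fixed_group :: "('x, 'v::euclidean_space) symm_space \<Rightarrow> 'x set" where
  "fixed_group M = {x \<in> carrier M. Theta M x = x}"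

definition symmetric_space :: "('x, 'v::euclidean_space) symm_space \<Rightarrow> bool" where
  "symmetric_space M \<longleftrightarrow>
     connected_lie_group M \<and> semisimple M \<and>
     Theta M \<in> iso M M \<and> continuous_map (gtop M) (gtop M) (Theta M) \<and>
     (\<forall>x\<in>carrier M. Theta M (Theta M x) = x) \<and>
     (\<forall>X\<in>lalg M. theta M X \<in> lalg M \<and> theta M (theta M X) = X) \<and>
     (\<forall>X\<in>lalg M. \<forall>Y\<in>lalg M. \<forall>c d.
        theta M (c *\<^sub>R X + d *\<^sub>R Y) = c *\<^sub>R theta M X + d *\<^sub>R theta M Y) \<and>
     (\<forall>X\<in>lalg M. \<forall>Y\<in>lalg M. theta M (lbracket M X Y) = lbracket M (theta M X) (theta M Y)) \<and>
     (\<forall>X\<in>lalg M. Theta M (gexp M X) = gexp M (theta M X)) \<and>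
     subgroup (Kgrp M) M \<and> Kgrp M \<subseteq> fixed_group M \<and>
     connected_component_of_set (subtopology (gtop M) (fixed_group M)) \<one>\<^bsub>M\<^esub> \<subseteq> Kgrp M"

definition kpart :: "('x, 'v::euclidean_space) symm_space \<Rightarrow> 'v set" where
  "kpart M = {X \<in> lalg M. theta M X = X}"

definition spart :: "('x, 'v::euclidean_space) symm_space \<Rightarrow> 'v set" where
  "spart M = {X \<in> lalg M. theta M X = - X}"

definition compact_type :: "('x, 'v::euclidean_space) symm_space \<Rightarrow> bool" where
  "compact_type M \<longleftrightarrow> (\<forall>X\<in>lalg M. X \<noteq> 0 \<longrightarrow> killing M X X < 0)"

definition noncompact_type :: "('x, 'v::euclidean_space) symm_space \<Rightarrow> bool" where
  "noncompact_type M \<longleftrightarrow>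
     (\<forall>X\<in>kpart M. X \<noteq> 0 \<longrightarrow> killing M X X < 0) \<and> (\<forall>X\<in>spart M. X \<noteq> 0 \<longrightarrow> killing M X X > 0)"

text \<open>
  Irreducibility is that of the isotropy representation. The action of \<open>G\<close> on \<open>G/K\<close> need not be
  effective, so \<open>kpart M\<close> may contain ideals.
\<close>

definition irreducible_space :: "('x, 'v::euclidean_space) symm_space \<Rightarrow> bool" where
  "irreducible_space M \<longleftrightarrow> spart M \<noteq> {0} \<and>
     (\<forall>V. subspace V \<and> V \<subseteq> spart M \<and> (\<forall>X\<in>kpart M. \<forall>Y\<in>V. lbracket M X Y \<in> V)
        \<longrightarrow> V = {0} \<or> V = spart M)"

definition quotient_top :: "'x topology \<Rightarrow> ('x \<Rightarrow> 'y) \<Rightarrow> 'y topology" where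
  "quotient_top X q =
     topology (\<lambda>U. U \<subseteq> q ` topspace X \<and> openin X {x \<in> topspace X. q x \<in> U})"

lemma openin_quotient_top:
  "openin (quotient_top X q) U \<longleftrightarrow> U \<subseteq> q ` topspace X \<and> openin X {x \<in> topspace X. q x \<in> U}"
proof -
  have "istopology (\<lambda>U. U \<subseteq> q ` topspace X \<and> openin X {x \<in> topspace X. q x \<in> U})"
    unfolding istopology_def
  proof (intro conjI allI impI)
    fix S T
    assume S: "S \<subseteq> q ` topspace X \<and> openin X {x \<in> topspace X. q x \<in> S}"
      and T: "T \<subseteq> q ` topspace X \<and> openin X {x \<in> topspace X. q x \<in> T}"
    show "S \<inter> T \<subseteq> q ` topspace X" using S by blast
    have "{x \<in> topspace X. q x \<in> S \<inter> T} =
        {x \<in> topspace X. q x \<in> S} \<inter> {x \<in> topspace X. q x \<in> T}" by blast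
    then show "openin X {x \<in> topspace X. q x \<in> S \<inter> T}" using S T by (simp add: openin_Int)
  next
    fix \<K>
    assume K: "\<forall>S\<in>\<K>. S \<subseteq> q ` topspace X \<and> openin X {x \<in> topspace X. q x \<in> S}"
    show "\<Union> \<K> \<subseteq> q ` topspace X" using K by blast
    have "{x \<in> topspace X. q x \<in> \<Union> \<K>} = (\<Union>S\<in>\<K>. {x \<in> topspace X. q x \<in> S})" by blast
    then show "openin X {x \<in> topspace X. q x \<in> \<Union> \<K>}" using K by (simp add: openin_clauses(3))
  qed
  then show ?thesis by (simp add: quotient_top_def)
qed

definition coset_space :: "('x, 'v::euclidean_space) symm_space \<Rightarrow> 'x set topology" where
  "coset_space M = quotient_top (gtop M) (\<lambda>x. x <#\<^bsub>M\<^esub> Kgrp M)"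

definition simply_connected_top :: "'y topology \<Rightarrow> bool" where
  "simply_connected_top X \<longleftrightarrow> path_connected_space X \<and>
     (\<forall>p. continuous_map (top_of_set {0..1::real}) X p \<and> p 0 = p 1 \<longrightarrow>
        homotopic_with (\<lambda>h. h 0 = p 0 \<and> h 1 = p 0) (top_of_set {0..1}) X p (\<lambda>_. p 0))"

definition lie_ideal :: "('x, 'v::euclidean_space) symm_space \<Rightarrow> 'v set \<Rightarrow> bool" where
  "lie_ideal M I \<longleftrightarrow> subspace I \<and> I \<subseteq> lalg M \<and> (\<forall>X\<in>lalg M. \<forall>Y\<in>I. lbracket M X Y \<in> I)"

text \<open>
  \<open>Fs\<close> enumerates the irreducible factors of the universal covering of \<open>M\<close>: simply connected
  irreducible symmetric spaces whose Lie algebras are ideals of the Lie algebra \<open>g\<close> of \<open>M\<close> (with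
  the induced involution), such that \<open>g\<close> is the direct sum of these ideals and of an ideal contained
  in \<open>k\<close>, which acts trivially on the universal covering. A simply connected
  symmetric space being determined by its Lie algebra and involution, the product of the
  factors is the universal covering.
\<close>

definition universal_cover_factors ::
    "('x, 'v::euclidean_space) symm_space \<Rightarrow> ('x, 'v) symm_space list \<Rightarrow> bool" where
  "universal_cover_factors M Fs \<longleftrightarrow>
     (\<forall>S\<in>set Fs. symmetric_space S \<and> irreducible_space S \<and>
        simply_connected_top (coset_space S) \<and> lie_ideal M (lalg S) \<and>
        (\<forall>X\<in>lalg S. \<forall>Y\<in>lalg S. lbracket S X Y = lbracket M X Y) \<and>
        (\<forall>X\<in>lalg S. theta S X = theta M X)) \<and>
     (\<exists>I. lie_ideal M I \<and> I \<subseteq> kpart M \<and>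
        span (I \<union> (\<Union>S\<in>set Fs. lalg S)) = lalg M \<and>
        dim (lalg M) = dim I + (\<Sum>s<length Fs. dim (lalg (Fs ! s))))"

text \<open>
  For irreducible spaces propagation is defined for the spaces themselves; in general it
  is defined via the universal coverings. Hence an irreducible \<open>M\<close> may also be its own single factor.
\<close>

definition irreducible_factors ::
    "('x, 'v::euclidean_space) symm_space \<Rightarrow> ('x, 'v) symm_space list \<Rightarrow> bool" where
  "irreducible_factors M Fs \<longleftrightarrow>
     (irreducible_space M \<and> Fs = [M]) \<or> universal_cover_factors M Fs"

section \<open>Restricted roots and Weyl groups\<close>

definition maximal_abelian :: "('x, 'v::euclidean_space) symm_space \<Rightarrow> 'v set \<Rightarrow> bool" where
  "maximal_abelian M a \<longleftrightarrow> subspace a \<and> a \<subseteq> spart M \<and>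
     (\<forall>H\<in>a. \<forall>H'\<in>a. lbracket M H H' = 0) \<and>
     (\<forall>X\<in>spart M. (\<forall>H\<in>a. lbracket M H X = 0) \<longrightarrow> X \<in> a)"

text \<open>
  Linear functionals on, and linear maps of, a subspace are represented by extensional functions,
  so that distinct functions are distinct maps of the subspace.
\<close>

definition functionals :: "'v::euclidean_space set \<Rightarrow> ('v \<Rightarrow> real) set" where
  "functionals a = {restrict h a | h. linear h}"

text \<open>
  In the compact case the roots of the complexification take imaginary values on \<open>a\<close>. Dividing
  them by the imaginary unit gives real functionals: \<open>[H, X + iY] = i \<alpha>(H) (X + iY)\<close> for \<open>H\<close> in
  \<open>a\<close>, where the root vector \<open>X + iY\<close> in the complexified Lie algebra is given by the pair \<open>(X, Y)\<close>.
\<close>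

definition restricted_roots ::
    "('x, 'v::euclidean_space) symm_space \<Rightarrow> 'v set \<Rightarrow> ('v \<Rightarrow> real) set" where
  "restricted_roots M a =
     {\<alpha> \<in> functionals a. (\<exists>H\<in>a. \<alpha> H \<noteq> 0) \<and>
        (if compact_type M
         then \<exists>X\<in>lalg M. \<exists>Y\<in>lalg M. (X, Y) \<noteq> (0, 0) \<and>
           (\<forall>H\<in>a. lbracket M H X = - \<alpha> H *\<^sub>R Y \<and> lbracket M H Y = \<alpha> H *\<^sub>R X)
         else \<exists>X\<in>lalg M. X \<noteq> 0 \<and> (\<forall>H\<in>a. lbracket M H X = \<alpha> H *\<^sub>R X))}"

definition half_roots ::
    "('x, 'v::euclidean_space) symm_space \<Rightarrow> 'v set \<Rightarrow> ('v \<Rightarrow> real) set" where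
  "half_roots M a =
     {\<alpha> \<in> restricted_roots M a. (\<lambda>H\<in>a. \<alpha> H / 2) \<notin> restricted_roots M a}"

text \<open>
  With \<open>T\<close> the Killing-dual vector of \<open>\<alpha>\<close>, the coroot is \<open>2 T / \<langle>\<alpha>, \<alpha>\<rangle>\<close>. It does not depend on the
  sign of the (definite) Killing form on \<open>a\<close>.
\<close>

definition coroot :: "('x, 'v::euclidean_space) symm_space \<Rightarrow> 'v set \<Rightarrow> ('v \<Rightarrow> real) \<Rightarrow> 'v" where
  "coroot M a \<alpha> = (let T = (THE T. T \<in> a \<and> (\<forall>H\<in>a. killing M T H = \<alpha> H)) in (2 / \<alpha> T) *\<^sub>R T)"

definition root_reflection ::
    "('x, 'v::euclidean_space) symm_space \<Rightarrow> 'v set \<Rightarrow> ('v \<Rightarrow> real) \<Rightarrow> 'v \<Rightarrow> 'v" where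
  "root_reflection M a \<alpha> = (\<lambda>H\<in>a. H - \<alpha> H *\<^sub>R coroot M a \<alpha>)"

text \<open>Reflections being involutions, closure under products yields the generated group.\<close>

inductive_set weyl_group :: "('x, 'v::euclidean_space) symm_space \<Rightarrow> 'v set \<Rightarrow> ('v \<Rightarrow> 'v) set"
  for M a where
  "(\<lambda>H\<in>a. H) \<in> weyl_group M a"
| "w \<in> weyl_group M a \<Longrightarrow> \<alpha> \<in> restricted_roots M a \<Longrightarrow>
     compose a (root_reflection M a \<alpha>) w \<in> weyl_group M a"

section \<open>Dynkin diagrams and standard coordinates\<close>

datatype classical_type = TypeA | TypeB | TypeC | TypeD

fun admissible_rank :: "classical_type \<Rightarrow> nat \<Rightarrow> bool" where
  "admissible_rank TypeA r \<longleftrightarrow> r \<ge> 1"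
| "admissible_rank TypeB r \<longleftrightarrow> r \<ge> 2"
| "admissible_rank TypeC r \<longleftrightarrow> r \<ge> 3"
| "admissible_rank TypeD r \<longleftrightarrow> r \<ge> 4"

definition num_coords :: "classical_type \<Rightarrow> nat \<Rightarrow> nat" where
  "num_coords X r = (if X = TypeA then r + 1 else r)"

text \<open>
  \<open>std_simple X i k\<close> is the coefficient of the coordinate functional \<open>f\<^sub>k\<close> in the simple root
  \<open>\<alpha>\<^sub>i\<close>. The nodes are \<open>\<alpha>\<^sub>1, \<dots>, \<alpha>\<^sub>r\<close> from right to left; in type \<open>A\<close> the node
  \<open>\<alpha>\<^sub>i\<close> is \<open>f\<^bsub>i+1\<^esub> - f\<^sub>i\<close>.
\<close>

fun std_simple :: "classical_type \<Rightarrow> nat \<Rightarrow> nat \<Rightarrow> real" where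
  "std_simple TypeA i k = of_bool (k = i + 1) - of_bool (k = i)"
| "std_simple TypeB i k =
     (if i = 1 then of_bool (k = 1) else of_bool (k = i) - of_bool (k + 1 = i))"
| "std_simple TypeC i k =
     (if i = 1 then 2 * of_bool (k = 1) else of_bool (k = i) - of_bool (k + 1 = i))"
| "std_simple TypeD i k =
     (if i = 1 then of_bool (k = 1) + of_bool (k = 2) else of_bool (k = i) - of_bool (k + 1 = i))"

definition std_cartan :: "classical_type \<Rightarrow> nat \<Rightarrow> nat \<Rightarrow> nat \<Rightarrow> real" where
  "std_cartan X r i j =
     2 * (\<Sum>k=1..num_coords X r. std_simple X i k * std_simple X j k) /
     (\<Sum>k=1..num_coords X r. std_simple X i k * std_simple X i k)"

definition regular_element :: "('v \<Rightarrow> real) set \<Rightarrow> 'v set \<Rightarrow> 'v \<Rightarrow> bool" where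
  "regular_element R a H\<^sub>0 \<longleftrightarrow> H\<^sub>0 \<in> a \<and> (\<forall>\<alpha>\<in>R. \<alpha> H\<^sub>0 \<noteq> 0)"

text \<open>The positive systems of a root system are the sets of roots positive at a regular element.\<close>

definition positive_roots :: "('v \<Rightarrow> real) set \<Rightarrow> 'v \<Rightarrow> ('v \<Rightarrow> real) set" where
  "positive_roots R H\<^sub>0 = {\<alpha> \<in> R. \<alpha> H\<^sub>0 > 0}"

definition simple_roots ::
    "('v \<Rightarrow> real) set \<Rightarrow> 'v set \<Rightarrow> 'v \<Rightarrow> ('v \<Rightarrow> real) set" where
  "simple_roots R a H\<^sub>0 = {\<alpha> \<in> positive_roots R H\<^sub>0.
     \<not> (\<exists>\<beta>\<in>positive_roots R H\<^sub>0. \<exists>\<gamma>\<in>positive_roots R H\<^sub>0. \<forall>H\<in>a. \<alpha> H = \<beta> H + \<gamma> H)}"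

text \<open>
  \<open>\<alpha> 1, \<dots>, \<alpha> r\<close> are the simple roots of a positive system of the half roots and their Dynkin
  diagram (expressed by the Cartan integers) is the diagram \<open>X\<^sub>r\<close>, with its standard numbering.
\<close>

definition dynkin_numbering :: "classical_type \<Rightarrow> nat \<Rightarrow> ('x, 'v::euclidean_space) symm_space \<Rightarrow>
    'v set \<Rightarrow> (nat \<Rightarrow> 'v \<Rightarrow> real) \<Rightarrow> bool" where
  "dynkin_numbering X r M a \<alpha> \<longleftrightarrow> admissible_rank X r \<and>
     (\<exists>H\<^sub>0. regular_element (half_roots M a) a H\<^sub>0 \<and>
        bij_betw \<alpha> {1..r} (simple_roots (half_roots M a) a H\<^sub>0)) \<and>
     (\<forall>i\<in>{1..r}. \<forall>j\<in>{1..r}. \<alpha> j (coroot M a (\<alpha> i)) = std_cartan X r i j)"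

definition has_type :: "classical_type \<Rightarrow> nat \<Rightarrow> ('x, 'v::euclidean_space) symm_space \<Rightarrow>
    'v set \<Rightarrow> bool" where
  "has_type X r M a \<longleftrightarrow> (\<exists>\<alpha>. dynkin_numbering X r M a \<alpha>)"

text \<open>
  \<open>f k\<close>, for \<open>1 \<le> k \<le> num_coords X r\<close>, are the functionals \<open>x \<mapsto> x\<^sub>k\<close> of a standard coordinate
  system on \<open>a\<close>. As the simple roots form a basis of the dual of \<open>a\<close>, the numbering determines
  the coordinates.
\<close>

definition standard_coordinates :: "classical_type \<Rightarrow> nat \<Rightarrow>
    ('x, 'v::euclidean_space) symm_space \<Rightarrow> 'v set \<Rightarrow> (nat \<Rightarrow> 'v \<Rightarrow> real) \<Rightarrow> bool" where
  "standard_coordinates X r M a f \<longleftrightarrow>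
     (\<forall>k\<in>{1..num_coords X r}. f k \<in> functionals a) \<and>
     (X = TypeA \<longrightarrow> (\<forall>x\<in>a. (\<Sum>k=1..num_coords X r. f k x) = 0)) \<and>
     dynkin_numbering X r M a (\<lambda>i. \<lambda>x\<in>a. \<Sum>k=1..num_coords X r. std_simple X i k * f k x)"

text \<open>
  The extended Weyl group of an irreducible factor of type \<open>D\<close> refers to standard coordinates: for
  \<open>D\<^sub>4\<close> it depends on which end of the diagram is the left one. So the coordinates are a parameter,
  required to be standard whenever the factor has type \<open>D\<close>.
\<close>

definition coordinates_for_D :: "('x, 'v::euclidean_space) symm_space \<Rightarrow> 'v set \<Rightarrow>
    (nat \<Rightarrow> 'v \<Rightarrow> real) \<Rightarrow> bool" where
  "coordinates_for_D M a f \<longleftrightarrow>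
     (\<forall>r. has_type TypeD r M a \<longrightarrow> standard_coordinates TypeD r M a f)"

definition ext_weyl_factor :: "('x, 'v::euclidean_space) symm_space \<Rightarrow> 'v set \<Rightarrow>
    (nat \<Rightarrow> 'v \<Rightarrow> real) \<Rightarrow> ('v \<Rightarrow> 'v) set" where
  "ext_weyl_factor M a f =
     (if \<exists>r. has_type TypeD r M a
      then {w \<in> a \<rightarrow>\<^sub>E a. \<exists>r \<pi> \<epsilon>. has_type TypeD r M a \<and> \<pi> permutes {1..r} \<and>
              (\<forall>k\<in>{1..r}. \<epsilon> k = 1 \<or> \<epsilon> k = (-1::real)) \<and>
              (\<forall>x\<in>a. \<forall>k\<in>{1..r}. f k (w x) = \<epsilon> k * f (\<pi> k) x)}
      else weyl_group M a)"

text \<open>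
  The product of the groups of the factors, acting on \<open>a\<close>, the direct sum of the subspaces
  \<open>a \<inter> lalg (Fs ! s)\<close>.
\<close>

definition ext_weyl_group :: "'v::euclidean_space set \<Rightarrow> ('x, 'v) symm_space list \<Rightarrow>
    (nat \<Rightarrow> nat \<Rightarrow> 'v \<Rightarrow> real) \<Rightarrow> ('v \<Rightarrow> 'v) set" where
  "ext_weyl_group a Fs fs =
     {restrict h a | h. linear h \<and> h ` a \<subseteq> a \<and>
        (\<forall>s<length Fs. restrict h (a \<inter> lalg (Fs ! s)) \<in>
           ext_weyl_factor (Fs ! s) (a \<inter> lalg (Fs ! s)) (fs s))}"

section \<open>Propagation\<close>

text \<open>
  Propagation of irreducible spaces. If the flat subspaces coincide and the type is \<open>D\<close>, the same
  standard coordinates are used on both sides. In the other case both diagrams are \<open>X\<^sub>r\<close> with the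
  same \<open>X\<close>, the larger one arising by adding nodes at the left end, and the inclusion of the
  flat subspaces is \<open>x \<mapsto> (0, \<dots>, 0, x)\<close> in standard coordinates.
\<close>

definition propagates_irreducible :: "('x, 'v::euclidean_space) symm_space \<Rightarrow> 'v set \<Rightarrow>
    (nat \<Rightarrow> 'v \<Rightarrow> real) \<Rightarrow> ('x, 'v) symm_space \<Rightarrow> 'v set \<Rightarrow> (nat \<Rightarrow> 'v \<Rightarrow> real) \<Rightarrow> bool" where
  "propagates_irreducible Mk ak fk Mn an fn \<longleftrightarrow>
     lie_subgroup Mn Mk \<and> Kgrp Mn = Kgrp Mk \<inter> carrier Mn \<and>
     (\<forall>X\<in>lalg Mn. theta Mn X = theta Mk X) \<and> an \<subseteq> ak \<and>
     ((an = ak \<and> half_roots Mn an = half_roots Mk ak \<and>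
        (\<forall>r. has_type TypeD r Mn an \<longrightarrow> (\<forall>k\<in>{1..r}. \<forall>x\<in>an. fk k x = fn k x))) \<or>
      (\<exists>X rk rn. rn \<le> rk \<and>
        standard_coordinates X rk Mk ak fk \<and> standard_coordinates X rn Mn an fn \<and>
        (\<forall>x\<in>an. (\<forall>k\<in>{1..num_coords X rn}. fk k x = fn k x) \<and>
                 (\<forall>k\<in>{num_coords X rn<..num_coords X rk}. fk k x = 0))))"

text \<open>
  \<open>Fk\<close>, \<open>Fn\<close> are the enumerations of the irreducible factors, \<open>fk s\<close>, \<open>fn s\<close> the coordinates on the
  \<open>s\<close>-th factors (numbered from 0).
\<close>

definition propagates :: "('x, 'v::euclidean_space) symm_space \<Rightarrow> 'v set \<Rightarrow>
    ('x, 'v) symm_space list \<Rightarrow> (nat \<Rightarrow> nat \<Rightarrow> 'v \<Rightarrow> real) \<Rightarrow>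
    ('x, 'v) symm_space \<Rightarrow> 'v set \<Rightarrow>
    ('x, 'v) symm_space list \<Rightarrow> (nat \<Rightarrow> nat \<Rightarrow> 'v \<Rightarrow> real) \<Rightarrow> bool" where
  "propagates Mk ak Fk fk Mn an Fn fn \<longleftrightarrow>
     maximal_abelian Mk ak \<and> maximal_abelian Mn an \<and>
     irreducible_factors Mk Fk \<and> irreducible_factors Mn Fn \<and> length Fn \<le> length Fk \<and>
     (\<forall>s<length Fk. coordinates_for_D (Fk ! s) (ak \<inter> lalg (Fk ! s)) (fk s)) \<and>
     (\<forall>s<length Fn. coordinates_for_D (Fn ! s) (an \<inter> lalg (Fn ! s)) (fn s)) \<and>
     (\<forall>s<length Fn. propagates_irreducible
        (Fk ! s) (ak \<inter> lalg (Fk ! s)) (fk s) (Fn ! s) (an \<inter> lalg (Fn ! s)) (fn s))"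

section \<open>Stabilisers and invariants\<close>

definition stabiliser :: "('v \<Rightarrow> 'v) set \<Rightarrow> 'v set \<Rightarrow> ('v \<Rightarrow> 'v) set" where
  "stabiliser W b = {w \<in> W. w ` b = b}"

text \<open>
  The value type \<open>'c\<close> can be the reals or the complex numbers. Every polynomial function on a
  subspace is the restriction of one on the ambient space.
\<close>

definition inv_polys :: "('v::euclidean_space \<Rightarrow> 'v) set \<Rightarrow> 'v set \<Rightarrow>
    ('v \<Rightarrow> 'c::{real_normed_field, euclidean_space}) set" where
  "inv_polys W a =
     {restrict p a | p. polynomial_function p \<and> (\<forall>w\<in>W. \<forall>x\<in>a. p (w x) = p x)}"

definition restrictions :: "'v set \<Rightarrow> ('v \<Rightarrow> 'y) set \<Rightarrow> ('v \<Rightarrow> 'y) set" where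
  "restrictions b F = (\<lambda>f. restrict f b) ` F"

end

theory Submission
  imports Defs
begin

text \<open>
  Everything is reduced to the action of signed permutations on coordinates.

  Restricted roots form a root system on \<open>a\<close>. For noncompact type a root vector and its image under
  the involution generate a copy of \<open>sl\<^sub>2\<close>, whose representation theory shows that root reflections
  permute the roots. Compact type is reduced to this case by passing to the dual algebra
  \<open>k + is\<close> (\<open>restricted_root_system\<close>). The Weyl group is generated by the reflections in the
  simple roots (\<open>simple_reflections_generate\<close>), and in standard coordinates these are adjacent
  transpositions and, for \<open>\<alpha>\<^sub>1\<close> in types \<open>B\<close>, \<open>C\<close>, \<open>D\<close>, a change of one sign or an exchange
  with a change of two signs. So the Weyl group consists of all permutations (type \<open>A\<close>), all signed permutations (types
  \<open>B\<close>, \<open>C\<close>), or the signed permutations with an even number of minus signs (type \<open>D\<close>), see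
  \<open>standard_weyl_group\<close>. The extended group in type \<open>D\<close> is the group of type \<open>B\<close>, so it behaves
  like the Weyl groups of the other types.

  The subspace \<open>an\<close> of \<open>ak\<close> is given by the vanishing of some coordinates. A signed permutation
  that preserves \<open>an\<close> permutes these coordinates among themselves and so restricts to a signed
  permutation of \<open>an\<close>. Only in type \<open>D\<close> is information lost: one sign change on \<open>an\<close> can be
  compensated by a sign change in a coordinate that vanishes there. The restricted group is then
  strictly larger, and the product of the coordinates of \<open>an\<close> is an invariant polynomial of the
  small Weyl group which a restricted invariant cannot be, since it changes sign under the
  restricted group (\<open>propagates_irreducible_strict\<close>).

  Extension of invariants does not use generators of the algebra of invariants. For an invariant
  \<open>q\<close> on \<open>an\<close>, with \<open>n\<close> coordinates, and a set \<open>S\<close> of at most \<open>n\<close> coordinates of \<open>ak\<close>, let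
  \<open>q (x\<^sub>S)\<close> be the value of \<open>q\<close> at the vector with the entries \<open>x k\<close>, \<open>k \<in> S\<close>, padded by zeros;
  by invariance their order is immaterial. The function
  \<open>p x = (\<Sum>S. t (card S) * q (x\<^sub>S))\<close> is invariant for any weights \<open>t\<close>. On \<open>an\<close> a set \<open>S\<close> counts only
  through its intersection with the \<open>n\<close> coordinates of \<open>an\<close>, and \<open>t\<close> can be chosen so that everything
  cancels except for the full intersection, which contributes \<open>q x\<close>
  (\<open>alternating_weights\<close>, \<open>extends_invariants_signed_permutations\<close>). In type \<open>A\<close> the vectors are
  moreover projected to the hyperplane of vanishing coordinate sum.

  For reducible spaces, root vectors lie in single factors, so the Weyl group is a product
  (\<open>weyl_group_product\<close>), restriction is computed in each factor (\<open>product_group_restrict\<close>), and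
  invariants are extended in one factor after the other (\<open>product_invariants_extend\<close>). A space of type
  \<open>D\<close> has a single factor because its diagram is connected.
\<close>

section \<open>Traces and eigenvectors\<close>

lemma expand_orthonormal:
  fixes C :: "'v::euclidean_space set"
  assumes C: "finite C" "pairwise orthogonal C" "\<And>x. x \<in> C \<Longrightarrow> norm x = 1" and v: "v \<in> span C"
  shows "v = (\<Sum>c\<in>C. (c \<bullet> v) *\<^sub>R c)"
proof -
  obtain u where u: "v = (\<Sum>c\<in>C. u c *\<^sub>R c)"
    using v span_finite[OF C(1)] by auto
  have "d \<bullet> v = u d" if d: "d \<in> C" for d
  proof -
    have "d \<bullet> v = (\<Sum>c\<in>C. u c * (d \<bullet> c))" by (simp add: u inner_sum_right)
    also have "\<dots> = (\<Sum>c\<in>C. if c = d then u d else 0)"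
      using C d by (intro sum.cong) (auto simp: pairwise_def orthogonal_def norm_eq_1)
    finally show ?thesis using C(1) d by simp
  qed
  then show ?thesis using u by (metis (no_types, lifting) sum.cong)
qed

text \<open>
  Expressing the trace through an orthonormal basis frees it from the arbitrary choice of a basis.
\<close>

lemma trace_basis_orthonormal:
  fixes V :: "'v::euclidean_space set"
  assumes h: "linear h" "h ` V \<subseteq> V" and B: "independent B" "span B = V"
    and C: "finite C" "pairwise orthogonal C" "\<And>x. x \<in> C \<Longrightarrow> norm x = 1" "span C = V"
  shows "(\<Sum>b\<in>B. representation B (h b) b) = (\<Sum>c\<in>C. c \<bullet> h c)"
proof -
  have BV: "b \<in> V" if "b \<in> B" for b using that B(2) span_base by blast
  have CV: "c \<in> V" if "c \<in> C" for c using that C(4) span_base by blast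
  have finB: "finite B" using B(1) independent_imp_finite by blast
  have rep: "representation B (h b) b = (\<Sum>c\<in>C. (c \<bullet> b) * representation B (h c) b)" if b: "b \<in> B" for b
  proof -
    have "h b = h (\<Sum>c\<in>C. (c \<bullet> b) *\<^sub>R c)"
      using expand_orthonormal[OF C(1-3)] C(4) BV[OF b] by simp
    also have "\<dots> = (\<Sum>c\<in>C. (c \<bullet> b) *\<^sub>R h c)"
      using h(1) by (simp add: linear_sum linear_scale)
    finally have "h b = (\<Sum>c\<in>C. (c \<bullet> b) *\<^sub>R h c)" .
    then have "representation B (h b) = (\<lambda>x. \<Sum>c\<in>C. representation B ((c \<bullet> b) *\<^sub>R h c) x)"
      using B CV h(2) by (simp del: representation_scale) (subst representation_sum, auto intro!: span_scale simp: image_subset_iff)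
    moreover have "representation B ((c \<bullet> b) *\<^sub>R h c) x = (c \<bullet> b) * representation B (h c) x" if "c \<in> C" for c x
      using B CV[OF that] h(2) by (simp add: representation_scale image_subset_iff)
    ultimately show ?thesis by simp
  qed
  have "(\<Sum>b\<in>B. representation B (h b) b) = (\<Sum>c\<in>C. \<Sum>b\<in>B. (c \<bullet> b) * representation B (h c) b)"
    using rep by (simp add: sum.swap[of _ C])
  also have "\<dots> = (\<Sum>c\<in>C. c \<bullet> h c)"
  proof (rule sum.cong[OF refl])
    fix c assume c: "c \<in> C"
    then have hc: "h c \<in> span B" using CV B(2) h(2) by auto
    have "c \<bullet> h c = c \<bullet> (\<Sum>b\<in>B. representation B (h c) b *\<^sub>R b)"
      using sum_representation_eq[OF B(1) hc finB order.refl] by simp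
    then show "(\<Sum>b\<in>B. (c \<bullet> b) * representation B (h c) b) = c \<bullet> h c"
      by (simp add: inner_sum_right mult.commute)
  qed
  finally show ?thesis .
qed

lemma trace_on_orthonormal:
  fixes V :: "'v::euclidean_space set"
  assumes h: "linear h" "h ` V \<subseteq> V"
    and C: "finite C" "pairwise orthogonal C" "\<And>x. x \<in> C \<Longrightarrow> norm x = 1" "span C = V" "independent C"
  shows "trace_on V h = (\<Sum>c\<in>C. c \<bullet> h c)"
proof -
  let ?B = "SOME B. independent B \<and> span B = V"
  have "\<exists>B. independent B \<and> span B = V" using C(4,5) by blast
  then have "independent ?B \<and> span ?B = V" by (rule someI_ex)
  then show ?thesis
    unfolding trace_on_def Let_def using trace_basis_orthonormal[OF h _ _ C(1-4), of ?B] by simp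
qed

lemma orthonormal_basis_exists:
  fixes V :: "'v::euclidean_space set"
  assumes "subspace V"
  obtains C where "finite C" "pairwise orthogonal C" "\<And>x. x \<in> C \<Longrightarrow> norm x = 1" "span C = V" "independent C"
  using orthonormal_basis_subspace[OF assms] independent_imp_finite by metis

lemma trace_on_basis:
  fixes V :: "'v::euclidean_space set"
  assumes "linear h" "h ` V \<subseteq> V" and "independent B" "span B = V"
  shows "trace_on V h = (\<Sum>b\<in>B. representation B (h b) b)"
proof -
  obtain C where C: "finite C" "pairwise orthogonal C" "\<And>x. x \<in> C \<Longrightarrow> norm x = 1" "span C = V" "independent C"
    using orthonormal_basis_exists assms(4) subspace_span by metis
  show ?thesis
    using trace_on_orthonormal[OF assms(1,2) C] trace_basis_orthonormal[OF assms C(1-4)] by simp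
qed

lemma trace_on_cong:
  fixes V :: "'v::euclidean_space set"
  assumes "subspace V" and "\<And>x. x \<in> V \<Longrightarrow> h x = h' x"
  shows "trace_on V h = trace_on V h'"
proof -
  let ?B = "SOME B. independent B \<and> span B = V"
  have "\<exists>B. independent B \<and> span B = V"
    using orthonormal_basis_exists[OF assms(1)] by metis
  then have "independent ?B \<and> span ?B = V" by (rule someI_ex)
  then have "b \<in> V" if "b \<in> ?B" for b using that span_base by blast
  then show ?thesis
    unfolding trace_on_def Let_def using assms(2) by (intro sum.cong) auto
qed

lemma trace_on_add:
  fixes V :: "'v::euclidean_space set"
  assumes "subspace V" "linear h" "h ` V \<subseteq> V" "linear h'" "h' ` V \<subseteq> V"
  shows "trace_on V (\<lambda>x. h x + h' x) = trace_on V h + trace_on V h'"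
proof -
  obtain C where C: "finite C" "pairwise orthogonal C" "\<And>x. x \<in> C \<Longrightarrow> norm x = 1" "span C = V" "independent C"
    using orthonormal_basis_exists[OF assms(1)] by metis
  have "(\<lambda>x. h x + h' x) ` V \<subseteq> V" using assms by (auto intro: subspace_add)
  then show ?thesis
    using trace_on_orthonormal[OF assms(2,3) C] trace_on_orthonormal[OF assms(4,5) C]
      trace_on_orthonormal[OF linear_compose_add[OF assms(2,4)] _ C]
    by (simp add: inner_add_right sum.distrib)
qed

lemma trace_on_scale:
  fixes V :: "'v::euclidean_space set"
  assumes "subspace V" "linear h" "h ` V \<subseteq> V"
  shows "trace_on V (\<lambda>x. c *\<^sub>R h x) = c * trace_on V h"
proof -
  obtain C where C: "finite C" "pairwise orthogonal C" "\<And>x. x \<in> C \<Longrightarrow> norm x = 1" "span C = V" "independent C"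
    using orthonormal_basis_exists[OF assms(1)] by metis
  have "(\<lambda>x. c *\<^sub>R h x) ` V \<subseteq> V" using assms by (auto intro: subspace_scale)
  then show ?thesis
    using trace_on_orthonormal[OF assms(2,3) C] trace_on_orthonormal[OF linear_compose_scale_right[OF assms(2)] _ C]
    by (simp add: sum_distrib_left)
qed

lemma trace_on_commute:
  fixes V :: "'v::euclidean_space set"
  assumes V: "subspace V" and h: "linear h" "h ` V \<subseteq> V" and k: "linear k" "k ` V \<subseteq> V"
  shows "trace_on V (\<lambda>x. h (k x)) = trace_on V (\<lambda>x. k (h x))"
proof -
  obtain C where C: "finite C" "pairwise orthogonal C" "\<And>x. x \<in> C \<Longrightarrow> norm x = 1" "span C = V" "independent C"
    using orthonormal_basis_exists[OF V] by metis
  have CV: "c \<in> V" if "c \<in> C" for c using that C(4) span_base by blast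
  have expand: "trace_on V (\<lambda>x. h (k x)) = (\<Sum>c\<in>C. \<Sum>d\<in>C. (d \<bullet> k c) * (c \<bullet> h d))"
    if h: "linear h" "h ` V \<subseteq> V" and k: "linear k" "k ` V \<subseteq> V" for h k :: "'v \<Rightarrow> 'v"
  proof -
    have "linear (\<lambda>x. h (k x))" "(\<lambda>x. h (k x)) ` V \<subseteq> V"
      using linear_compose[OF k(1) h(1)] h k by (auto simp: comp_def)
    then have "trace_on V (\<lambda>x. h (k x)) = (\<Sum>c\<in>C. c \<bullet> h (k c))"
      by (rule trace_on_orthonormal[OF _ _ C])
    also have "\<dots> = (\<Sum>c\<in>C. c \<bullet> h (\<Sum>d\<in>C. (d \<bullet> k c) *\<^sub>R d))"
    proof (rule sum.cong[OF refl])
      fix c assume "c \<in> C"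
      then have "k c \<in> span C" using k(2) CV C(4) by blast
      then show "c \<bullet> h (k c) = c \<bullet> h (\<Sum>d\<in>C. (d \<bullet> k c) *\<^sub>R d)"
        using expand_orthonormal[OF C(1-3)] by simp
    qed
    also have "\<dots> = (\<Sum>c\<in>C. \<Sum>d\<in>C. (d \<bullet> k c) * (c \<bullet> h d))"
      using h(1) by (simp add: linear_sum linear_scale inner_sum_right)
    finally show ?thesis .
  qed
  have "trace_on V (\<lambda>x. h (k x)) = (\<Sum>c\<in>C. \<Sum>d\<in>C. (d \<bullet> k c) * (c \<bullet> h d))"
    by (rule expand[OF h k])
  also have "\<dots> = (\<Sum>d\<in>C. \<Sum>c\<in>C. (c \<bullet> h d) * (d \<bullet> k c))"
    by (subst sum.swap) (simp add: mult.commute)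
  also have "\<dots> = trace_on V (\<lambda>x. k (h x))"
    by (rule expand[OF k h, symmetric])
  finally show ?thesis .
qed

text \<open>
  Extend a basis of the range to a basis of the whole space: the added vectors contribute nothing.
\<close>

lemma trace_on_subspace:
  fixes V :: "'v::euclidean_space set"
  assumes V: "subspace V" and U: "subspace U" "U \<subseteq> V" and h: "linear h" "h ` V \<subseteq> U"
  shows "trace_on V h = trace_on U h"
proof -
  obtain B where B: "independent B" "span B = U"
    using orthonormal_basis_exists[OF U(1)] by metis
  obtain B' where B': "B \<subseteq> B'" "B' \<subseteq> V" "independent B'" "V \<subseteq> span B'"
    using maximal_independent_subset_extend[of B V] B U(2) span_base by blast
  have spB': "span B' = V" using B'(2,4) V span_minimal by blast
  have fin: "finite B'" using B'(3) independent_imp_finite by blast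
  have "trace_on V h = (\<Sum>b\<in>B'. representation B' (h b) b)"
    using h U(2) B'(3) spB' by (intro trace_on_basis) auto
  also have "\<dots> = (\<Sum>b\<in>B'. representation B (h b) b)"
    using h(2) B(2) B' by (intro sum.cong refl) (metis image_subset_iff representation_extend subsetD)
  also have "\<dots> = (\<Sum>b\<in>B. representation B (h b) b)"
    using fin B'(1) by (intro sum.mono_neutral_right) (auto dest: representation_ne_zero)
  also have "\<dots> = trace_on U h"
    using h U(2) B by (intro trace_on_basis[symmetric]) auto
  finally show ?thesis .
qed

text \<open>
  A maximum of the Rayleigh quotient on the compact unit sphere is an eigenvector. Only the
  definite form \<open>Q\<close> on \<open>V\<close> is related to \<open>A\<close>; the ambient
  inner product serves for compactness.
\<close>

lemma selfadjoint_eigenvector: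
  fixes V :: "'v::euclidean_space set" and Q :: "'v \<Rightarrow> 'v \<Rightarrow> real"
  assumes V: "subspace V" "V \<noteq> {0}" and A: "linear A" "A ` V \<subseteq> V"
    and Q: "bilinear Q" "\<And>x y. x \<in> V \<Longrightarrow> y \<in> V \<Longrightarrow> Q x y = Q y x"
      "\<And>x. x \<in> V \<Longrightarrow> x \<noteq> 0 \<Longrightarrow> Q x x > 0"
    and sa: "\<And>x y. x \<in> V \<Longrightarrow> y \<in> V \<Longrightarrow> Q (A x) y = Q x (A y)"
  obtains v l where "v \<in> V" "v \<noteq> 0" "A v = l *\<^sub>R v"
proof -
  let ?S = "V \<inter> sphere 0 1"
  have "compact ?S" using closed_subspace[OF V(1)] by (simp add: closed_Int_compact)
  moreover have "?S \<noteq> {}"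
  proof -
    obtain x where x: "x \<in> V" "x \<noteq> 0" using V subspace_0 by blast
    then have "(1 / norm x) *\<^sub>R x \<in> ?S" using V(1) by (simp add: subspace_scale)
    then show ?thesis by blast
  qed
  moreover have "continuous_on ?S (\<lambda>x. Q (A x) x / Q x x)"
  proof (rule continuous_on_divide)
    have "continuous_on ?S A"
      using A(1) by (simp add: linear_continuous_on linear_conv_bounded_linear)
    then show "continuous_on ?S (\<lambda>x. Q (A x) x)"
      by (rule bilinear_continuous_on_compose[OF _ continuous_on_id Q(1)])
    show "continuous_on ?S (\<lambda>x. Q x x)"
      by (rule bilinear_continuous_on_compose[OF continuous_on_id continuous_on_id Q(1)])
    show "\<forall>x\<in>?S. Q x x \<noteq> 0" using Q(3) by fastforce
  qed
  ultimately obtain v where v: "v \<in> ?S" "\<And>x. x \<in> ?S \<Longrightarrow> Q (A x) x / Q x x \<le> Q (A v) v / Q v v"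
    using continuous_attains_sup[of ?S "\<lambda>x. Q (A x) x / Q x x"] by blast
  define l where "l = Q (A v) v / Q v v"
  define D where "D x = l * Q x x - Q (A x) x" for x
  have vV: "v \<in> V" "v \<noteq> 0" using v(1) by auto
  note bil = bilinear_ladd[OF Q(1)] bilinear_radd[OF Q(1)] bilinear_lmul[OF Q(1)] bilinear_rmul[OF Q(1)]
    linear_add[OF A(1)] linear_scale[OF A(1)]
  have D0: "D x \<ge> 0" if "x \<in> V" for x
  proof (cases "x = 0")
    case True
    then show ?thesis using bilinear_rzero[OF Q(1)] by (simp add: D_def)
  next
    case False
    define y where "y = (1 / norm x) *\<^sub>R x"
    have "y \<in> ?S" using that V(1) False by (simp add: y_def subspace_scale)
    then have "y \<in> V" "y \<noteq> 0" "Q (A y) y / Q y y \<le> l"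
      using v(2)[of y] by (auto simp: l_def)
    then have "Q y y > 0" "Q (A y) y / Q y y \<le> l" using Q(3) by simp_all
    then have "Q (A y) y \<le> l * Q y y" by (simp add: pos_divide_le_eq)
    moreover have "Q (A y) y = (1 / norm x)\<^sup>2 * Q (A x) x" "Q y y = (1 / norm x)\<^sup>2 * Q x x"
      by (simp_all add: y_def bil power2_eq_square)
    ultimately have "(1 / norm x)\<^sup>2 * Q (A x) x \<le> (1 / norm x)\<^sup>2 * (l * Q x x)" by (simp add: mult.left_commute)
    then have "Q (A x) x \<le> l * Q x x" using False by (simp add: mult_le_cancel_left)
    then show ?thesis by (simp add: D_def)
  qed
  have Dv: "D v = 0" using Q(3)[OF vV] by (simp add: D_def l_def)
  have "l * Q v w - Q (A v) w = 0" if w: "w \<in> V" for w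
  proof -
    define k where "k = l * Q v w - Q (A v) w"
    \<comment> \<open>the first-order condition at a maximum of the Rayleigh quotient\<close>
    have exp: "D (v + t *\<^sub>R w) = 2 * t * k + t\<^sup>2 * D w" for t
    proof -
      have "D (v + t *\<^sub>R w) = D v + t * (l * Q v w + l * Q w v - Q (A v) w - Q (A w) v) + t\<^sup>2 * D w"
        by (simp add: D_def bil algebra_simps power2_eq_square)
      moreover have "Q w v = Q v w" "Q (A w) v = Q (A v) w"
        using Q(2) sa vV w A(2) by (auto simp: image_subset_iff)
      ultimately show ?thesis using Dv by (simp add: k_def algebra_simps)
    qed
    define m where "m = D w"
    have m: "m \<ge> 0" using D0[OF w] by (simp add: m_def)
    \<comment> \<open>for \<open>t = - k / (m + 1)\<close> the polynomial \<open>2 t k + t\<^sup>2 m\<close> is negative unless \<open>k = 0\<close>\<close>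
    have "v + (- k / (m + 1)) *\<^sub>R w \<in> V"
      using vV w V(1) by (simp add: subspace_diff subspace_scale)
    then have "0 \<le> 2 * (- k / (m + 1)) * k + (- k / (m + 1))\<^sup>2 * m"
      using D0 exp m_def by metis
    also have "\<dots> = - (k\<^sup>2 * (m + 2)) / (m + 1)\<^sup>2"
      using m by (simp add: divide_simps power2_eq_square) (simp add: algebra_simps)
    finally have "k\<^sup>2 * (m + 2) \<le> 0"
      using m by (simp add: divide_simps split: if_splits)
    then have "k\<^sup>2 \<le> 0" using m by (simp add: mult_le_0_iff)
    then show ?thesis by (simp add: k_def)
  qed
  moreover have wV: "l *\<^sub>R v - A v \<in> V"
    using vV A(2) V(1) by (auto intro!: subspace_diff subspace_scale)
  ultimately have "Q (l *\<^sub>R v - A v) (l *\<^sub>R v - A v) = 0"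
    using bilinear_lsub[OF Q(1)] bilinear_lmul[OF Q(1)] by simp
  then have "l *\<^sub>R v - A v = 0" using Q(3)[OF wV] by force
  then show ?thesis using that[of v l] vV by simp
qed

text \<open>
  In a nonzero common invariant subspace of least dimension, an eigenspace of one of the operators
  is again invariant under all of them, so it is the whole subspace.
\<close>

lemma simultaneous_eigenvector:
  fixes V :: "'v::euclidean_space set" and Q :: "'v \<Rightarrow> 'v \<Rightarrow> real"
  assumes V: "subspace V" "V \<noteq> {0}"
    and A: "\<And>i. i \<in> I \<Longrightarrow> linear (A i)" "\<And>i. i \<in> I \<Longrightarrow> A i ` V \<subseteq> V"
    and Q: "bilinear Q" "\<And>x y. x \<in> V \<Longrightarrow> y \<in> V \<Longrightarrow> Q x y = Q y x"
      "\<And>x. x \<in> V \<Longrightarrow> x \<noteq> 0 \<Longrightarrow> Q x x > 0"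
    and sa: "\<And>i x y. i \<in> I \<Longrightarrow> x \<in> V \<Longrightarrow> y \<in> V \<Longrightarrow> Q (A i x) y = Q x (A i y)"
    and comm: "\<And>i j x. i \<in> I \<Longrightarrow> j \<in> I \<Longrightarrow> x \<in> V \<Longrightarrow> A i (A j x) = A j (A i x)"
  obtains v where "v \<in> V" "v \<noteq> 0" "\<And>i. i \<in> I \<Longrightarrow> \<exists>l. A i v = l *\<^sub>R v"
proof -
  define P where "P F \<longleftrightarrow> subspace F \<and> F \<noteq> {0} \<and> F \<subseteq> V \<and> (\<forall>i\<in>I. A i ` F \<subseteq> F)" for F
  have PV: "P V" using V A(2) by (simp add: P_def)
  define F where "F = arg_min dim P"
  have F: "P F" and Fmin: "\<And>F'. P F' \<Longrightarrow> dim F \<le> dim F'"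
    using arg_min_nat_lemma[of P V dim, OF PV] by (simp_all add: F_def)
  have FV: "x \<in> V" if "x \<in> F" for x using F that by (auto simp: P_def)
  have eig: "\<exists>l. \<forall>v\<in>F. A i v = l *\<^sub>R v" if i: "i \<in> I" for i
  proof -
    have F': "subspace F" "F \<noteq> {0}" "A i ` F \<subseteq> F" using F i by (simp_all add: P_def)
    obtain v l where v: "v \<in> F" "v \<noteq> 0" "A i v = l *\<^sub>R v"
      by (rule selfadjoint_eigenvector[OF F'(1,2) A(1)[OF i] F'(3) Q(1)]) (simp_all add: Q FV sa i)
    define F' where "F' = {x \<in> F. A i x = l *\<^sub>R x}"
    have "subspace F'"
      using F linear_add[OF A(1)[OF i]] linear_scale[OF A(1)[OF i]] linear_0[OF A(1)[OF i]]
      unfolding F'_def P_def by (auto simp: subspace_def scaleR_right_distrib)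
    moreover have "A j x \<in> F'" if "j \<in> I" "x \<in> F'" for j x
    proof -
      have "A i (A j x) = A j (l *\<^sub>R x)"
        using comm[OF i that(1)] FV that(2) by (simp add: F'_def)
      moreover have "A j x \<in> F" using F that by (auto simp only: F'_def P_def)
      ultimately show ?thesis
        using linear_scale[OF A(1)[OF that(1)]] by (simp add: F'_def)
    qed
    moreover have "F' \<subseteq> F" by (auto simp: F'_def)
    ultimately have "P F'" using F v by (auto simp: P_def F'_def)
    then have "dim F \<le> dim F'" by (rule Fmin)
    then have "F' = F"
      using subspace_dim_equal[OF \<open>subspace F'\<close> _ \<open>F' \<subseteq> F\<close>] F by (simp add: P_def)
    then show ?thesis by (auto simp: F'_def)
  qed
  obtain v where "v \<in> F" "v \<noteq> 0" using F subspace_0 by (auto simp: P_def)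
  then show ?thesis using that eig FV by blast
qed

section \<open>Functionals on a subspace\<close>

lemma functional_linear:
  assumes "\<alpha> \<in> functionals a"
  obtains h where "linear h" "\<alpha> = restrict h a"
  using assms by (auto simp: functionals_def)

lemma functionalI:
  assumes "linear h" "\<And>x. x \<in> a \<Longrightarrow> \<alpha> x = h x" "\<alpha> \<in> extensional a"
  shows "\<alpha> \<in> functionals a"
proof -
  have "\<alpha> = restrict h a" using assms(2,3) by (auto simp: extensional_def fun_eq_iff)
  then show ?thesis using assms(1) by (auto simp: functionals_def)
qed

lemma functional_add:
  assumes "\<alpha> \<in> functionals a" "subspace a" "x \<in> a" "y \<in> a"
  shows "\<alpha> (x + y) = \<alpha> x + \<alpha> y"
  using assms by (auto simp: functionals_def linear_add subspace_add)

lemma functional_scale: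
  assumes "\<alpha> \<in> functionals a" "subspace a" "x \<in> a"
  shows "\<alpha> (c *\<^sub>R x) = c * \<alpha> x"
  using assms by (auto simp: functionals_def linear_scale subspace_scale)

lemma functional_diff:
  assumes "\<alpha> \<in> functionals a" "subspace a" "x \<in> a" "y \<in> a"
  shows "\<alpha> (x - y) = \<alpha> x - \<alpha> y"
  using assms by (auto simp: functionals_def linear_diff subspace_diff)

lemma functional_zero:
  assumes "\<alpha> \<in> functionals a" "subspace a"
  shows "\<alpha> 0 = 0"
  using assms by (auto simp: functionals_def linear_0 subspace_0)

lemma functional_eqI:
  assumes "\<alpha> \<in> functionals a" "\<beta> \<in> functionals a" "\<And>x. x \<in> a \<Longrightarrow> \<alpha> x = \<beta> x"
  shows "\<alpha> = \<beta>"
  using assms by (auto simp: functionals_def fun_eq_iff)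

lemma functional_comb:
  assumes "\<alpha> \<in> functionals a" "\<beta> \<in> functionals a"
  shows "(\<lambda>x\<in>a. \<alpha> x + c * \<beta> x) \<in> functionals a"
proof -
  obtain h k where hk: "linear h" "\<alpha> = restrict h a" "linear k" "\<beta> = restrict k a"
    using assms by (metis functional_linear)
  have "linear (\<lambda>x. h x + c * k x)"
    using hk by (intro linearI) (simp_all add: linear_add linear_scale algebra_simps)
  then show ?thesis by (rule functionalI) (simp_all add: hk)
qed

lemma functional_mult:
  assumes "\<alpha> \<in> functionals a"
  shows "(\<lambda>x\<in>a. c * \<alpha> x) \<in> functionals a"
proof -
  obtain h where hk: "linear h" "\<alpha> = restrict h a"
    using assms by (metis functional_linear)
  have "linear (\<lambda>x. c * h x)"
    using hk by (intro linearI) (simp_all add: linear_add linear_scale algebra_simps)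
  then show ?thesis by (rule functionalI) (simp_all add: hk)
qed

section \<open>Restricted roots\<close>

text \<open>
  Bracket and involution are total on the ambient space and take values in \<open>g\<close>. A Lie
  algebra structure given only on \<open>g\<close> is brought into this form by a linear
  projection to \<open>g\<close>; in return, \<open>linear\<close> and \<open>bilinear\<close>
  apply without side conditions.
\<close>

locale involutive_lie_algebra =
  fixes g :: "'v::euclidean_space set" and br :: "'v \<Rightarrow> 'v \<Rightarrow> 'v" and th :: "'v \<Rightarrow> 'v"
  assumes subspace_g: "subspace g"
    and bilinear_br: "bilinear br"
    and linear_th: "linear th"
    and br_closed: "br X Y \<in> g"
    and th_closed: "th X \<in> g"
    and br_self: "br X X = 0"
    and jacobi: "br X (br Y Z) + br Y (br Z X) + br Z (br X Y) = 0"
    and th_th: "X \<in> g \<Longrightarrow> th (th X) = X"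
    and th_br: "th (br X Y) = br (th X) (th Y)"
begin

lemmas br_simps =
  bilinear_ladd[OF bilinear_br] bilinear_radd[OF bilinear_br]
  bilinear_lsub[OF bilinear_br] bilinear_rsub[OF bilinear_br]
  bilinear_lmul[OF bilinear_br] bilinear_rmul[OF bilinear_br]
  bilinear_lneg[OF bilinear_br] bilinear_rneg[OF bilinear_br]
  bilinear_lzero[OF bilinear_br] bilinear_rzero[OF bilinear_br]

lemmas th_simps = linear_add[OF linear_th] linear_diff[OF linear_th] linear_scale[OF linear_th]
  linear_neg[OF linear_th] linear_0[OF linear_th]

lemma linear_ad: "linear (br X)"
  using bilinear_br by (simp add: bilinear_def)

lemma br_skew: "br Y X = - br X Y"
proof -
  have "br (X + Y) (X + Y) = br X X + br X Y + (br Y X + br Y Y)"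
    by (simp only: bilinear_ladd[OF bilinear_br] bilinear_radd[OF bilinear_br] add_ac)
  then have "br X Y + br Y X = 0" by (simp add: br_self)
  then show ?thesis by (simp add: add_eq_0_iff)
qed

lemma ad_br: "br (br X Y) Z = br X (br Y Z) - br Y (br X Z)"
proof -
  have "br Y (br Z X) = - br Y (br X Z)" by (metis br_simps(8) br_skew)
  moreover have "br Z (br X Y) = - br (br X Y) Z" by (rule br_skew)
  ultimately show ?thesis using jacobi[of X Y Z] by (simp add: algebra_simps)
qed

lemma linear_ad2: "linear (\<lambda>Z. br X (br Y Z))"
  by (intro linearI) (simp_all add: br_simps)

text \<open>The Killing form.\<close>

definition kf :: "'v \<Rightarrow> 'v \<Rightarrow> real" where
  "kf X Y = trace_on g (\<lambda>Z. br X (br Y Z))"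

lemma kf_sym: "kf X Y = kf Y X"
  unfolding kf_def
  by (rule trace_on_commute[OF subspace_g linear_ad _ linear_ad]) (auto simp: br_closed)

lemma kf_add: "kf (X + X') Y = kf X Y + kf X' Y"
proof -
  have "kf (X + X') Y = trace_on g (\<lambda>Z. br X (br Y Z) + br X' (br Y Z))"
    unfolding kf_def by (simp add: br_simps)
  also have "\<dots> = kf X Y + kf X' Y"
    unfolding kf_def by (rule trace_on_add[OF subspace_g linear_ad2 _ linear_ad2]) (auto simp: br_closed)
  finally show ?thesis .
qed

lemma kf_scale: "kf (c *\<^sub>R X) Y = c * kf X Y"
proof -
  have "kf (c *\<^sub>R X) Y = trace_on g (\<lambda>Z. c *\<^sub>R br X (br Y Z))"
    unfolding kf_def by (simp add: br_simps)
  also have "\<dots> = c * kf X Y"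
    unfolding kf_def by (rule trace_on_scale[OF subspace_g linear_ad2]) (auto simp: br_closed)
  finally show ?thesis .
qed

lemma bilinear_kf: "bilinear kf"
proof -
  have "linear (\<lambda>X. kf X Y)" for Y by (intro linearI) (simp_all add: kf_add kf_scale)
  then show ?thesis unfolding bilinear_def by (metis (no_types, lifting) ext kf_sym)
qed

lemmas kf_simps =
  bilinear_ladd[OF bilinear_kf] bilinear_radd[OF bilinear_kf]
  bilinear_lsub[OF bilinear_kf] bilinear_rsub[OF bilinear_kf]
  bilinear_lmul[OF bilinear_kf] bilinear_rmul[OF bilinear_kf]
  bilinear_lneg[OF bilinear_kf] bilinear_rneg[OF bilinear_kf]
  bilinear_lzero[OF bilinear_kf] bilinear_rzero[OF bilinear_kf]

text \<open>Cyclicity of the trace, applied to \<open>ad (br X Y) = [ad X, ad Y]\<close>.\<close>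

lemma kf_invariant: "kf (br X Y) Z = kf X (br Y Z)"
proof -
  have lin3: "linear (\<lambda>W. br A (br B (br C W)))" for A B C
    by (intro linearI) (simp_all add: br_simps)
  have "kf (br X Y) Z = trace_on g (\<lambda>W. br X (br Y (br Z W)) + (-1) *\<^sub>R br Y (br X (br Z W)))"
    unfolding kf_def by (simp add: ad_br)
  also have "\<dots> = trace_on g (\<lambda>W. br X (br Y (br Z W))) + trace_on g (\<lambda>W. (-1) *\<^sub>R br Y (br X (br Z W)))"
    by (rule trace_on_add[OF subspace_g lin3 _ linear_compose_scale_right[OF lin3]])
       (auto simp: br_closed subspace_neg[OF subspace_g])
  also have "trace_on g (\<lambda>W. (-1) *\<^sub>R br Y (br X (br Z W))) = - trace_on g (\<lambda>W. br Y (br X (br Z W)))"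
    by (subst trace_on_scale[OF subspace_g lin3]) (auto simp: br_closed)
  also have "trace_on g (\<lambda>W. br Y (br X (br Z W))) = trace_on g (\<lambda>W. br X (br Z (br Y W)))"
    by (rule trace_on_commute[OF subspace_g linear_ad _ linear_ad2]) (auto simp: br_closed)
  finally have 1: "kf (br X Y) Z =
      trace_on g (\<lambda>W. br X (br Y (br Z W))) - trace_on g (\<lambda>W. br X (br Z (br Y W)))" by simp
  have "kf X (br Y Z) = trace_on g (\<lambda>W. br X (br Y (br Z W)) + (-1) *\<^sub>R br X (br Z (br Y W)))"
    unfolding kf_def by (simp add: ad_br br_simps)
  also have "\<dots> = trace_on g (\<lambda>W. br X (br Y (br Z W))) + trace_on g (\<lambda>W. (-1) *\<^sub>R br X (br Z (br Y W)))"
    by (rule trace_on_add[OF subspace_g lin3 _ linear_compose_scale_right[OF lin3]])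
       (auto simp: br_closed subspace_neg[OF subspace_g])
  also have "trace_on g (\<lambda>W. (-1) *\<^sub>R br X (br Z (br Y W))) = - trace_on g (\<lambda>W. br X (br Z (br Y W)))"
    by (subst trace_on_scale[OF subspace_g lin3]) (auto simp: br_closed)
  finally show ?thesis using 1 by simp
qed

lemma kf_th: "X \<in> g \<Longrightarrow> Y \<in> g \<Longrightarrow> kf (th X) (th Y) = kf X Y"
proof -
  assume X: "X \<in> g" and Y: "Y \<in> g"
  have lin: "linear (\<lambda>Z. br X (br Y (th Z)))"
    by (intro linearI) (simp_all add: br_simps th_simps)
  have "kf (th X) (th Y) = trace_on g (\<lambda>Z. th (br X (br Y (th Z))))"
    unfolding kf_def by (rule trace_on_cong[OF subspace_g]) (simp add: th_br th_th)
  also have "\<dots> = trace_on g (\<lambda>Z. br X (br Y (th (th Z))))"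
    by (rule trace_on_commute[OF subspace_g linear_th _ lin]) (auto simp: br_closed th_closed)
  also have "\<dots> = kf X Y"
    unfolding kf_def by (rule trace_on_cong[OF subspace_g]) (simp add: th_th)
  finally show ?thesis .
qed

end

text \<open>
  The sign conditions say that \<open>th\<close> is a Cartan involution; by them the Killing form is positive definite on \<open>a\<close>.
\<close>

locale noncompact_lie_algebra = involutive_lie_algebra g br th
  for g :: "'v::euclidean_space set" and br th +
  fixes a :: "'v set"
  assumes kf_neg: "X \<in> g \<Longrightarrow> th X = X \<Longrightarrow> X \<noteq> 0 \<Longrightarrow> kf X X < 0"
    and kf_pos: "X \<in> g \<Longrightarrow> th X = - X \<Longrightarrow> X \<noteq> 0 \<Longrightarrow> kf X X > 0"
    and subspace_a: "subspace a"
    and a_g: "H \<in> a \<Longrightarrow> H \<in> g"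
    and a_s: "H \<in> a \<Longrightarrow> th H = - H"
    and a_comm: "H \<in> a \<Longrightarrow> H' \<in> a \<Longrightarrow> br H H' = 0"
    and a_max: "X \<in> g \<Longrightarrow> th X = - X \<Longrightarrow> (\<And>H. H \<in> a \<Longrightarrow> br H X = 0) \<Longrightarrow> X \<in> a"
begin

text \<open>
  The positive definite form given by the Killing form and the Cartan involution. The operators
  \<open>ad H\<close>, for \<open>H \<in> a\<close>, are symmetric for it.
\<close>

definition Bt :: "'v \<Rightarrow> 'v \<Rightarrow> real" where
  "Bt X Y = - kf X (th Y)"

lemma bilinear_Bt: "bilinear Bt"
  unfolding bilinear_def Bt_def
  by (auto intro!: linearI simp: kf_simps th_simps)

lemma Bt_sym: "X \<in> g \<Longrightarrow> Y \<in> g \<Longrightarrow> Bt X Y = Bt Y X"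
  unfolding Bt_def by (metis kf_sym kf_th th_closed th_th)

lemma Bt_pos:
  assumes "X \<in> g" "X \<noteq> 0"
  shows "Bt X X > 0"
proof -
  define K where "K = (1/2) *\<^sub>R (X + th X)"
  define S where "S = (1/2) *\<^sub>R (X - th X)"
  have "K \<in> g" "S \<in> g"
    using assms(1) th_closed subspace_g by (simp_all add: K_def S_def subspace_add subspace_diff subspace_scale)
  moreover have "th K = K" "th S = - S"
    using assms(1) by (simp_all add: K_def S_def th_simps th_th algebra_simps)
  moreover have XKS: "X = K + S" "th X = K - S"
    by (simp_all add: K_def S_def algebra_simps flip: scaleR_add_left)
  ultimately have "kf K K < 0 \<or> K = 0" "kf S S > 0 \<or> S = 0" using kf_neg kf_pos by blast+
  moreover have "K \<noteq> 0 \<or> S \<noteq> 0" using assms(2) XKS by auto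
  moreover have "Bt X X = - kf K K + kf S S"
    unfolding Bt_def XKS(2) by (subst XKS(1)) (simp add: kf_simps kf_sym[of S K])
  ultimately show ?thesis by (auto simp: kf_simps)
qed

lemma Bt_ad: "H \<in> a \<Longrightarrow> Bt (br H X) Y = Bt X (br H Y)"
proof -
  assume H: "H \<in> a"
  have "Bt (br H X) Y = kf (br X H) (th Y)" unfolding Bt_def by (subst br_skew) (simp add: kf_simps)
  also have "\<dots> = kf X (br H (th Y))" by (rule kf_invariant)
  also have "br H (th Y) = - th (br H Y)" using H by (simp add: th_br a_s br_simps)
  finally show ?thesis by (simp add: Bt_def kf_simps)
qed

lemma a_commute: "H \<in> a \<Longrightarrow> H' \<in> a \<Longrightarrow> br H (br H' X) = br H' (br H X)"
  using ad_br[of H H' X] a_comm[of H H'] by (simp add: br_simps)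

definition wspace :: "('v \<Rightarrow> real) \<Rightarrow> 'v set" where
  "wspace \<beta> = {Z \<in> g. \<forall>H\<in>a. br H Z = \<beta> H *\<^sub>R Z}"

definition weights :: "('v \<Rightarrow> real) set" where
  "weights = {\<beta> \<in> functionals a. \<exists>Z\<in>wspace \<beta>. Z \<noteq> 0}"

definition roots :: "('v \<Rightarrow> real) set" where
  "roots = {\<alpha> \<in> functionals a. (\<exists>H\<in>a. \<alpha> H \<noteq> 0) \<and> (\<exists>X\<in>g. X \<noteq> 0 \<and> (\<forall>H\<in>a. br H X = \<alpha> H *\<^sub>R X))}"

lemma roots_weights: "\<alpha> \<in> roots \<longleftrightarrow> \<alpha> \<in> weights \<and> (\<exists>H\<in>a. \<alpha> H \<noteq> 0)"
  unfolding roots_def weights_def wspace_def by blast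

lemma wspace_cong: "(\<And>H. H \<in> a \<Longrightarrow> \<beta> H = \<gamma> H) \<Longrightarrow> wspace \<beta> = wspace \<gamma>"
  unfolding wspace_def by auto

lemma br_wspace:
  assumes "X \<in> wspace \<alpha>" "Y \<in> wspace \<beta>"
  shows "br X Y \<in> wspace (\<lambda>H. \<alpha> H + \<beta> H)"
proof -
  have "br H (br X Y) = (\<alpha> H + \<beta> H) *\<^sub>R br X Y" if "H \<in> a" for H
    using ad_br[of H X Y] assms that by (simp add: wspace_def br_simps algebra_simps)
  then show ?thesis by (simp add: wspace_def br_closed)
qed

lemma weight_vectors_zero:
  assumes "finite F" "F \<subseteq> functionals a" "\<And>\<beta>. \<beta> \<in> F \<Longrightarrow> v \<beta> \<in> wspace \<beta>" "(\<Sum>\<beta>\<in>F. v \<beta>) = 0"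
  shows "\<forall>\<beta>\<in>F. v \<beta> = 0"
  using assms
proof (induction F arbitrary: v rule: finite_induct)
  case empty
  then show ?case by simp
next
  case (insert \<gamma> F)
  have z: "v \<beta> = 0" if \<beta>: "\<beta> \<in> F" for \<beta>
  proof -
    have "\<beta> \<noteq> \<gamma>" using \<beta> insert.hyps by blast
    then obtain H where H: "H \<in> a" "\<beta> H \<noteq> \<gamma> H"
      using functional_eqI insert.prems(1) \<beta> by (metis insertCI subsetD)
    have "br H (\<Sum>\<beta>\<in>insert \<gamma> F. v \<beta>) = (\<Sum>\<beta>\<in>insert \<gamma> F. \<beta> H *\<^sub>R v \<beta>)"
      using insert.prems(2) H(1) by (simp only: linear_sum[OF linear_ad]) (auto intro!: sum.cong simp: wspace_def)
    then have "(\<Sum>\<beta>\<in>insert \<gamma> F. \<beta> H *\<^sub>R v \<beta>) = 0" using insert.prems(3) by (simp add: br_simps)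
    moreover have "(\<Sum>\<beta>\<in>insert \<gamma> F. \<gamma> H *\<^sub>R v \<beta>) = 0"
      using insert.prems(3) by (simp only: scaleR_sum_right[symmetric]) simp
    ultimately have "(\<Sum>\<beta>\<in>insert \<gamma> F. (\<beta> H - \<gamma> H) *\<^sub>R v \<beta>) = 0"
      by (simp only: scaleR_diff_left sum_subtractf diff_zero)
    then have "(\<Sum>\<beta>\<in>F. (\<beta> H - \<gamma> H) *\<^sub>R v \<beta>) = 0" using insert.hyps by simp
    moreover have "(\<beta>' H - \<gamma> H) *\<^sub>R v \<beta>' \<in> wspace \<beta>'" if "\<beta>' \<in> F" for \<beta>'
      using insert.prems(2)[of \<beta>'] that subspace_scale[OF subspace_g]
      by (auto simp: wspace_def br_simps)
    ultimately have "\<forall>\<beta>'\<in>F. (\<beta>' H - \<gamma> H) *\<^sub>R v \<beta>' = 0"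
      using insert.IH[of "\<lambda>\<beta>'. (\<beta>' H - \<gamma> H) *\<^sub>R v \<beta>'"] insert.prems(1) by simp
    then show ?thesis using \<beta> H(2) by auto
  qed
  then have "v \<gamma> = 0" using insert.prems(3) insert.hyps by simp
  then show ?case using z by blast
qed

lemma finite_weights: "finite weights"
proof -
  define v where "v \<beta> = (SOME Z. Z \<in> wspace \<beta> \<and> Z \<noteq> 0)" for \<beta>
  have v: "v \<beta> \<in> wspace \<beta> \<and> v \<beta> \<noteq> 0" if "\<beta> \<in> weights" for \<beta>
  proof -
    have "\<exists>Z. Z \<in> wspace \<beta> \<and> Z \<noteq> 0" using that by (auto simp: weights_def)
    then show ?thesis unfolding v_def by (rule someI_ex)
  qed
  have wf: "weights \<subseteq> functionals a" by (auto simp: weights_def)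
  have zero: "\<forall>\<beta>\<in>F. c \<beta> = 0" if F: "finite F" "F \<subseteq> weights" "(\<Sum>\<beta>\<in>F. c \<beta> *\<^sub>R v \<beta>) = 0" for F c
  proof -
    have "c \<beta> *\<^sub>R v \<beta> \<in> wspace \<beta>" if "\<beta> \<in> F" for \<beta>
      using v[of \<beta>] that F(2) subspace_scale[OF subspace_g] by (auto simp: wspace_def br_simps)
    then have "\<forall>\<beta>\<in>F. c \<beta> *\<^sub>R v \<beta> = 0"
      using weight_vectors_zero[of F "\<lambda>\<beta>. c \<beta> *\<^sub>R v \<beta>"] F wf by auto
    then show ?thesis using v F(2) by auto
  qed
  have inj: "inj_on v weights"
  proof (rule inj_onI, rule ccontr)
    fix \<beta> \<gamma> assume bg: "\<beta> \<in> weights" "\<gamma> \<in> weights" "v \<beta> = v \<gamma>" "\<beta> \<noteq> \<gamma>"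
    have "(\<Sum>\<delta>\<in>{\<beta>, \<gamma>}. (if \<delta> = \<beta> then 1 else -1) *\<^sub>R v \<delta>) = 0" using bg(3,4) by auto
    then show False using zero[of "{\<beta>, \<gamma>}" "\<lambda>\<delta>. if \<delta> = \<beta> then 1 else -1"] bg by auto
  qed
  have "independent (v ` weights)"
  proof
    assume "dependent (v ` weights)"
    then obtain U u where U: "finite U" "U \<subseteq> v ` weights" "(\<Sum>x\<in>U. u x *\<^sub>R x) = 0" "\<exists>x\<in>U. u x \<noteq> 0"
      unfolding dependent_explicit by blast
    obtain F where F: "F \<subseteq> weights" "U = v ` F" using U(2) by (meson subset_imageE)
    have injF: "inj_on v F" using inj F(1) by (rule inj_on_subset)
    then have "finite F" using U(1) F(2) finite_imageD by blast
    moreover have "(\<Sum>\<beta>\<in>F. u (v \<beta>) *\<^sub>R v \<beta>) = 0" using U(3) F(2) by (simp add: sum.reindex[OF injF])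
    ultimately show False using zero[of F "\<lambda>\<beta>. u (v \<beta>)"] F U(4) by auto
  qed
  then have "finite (v ` weights)" by (rule independent_imp_finite)
  then show ?thesis using inj finite_imageD by blast
qed

lemma finite_progression:
  assumes "\<alpha> \<in> functionals a" "\<exists>H\<in>a. \<alpha> H \<noteq> 0"
  shows "finite {k::nat. (\<lambda>H\<in>a. \<beta> H + real k * \<alpha> H) \<in> weights}" (is "finite ?K")
proof -
  obtain H where H: "H \<in> a" "\<alpha> H \<noteq> 0" using assms(2) by blast
  have "inj_on (\<lambda>k::nat. \<lambda>H\<in>a. \<beta> H + real k * \<alpha> H) ?K"
  proof (rule inj_onI)
    fix k l assume "(\<lambda>H\<in>a. \<beta> H + real k * \<alpha> H) = (\<lambda>H\<in>a. \<beta> H + real l * \<alpha> H)"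
    then have "(\<lambda>H\<in>a. \<beta> H + real k * \<alpha> H) H = (\<lambda>H\<in>a. \<beta> H + real l * \<alpha> H) H" by simp
    then show "k = l" using H by simp
  qed
  then show ?thesis
    by (rule inj_on_finite[OF _ _ finite_weights]) auto
qed

text \<open>
  The vectors \<open>E\<^sup>k u\<close> form a string of weight vectors with \<open>F
  E\<^sup>k\<^sup>+\<^sup>1 u = (k + 1) (- \<beta> h - k) E\<^sup>k u\<close>. As there are
  finitely many weights, some last vector \<open>E\<^sup>M u\<close> is nonzero, and the factor
  for \<open>k = M\<close> must vanish.
\<close>

lemma string_from_lowest:
  assumes E: "E \<in> wspace \<alpha>" and F: "F \<in> wspace (\<lambda>H. - \<alpha> H)"
    and h: "br E F = h" "h \<in> a" "\<alpha> h = 2" and \<alpha>: "\<alpha> \<in> functionals a"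
    and \<beta>: "\<beta> \<in> functionals a" "u \<in> wspace \<beta>" "u \<noteq> 0" "br F u = 0"
  obtains M :: nat where "\<beta> h = - real M" "\<And>k. k \<le> M \<Longrightarrow> (\<lambda>H\<in>a. \<beta> H + real k * \<alpha> H) \<in> weights"
proof -
  define v where "v k = (br E ^^ k) u" for k
  have vS: "v (Suc k) = br E (v k)" for k by (simp add: v_def)
  have vw: "v k \<in> wspace (\<lambda>H. \<beta> H + real k * \<alpha> H)" for k
  proof (induction k)
    case 0
    then show ?case using \<beta>(2) by (simp add: v_def)
  next
    case (Suc k)
    have "wspace (\<lambda>H. \<alpha> H + (\<beta> H + real k * \<alpha> H)) = wspace (\<lambda>H. \<beta> H + real (Suc k) * \<alpha> H)"
      by (rule wspace_cong) (simp add: algebra_simps)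
    then show ?case using br_wspace[OF E Suc] by (simp only: vS)
  qed
  have weight: "(\<lambda>H\<in>a. \<beta> H + real k * \<alpha> H) \<in> weights" if "v k \<noteq> 0" for k
  proof -
    have "v k \<in> wspace (\<lambda>H\<in>a. \<beta> H + real k * \<alpha> H)"
      using vw[of k] by (simp add: wspace_def)
    then show ?thesis using that functional_comb[OF \<beta>(1) \<alpha>] by (auto simp: weights_def)
  qed
  have Fv: "br F (v (Suc k)) = (real (k + 1) * (- \<beta> h - real k)) *\<^sub>R v k" for k
  proof (induction k)
    case 0
    have "br F (br E u) = br E (br F u) - br h u" using ad_br[of E F u] h(1) by (simp add: algebra_simps)
    also have "\<dots> = (- \<beta> h) *\<^sub>R u" using \<beta>(2,4) h(2) by (simp add: wspace_def br_simps)
    finally show ?case by (simp add: v_def)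
  next
    case (Suc k)
    let ?w = "v (Suc k)"
    have "br F (br E ?w) = br E (br F ?w) - br h ?w" using ad_br[of E F ?w] h(1) by (simp add: algebra_simps)
    also have "br E (br F ?w) = (real (k + 1) * (- \<beta> h - real k)) *\<^sub>R ?w" unfolding Suc by (simp add: br_simps vS)
    also have "br h ?w = (\<beta> h + real (Suc k) * 2) *\<^sub>R ?w" using vw[of "Suc k"] h(2,3) by (simp add: wspace_def)
    also have "(real (k + 1) * (- \<beta> h - real k)) *\<^sub>R ?w - (\<beta> h + real (Suc k) * 2) *\<^sub>R ?w
        = (real (k + 1) * (- \<beta> h - real k) - (\<beta> h + real (Suc k) * 2)) *\<^sub>R ?w"
      by (rule scaleR_diff_left[symmetric])
    also have "real (k + 1) * (- \<beta> h - real k) - (\<beta> h + real (Suc k) * 2) =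
        real (Suc k + 1) * (- \<beta> h - real (Suc k))"
      by (simp add: algebra_simps)
    finally show ?case by (simp only: vS[of "Suc k"])
  qed
  have "\<exists>k. v k = 0"
  proof (rule ccontr)
    assume "\<nexists>k. v k = 0"
    then have "{k::nat. (\<lambda>H\<in>a. \<beta> H + real k * \<alpha> H) \<in> weights} = UNIV" using weight by auto
    moreover have "\<exists>H\<in>a. \<alpha> H \<noteq> 0" using h(2,3) by (metis zero_neq_numeral)
    ultimately show False using finite_progression[OF \<alpha>, of \<beta>] by simp
  qed
  define m where "m = (LEAST k. v k = 0)"
  have m: "v m = 0" "\<And>k. k < m \<Longrightarrow> v k \<noteq> 0"
    using LeastI_ex[OF \<open>\<exists>k. v k = 0\<close>] not_less_Least by (auto simp: m_def)
  have "m \<noteq> 0" using m(1) \<beta>(3) by (intro notI) (simp add: v_def)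
  then obtain M where M: "m = Suc M" using not0_implies_Suc by blast
  have "br F (v (Suc M)) = 0" using m(1) M by (simp add: br_simps)
  then have "(real (M + 1) * (- \<beta> h - real M)) *\<^sub>R v M = 0" by (simp only: Fv)
  then have "\<beta> h = - real M" using m(2)[of M] M by auto
  moreover have "(\<lambda>H\<in>a. \<beta> H + real k * \<alpha> H) \<in> weights" if "k \<le> M" for k
    using weight m(2) M that by simp
  ultimately show ?thesis using that by blast
qed

text \<open>
  Let \<open>\<gamma> = \<beta> - q \<alpha>\<close> be the lowest weight below
  \<open>\<beta>\<close> and \<open>M = - \<gamma> h\<close> the length of its string. Then
  \<open>\<beta> h = 2 q - M\<close>, so that the reflected weight \<open>\<beta> - \<beta> h
  \<alpha> = \<gamma> + (M - q) \<alpha>\<close> belongs to the string.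
\<close>

lemma reflect_weight_nonpos:
  assumes E: "E \<in> wspace \<alpha>" and F: "F \<in> wspace (\<lambda>H. - \<alpha> H)"
    and h: "br E F = h" "h \<in> a" "\<alpha> h = 2" and \<alpha>: "\<alpha> \<in> functionals a"
    and \<beta>: "\<beta> \<in> weights" "\<beta> h \<le> 0"
  shows "(\<lambda>H\<in>a. \<beta> H - \<beta> h * \<alpha> H) \<in> weights"
proof -
  have \<beta>f: "\<beta> \<in> functionals a" using \<beta>(1) by (simp add: weights_def)
  let ?K = "{k::nat. (\<lambda>H\<in>a. \<beta> H - real k * \<alpha> H) \<in> weights}"
  have neg: "(\<lambda>H\<in>a. - 1 * \<alpha> H) \<in> functionals a" by (rule functional_mult[OF \<alpha>])
  have ne: "\<exists>H\<in>a. (\<lambda>H\<in>a. - 1 * \<alpha> H) H \<noteq> 0" using h(2,3) by (intro bexI[of _ h]) auto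
  have eqn: "(\<lambda>H\<in>a. \<beta> H + real k * (\<lambda>H\<in>a. - 1 * \<alpha> H) H) = (\<lambda>H\<in>a. \<beta> H - real k * \<alpha> H)" for k
    by (auto simp: fun_eq_iff)
  have finK: "finite ?K"
    using finite_progression[OF neg ne, of \<beta>] by (simp only: eqn)
  have "(\<lambda>H\<in>a. \<beta> H - real 0 * \<alpha> H) = \<beta>" using \<beta>f by (auto simp: functionals_def fun_eq_iff)
  then have K0: "0 \<in> ?K" using \<beta>(1) by (simp del: of_nat_0)
  define q where "q = Max ?K"
  have "q \<in> ?K" unfolding q_def using K0 by (intro Max_in[OF finK]) blast
  moreover have "Suc q \<notin> ?K" using Max_ge[OF finK, of "Suc q"] unfolding q_def[symmetric] by linarith
  ultimately have q: "q \<in> ?K" "Suc q \<notin> ?K" by blast+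
  define \<gamma> where "\<gamma> = (\<lambda>H\<in>a. \<beta> H - real q * \<alpha> H)"
  obtain u where u: "u \<in> wspace \<gamma>" "u \<noteq> 0" and \<gamma>f: "\<gamma> \<in> functionals a"
    using q(1) by (auto simp: weights_def \<gamma>_def)
  have "br F u \<in> wspace (\<lambda>H\<in>a. \<beta> H - real (Suc q) * \<alpha> H)"
  proof -
    have "wspace (\<lambda>H. - \<alpha> H + \<gamma> H) = wspace (\<lambda>H\<in>a. \<beta> H - real (Suc q) * \<alpha> H)"
      by (rule wspace_cong) (simp add: \<gamma>_def algebra_simps)
    then show ?thesis using br_wspace[OF F u(1)] by simp
  qed
  moreover have "(\<lambda>H\<in>a. \<beta> H - real (Suc q) * \<alpha> H) \<in> functionals a"
    using functional_comb[OF \<beta>f \<alpha>, of "- real (Suc q)"] by (simp del: of_nat_Suc)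
  ultimately have "br F u = 0" using q(2) by (auto simp: weights_def)
  then obtain M where M: "\<gamma> h = - real M" "\<And>k. k \<le> M \<Longrightarrow> (\<lambda>H\<in>a. \<gamma> H + real k * \<alpha> H) \<in> weights"
    using string_from_lowest[OF E F h \<alpha> \<gamma>f u] by blast
  have \<beta>h: "\<beta> h = 2 * real q - real M" using M(1) h(2,3) by (simp add: \<gamma>_def)
  then have "q \<le> M" using \<beta>(2) by simp
  have "(\<lambda>H\<in>a. \<gamma> H + real (M - q) * \<alpha> H) = (\<lambda>H\<in>a. \<beta> H - \<beta> h * \<alpha> H)"
  proof -
    have "real (M - q) = real q - \<beta> h" using \<beta>h \<open>q \<le> M\<close> by (simp add: of_nat_diff)
    show ?thesis unfolding \<open>real (M - q) = real q - \<beta> h\<close>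
      by (simp add: fun_eq_iff \<gamma>_def algebra_simps)
  qed
  then show ?thesis using M(2)[of "M - q"] by simp
qed

lemma reflect_weight:
  assumes E: "E \<in> wspace \<alpha>" and F: "F \<in> wspace (\<lambda>H. - \<alpha> H)"
    and h: "br E F = h" "h \<in> a" "\<alpha> h = 2" and \<alpha>: "\<alpha> \<in> functionals a"
    and \<beta>: "\<beta> \<in> weights"
  shows "(\<lambda>H\<in>a. \<beta> H - \<beta> h * \<alpha> H) \<in> weights"
proof (cases "\<beta> h \<le> 0")
  case True
  then show ?thesis using reflect_weight_nonpos[OF E F h \<alpha> \<beta>] by blast
next
  case False
  define \<alpha>' where "\<alpha>' = (\<lambda>H\<in>a. - 1 * \<alpha> H)"
  have nh: "- h \<in> a" using h(2) subspace_a by (simp add: subspace_neg)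
  have "F \<in> wspace \<alpha>'" using F by (auto simp: wspace_def \<alpha>'_def)
  moreover have "E \<in> wspace (\<lambda>H. - \<alpha>' H)" using E by (auto simp: wspace_def \<alpha>'_def)
  moreover have "br F E = - h" using h(1) br_skew by metis
  moreover have "\<alpha>' (- h) = 2"
    using nh functional_scale[OF \<alpha> subspace_a h(2), of "-1"] h(3) by (simp add: \<alpha>'_def)
  moreover have "\<alpha>' \<in> functionals a" unfolding \<alpha>'_def by (rule functional_mult[OF \<alpha>])
  moreover have \<beta>f: "\<beta> \<in> functionals a" using \<beta> by (simp add: weights_def)
  have \<beta>n: "\<beta> (- h) = - \<beta> h" using functional_scale[OF \<beta>f subspace_a h(2), of "-1"] by simp
  ultimately have "(\<lambda>H\<in>a. \<beta> H - \<beta> (- h) * \<alpha>' H) \<in> weights"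
    using False nh \<beta> by (intro reflect_weight_nonpos[of F \<alpha>' E]) auto
  moreover have "(\<lambda>H\<in>a. \<beta> H - \<beta> (- h) * \<alpha>' H) = (\<lambda>H\<in>a. \<beta> H - \<beta> h * \<alpha> H)"
    by (auto simp: fun_eq_iff \<alpha>'_def \<beta>n)
  ultimately show ?thesis by simp
qed

text \<open>
  A root vector \<open>X\<close> and its image under the involution span, together with their bracket, a copy of
  \<open>sl\<^sub>2\<close>; by maximality of \<open>a\<close> the bracket is a multiple of the Killing-dual vector of the root.
\<close>

lemma root_sl2:
  assumes "\<alpha> \<in> roots"
  obtains E F T h where "E \<in> wspace \<alpha>" "F \<in> wspace (\<lambda>H. - \<alpha> H)" "br E F = h" "h \<in> a" "\<alpha> h = 2"
    "T \<in> a" "\<And>H. H \<in> a \<Longrightarrow> kf T H = \<alpha> H" "\<alpha> T > 0" "h = (2 / \<alpha> T) *\<^sub>R T"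
proof -
  have \<alpha>: "\<alpha> \<in> functionals a" using assms by (simp add: roots_def)
  obtain X H1 where X: "X \<in> wspace \<alpha>" "X \<noteq> 0" and H1: "H1 \<in> a" "\<alpha> H1 \<noteq> 0"
    using assms by (auto simp: roots_def wspace_def)
  have Xg: "X \<in> g" using X by (simp add: wspace_def)
  have thX: "th X \<in> wspace (\<lambda>H. - \<alpha> H)"
  proof -
    have "br H (th X) = - \<alpha> H *\<^sub>R th X" if H: "H \<in> a" for H
    proof -
      have "br H (th X) = - th (br H X)" using H by (simp add: th_br a_s br_simps)
      then show ?thesis using X(1) H by (simp add: wspace_def th_simps)
    qed
    then show ?thesis by (simp add: wspace_def th_closed)
  qed
  define b where "b = Bt X X"
  have b: "b > 0" using Bt_pos[OF Xg X(2)] by (simp add: b_def)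
  define T where "T = (- 1 / b) *\<^sub>R br X (th X)"
  have Ta: "T \<in> a"
  proof (rule a_max)
    show "T \<in> g" unfolding T_def by (rule subspace_scale[OF subspace_g br_closed])
    show "th T = - T" unfolding T_def using Xg by (simp add: th_simps th_br th_th br_skew[of X "th X"])
    fix H assume "H \<in> a"
    then have "br H (br X (th X)) = 0" using br_wspace[OF X(1) thX] by (simp add: wspace_def)
    then show "br H T = 0" unfolding T_def by (simp add: br_simps)
  qed
  have TH: "kf T H = \<alpha> H" if H: "H \<in> a" for H
  proof -
    have "kf (br X (th X)) H = kf H (br X (th X))" by (rule kf_sym)
    also have "\<dots> = kf (br H X) (th X)" by (rule kf_invariant[symmetric])
    also have "\<dots> = - \<alpha> H * b" using X(1) H by (simp add: wspace_def kf_simps b_def Bt_def)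
    finally show ?thesis using b unfolding T_def by (simp add: kf_simps)
  qed
  have "T \<noteq> 0" using TH[OF H1(1)] H1(2) by (auto simp: kf_simps)
  then have pos: "\<alpha> T > 0" using kf_pos[OF a_g[OF Ta] a_s[OF Ta]] TH[OF Ta] by simp
  define F where "F = (- 2 / (\<alpha> T * b)) *\<^sub>R th X"
  have "F \<in> wspace (\<lambda>H. - \<alpha> H)"
    using thX subspace_scale[OF subspace_g, of "th X" "- 2 / (\<alpha> T * b)"]
    unfolding F_def wspace_def by (auto simp: br_simps)
  moreover have "br X F = (2 / \<alpha> T) *\<^sub>R T" unfolding F_def T_def by (simp add: br_simps)
  moreover have "(2 / \<alpha> T) *\<^sub>R T \<in> a" using Ta subspace_a by (simp add: subspace_scale)
  moreover have "\<alpha> ((2 / \<alpha> T) *\<^sub>R T) = 2" using functional_scale[OF \<alpha> subspace_a Ta] pos by simp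
  ultimately show ?thesis using that[OF X(1) _ _ _ _ Ta TH pos] by blast
qed

lemma dual_vector_unique:
  assumes "T \<in> a" "T' \<in> a" "\<And>H. H \<in> a \<Longrightarrow> kf T H = kf T' H"
  shows "T = T'"
proof (rule ccontr)
  assume "T \<noteq> T'"
  moreover have "T - T' \<in> a" using assms subspace_a by (simp add: subspace_diff)
  ultimately have "kf (T - T') (T - T') > 0" using kf_pos a_g a_s by (metis eq_iff_diff_eq_0)
  then show False using assms(3)[OF \<open>T - T' \<in> a\<close>] by (simp add: kf_simps)
qed

text \<open>
  Being symmetric, \<open>ad H\<close> is injective on its image, which is nonzero if \<open>H
  \<noteq> 0\<close>. A common eigenvector of \<open>a\<close> in this image belongs to a root
  that does not vanish at \<open>H\<close>.
\<close>

lemma roots_separate: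
  assumes H: "H \<in> a" "\<And>\<alpha>. \<alpha> \<in> roots \<Longrightarrow> \<alpha> H = 0"
  shows "H = 0"
proof (rule ccontr)
  assume "H \<noteq> 0"
  then have pos: "kf H H > 0" using kf_pos a_g a_s H(1) by blast
  define V where "V = br H ` g"
  have Vg: "V \<subseteq> g" by (auto simp: V_def br_closed)
  have "subspace V" unfolding V_def by (rule linear_subspace_image[OF linear_ad subspace_g])
  moreover have "V \<noteq> {0}"
  proof
    assume "V = {0}"
    then have "br H Z = 0" if "Z \<in> g" for Z using that by (auto simp: V_def)
    then have "kf H H = trace_on g (\<lambda>Z. 0 *\<^sub>R br H Z)"
      unfolding kf_def by (intro trace_on_cong[OF subspace_g]) (simp add: br_simps)
    also have "\<dots> = 0 * trace_on g (br H)"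
      by (rule trace_on_scale[OF subspace_g linear_ad]) (auto simp: br_closed)
    finally show False using pos by simp
  qed
  moreover have "br H' ` V \<subseteq> V" if "H' \<in> a" for H'
    using a_commute[OF that H(1)] br_closed by (auto simp: V_def)
  ultimately obtain v where v: "v \<in> V" "v \<noteq> 0" "\<And>H'. H' \<in> a \<Longrightarrow> \<exists>l. br H' v = l *\<^sub>R v"
    using simultaneous_eigenvector[of V a br Bt] linear_ad bilinear_Bt Bt_sym Bt_pos Bt_ad a_commute Vg
    by (smt (verit) subsetD)
  define \<alpha> where "\<alpha> = (\<lambda>H'\<in>a. Bt (br H' v) v / Bt v v)"
  have vpos: "Bt v v > 0" using Bt_pos v Vg by blast
  have "linear (\<lambda>H'. Bt (br H' v) v / Bt v v)"
    by (intro linearI) (simp_all add: br_simps bilinear_ladd[OF bilinear_Bt] bilinear_lmul[OF bilinear_Bt] add_divide_distrib)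
  then have "\<alpha> \<in> functionals a" by (rule functionalI) (simp_all add: \<alpha>_def)
  moreover have eig: "br H' v = \<alpha> H' *\<^sub>R v" if "H' \<in> a" for H'
    using v(3)[OF that] vpos that by (auto simp: \<alpha>_def bilinear_lmul[OF bilinear_Bt])
  moreover have "\<alpha> H \<noteq> 0"
  proof
    assume "\<alpha> H = 0"
    then have 0: "br H v = 0" using eig[OF H(1)] by simp
    obtain Z where Z: "v = br H Z" using v(1) by (auto simp: V_def)
    have "Bt v v = Bt Z (br H v)" using Bt_ad[OF H(1), of Z v] Z by simp
    then show False using 0 vpos by (simp add: bilinear_rzero[OF bilinear_Bt])
  qed
  ultimately have "\<alpha> \<in> roots" using H(1) v Vg unfolding roots_def by blast
  then show False using H(2) \<open>\<alpha> H \<noteq> 0\<close> by blast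
qed

end

section \<open>Root systems\<close>

text \<open>
  Multiples of a root may be roots. The condition on the form \<open>Q\<close> says that the reflections are orthogonal.
\<close>

locale root_system =
  fixes a :: "'v::euclidean_space set" and R :: "('v \<Rightarrow> real) set"
    and c :: "('v \<Rightarrow> real) \<Rightarrow> 'v" and Q :: "'v \<Rightarrow> 'v \<Rightarrow> real"
  assumes subspace_a: "subspace a"
    and finite_R: "finite R"
    and R_functional: "\<alpha> \<in> R \<Longrightarrow> \<alpha> \<in> functionals a"
    and R_separate: "H \<in> a \<Longrightarrow> (\<And>\<alpha>. \<alpha> \<in> R \<Longrightarrow> \<alpha> H = 0) \<Longrightarrow> H = 0"
    and c_a: "\<alpha> \<in> R \<Longrightarrow> c \<alpha> \<in> a"
    and c_two: "\<alpha> \<in> R \<Longrightarrow> \<alpha> (c \<alpha>) = 2"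
    and R_reflect: "\<alpha> \<in> R \<Longrightarrow> \<beta> \<in> R \<Longrightarrow> (\<lambda>H\<in>a. \<beta> H - \<beta> (c \<alpha>) * \<alpha> H) \<in> R"
    and bilinear_Q: "bilinear Q"
    and Q_sym: "x \<in> a \<Longrightarrow> y \<in> a \<Longrightarrow> Q x y = Q y x"
    and Q_pos: "x \<in> a \<Longrightarrow> x \<noteq> 0 \<Longrightarrow> Q x x > 0"
    and Q_c: "\<alpha> \<in> R \<Longrightarrow> H \<in> a \<Longrightarrow> 2 * Q (c \<alpha>) H = \<alpha> H * Q (c \<alpha>) (c \<alpha>)"

context noncompact_lie_algebra
begin

definition dual_vector :: "('v \<Rightarrow> real) \<Rightarrow> 'v" where
  "dual_vector \<alpha> = (THE T. T \<in> a \<and> (\<forall>H\<in>a. kf T H = \<alpha> H))"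

lemma dual_vector:
  assumes "\<alpha> \<in> roots"
  shows "dual_vector \<alpha> \<in> a" "H \<in> a \<Longrightarrow> kf (dual_vector \<alpha>) H = \<alpha> H" "\<alpha> (dual_vector \<alpha>) > 0"
    "\<beta> \<in> roots \<Longrightarrow> (\<lambda>H\<in>a. \<beta> H - \<beta> ((2 / \<alpha> (dual_vector \<alpha>)) *\<^sub>R dual_vector \<alpha>) * \<alpha> H) \<in> roots"
proof -
  have \<alpha>: "\<alpha> \<in> functionals a" using assms by (simp add: roots_def)
  obtain E F T h where *: "E \<in> wspace \<alpha>" "F \<in> wspace (\<lambda>H. - \<alpha> H)" "br E F = h" "h \<in> a" "\<alpha> h = 2"
    and T: "T \<in> a" "\<And>H. H \<in> a \<Longrightarrow> kf T H = \<alpha> H" "\<alpha> T > 0" and h: "h = (2 / \<alpha> T) *\<^sub>R T"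
    using root_sl2[OF assms] by metis
  have "dual_vector \<alpha> = T"
    unfolding dual_vector_def using T dual_vector_unique by (intro the_equality) auto
  then show "dual_vector \<alpha> \<in> a" "H \<in> a \<Longrightarrow> kf (dual_vector \<alpha>) H = \<alpha> H" "\<alpha> (dual_vector \<alpha>) > 0"
    using T by simp_all
  assume \<beta>: "\<beta> \<in> roots"
  then have \<beta>f: "\<beta> \<in> functionals a" and "\<beta> \<in> weights" by (simp_all add: roots_weights weights_def)
  then have "(\<lambda>H\<in>a. \<beta> H - \<beta> h * \<alpha> H) \<in> weights" by (intro reflect_weight[OF * \<alpha>])
  moreover have "\<exists>H\<in>a. (\<lambda>H\<in>a. \<beta> H - \<beta> h * \<alpha> H) H \<noteq> 0"
  proof (rule ccontr)
    assume z: "\<not> (\<exists>H\<in>a. (\<lambda>H\<in>a. \<beta> H - \<beta> h * \<alpha> H) H \<noteq> 0)"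
    then have b: "\<beta> H = \<beta> h * \<alpha> H" if "H \<in> a" for H using that by auto
    then have "\<beta> h = 0" using b[OF *(4)] *(5) by simp
    then show False using b \<beta> by (auto simp: roots_def)
  qed
  ultimately have "(\<lambda>H\<in>a. \<beta> H - \<beta> h * \<alpha> H) \<in> roots" by (simp add: roots_weights)
  then show "(\<lambda>H\<in>a. \<beta> H - \<beta> ((2 / \<alpha> (dual_vector \<alpha>)) *\<^sub>R dual_vector \<alpha>) * \<alpha> H) \<in> roots"
    by (simp add: h \<open>dual_vector \<alpha> = T\<close>)
qed

lemma root_system:
  "root_system a roots (\<lambda>\<alpha>. (2 / \<alpha> (dual_vector \<alpha>)) *\<^sub>R dual_vector \<alpha>) kf"
proof
  fix \<alpha> assume \<alpha>: "\<alpha> \<in> roots"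
  then have \<alpha>f: "\<alpha> \<in> functionals a" by (simp add: roots_def)
  note d = dual_vector[OF \<alpha>]
  show "(2 / \<alpha> (dual_vector \<alpha>)) *\<^sub>R dual_vector \<alpha> \<in> a" using d(1) subspace_a by (simp add: subspace_scale)
  show "\<alpha> ((2 / \<alpha> (dual_vector \<alpha>)) *\<^sub>R dual_vector \<alpha>) = 2"
    using functional_scale[OF \<alpha>f subspace_a d(1)] d(3) by simp
  show "(\<lambda>H\<in>a. \<beta> H - \<beta> ((2 / \<alpha> (dual_vector \<alpha>)) *\<^sub>R dual_vector \<alpha>) * \<alpha> H) \<in> roots"
    if "\<beta> \<in> roots" for \<beta> using d(4) that .
  fix H assume H: "H \<in> a"
  show "2 * kf ((2 / \<alpha> (dual_vector \<alpha>)) *\<^sub>R dual_vector \<alpha>) H =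
      \<alpha> H * kf ((2 / \<alpha> (dual_vector \<alpha>)) *\<^sub>R dual_vector \<alpha>) ((2 / \<alpha> (dual_vector \<alpha>)) *\<^sub>R dual_vector \<alpha>)"
    using d(2)[OF H] d(2)[OF d(1)] d(3) by (simp add: kf_simps)
next
  show "finite roots" by (rule finite_subset[OF _ finite_weights]) (auto simp: roots_weights)
  show "bilinear kf" by (rule bilinear_kf)
  show "subspace a" by (rule subspace_a)
  show "\<alpha> \<in> functionals a" if "\<alpha> \<in> roots" for \<alpha> using that by (simp add: roots_def)
  show "H = 0" if "H \<in> a" "\<And>\<alpha>. \<alpha> \<in> roots \<Longrightarrow> \<alpha> H = 0" for H using roots_separate that .
  show "kf x y = kf y x" for x y by (rule kf_sym)
  show "kf x x > 0" if "x \<in> a" "x \<noteq> 0" for x using that by (simp add: kf_pos a_g a_s)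
qed

end

text \<open>
  Compact and noncompact type are exchanged by replacing \<open>k + s\<close> with \<open>k + is\<close>. On the same vector
  space this changes the sign of the bracket of two elements of \<open>s\<close>.
\<close>

context involutive_lie_algebra
begin

text \<open>
  On \<open>g\<close> these are the projections to the eigenspaces of the involution. Writing
  \<open>th (th X)\<close> in place of \<open>X\<close> gives values in \<open>g\<close> for every
  argument.
\<close>

definition kproj :: "'v \<Rightarrow> 'v" where "kproj X = (1/2) *\<^sub>R (th (th X) + th X)"
definition sproj :: "'v \<Rightarrow> 'v" where "sproj X = (1/2) *\<^sub>R (th (th X) - th X)"

definition dbr :: "'v \<Rightarrow> 'v \<Rightarrow> 'v" where
  "dbr X Y = br (kproj X) (kproj Y) + br (kproj X) (sproj Y) + br (sproj X) (kproj Y) - br (sproj X) (sproj Y)"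

lemma linear_kproj: "linear kproj" and linear_sproj: "linear sproj"
  unfolding kproj_def sproj_def by (auto intro!: linearI simp: th_simps algebra_simps)

lemma th_kproj: "th (kproj X) = kproj X" and th_sproj: "th (sproj X) = - sproj X"
  using th_th[OF th_closed] by (simp_all add: kproj_def sproj_def th_simps algebra_simps)

lemma kproj_fixed: "X \<in> g \<Longrightarrow> th X = X \<Longrightarrow> kproj X = X \<and> sproj X = 0"
  and sproj_fixed: "X \<in> g \<Longrightarrow> th X = - X \<Longrightarrow> kproj X = 0 \<and> sproj X = X"
  by (simp_all add: kproj_def sproj_def th_simps flip: scaleR_add_left)

lemma ksproj_sum: "kproj X + sproj X = th (th X)" "kproj X - sproj X = th X"
  by (simp_all add: kproj_def sproj_def algebra_simps flip: scaleR_add_left)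

lemma proj_dbr:
  "kproj (dbr X Y) = br (kproj X) (kproj Y) - br (sproj X) (sproj Y)"
  "sproj (dbr X Y) = br (kproj X) (sproj Y) + br (sproj X) (kproj Y)"
proof -
  have "kproj (br A B) = br A B \<and> sproj (br A B) = 0" if "th A = A" "th B = B" for A B
    using kproj_fixed[OF br_closed] that by (simp add: th_br)
  moreover have "kproj (br A B) = br A B \<and> sproj (br A B) = 0" if "th A = - A" "th B = - B" for A B
    using kproj_fixed[OF br_closed] that by (simp add: th_br br_simps)
  moreover have "kproj (br A B) = 0 \<and> sproj (br A B) = br A B" if "th A = A" "th B = - B" for A B
    using sproj_fixed[OF br_closed] that by (simp add: th_br br_simps)
  moreover have "kproj (br A B) = 0 \<and> sproj (br A B) = br A B" if "th A = - A" "th B = B" for A B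
    using sproj_fixed[OF br_closed] that by (simp add: th_br br_simps)
  ultimately show
    "kproj (dbr X Y) = br (kproj X) (kproj Y) - br (sproj X) (sproj Y)"
    "sproj (dbr X Y) = br (kproj X) (sproj Y) + br (sproj X) (kproj Y)"
    unfolding dbr_def using th_kproj th_sproj
    by (simp_all add: linear_add[OF linear_kproj] linear_diff[OF linear_kproj]
        linear_add[OF linear_sproj] linear_diff[OF linear_sproj])
qed

lemma dbr_closed: "dbr X Y \<in> g"
  unfolding dbr_def using br_closed subspace_g by (simp add: subspace_add subspace_diff)

lemma dual_algebra: "involutive_lie_algebra g dbr th"
proof (rule involutive_lie_algebra.intro)
  show "subspace g" by (rule subspace_g)
  show "linear th" by (rule linear_th)
  show "bilinear dbr"
    unfolding bilinear_def dbr_def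
    by (auto intro!: linearI simp: br_simps algebra_simps linear_add[OF linear_kproj] linear_scale[OF linear_kproj]
        linear_add[OF linear_sproj] linear_scale[OF linear_sproj])
  show "dbr X Y \<in> g" for X Y by (rule dbr_closed)
  show "th X \<in> g" for X by (rule th_closed)
  show "th (th X) = X" if "X \<in> g" for X using that by (rule th_th)
  show "dbr X X = 0" for X
    unfolding dbr_def using br_skew[of "kproj X" "sproj X"] by (simp add: br_self)
  show "th (dbr X Y) = dbr (th X) (th Y)" for X Y
  proof -
    have "kproj (th X) = kproj X" "sproj (th X) = - sproj X" for X
      using th_th[OF th_closed] by (simp_all add: kproj_def sproj_def th_simps algebra_simps)
    then show ?thesis
      unfolding dbr_def by (simp add: th_simps th_br th_kproj th_sproj br_simps)
  qed
  fix X Y Z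
  define A B C where "A = kproj X" and "B = kproj Y" and "C = kproj Z"
  define A' B' C' where "A' = sproj X" and "B' = sproj Y" and "C' = sproj Z"
  let ?J = "\<lambda>X Y Z. br X (br Y Z) + br Y (br Z X) + br Z (br X Y)"
  have "dbr X (dbr Y Z) + dbr Y (dbr Z X) + dbr Z (dbr X Y) =
      ?J A B C + ?J A B C' + ?J A B' C + ?J A' B C - ?J A B' C' - ?J A' B C' - ?J A' B' C - ?J A' B' C'"
    unfolding dbr_def[of X "dbr Y Z"] dbr_def[of Y "dbr Z X"] dbr_def[of Z "dbr X Y"] proj_dbr
      A_def[symmetric] B_def[symmetric] C_def[symmetric] A'_def[symmetric] B'_def[symmetric] C'_def[symmetric]
    by (simp add: br_simps algebra_simps)
  then show "dbr X (dbr Y Z) + dbr Y (dbr Z X) + dbr Z (dbr X Y) = 0"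
    by (simp only: jacobi add_0 diff_zero)
qed

lemma dbr_s:
  assumes "H \<in> g" "th H = - H"
  shows "dbr H Z = br H (th Z)"
proof -
  have "dbr H Z = br H (kproj Z) - br H (sproj Z)"
    using sproj_fixed[OF assms] by (simp add: dbr_def br_simps)
  also have "\<dots> = br H (kproj Z - sproj Z)" by (rule bilinear_rsub[OF bilinear_br, symmetric])
  finally show ?thesis by (simp only: ksproj_sum)
qed

lemma dbr_k:
  assumes "X \<in> g" "th X = X" "Z \<in> g"
  shows "dbr X Z = br X Z"
proof -
  have "dbr X Z = br X (kproj Z) + br X (sproj Z)"
    using kproj_fixed[OF assms(1,2)] by (simp add: dbr_def br_simps)
  also have "\<dots> = br X (kproj Z + sproj Z)" by (rule bilinear_radd[OF bilinear_br, symmetric])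
  finally show ?thesis using assms(3) by (simp only: ksproj_sum th_th)
qed

lemma dual_kf_s:
  assumes "H \<in> g" "th H = - H" "H' \<in> g" "th H' = - H'"
  shows "involutive_lie_algebra.kf g dbr H H' = - kf H H'"
proof -
  interpret d: involutive_lie_algebra g dbr th by (rule dual_algebra)
  have "dbr H (dbr H' Z) = -1 *\<^sub>R br H (br H' Z)" if "Z \<in> g" for Z
    using that assms by (simp add: dbr_s th_br th_th br_simps)
  then have "d.kf H H' = trace_on g (\<lambda>Z. -1 *\<^sub>R br H (br H' Z))"
    unfolding d.kf_def by (intro trace_on_cong[OF subspace_g])
  also have "\<dots> = -1 * trace_on g (\<lambda>Z. br H (br H' Z))"
    by (rule trace_on_scale[OF subspace_g linear_ad2]) (auto simp: br_closed)
  finally show ?thesis by (simp add: kf_def)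
qed

lemma dual_kf_k:
  assumes "X \<in> g" "th X = X"
  shows "involutive_lie_algebra.kf g dbr X X = kf X X"
proof -
  interpret d: involutive_lie_algebra g dbr th by (rule dual_algebra)
  show ?thesis
    unfolding d.kf_def kf_def by (intro trace_on_cong[OF subspace_g]) (simp add: dbr_k assms br_closed)
qed

text \<open>
  Over the complex numbers, \<open>br\<close> and \<open>dbr\<close> are brackets of two real
  forms of the same algebra. A pair \<open>(X, Y)\<close> stands for the root vector \<open>X +
  iY\<close>, whose real and imaginary parts are taken with respect to the other real form.
\<close>

lemma dual_root_vectors:
  assumes a: "\<And>H. H \<in> a \<Longrightarrow> H \<in> g" "\<And>H. H \<in> a \<Longrightarrow> th H = - H"
  shows "(\<exists>X\<in>g. \<exists>Y\<in>g. (X, Y) \<noteq> (0, 0) \<and> (\<forall>H\<in>a. br H X = - \<alpha> H *\<^sub>R Y \<and> br H Y = \<alpha> H *\<^sub>R X)) \<longleftrightarrow>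
    (\<exists>Z\<in>g. Z \<noteq> 0 \<and> (\<forall>H\<in>a. dbr H Z = \<alpha> H *\<^sub>R Z))"
proof
  have thbr: "br H (th W) = - th (br H W)" if "H \<in> a" for H W
    using a[OF that] by (simp add: th_br br_simps)
  assume "\<exists>X\<in>g. \<exists>Y\<in>g. (X, Y) \<noteq> (0, 0) \<and> (\<forall>H\<in>a. br H X = - \<alpha> H *\<^sub>R Y \<and> br H Y = \<alpha> H *\<^sub>R X)"
  then obtain X Y where XY: "X \<in> g" "Y \<in> g" "(X, Y) \<noteq> (0, 0)"
    "\<And>H. H \<in> a \<Longrightarrow> br H X = - \<alpha> H *\<^sub>R Y" "\<And>H. H \<in> a \<Longrightarrow> br H Y = \<alpha> H *\<^sub>R X" by blast
  \<comment> \<open>twice the real and imaginary parts of \<open>X + iY\<close>, where \<open>S\<close> in \<open>s\<close> stands for \<open>- iS\<close> in the dual real form\<close>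
  define Z where "Z = X + th X - (Y - th Y)"
  define Z' where "Z' = Y + th Y + (X - th X)"
  have "Z \<in> g" "Z' \<in> g"
    using XY(1,2) th_closed subspace_g by (simp_all add: Z_def Z'_def subspace_add subspace_diff)
  moreover have "dbr H Z = \<alpha> H *\<^sub>R Z" "dbr H Z' = \<alpha> H *\<^sub>R Z'" if H: "H \<in> a" for H
    using XY a[OF H] thbr[OF H] H
    by (simp_all add: dbr_s Z_def Z'_def th_simps th_th br_simps algebra_simps)
  moreover have "Z \<noteq> 0 \<or> Z' \<noteq> 0"
  proof (rule ccontr)
    assume "\<not> (Z \<noteq> 0 \<or> Z' \<noteq> 0)"
    then have 1: "X + th X = Y - th Y" "Y + th Y = th X - X" by (simp_all add: Z_def Z'_def algebra_simps add_eq_0_iff)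
    have "th (X + th X) = X + th X" "th (Y - th Y) = - (Y - th Y)"
      "th (Y + th Y) = Y + th Y" "th (th X - X) = - (th X - X)"
      using XY(1,2) by (simp_all add: th_simps th_th)
    then have "X + th X = - (X + th X)" "Y + th Y = - (Y + th Y)" using 1 by metis+
    moreover have "W = 0" if "W = - W" for W :: 'v
    proof -
      have "2 *\<^sub>R W = 0" using that unfolding scaleR_2 by (simp only: eq_neg_iff_add_eq_0)
      then show ?thesis by simp
    qed
    ultimately have "X + th X = 0" "Y + th Y = 0" by blast+
    then have "X + X = 0" "Y + Y = 0" using 1 by (simp_all add: algebra_simps)
    then show False using XY(3) by (simp flip: scaleR_2)
  qed
  ultimately show "\<exists>Z\<in>g. Z \<noteq> 0 \<and> (\<forall>H\<in>a. dbr H Z = \<alpha> H *\<^sub>R Z)" by blast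
next
  assume "\<exists>Z\<in>g. Z \<noteq> 0 \<and> (\<forall>H\<in>a. dbr H Z = \<alpha> H *\<^sub>R Z)"
  then obtain Z where Z: "Z \<in> g" "Z \<noteq> 0" "\<And>H. H \<in> a \<Longrightarrow> dbr H Z = \<alpha> H *\<^sub>R Z" by blast
  \<comment> \<open>the parts of \<open>Z\<close> in \<open>k\<close> and \<open>s\<close>, doubled; the latter becomes imaginary\<close>
  define X where "X = Z + th Z"
  define Y where "Y = th Z - Z"
  have "X \<in> g" "Y \<in> g"
    using Z(1) th_closed subspace_g by (simp_all add: X_def Y_def subspace_add subspace_diff)
  moreover have "(X, Y) \<noteq> (0, 0)"
  proof
    assume "(X, Y) = (0, 0)"
    then have "X - Y = 0" by simp
    then have "2 *\<^sub>R Z = 0" by (simp add: X_def Y_def scaleR_2)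
    then show False using Z(2) by simp
  qed
  moreover have "br H X = - \<alpha> H *\<^sub>R Y" "br H Y = \<alpha> H *\<^sub>R X" if H: "H \<in> a" for H
  proof -
    have 1: "br H (th Z) = \<alpha> H *\<^sub>R Z" using Z(3)[OF H] dbr_s[OF a[OF H]] by simp
    have "br H Z = br H (th (th Z))" using Z(1) by (simp add: th_th)
    also have "\<dots> = - th (br H (th Z))" using a[OF H] by (simp add: th_br br_simps)
    finally have 2: "br H Z = - \<alpha> H *\<^sub>R th Z" by (simp add: 1 th_simps)
    show "br H X = - \<alpha> H *\<^sub>R Y" "br H Y = \<alpha> H *\<^sub>R X"
      using 1 2 by (simp_all add: X_def Y_def br_simps algebra_simps)
  qed
  ultimately show "\<exists>X\<in>g. \<exists>Y\<in>g. (X, Y) \<noteq> (0, 0) \<and> (\<forall>H\<in>a. br H X = - \<alpha> H *\<^sub>R Y \<and> br H Y = \<alpha> H *\<^sub>R X)"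
    by (intro bexI[of _ X] bexI[of _ Y] conjI ballI)
qed

end

lemma subspace_projection_exists:
  fixes g :: "'v::euclidean_space set"
  assumes "subspace g"
  obtains p where "linear p" "\<And>x. p x \<in> g" "\<And>x. x \<in> g \<Longrightarrow> p x = x"
proof -
  have l: "linear (\<lambda>x::'v. x)" by (rule linear_ident)
  have "inj_on (\<lambda>x::'v. x) g" by simp
  have "\<exists>p. range p \<subseteq> g \<and> linear p \<and> (\<forall>v\<in>g. p v = v)"
    using linear_exists_left_inverse_on[OF l assms \<open>inj_on (\<lambda>x::'v. x) g\<close>] .
  then obtain p where p: "range p \<subseteq> g" "linear p" "\<forall>v\<in>g. p v = v" by blast
  show ?thesis
  proof (rule that[of p])
    show "p x \<in> g" for x using p(1) by blast
  qed (simp_all add: p)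
qed

lemma root_system_transfer:
  assumes "root_system a R c Q" "\<And>\<alpha>. \<alpha> \<in> R \<Longrightarrow> c \<alpha> = c' \<alpha>"
  shows "root_system a R c' Q"
proof -
  interpret root_system a R c Q by (rule assms(1))
  note e = assms(2)[symmetric]
  show ?thesis
  proof (rule root_system.intro)
    show "c' \<alpha> \<in> a" "\<alpha> (c' \<alpha>) = 2" if "\<alpha> \<in> R" for \<alpha> using that c_a c_two by (simp_all add: e)
    show "(\<lambda>H\<in>a. \<beta> H - \<beta> (c' \<alpha>) * \<alpha> H) \<in> R" if "\<alpha> \<in> R" "\<beta> \<in> R" for \<alpha> \<beta>
      using that R_reflect by (simp add: e)
    show "2 * Q (c' \<alpha>) H = \<alpha> H * Q (c' \<alpha>) (c' \<alpha>)" if "\<alpha> \<in> R" "H \<in> a" for \<alpha> H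
      using that Q_c by (simp add: e)
  next
    show "H = 0" if "H \<in> a" "\<And>\<alpha>. \<alpha> \<in> R \<Longrightarrow> \<alpha> H = 0" for H using R_separate that .
  qed (simp_all add: subspace_a finite_R R_functional bilinear_Q Q_sym Q_pos)
qed

text \<open>Precompose bracket and involution with a linear projection onto the Lie algebra.\<close>

lemma symmetric_space_algebra:
  assumes M: "symmetric_space M"
  shows "\<exists>br th. involutive_lie_algebra (lalg M) br th \<and> (\<forall>X\<in>lalg M. th X = theta M X) \<and>
    (\<forall>X\<in>lalg M. \<forall>Y\<in>lalg M. br X Y = lbracket M X Y)"
proof -
  let ?g = "lalg M"
  have la: "lie_algebra ?g (lbracket M)"
    using M by (simp add: symmetric_space_def connected_lie_group_def)
  then have g: "subspace ?g" by (simp add: lie_algebra_def)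
  obtain p where p: "linear p" "\<And>x. p x \<in> ?g" "\<And>x. x \<in> ?g \<Longrightarrow> p x = x"
    using subspace_projection_exists[OF g] by blast
  define br where "br X Y = lbracket M (p X) (p Y)" for X Y
  define th where "th X = theta M (p X)" for X
  have brl: "lbracket M (X + Y) Z = lbracket M X Z + lbracket M Y Z"
    "lbracket M Z (X + Y) = lbracket M Z X + lbracket M Z Y"
    "lbracket M (d *\<^sub>R X) Z = d *\<^sub>R lbracket M X Z" "lbracket M Z (d *\<^sub>R X) = d *\<^sub>R lbracket M Z X"
    if "X \<in> ?g" "Y \<in> ?g" "Z \<in> ?g" for X Y Z d
  proof -
    have 1: "lbracket M (c *\<^sub>R X + d *\<^sub>R Y) Z = c *\<^sub>R lbracket M X Z + d *\<^sub>R lbracket M Y Z"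
      "lbracket M Z (c *\<^sub>R X + d *\<^sub>R Y) = c *\<^sub>R lbracket M Z X + d *\<^sub>R lbracket M Z Y" for c d
      using la that unfolding lie_algebra_def by blast+
    show "lbracket M (X + Y) Z = lbracket M X Z + lbracket M Y Z"
      "lbracket M Z (X + Y) = lbracket M Z X + lbracket M Z Y"
      "lbracket M (d *\<^sub>R X) Z = d *\<^sub>R lbracket M X Z" "lbracket M Z (d *\<^sub>R X) = d *\<^sub>R lbracket M Z X"
      using 1[of 1 1] 1[of d 0] by simp_all
  qed
  have brg: "lbracket M X Y \<in> ?g" if "X \<in> ?g" "Y \<in> ?g" for X Y
    using la that unfolding lie_algebra_def by blast
  have brself: "lbracket M X X = 0" if "X \<in> ?g" for X
    using la that unfolding lie_algebra_def by blast
  have brjac: "lbracket M X (lbracket M Y Z) + lbracket M Y (lbracket M Z X) + lbracket M Z (lbracket M X Y) = 0"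
    if "X \<in> ?g" "Y \<in> ?g" "Z \<in> ?g" for X Y Z
    using la that unfolding lie_algebra_def by blast
  have thg: "theta M X \<in> ?g" "theta M (theta M X) = X" if "X \<in> ?g" for X
    using M that by (auto simp: symmetric_space_def)
  have thl: "theta M (c *\<^sub>R X + d *\<^sub>R Y) = c *\<^sub>R theta M X + d *\<^sub>R theta M Y"
    "theta M (lbracket M X Y) = lbracket M (theta M X) (theta M Y)" if "X \<in> ?g" "Y \<in> ?g" for X Y c d
    using M that unfolding symmetric_space_def by blast+
  interpret L: involutive_lie_algebra ?g br th
  proof (rule involutive_lie_algebra.intro)
    show "subspace ?g" by (rule g)
    show "bilinear br" unfolding bilinear_def br_def
      by (auto intro!: linearI simp: linear_add[OF p(1)] linear_scale[OF p(1)] p(2) brl(1,2)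
          brl(3)[OF p(2) p(2) p(2)] brl(4)[OF p(2) p(2) p(2)])
    show "linear th"
    proof (rule linearI)
      show "th (X + Y) = th X + th Y" for X Y
        unfolding th_def linear_add[OF p(1)] using thl(1)[OF p(2) p(2), of 1 X 1 Y] by simp
      show "th (d *\<^sub>R X) = d *\<^sub>R th X" for d X
        unfolding th_def linear_scale[OF p(1)] using thl(1)[OF p(2) p(2), of d X 0 X] by simp
    qed
    fix X Y Z
    show "br X Y \<in> ?g" "th X \<in> ?g" "br X X = 0" by (simp_all add: br_def th_def brg brself thg p(2))
    show "br X (br Y Z) + br Y (br Z X) + br Z (br X Y) = 0"
      using brjac[OF p(2) p(2) p(2)] by (simp add: br_def p brg)
    show "th (th X) = X" if "X \<in> ?g" using that by (simp add: th_def p thg)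
    show "th (br X Y) = br (th X) (th Y)" by (simp add: th_def br_def p thg thl brg)
  qed
  have thM: "th X = theta M X" if "X \<in> ?g" for X
    using that by (simp add: th_def p)
  have brM: "br X Y = lbracket M X Y" if "X \<in> ?g" "Y \<in> ?g" for X Y
    using that by (simp add: br_def p)
  show ?thesis using L.involutive_lie_algebra_axioms thM brM by blast
qed

text \<open>
  Compact type becomes noncompact type for the dual bracket, with the same roots. The Killing form
  changes sign on \<open>a\<close>, hence so does the Killing-dual vector \<open>T\<close> of a
  root \<open>\<alpha>\<close>, but not the coroot \<open>2 T / \<alpha> T\<close>.
\<close>

theorem restricted_root_system:
  assumes M: "symmetric_space M" and type: "compact_type M \<or> noncompact_type M"
    and a: "maximal_abelian M a"
  obtains Q where "root_system a (restricted_roots M a) (coroot M a) Q"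
proof -
  let ?g = "lalg M"
  obtain br th where alg: "involutive_lie_algebra ?g br th \<and> (\<forall>X\<in>?g. th X = theta M X) \<and>
    (\<forall>X\<in>?g. \<forall>Y\<in>?g. br X Y = lbracket M X Y)"
    using symmetric_space_algebra[OF M] by (elim exE) (rule that)
  then interpret L: involutive_lie_algebra ?g br th by blast
  have thM: "th X = theta M X" if "X \<in> ?g" for X using alg that by blast
  have brM: "br X Y = lbracket M X Y" if "X \<in> ?g" "Y \<in> ?g" for X Y using alg that by blast
  have brg: "lbracket M X Y \<in> ?g" if "X \<in> ?g" "Y \<in> ?g" for X Y
    using brM[OF that] L.br_closed[of X Y] by simp
  note g = L.subspace_g
  have kfM: "L.kf X Y = killing M X Y" if "X \<in> ?g" "Y \<in> ?g" for X Y
    unfolding L.kf_def killing_def using that by (intro trace_on_cong[OF g]) (simp add: brM brg)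
  have "subspace a" "a \<subseteq> spart M" and comm: "\<forall>H\<in>a. \<forall>H'\<in>a. lbracket M H H' = 0"
    using a by (simp_all add: maximal_abelian_def)
  then have ag: "H \<in> ?g" "theta M H = - H" if "H \<in> a" for H
    using that by (auto simp: spart_def)
  then have as: "subspace a" "\<And>H. H \<in> a \<Longrightarrow> H \<in> ?g" "\<And>H. H \<in> a \<Longrightarrow> th H = - H"
    "\<And>H H'. H \<in> a \<Longrightarrow> H' \<in> a \<Longrightarrow> br H H' = 0"
    using \<open>subspace a\<close> comm by (simp_all add: thM brM)
  have amax: "X \<in> a" if "X \<in> ?g" "th X = - X" "\<And>H. H \<in> a \<Longrightarrow> br H X = 0" for X
  proof -
    have "X \<in> spart M" using that by (simp add: spart_def thM)
    moreover have "\<forall>H\<in>a. lbracket M H X = 0" using that as(2) by (simp add: brM)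
    ultimately show ?thesis using a by (simp add: maximal_abelian_def)
  qed
  show ?thesis
  proof (cases "compact_type M")
    case True
    interpret D: noncompact_lie_algebra ?g L.dbr th a
    proof (intro noncompact_lie_algebra.intro L.dual_algebra noncompact_lie_algebra_axioms.intro)
      have neg: "L.kf X X < 0" if "X \<in> ?g" "X \<noteq> 0" for X
        using True that by (simp add: kfM compact_type_def)
      show "involutive_lie_algebra.kf ?g L.dbr X X < 0" if "X \<in> ?g" "th X = X" "X \<noteq> 0" for X
        using L.dual_kf_k that neg by simp
      show "involutive_lie_algebra.kf ?g L.dbr X X > 0" if "X \<in> ?g" "th X = - X" "X \<noteq> 0" for X
        using L.dual_kf_s that neg by simp
      show "L.dbr H H' = 0" if "H \<in> a" "H' \<in> a" for H H'
        using that as by (simp add: L.dbr_s L.br_simps)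
      show "X \<in> a" if "X \<in> ?g" "th X = - X" "\<And>H. H \<in> a \<Longrightarrow> L.dbr H X = 0" for X
        using that as by (intro amax) (simp_all add: L.dbr_s L.br_simps)
    qed (use as in auto)
    have roots: "restricted_roots M a = D.roots"
    proof -
      have "(\<exists>X\<in>?g. \<exists>Y\<in>?g. (X, Y) \<noteq> (0, 0) \<and>
          (\<forall>H\<in>a. lbracket M H X = - \<alpha> H *\<^sub>R Y \<and> lbracket M H Y = \<alpha> H *\<^sub>R X)) \<longleftrightarrow>
          (\<exists>Z\<in>?g. Z \<noteq> 0 \<and> (\<forall>H\<in>a. L.dbr H Z = \<alpha> H *\<^sub>R Z))" for \<alpha>
      proof -
        have "(\<exists>X\<in>?g. \<exists>Y\<in>?g. (X, Y) \<noteq> (0, 0) \<and>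
          (\<forall>H\<in>a. lbracket M H X = - \<alpha> H *\<^sub>R Y \<and> lbracket M H Y = \<alpha> H *\<^sub>R X)) \<longleftrightarrow>
          (\<exists>X\<in>?g. \<exists>Y\<in>?g. (X, Y) \<noteq> (0, 0) \<and>
          (\<forall>H\<in>a. br H X = - \<alpha> H *\<^sub>R Y \<and> br H Y = \<alpha> H *\<^sub>R X))"
          using as(2) by (simp add: brM cong: bex_cong ball_cong)
        also have "\<dots> \<longleftrightarrow> (\<exists>Z\<in>?g. Z \<noteq> 0 \<and> (\<forall>H\<in>a. L.dbr H Z = \<alpha> H *\<^sub>R Z))"
          by (rule L.dual_root_vectors[OF as(2,3)])
        finally show ?thesis .
      qed
      then show ?thesis unfolding restricted_roots_def D.roots_def using True by simp
    qed
    have "coroot M a \<alpha> = (2 / \<alpha> (D.dual_vector \<alpha>)) *\<^sub>R D.dual_vector \<alpha>" if \<alpha>: "\<alpha> \<in> D.roots" for \<alpha>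
    proof -
      have \<alpha>f: "\<alpha> \<in> functionals a" using \<alpha> by (simp add: D.roots_def)
      note d = D.dual_vector[OF \<alpha>]
      have kk: "D.kf X Y = - killing M X Y" if "X \<in> a" "Y \<in> a" for X Y
        using L.dual_kf_s as that kfM by simp
      have neg: "killing M (- X) Y = - killing M X Y" if "X \<in> a" "Y \<in> a" for X Y
        using as that by (simp add: kfM[symmetric] L.kf_simps subspace_neg[OF as(1)])
      have "(THE T. T \<in> a \<and> (\<forall>H\<in>a. killing M T H = \<alpha> H)) = - D.dual_vector \<alpha>"
      proof (rule the_equality)
        show "- D.dual_vector \<alpha> \<in> a \<and> (\<forall>H\<in>a. killing M (- D.dual_vector \<alpha>) H = \<alpha> H)"
          using d as(1) kk neg by (simp add: subspace_neg)
        fix T assume T: "T \<in> a \<and> (\<forall>H\<in>a. killing M T H = \<alpha> H)"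
        then have "- T = D.dual_vector \<alpha>"
          using d kk neg as(1) by (intro D.dual_vector_unique) (simp_all add: subspace_neg)
        then show "T = - D.dual_vector \<alpha>" by (metis minus_minus)
      qed
      then show ?thesis
        unfolding coroot_def Let_def using functional_scale[OF \<alpha>f as(1) d(1), of "-1"] by simp
    qed
    then show ?thesis using that[of D.kf] root_system_transfer[OF D.root_system] roots by (simp add: roots)
  next
    case False
    then have nc: "noncompact_type M" using type by blast
    interpret D: noncompact_lie_algebra ?g br th a
    proof
      show "L.kf X X < 0" if "X \<in> ?g" "th X = X" "X \<noteq> 0" for X
        using nc that by (simp add: kfM noncompact_type_def kpart_def thM)
      show "L.kf X X > 0" if "X \<in> ?g" "th X = - X" "X \<noteq> 0" for X
        using nc that by (simp add: kfM noncompact_type_def spart_def thM)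
    qed (use as amax in auto)
    have roots: "restricted_roots M a = D.roots"
      unfolding restricted_roots_def D.roots_def using False as(2) by (simp add: brM cong: bex_cong ball_cong)
    have "coroot M a \<alpha> = (2 / \<alpha> (D.dual_vector \<alpha>)) *\<^sub>R D.dual_vector \<alpha>" if \<alpha>: "\<alpha> \<in> D.roots" for \<alpha>
    proof -
      have "(\<forall>H\<in>a. killing M T H = \<alpha> H) \<longleftrightarrow> (\<forall>H\<in>a. L.kf T H = \<alpha> H)" if "T \<in> a" for T
        using that as(2) by (simp add: kfM)
      then have "(THE T. T \<in> a \<and> (\<forall>H\<in>a. killing M T H = \<alpha> H)) = D.dual_vector \<alpha>"
        unfolding D.dual_vector_def by (metis (no_types, lifting))
      then show ?thesis by (simp add: coroot_def Let_def)
    qed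
    then show ?thesis using that[of L.kf] root_system_transfer[OF D.root_system] roots by (simp add: roots)
  qed
qed

section \<open>Reflection groups\<close>

definition reflection :: "'v::euclidean_space set \<Rightarrow> ('v \<Rightarrow> real) \<Rightarrow> 'v \<Rightarrow> 'v \<Rightarrow> 'v" where
  "reflection a \<alpha> d = (\<lambda>H\<in>a. H - \<alpha> H *\<^sub>R d)"

text \<open>
  Closure under products suffices, as the generators will be involutions. The maps are extensional
  on \<open>a\<close>.
\<close>

inductive_set generated_group :: "'v set \<Rightarrow> ('v \<Rightarrow> 'v) set \<Rightarrow> ('v \<Rightarrow> 'v) set" for a G where
  generated_id: "(\<lambda>H\<in>a. H) \<in> generated_group a G"
| generated_step: "w \<in> generated_group a G \<Longrightarrow> s \<in> G \<Longrightarrow> compose a s w \<in> generated_group a G"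

lemma generated_group_extensional: "w \<in> generated_group a G \<Longrightarrow> w \<in> extensional a"
  by (cases rule: generated_group.cases) auto

lemma generated_group_maps:
  assumes "G \<subseteq> a \<rightarrow> a" "w \<in> generated_group a G"
  shows "x \<in> a \<Longrightarrow> w x \<in> a"
  using assms(2)
proof (induction arbitrary: x rule: generated_group.induct)
  case (generated_step w s)
  then have "s \<in> a \<rightarrow> a" "w x \<in> a" using assms(1) by auto
  then show ?case using generated_step.prems by (auto simp: compose_def)
qed simp

lemma generated_group_compose:
  assumes G: "G \<subseteq> a \<rightarrow> a"
    and u: "u \<in> generated_group a G" and w: "w \<in> generated_group a G"
  shows "compose a u w \<in> generated_group a G"
  using u
proof (induction rule: generated_group.induct)
  case generated_id
  have "compose a (\<lambda>H\<in>a. H) w = w"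
    using generated_group_extensional[OF w] generated_group_maps[OF G w]
    by (auto simp: compose_def extensional_def fun_eq_iff)
  then show ?case using w by metis
next
  case (generated_step u s)
  have "compose a (compose a s u) w = compose a s (compose a u w)"
    using generated_group_maps[OF G w] by (auto simp: compose_def fun_eq_iff)
  then show ?case using generated_step generated_group.generated_step by metis
qed

lemma generated_group_generator:
  assumes "s \<in> G" "s \<in> extensional a"
  shows "s \<in> generated_group a G"
proof -
  have "compose a s (\<lambda>H\<in>a. H) = s" using assms(2) by (auto simp: compose_def extensional_def fun_eq_iff)
  then show ?thesis using generated_group.generated_step[OF generated_group.generated_id assms(1)] by metis
qed

lemma generated_group_subset:
  assumes G: "G' \<subseteq> a \<rightarrow> a" and "G \<subseteq> generated_group a G'"
  shows "generated_group a G \<subseteq> generated_group a G'"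
proof
  fix w assume "w \<in> generated_group a G"
  then show "w \<in> generated_group a G'"
  proof induction
    case generated_id
    show ?case by (rule generated_group.generated_id)
  next
    case (generated_step w s)
    then show ?case using generated_group_compose[OF G] assms(2) by blast
  qed
qed

context root_system
begin

lemmas R_linear = functional_add[OF R_functional subspace_a] functional_diff[OF R_functional subspace_a]
  functional_scale[OF R_functional subspace_a] functional_zero[OF R_functional subspace_a]

lemma reflection_a: "\<alpha> \<in> R \<Longrightarrow> H \<in> a \<Longrightarrow> reflection a \<alpha> (c \<alpha>) H \<in> a"
  by (simp add: reflection_def c_a subspace_a subspace_diff subspace_scale)

text \<open>
  A reflection preserving \<open>R\<close> is determined by its root. If \<open>d\<close> and \<open>c \<alpha>\<close> were different, the product of the
  two reflections would be a unipotent map of infinite order on the finite set \<open>R\<close>.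
\<close>

lemma coroot_unique:
  assumes \<alpha>: "\<alpha> \<in> R" and d: "d \<in> a" "\<alpha> d = 2"
    and refl: "\<And>\<beta>. \<beta> \<in> R \<Longrightarrow> (\<lambda>H\<in>a. \<beta> H - \<beta> d * \<alpha> H) \<in> R"
  shows "d = c \<alpha>"
proof -
  define e where "e = c \<alpha> - d"
  have ea: "e \<in> a" using c_a[OF \<alpha>] d(1) subspace_a by (simp add: e_def subspace_diff)
  have \<beta>e: "\<beta> e = \<beta> (c \<alpha>) - \<beta> d" if "\<beta> \<in> R" for \<beta>
    using R_linear(2)[OF that] c_a[OF \<alpha>] d(1) by (simp add: e_def)
  have \<alpha>e: "\<alpha> e = 0" using \<beta>e[OF \<alpha>] c_two[OF \<alpha>] d(2) by simp
  have "\<beta> e = 0" if \<beta>: "\<beta> \<in> R" for \<beta>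
  proof (rule ccontr)
    assume ne: "\<beta> e \<noteq> 0"
    \<comment> \<open>the powers of the product of the two reflections, applied to \<open>\<beta>\<close>\<close>
    define f where "f n = (\<lambda>H\<in>a. \<beta> H + real n * \<beta> e * \<alpha> H)" for n
    have fR: "f n \<in> R" for n
    proof (induction n)
      case 0
      have "f 0 = \<beta>" using R_functional[OF \<beta>] by (auto simp: f_def functionals_def fun_eq_iff)
      then show ?case using \<beta> by simp
    next
      case (Suc n)
      define \<gamma> where "\<gamma> = (\<lambda>H\<in>a. f n H - f n (c \<alpha>) * \<alpha> H)"
      have "\<gamma> \<in> R" unfolding \<gamma>_def by (rule R_reflect[OF \<alpha> Suc])
      then have "(\<lambda>H\<in>a. \<gamma> H - \<gamma> d * \<alpha> H) \<in> R" by (rule refl)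
      moreover have "\<gamma> H - \<gamma> d * \<alpha> H = f (Suc n) H" if H: "H \<in> a" for H
      proof -
        have "f n e = \<beta> e" using ea \<alpha>e by (simp add: f_def)
        then have fe: "f n (c \<alpha>) = f n d + \<beta> e" using \<beta>e[OF Suc] by simp
        have "\<gamma> H - \<gamma> d * \<alpha> H = f n H + (f n (c \<alpha>) - f n d) * \<alpha> H"
          using H d by (simp add: \<gamma>_def algebra_simps)
        also have "\<dots> = f n H + \<beta> e * \<alpha> H" by (simp add: fe)
        also have "\<dots> = f (Suc n) H" using H by (simp add: f_def algebra_simps)
        finally show ?thesis .
      qed
      then have "(\<lambda>H\<in>a. \<gamma> H - \<gamma> d * \<alpha> H) = f (Suc n)" by (auto simp: fun_eq_iff f_def)
      ultimately show ?case by simp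
    qed
    have "inj f"
    proof (rule injI)
      fix m n assume "f m = f n"
      then have "f m d = f n d" by simp
      then show "m = n" using ne d by (simp add: f_def)
    qed
    then have "infinite (range f)" by (simp add: finite_image_iff)
    then show False using finite_subset[OF _ finite_R] fR by blast
  qed
  then have "e = 0" using R_separate[OF ea] by blast
  then show ?thesis by (simp add: e_def)
qed

lemma R_neg: "\<alpha> \<in> R \<Longrightarrow> (\<lambda>H\<in>a. - \<alpha> H) \<in> R"
  using R_reflect[of \<alpha> \<alpha>] c_two[of \<alpha>] by simp

lemma R_compose_reflection:
  assumes "\<alpha> \<in> R" "\<beta> \<in> R"
  shows "(\<lambda>H\<in>a. \<beta> (reflection a \<alpha> (c \<alpha>) H)) \<in> R"
proof -
  have "(\<lambda>H\<in>a. \<beta> (reflection a \<alpha> (c \<alpha>) H)) = (\<lambda>H\<in>a. \<beta> H - \<beta> (c \<alpha>) * \<alpha> H)"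
    using R_linear[OF assms(2)] c_a[OF assms(1)] subspace_a
    by (auto simp: fun_eq_iff reflection_def subspace_scale)
  then show ?thesis using R_reflect[OF assms] by simp
qed

lemma reflection_reflection:
  assumes "\<alpha> \<in> R" "H \<in> a"
  shows "reflection a \<alpha> (c \<alpha>) (reflection a \<alpha> (c \<alpha>) H) = H"
proof -
  have "\<alpha> (H - \<alpha> H *\<^sub>R c \<alpha>) = - \<alpha> H"
    using assms c_a c_two subspace_a by (simp add: R_linear subspace_scale)
  then show ?thesis using reflection_a[OF assms] assms by (simp add: reflection_def)
qed

lemma coroot_proportional:
  assumes \<alpha>: "\<alpha> \<in> R" and \<beta>: "\<beta> \<in> R" and t: "\<And>H. H \<in> a \<Longrightarrow> \<beta> H = t * \<alpha> H"
  shows "reflection a \<beta> (c \<beta>) = reflection a \<alpha> (c \<alpha>)"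
proof -
  have t2: "t * \<alpha> (c \<beta>) = 2" using t[OF c_a[OF \<beta>]] c_two[OF \<beta>] by simp
  then have t0: "t \<noteq> 0" by auto
  define d where "d = (1 / t) *\<^sub>R c \<alpha>"
  have "d = c \<beta>"
  proof (rule coroot_unique[OF \<beta>])
    show "d \<in> a" using c_a[OF \<alpha>] subspace_a by (simp add: d_def subspace_scale)
    then show "\<beta> d = 2" using t t0 c_two[OF \<alpha>] R_linear(3)[OF \<alpha> c_a[OF \<alpha>]] by (simp add: d_def)
    fix \<gamma> assume \<gamma>: "\<gamma> \<in> R"
    have "(\<lambda>H\<in>a. \<gamma> H - \<gamma> d * \<beta> H) = (\<lambda>H\<in>a. \<gamma> H - \<gamma> (c \<alpha>) * \<alpha> H)"
      using t t0 R_linear(3)[OF \<gamma> c_a[OF \<alpha>]] by (auto simp: fun_eq_iff d_def)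
    then show "(\<lambda>H\<in>a. \<gamma> H - \<gamma> d * \<beta> H) \<in> R" using R_reflect[OF \<alpha> \<gamma>] by simp
  qed
  then show ?thesis
    using t t0 by (auto simp: reflection_def fun_eq_iff d_def simp flip: \<open>d = c \<beta>\<close>)
qed

lemma reflection_conjugate:
  assumes \<sigma>: "\<sigma> \<in> R" and \<beta>: "\<beta> \<in> R"
  defines "s \<equiv> reflection a \<sigma> (c \<sigma>)"
  defines "\<gamma> \<equiv> (\<lambda>H\<in>a. \<beta> (s H))"
  shows "reflection a \<beta> (c \<beta>) = compose a s (compose a (reflection a \<gamma> (c \<gamma>)) s)"
proof -
  have \<gamma>: "\<gamma> \<in> R" unfolding \<gamma>_def s_def by (rule R_compose_reflection[OF \<sigma> \<beta>])
  have sa: "s H \<in> a" "s (s H) = H" if "H \<in> a" for H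
    using reflection_a[OF \<sigma>] reflection_reflection[OF \<sigma>] that by (simp_all add: s_def)
  have sR: "(\<lambda>H\<in>a. \<delta> (s H)) \<in> R" if "\<delta> \<in> R" for \<delta>
    unfolding s_def by (rule R_compose_reflection[OF \<sigma> that])
  have slin: "s (H - t *\<^sub>R K) = s H - t *\<^sub>R s K" if "H \<in> a" "K \<in> a" for H K t
    using that \<sigma> subspace_a
    by (simp add: s_def reflection_def R_linear subspace_diff subspace_scale algebra_simps)
  have "s (c \<gamma>) = c \<beta>"
  proof (rule coroot_unique[OF \<beta>])
    show "s (c \<gamma>) \<in> a" using sa c_a[OF \<gamma>] by blast
    show "\<beta> (s (c \<gamma>)) = 2" using c_two[OF \<gamma>] c_a[OF \<gamma>] by (simp add: \<gamma>_def)
    fix \<delta> assume \<delta>: "\<delta> \<in> R"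
    define \<epsilon> where "\<epsilon> = (\<lambda>H\<in>a. \<delta> (s H))"
    have "(\<lambda>H\<in>a. \<epsilon> H - \<epsilon> (c \<gamma>) * \<gamma> H) \<in> R"
      unfolding \<epsilon>_def by (rule R_reflect[OF \<gamma> sR[OF \<delta>]])
    from sR[OF this] have "(\<lambda>H\<in>a. \<epsilon> (s H) - \<epsilon> (c \<gamma>) * \<gamma> (s H)) \<in> R"
      using sa by (simp cong: restrict_cong)
    moreover have "(\<lambda>H\<in>a. \<epsilon> (s H) - \<epsilon> (c \<gamma>) * \<gamma> (s H)) = (\<lambda>H\<in>a. \<delta> H - \<delta> (s (c \<gamma>)) * \<beta> H)"
      using sa c_a[OF \<gamma>] by (auto simp: fun_eq_iff \<epsilon>_def \<gamma>_def)
    ultimately show "(\<lambda>H\<in>a. \<delta> H - \<delta> (s (c \<gamma>)) * \<beta> H) \<in> R" by simp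
  qed
  then show ?thesis
    using sa slin c_a[OF \<gamma>] by (auto simp: fun_eq_iff compose_def reflection_def \<gamma>_def)
qed

definition reflections :: "('v \<Rightarrow> real) set \<Rightarrow> ('v \<Rightarrow> 'v) set" where
  "reflections S = (\<lambda>\<alpha>. reflection a \<alpha> (c \<alpha>)) ` S"

lemma reflections_a: "S \<subseteq> R \<Longrightarrow> reflections S \<subseteq> a \<rightarrow> a"
  using reflection_a by (auto simp: reflections_def)

lemma reflections_ext: "s \<in> reflections S \<Longrightarrow> s \<in> extensional a"
  by (auto simp: reflections_def reflection_def)

text \<open>The multiples \<open>\<alpha> / 2\<^sup>k\<close> that are roots are finite in number, so every root is a multiple of one
  whose half is not a root.\<close>

lemma half_root_exists:
  assumes "\<alpha> \<in> R"
  obtains \<beta> t where "\<beta> \<in> R" "(\<lambda>H\<in>a. \<beta> H / 2) \<notin> R" "\<And>H. H \<in> a \<Longrightarrow> \<alpha> H = t * \<beta> H"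
proof -
  define f where "f k = (\<lambda>H\<in>a. \<alpha> H / 2 ^ k)" for k :: nat
  have f0: "f 0 = \<alpha>" using R_functional[OF assms] by (auto simp: f_def functionals_def fun_eq_iff)
  have inj: "inj f"
  proof (rule injI)
    fix k l assume "f k = f l"
    then have "f k (c \<alpha>) = f l (c \<alpha>)" by simp
    then show "k = l" using c_a[OF assms] c_two[OF assms] by (simp add: f_def)
  qed
  have "\<exists>k. f k \<notin> R"
  proof (rule ccontr)
    assume "\<nexists>k. f k \<notin> R"
    then have "finite (range f)" using finite_subset[OF _ finite_R] by blast
    then show False using inj by (simp add: finite_image_iff)
  qed
  define m where "m = (LEAST k. f k \<notin> R)"
  have m: "f m \<notin> R" "\<And>k. k < m \<Longrightarrow> f k \<in> R"
    using LeastI_ex[OF \<open>\<exists>k. f k \<notin> R\<close>] not_less_Least by (auto simp: m_def)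
  have "m \<noteq> 0" using m(1) f0 assms by (metis)
  then obtain k where k: "m = Suc k" using not0_implies_Suc by blast
  have "(\<lambda>H\<in>a. f k H / 2) = f m" by (auto simp: f_def k fun_eq_iff)
  then show ?thesis using that[of "f k" "2 ^ k"] m k by (auto simp: f_def)
qed

text \<open>
  A reflection is linear, so it maps \<open>\<beta> / 2\<close> to half the image of
  \<open>\<beta>\<close>; since reflections are involutions that permute \<open>R\<close>, they
  also permute the roots whose half is not a root.
\<close>

lemma half_root_system: "root_system a {\<alpha>\<in>R. (\<lambda>H\<in>a. \<alpha> H / 2) \<notin> R} c Q" (is "root_system a ?R c Q")
proof (rule root_system.intro)
  show "finite ?R" using finite_R by simp
  show "H = 0" if H: "H \<in> a" "\<And>\<alpha>. \<alpha> \<in> ?R \<Longrightarrow> \<alpha> H = 0" for H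
  proof (rule R_separate[OF H(1)])
    fix \<alpha> assume "\<alpha> \<in> R"
    then obtain \<beta> t where "\<beta> \<in> R" "(\<lambda>H\<in>a. \<beta> H / 2) \<notin> R" "\<And>H. H \<in> a \<Longrightarrow> \<alpha> H = t * \<beta> H"
      using half_root_exists by metis
    then show "\<alpha> H = 0" using H by simp
  qed
  show "(\<lambda>H\<in>a. \<beta> H - \<beta> (c \<alpha>) * \<alpha> H) \<in> ?R" if \<alpha>: "\<alpha> \<in> ?R" and \<beta>: "\<beta> \<in> ?R" for \<alpha> \<beta>
  proof -
    have \<alpha>R: "\<alpha> \<in> R" and \<beta>R: "\<beta> \<in> R" using \<alpha> \<beta> by simp_all
    define \<gamma> where "\<gamma> = (\<lambda>H\<in>a. \<beta> H - \<beta> (c \<alpha>) * \<alpha> H)"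
    have "(\<lambda>H\<in>a. \<gamma> H / 2) \<notin> R"
    proof
      assume "(\<lambda>H\<in>a. \<gamma> H / 2) \<in> R"
      from R_reflect[OF \<alpha>R this]
      have "(\<lambda>H\<in>a. (\<lambda>H\<in>a. \<gamma> H / 2) H - (\<lambda>H\<in>a. \<gamma> H / 2) (c \<alpha>) * \<alpha> H) \<in> R" .
      moreover have "(\<lambda>H\<in>a. (\<lambda>H\<in>a. \<gamma> H / 2) H - (\<lambda>H\<in>a. \<gamma> H / 2) (c \<alpha>) * \<alpha> H) = (\<lambda>H\<in>a. \<beta> H / 2)"
        using c_a[OF \<alpha>R] c_two[OF \<alpha>R] by (auto simp: fun_eq_iff \<gamma>_def field_simps)
      ultimately show False using \<beta> by simp
    qed
    then show ?thesis using R_reflect[OF \<alpha>R \<beta>R] by (simp add: \<gamma>_def)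
  qed
  show "2 * Q (c \<alpha>) H = \<alpha> H * Q (c \<alpha>) (c \<alpha>)" if "\<alpha> \<in> ?R" "H \<in> a" for \<alpha> H
    using Q_c that by simp
  show "Q x y = Q y x" if "x \<in> a" "y \<in> a" for x y using that by (rule Q_sym)
qed (simp_all add: subspace_a R_functional c_a c_two bilinear_Q Q_pos)

lemma reflections_half: "reflections R = reflections {\<alpha>\<in>R. (\<lambda>H\<in>a. \<alpha> H / 2) \<notin> R}"
proof
  show "reflections R \<subseteq> reflections {\<alpha>\<in>R. (\<lambda>H\<in>a. \<alpha> H / 2) \<notin> R}"
  proof
    fix s assume "s \<in> reflections R"
    then obtain \<alpha> where \<alpha>: "\<alpha> \<in> R" "s = reflection a \<alpha> (c \<alpha>)" by (auto simp: reflections_def)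
    obtain \<beta> t where \<beta>: "\<beta> \<in> R" "(\<lambda>H\<in>a. \<beta> H / 2) \<notin> R" "\<And>H. H \<in> a \<Longrightarrow> \<alpha> H = t * \<beta> H"
      using half_root_exists[OF \<alpha>(1)] by metis
    have "s = reflection a \<beta> (c \<beta>)" unfolding \<alpha>(2) by (rule coroot_proportional[OF \<beta>(1) \<alpha>(1) \<beta>(3)])
    then show "s \<in> reflections {\<alpha>\<in>R. (\<lambda>H\<in>a. \<alpha> H / 2) \<notin> R}" using \<beta> by (auto simp: reflections_def)
  qed
qed (auto simp: reflections_def)

end

locale positive_root_system = root_system +
  fixes H\<^sub>0
  assumes regular: "regular_element R a H\<^sub>0"
begin

abbreviation "S \<equiv> simple_roots R a H\<^sub>0"

lemma H0: "H\<^sub>0 \<in> a" and H0_ne: "\<alpha> \<in> R \<Longrightarrow> \<alpha> H\<^sub>0 \<noteq> 0"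
  using regular by (auto simp: regular_element_def)

lemma S_R: "\<sigma> \<in> S \<Longrightarrow> \<sigma> \<in> R" and S_pos: "\<sigma> \<in> S \<Longrightarrow> \<sigma> H\<^sub>0 > 0"
  by (auto simp: simple_roots_def positive_roots_def)

lemma finite_S: "finite S"
  using finite_subset[OF _ finite_R] S_R by blast

text \<open>
  A positive root that is not simple is a sum of two positive roots, both with smaller values at
  \<open>H\<^sub>0\<close>; as there are finitely many roots, splitting comes to an end.
\<close>

lemma positive_combination:
  assumes "\<alpha> \<in> R" "\<alpha> H\<^sub>0 > 0"
  obtains t where "\<And>\<sigma>. t \<sigma> \<ge> (0::real)" "\<And>H. H \<in> a \<Longrightarrow> \<alpha> H = (\<Sum>\<sigma>\<in>S. t \<sigma> * \<sigma> H)"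
proof -
  have "\<exists>t. (\<forall>\<sigma>. t \<sigma> \<ge> (0::real)) \<and> (\<forall>H\<in>a. \<alpha> H = (\<Sum>\<sigma>\<in>S. t \<sigma> * \<sigma> H))"
    using assms
  proof (induction "card {\<beta>\<in>R. \<beta> H\<^sub>0 < \<alpha> H\<^sub>0}" arbitrary: \<alpha> rule: less_induct)
    case less
    show ?case
    proof (cases "\<alpha> \<in> S")
      case True
      have "\<alpha> H = (\<Sum>\<sigma>\<in>S. of_bool (\<sigma> = \<alpha>) * \<sigma> H)" for H
        using finite_S True by (simp add: of_bool_def if_distrib[of "\<lambda>x. x * _"] cong: if_cong)
      then show ?thesis by (intro exI[of _ "\<lambda>\<sigma>. of_bool (\<sigma> = \<alpha>)"]) auto
    next
      case False
      then obtain \<beta> \<gamma> where bg: "\<beta> \<in> R" "\<beta> H\<^sub>0 > 0" "\<gamma> \<in> R" "\<gamma> H\<^sub>0 > 0" "\<And>H. H \<in> a \<Longrightarrow> \<alpha> H = \<beta> H + \<gamma> H"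
        using less.prems unfolding simple_roots_def positive_roots_def by blast
      have lt: "\<beta> H\<^sub>0 < \<alpha> H\<^sub>0" "\<gamma> H\<^sub>0 < \<alpha> H\<^sub>0" using bg H0 by simp_all
      have sub: "card {\<delta>\<in>R. \<delta> H\<^sub>0 < \<delta>' H\<^sub>0} < card {\<delta>\<in>R. \<delta> H\<^sub>0 < \<alpha> H\<^sub>0}"
        if "\<delta>' \<in> R" "\<delta>' H\<^sub>0 < \<alpha> H\<^sub>0" for \<delta>'
        using that finite_R by (intro psubset_card_mono) auto
      obtain t where t: "\<forall>\<sigma>. t \<sigma> \<ge> 0" "\<forall>H\<in>a. \<beta> H = (\<Sum>\<sigma>\<in>S. t \<sigma> * \<sigma> H)"
        using less.hyps[OF sub[OF bg(1) lt(1)] bg(1,2)] by blast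
      obtain t' where t': "\<forall>\<sigma>. t' \<sigma> \<ge> 0" "\<forall>H\<in>a. \<gamma> H = (\<Sum>\<sigma>\<in>S. t' \<sigma> * \<sigma> H)"
        using less.hyps[OF sub[OF bg(3) lt(2)] bg(3,4)] by blast
      show ?thesis
        using t t' bg(5) by (intro exI[of _ "\<lambda>\<sigma>. t \<sigma> + t' \<sigma>"]) (simp add: distrib_right sum.distrib)
    qed
  qed
  then show ?thesis using that by blast
qed

lemma simple_separate:
  assumes "H \<in> a" "\<And>\<sigma>. \<sigma> \<in> S \<Longrightarrow> \<sigma> H = 0"
  shows "H = 0"
proof (rule R_separate[OF assms(1)])
  have pos: "\<alpha> H = 0" if \<alpha>: "\<alpha> \<in> R" "\<alpha> H\<^sub>0 > 0" for \<alpha>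
  proof -
    obtain t where "\<And>\<sigma>. t \<sigma> \<ge> (0::real)" "\<And>H. H \<in> a \<Longrightarrow> \<alpha> H = (\<Sum>\<sigma>\<in>S. t \<sigma> * \<sigma> H)"
      using positive_combination[OF \<alpha>] by blast
    then have "\<alpha> H = (\<Sum>\<sigma>\<in>S. t \<sigma> * \<sigma> H)" using assms(1) by blast
    also have "\<dots> = 0" using assms(2) by (intro sum.neutral) simp
    finally show ?thesis .
  qed
  fix \<alpha> assume \<alpha>: "\<alpha> \<in> R"
  show "\<alpha> H = 0"
  proof (cases "\<alpha> H\<^sub>0 > 0")
    case True
    then show ?thesis using pos \<alpha> by blast
  next
    case False
    then have "(\<lambda>H\<in>a. - \<alpha> H) H\<^sub>0 > 0" using H0 H0_ne[OF \<alpha>] by simp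
    then show ?thesis using pos[OF R_neg[OF \<alpha>]] assms(1) by simp
  qed
qed

end

text \<open>
  Simple roots of a positive system form obtuse angles. For the classical Dynkin diagrams the angles are read off from the Cartan integers.
\<close>

locale simple_root_system = positive_root_system +
  assumes obtuse: "\<sigma> \<in> S \<Longrightarrow> \<tau> \<in> S \<Longrightarrow> \<sigma> \<noteq> \<tau> \<Longrightarrow> \<tau> (c \<sigma>) \<le> 0"
begin

text \<open>Both numbers have the sign of \<open>Q (c \<alpha>) (c \<beta>)\<close>.\<close>

lemma coroot_sign: "\<alpha> \<in> R \<Longrightarrow> \<beta> \<in> R \<Longrightarrow> \<alpha> (c \<beta>) > 0 \<Longrightarrow> \<beta> (c \<alpha>) > 0"
proof -
  assume \<alpha>: "\<alpha> \<in> R" and \<beta>: "\<beta> \<in> R" and pos: "\<alpha> (c \<beta>) > 0"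
  have Q: "Q (c \<alpha>) (c \<alpha>) > 0" "Q (c \<beta>) (c \<beta>) > 0"
    using Q_pos[OF c_a] \<alpha> \<beta> c_two R_linear(4) by (metis zero_neq_numeral)+
  have "2 * Q (c \<alpha>) (c \<beta>) = \<alpha> (c \<beta>) * Q (c \<alpha>) (c \<alpha>)" using Q_c[OF \<alpha> c_a[OF \<beta>]] .
  moreover have "2 * Q (c \<beta>) (c \<alpha>) = \<beta> (c \<alpha>) * Q (c \<beta>) (c \<beta>)" using Q_c[OF \<beta> c_a[OF \<alpha>]] .
  moreover have "Q (c \<alpha>) (c \<beta>) = Q (c \<beta>) (c \<alpha>)" using Q_sym c_a \<alpha> \<beta> by blast
  moreover have "\<alpha> (c \<beta>) * Q (c \<alpha>) (c \<alpha>) > 0" using pos Q(1) by simp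
  ultimately have "\<beta> (c \<alpha>) * Q (c \<beta>) (c \<beta>) > 0" by simp
  then show "\<beta> (c \<alpha>) > 0" using Q(2) by (simp add: zero_less_mult_iff)
qed

text \<open>
  A simple reflection moves a positive root that is not a multiple of its simple root to a positive
  root. Choosing a simple root at an acute angle makes the root smaller at \<open>H\<^sub>0\<close>, so that after
  finitely many steps every root is conjugate to a multiple of a simple root.
\<close>

lemma reflection_in_simple_group:
  assumes "\<beta> \<in> R" "\<beta> H\<^sub>0 > 0"
  shows "reflection a \<beta> (c \<beta>) \<in> generated_group a (reflections S)"
  using assms
proof (induction "card {\<gamma>\<in>R. \<gamma> H\<^sub>0 < \<beta> H\<^sub>0}" arbitrary: \<beta> rule: less_induct)
  case less
  note \<beta> = less.prems
  have SR: "S \<subseteq> R" using S_R by blast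
  have gen: "reflection a \<sigma> (c \<sigma>) \<in> generated_group a (reflections S)" if "\<sigma> \<in> S" for \<sigma>
    using that by (intro generated_group_generator reflections_ext) (auto simp: reflections_def)
  obtain t where t: "\<And>\<sigma>. t \<sigma> \<ge> (0::real)" "\<And>H. H \<in> a \<Longrightarrow> \<beta> H = (\<Sum>\<sigma>\<in>S. t \<sigma> * \<sigma> H)"
    using positive_combination[OF \<beta>] by blast
  show ?case
  proof (cases "\<exists>\<sigma>\<in>S. \<exists>t. \<forall>H\<in>a. \<beta> H = t * \<sigma> H")
    case True
    then obtain \<sigma> t where \<sigma>: "\<sigma> \<in> S" "\<And>H. H \<in> a \<Longrightarrow> \<beta> H = t * \<sigma> H" by blast
    then have "reflection a \<beta> (c \<beta>) = reflection a \<sigma> (c \<sigma>)"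
      using coroot_proportional[OF S_R \<beta>(1)] by blast
    then show ?thesis using gen[OF \<sigma>(1)] by simp
  next
    case False
    have "(\<Sum>\<sigma>\<in>S. t \<sigma> * \<sigma> (c \<beta>)) = 2" using t(2)[OF c_a[OF \<beta>(1)]] c_two[OF \<beta>(1)] by simp
    then have "\<exists>\<sigma>\<in>S. t \<sigma> * \<sigma> (c \<beta>) > 0" using sum_nonpos[of S "\<lambda>\<sigma>. t \<sigma> * \<sigma> (c \<beta>)"] by force
    then obtain \<sigma> where \<sigma>: "\<sigma> \<in> S" "t \<sigma> * \<sigma> (c \<beta>) > 0" by blast
    have "\<sigma> (c \<beta>) > 0" using \<sigma>(2) t(1)[of \<sigma>] by (simp add: zero_less_mult_iff)
    then have pos: "\<beta> (c \<sigma>) > 0" using coroot_sign S_R[OF \<sigma>(1)] \<beta>(1) by blast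
    define s where "s = reflection a \<sigma> (c \<sigma>)"
    define \<gamma> where "\<gamma> = (\<lambda>H\<in>a. \<beta> (s H))"
    have \<gamma>R: "\<gamma> \<in> R" unfolding \<gamma>_def s_def by (rule R_compose_reflection[OF S_R[OF \<sigma>(1)] \<beta>(1)])
    have \<gamma>: "\<gamma> H = \<beta> H - \<beta> (c \<sigma>) * \<sigma> H" if "H \<in> a" for H
      using that R_linear[OF \<beta>(1)] c_a[OF S_R[OF \<sigma>(1)]] subspace_a
      by (simp add: \<gamma>_def s_def reflection_def subspace_scale)
    have lt: "\<gamma> H\<^sub>0 < \<beta> H\<^sub>0" using \<gamma>[OF H0] pos S_pos[OF \<sigma>(1)] by simp
    have \<gamma>pos: "\<gamma> H\<^sub>0 > 0"
    proof (rule ccontr)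
      assume "\<not> \<gamma> H\<^sub>0 > 0"
      then have "(\<lambda>H\<in>a. - \<gamma> H) H\<^sub>0 > 0" using H0 H0_ne[OF \<gamma>R] by simp
      then obtain u where u: "\<And>\<sigma>. u \<sigma> \<ge> (0::real)" "\<And>H. H \<in> a \<Longrightarrow> (\<lambda>H\<in>a. - \<gamma> H) H = (\<Sum>\<sigma>\<in>S. u \<sigma> * \<sigma> H)"
        using positive_combination[OF R_neg[OF \<gamma>R]] by blast
      define k where "k = \<beta> (c \<sigma>) - t \<sigma> - u \<sigma>"
      \<comment> \<open>\<open>\<beta> - \<gamma>\<close> is a multiple of \<open>\<sigma>\<close>, hence so is the part of \<open>\<beta> - \<gamma>\<close> outside \<open>\<sigma>\<close>\<close>
      have k: "(\<Sum>\<tau>\<in>S - {\<sigma>}. (t \<tau> + u \<tau>) * \<tau> H) = k * \<sigma> H" if H: "H \<in> a" for H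
      proof -
        have "(\<Sum>\<tau>\<in>S. (t \<tau> + u \<tau>) * \<tau> H) = \<beta> H - \<gamma> H"
          using t(2)[OF H] u(2)[OF H] H by (simp add: distrib_right sum.distrib)
        also have "\<dots> = \<beta> (c \<sigma>) * \<sigma> H" using \<gamma>[OF H] by simp
        finally show ?thesis using finite_S \<sigma>(1) by (simp add: sum_diff1 k_def algebra_simps)
      qed
      have terms: "(t \<tau> + u \<tau>) * \<tau> H\<^sub>0 \<ge> 0" if "\<tau> \<in> S - {\<sigma>}" for \<tau>
        using that t(1)[of \<tau>] u(1)[of \<tau>] S_pos[of \<tau>] by simp
      have "k * \<sigma> H\<^sub>0 \<ge> 0" unfolding k[OF H0, symmetric] using terms by (rule sum_nonneg)
      then have "k \<ge> 0" using S_pos[OF \<sigma>(1)] by (simp add: zero_le_mult_iff)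
      have "k * \<sigma> (c \<sigma>) \<le> 0"
        unfolding k[OF c_a[OF S_R[OF \<sigma>(1)]], symmetric]
        using t(1) u(1) obtuse[OF \<sigma>(1)] by (intro sum_nonpos mult_nonneg_nonpos add_nonneg_nonneg) auto
      then have "k = 0" using \<open>k \<ge> 0\<close> c_two[OF S_R[OF \<sigma>(1)]] by simp
      then have "\<forall>\<tau>\<in>S - {\<sigma>}. (t \<tau> + u \<tau>) * \<tau> H\<^sub>0 = 0"
        using k[OF H0] finite_S terms by (subst sum_nonneg_eq_0_iff[symmetric]) auto
      then have "t \<tau> = 0" if "\<tau> \<in> S - {\<sigma>}" for \<tau>
      proof -
        have "(t \<tau> + u \<tau>) * \<tau> H\<^sub>0 = 0" "\<tau> H\<^sub>0 > 0"
          using \<open>\<forall>\<tau>\<in>S - {\<sigma>}. (t \<tau> + u \<tau>) * \<tau> H\<^sub>0 = 0\<close> that S_pos by blast+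
        then have "t \<tau> + u \<tau> = 0" by simp
        then show ?thesis using t(1)[of \<tau>] u(1)[of \<tau>] by linarith
      qed
      then have "\<beta> H = t \<sigma> * \<sigma> H" if "H \<in> a" for H
        using t(2)[OF that] finite_S \<sigma>(1) by (simp add: sum.remove[of S \<sigma>])
      then show False using False \<sigma>(1) by blast
    qed
    have "card {\<delta>\<in>R. \<delta> H\<^sub>0 < \<gamma> H\<^sub>0} < card {\<delta>\<in>R. \<delta> H\<^sub>0 < \<beta> H\<^sub>0}"
      using lt \<gamma>R finite_R by (intro psubset_card_mono) auto
    then have "reflection a \<gamma> (c \<gamma>) \<in> generated_group a (reflections S)"
      using less.hyps \<gamma>R \<gamma>pos by blast
    moreover have "reflection a \<beta> (c \<beta>) = compose a s (compose a (reflection a \<gamma> (c \<gamma>)) s)"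
      unfolding \<gamma>_def s_def by (rule reflection_conjugate[OF S_R[OF \<sigma>(1)] \<beta>(1)])
    ultimately show ?thesis
      using generated_group_compose[OF reflections_a[OF SR]] gen[OF \<sigma>(1)] by (simp add: s_def)
  qed
qed

theorem simple_reflections_generate:
  "generated_group a (reflections R) = generated_group a (reflections S)"
proof
  have SR: "S \<subseteq> R" using S_R by blast
  have "reflection a \<beta> (c \<beta>) \<in> generated_group a (reflections S)" if \<beta>: "\<beta> \<in> R" for \<beta>
  proof (cases "\<beta> H\<^sub>0 > 0")
    case True
    then show ?thesis using reflection_in_simple_group \<beta> by blast
  next
    case False
    then have "(\<lambda>H\<in>a. - \<beta> H) H\<^sub>0 > 0" using H0 H0_ne[OF \<beta>] by simp
    then have "reflection a (\<lambda>H\<in>a. - \<beta> H) (c (\<lambda>H\<in>a. - \<beta> H)) \<in> generated_group a (reflections S)"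
      using reflection_in_simple_group R_neg[OF \<beta>] by blast
    moreover have "reflection a (\<lambda>H\<in>a. - \<beta> H) (c (\<lambda>H\<in>a. - \<beta> H)) = reflection a \<beta> (c \<beta>)"
      using coroot_proportional[OF \<beta> R_neg[OF \<beta>], of "-1"] by simp
    ultimately show ?thesis by simp
  qed
  then show "generated_group a (reflections R) \<subseteq> generated_group a (reflections S)"
    by (intro generated_group_subset[OF reflections_a[OF SR]]) (auto simp: reflections_def)
  show "generated_group a (reflections S) \<subseteq> generated_group a (reflections R)"
    using SR by (intro generated_group_subset[OF reflections_a[OF order.refl]] subsetI generated_group_generator)
      (auto simp: reflections_def intro: reflections_ext[of _ S, unfolded reflections_def])
qed

end

section \<open>Signed permutations of coordinates\<close>

text \<open>
  The flag \<open>Z\<close> marks the coordinates of a hyperplane \<open>\<Sum>x\<^sub>k =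
  0\<close>, as in type \<open>A\<close>. Apart from this relation the coordinates are independent
  and separate points.
\<close>

definition coordinate_system :: "bool \<Rightarrow> 'v::euclidean_space set \<Rightarrow> nat \<Rightarrow> (nat \<Rightarrow> 'v \<Rightarrow> real) \<Rightarrow> bool" where
  "coordinate_system Z a N f \<longleftrightarrow> subspace a \<and> (\<forall>k\<in>{1..N}. f k \<in> functionals a) \<and>
     (Z \<longrightarrow> (\<forall>x\<in>a. (\<Sum>k=1..N. f k x) = 0)) \<and>
     (\<forall>x\<in>a. (\<forall>k\<in>{1..N}. f k x = 0) \<longrightarrow> x = 0) \<and>
     (\<forall>y. (Z \<longrightarrow> (\<Sum>k=1..N. y k) = 0) \<longrightarrow> (\<exists>x\<in>a. \<forall>k\<in>{1..N}. f k x = y k))"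

text \<open>
  The entry at position \<open>k\<close> of the image is read off at position \<open>\<pi>
  k\<close>, so composition of maps reverses the order of the permutations.
\<close>

definition acts_as :: "'v set \<Rightarrow> nat \<Rightarrow> (nat \<Rightarrow> 'v \<Rightarrow> real) \<Rightarrow> ('v \<Rightarrow> 'v) \<Rightarrow> (nat \<Rightarrow> nat) \<Rightarrow> (nat \<Rightarrow> real) \<Rightarrow> bool" where
  "acts_as a N f w \<pi> \<epsilon> \<longleftrightarrow> (\<forall>x\<in>a. \<forall>k\<in>{1..N}. f k (w x) = \<epsilon> k * f (\<pi> k) x)"

definition signed_permutations :: "'v::euclidean_space set \<Rightarrow> nat \<Rightarrow> (nat \<Rightarrow> 'v \<Rightarrow> real) \<Rightarrow> (nat \<Rightarrow> real) set \<Rightarrow> ('v \<Rightarrow> 'v) set" where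
  "signed_permutations a N f E = {w \<in> a \<rightarrow>\<^sub>E a. \<exists>\<pi> \<epsilon>. \<pi> permutes {1..N} \<and> \<epsilon> \<in> E \<and> acts_as a N f w \<pi> \<epsilon>}"

definition sign_vectors :: "nat \<Rightarrow> (nat \<Rightarrow> real) set" where
  "sign_vectors N = {\<epsilon>. \<forall>k\<in>{1..N}. \<epsilon> k = 1 \<or> \<epsilon> k = -1}"

definition type_signs :: "classical_type \<Rightarrow> nat \<Rightarrow> (nat \<Rightarrow> real) set" where
  "type_signs X N = {\<epsilon> \<in> sign_vectors N.
     (X = TypeA \<longrightarrow> (\<forall>k\<in>{1..N}. \<epsilon> k = 1)) \<and> (X = TypeD \<longrightarrow> (\<Prod>k=1..N. \<epsilon> k) = 1)}"

definition flip :: "nat set \<Rightarrow> nat \<Rightarrow> real" where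
  "flip S k = (if k \<in> S then -1 else 1)"

lemma coordinate_unique:
  assumes "coordinate_system Z a N f" "x \<in> a" "y \<in> a" "\<And>k. k \<in> {1..N} \<Longrightarrow> f k x = f k y"
  shows "x = y"
proof -
  have sub: "subspace a" and f: "\<And>k. k \<in> {1..N} \<Longrightarrow> f k \<in> functionals a"
    and inj: "\<And>x. x \<in> a \<Longrightarrow> (\<forall>k\<in>{1..N}. f k x = 0) \<Longrightarrow> x = 0"
    using assms(1) unfolding coordinate_system_def by blast+
  have "x - y \<in> a" using sub assms(2,3) by (simp add: subspace_diff)
  moreover have "\<forall>k\<in>{1..N}. f k (x - y) = 0"
    using functional_diff[OF f sub] assms(2-4) by simp
  ultimately have "x - y = 0" by (rule inj)
  then show ?thesis by simp
qed

lemma coordinate_sum: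
  assumes "coordinate_system True a N f" "x \<in> a"
  shows "(\<Sum>k=1..N. f k x) = 0"
  using assms unfolding coordinate_system_def by blast

lemma permutes_range: "\<pi> permutes {1..N} \<Longrightarrow> k \<in> {1..N} \<Longrightarrow> \<pi> k \<in> {1..N::nat}"
  using permutes_in_image by metis

lemma acts_as_compose:
  assumes "acts_as a N f v \<pi> \<epsilon>" "acts_as a N f w \<rho> \<delta>" "w \<in> a \<rightarrow> a" "\<pi> permutes {1..N}"
  shows "acts_as a N f (compose a v w) (\<rho> \<circ> \<pi>) (\<lambda>k. \<epsilon> k * \<delta> (\<pi> k))"
  unfolding acts_as_def
proof (intro ballI)
  fix x k assume x: "x \<in> a" and k: "k \<in> {1..N}"
  have "w x \<in> a" using assms(3) x by blast
  then have "f k (v (w x)) = \<epsilon> k * f (\<pi> k) (w x)" using assms(1) k by (simp add: acts_as_def)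
  also have "\<dots> = \<epsilon> k * (\<delta> (\<pi> k) * f (\<rho> (\<pi> k)) x)"
    using assms(2) x permutes_range[OF assms(4) k] by (simp add: acts_as_def)
  finally show "f k (compose a v w x) = \<epsilon> k * \<delta> (\<pi> k) * f ((\<rho> \<circ> \<pi>) k) x"
    using x by (simp add: compose_def)
qed

lemma acts_as_unique:
  assumes "coordinate_system Z a N f" "acts_as a N f v \<pi> \<epsilon>" "acts_as a N f w \<pi> \<delta>"
    "\<And>k. k \<in> {1..N} \<Longrightarrow> \<epsilon> k = \<delta> k" "v \<in> a \<rightarrow>\<^sub>E a" "w \<in> a \<rightarrow>\<^sub>E a"
  shows "v = w"
proof (rule PiE_ext[OF assms(5,6)])
  fix x assume x: "x \<in> a"
  then have "v x \<in> a" "w x \<in> a" using assms(5,6) by auto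
  then show "v x = w x"
    using assms(2-4) x by (intro coordinate_unique[OF assms(1)]) (auto simp: acts_as_def)
qed

lemma type_signs_mult:
  assumes "\<pi> permutes {1..N}" "\<epsilon> \<in> type_signs X N" "\<delta> \<in> type_signs X N"
  shows "(\<lambda>k. \<epsilon> k * \<delta> (\<pi> k)) \<in> type_signs X N"
proof -
  have \<epsilon>: "\<epsilon> k = 1 \<or> \<epsilon> k = -1" and \<delta>: "\<delta> k = 1 \<or> \<delta> k = -1" if "k \<in> {1..N}" for k
    using that assms(2,3) unfolding type_signs_def sign_vectors_def by blast+
  have "\<epsilon> k * \<delta> (\<pi> k) = 1 \<or> \<epsilon> k * \<delta> (\<pi> k) = -1" if "k \<in> {1..N}" for k
    using \<epsilon>[OF that] \<delta>[OF permutes_range[OF assms(1) that]] by auto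
  moreover have "\<epsilon> k * \<delta> (\<pi> k) = 1" if "X = TypeA" "k \<in> {1..N}" for k
    using that permutes_range[OF assms(1) that(2)] assms(2,3) unfolding type_signs_def by simp
  moreover have "(\<Prod>k=1..N. \<epsilon> k * \<delta> (\<pi> k)) = 1" if "X = TypeD"
  proof -
    have "(\<Prod>k=1..N. \<delta> (\<pi> k)) = (\<Prod>k=1..N. \<delta> k)"
      by (rule prod.permute[OF assms(1), symmetric, unfolded comp_def])
    then show ?thesis using that assms(2,3) by (simp add: prod.distrib type_signs_def)
  qed
  ultimately show ?thesis unfolding type_signs_def sign_vectors_def by blast
qed

lemma extend_injections:
  assumes "finite B" "inj_on j S" "inj_on j' S" "j ` S \<subseteq> B" "j' ` S \<subseteq> B"
  obtains \<pi> where "\<pi> permutes B" "\<And>k. k \<in> S \<Longrightarrow> \<pi> (j k) = j' k"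
proof -
  have fin: "finite (j ` S)" "finite (j' ` S)" using assms finite_subset by blast+
  have "card (j ` S) = card S" "card (j' ` S) = card S" using assms(2,3) by (simp_all add: card_image)
  then have "card (B - j ` S) = card (B - j' ` S)"
    using assms fin by (simp add: card_Diff_subset)
  then obtain h where h: "bij_betw h (B - j ` S) (B - j' ` S)"
    using finite_same_card_bij[of "B - j ` S" "B - j' ` S"] assms(1) by auto
  define \<pi> where "\<pi> x = (if x \<in> j ` S then j' (inv_into S j x) else if x \<in> B then h x else x)" for x
  have 1: "\<pi> (j k) = j' k" if "k \<in> S" for k
    using that assms(2) by (simp add: \<pi>_def)
  have "bij_betw \<pi> (j ` S) (j' ` S)"
  proof (rule bij_betw_imageI)
    have "inj_on (\<pi> \<circ> j) S" using assms(3) 1 by (simp add: inj_on_def)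
    then show "inj_on \<pi> (j ` S)" by (rule inj_on_imageI)
    show "\<pi> ` j ` S = j' ` S" using 1 by (simp add: image_image)
  qed
  moreover have "bij_betw \<pi> (B - j ` S) (B - j' ` S)"
  proof -
    have "\<pi> x = h x" if "x \<in> B - j ` S" for x using that by (simp add: \<pi>_def)
    then show ?thesis using h bij_betw_cong[of "B - j ` S" \<pi> h] by blast
  qed
  ultimately have "bij_betw \<pi> (j ` S \<union> (B - j ` S)) (j' ` S \<union> (B - j' ` S))"
    by (rule bij_betw_combine) auto
  moreover have "j ` S \<union> (B - j ` S) = B" "j' ` S \<union> (B - j' ` S) = B" using assms by auto
  ultimately have "bij_betw \<pi> B B" by simp
  then have "\<pi> permutes B" using assms(4) by (intro bij_imp_permutes) (auto simp: \<pi>_def)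
  then show ?thesis using that 1 by blast
qed

text \<open>
  Adjacent transpositions generate all permutations. Conjugation by permutations then moves the given
  sign changes to arbitrary positions, or to arbitrary pairs of positions in type \<open>D\<close>, where an even
  set of positions is exhausted pair by pair.
\<close>

lemma signed_permutation_generation:
  fixes P :: "(nat \<Rightarrow> nat) \<Rightarrow> (nat \<Rightarrow> real) \<Rightarrow> bool"
  assumes cong: "\<And>\<pi> \<epsilon> \<delta>. P \<pi> \<epsilon> \<Longrightarrow> (\<And>k. k \<in> {1..N} \<Longrightarrow> \<epsilon> k = \<delta> k) \<Longrightarrow> P \<pi> \<delta>"
    and one: "P id (\<lambda>_. 1)"
    and mult: "\<And>\<pi> \<epsilon> \<rho> \<delta>. \<pi> permutes {1..N} \<Longrightarrow> \<rho> permutes {1..N} \<Longrightarrow> P \<pi> \<epsilon> \<Longrightarrow> P \<rho> \<delta> \<Longrightarrow>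
      P (\<rho> \<circ> \<pi>) (\<lambda>k. \<epsilon> k * \<delta> (\<pi> k))"
    and adj: "\<And>i. 1 \<le> i \<Longrightarrow> i + 1 \<le> N \<Longrightarrow> P (Transposition.transpose i (i + 1)) (\<lambda>_. 1)"
    and bc: "X = TypeB \<or> X = TypeC \<Longrightarrow> P id (flip {1})"
    and d: "X = TypeD \<Longrightarrow> P (Transposition.transpose 1 2) (flip {1, 2})"
    and N: "N \<ge> 2"
    and \<pi>: "\<pi> permutes {1..N}" and \<epsilon>: "\<epsilon> \<in> type_signs X N"
  shows "P \<pi> \<epsilon>"
proof -
  have mult1: "P (\<rho> \<circ> \<pi>) (\<lambda>_. 1)"
    if "\<pi> permutes {1..N}" "\<rho> permutes {1..N}" "P \<pi> (\<lambda>_. 1)" "P \<rho> (\<lambda>_. 1)" for \<pi> \<rho>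
    using mult[OF that] by simp
  have tp: "Transposition.transpose i j permutes {1..N}" if "i \<in> {1..N}" "j \<in> {1..N}" for i j :: nat
    using that by (rule permutes_swap_id)
  have trans_add: "P (Transposition.transpose i (i + Suc d)) (\<lambda>_. 1)" if "1 \<le> i" "i + Suc d \<le> N" for i d
    using that
  proof (induction d)
    case 0
    then show ?case using adj by simp
  next
    case (Suc d)
    let ?s = "Transposition.transpose (i + Suc d) (i + Suc d + 1)" and ?t = "Transposition.transpose i (i + Suc d)"
    have "P ?t (\<lambda>_. 1)" using Suc by simp
    moreover have "P ?s (\<lambda>_. 1)" using Suc.prems by (intro adj) auto
    moreover have "?s permutes {1..N}" using Suc.prems by (intro tp) auto
    moreover have "?t permutes {1..N}" using Suc.prems by (intro tp) auto
    ultimately have "P (?s \<circ> (?t \<circ> ?s)) (\<lambda>_. 1)" by (intro mult1 permutes_compose) auto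
    moreover have "?s \<circ> (?t \<circ> ?s) = Transposition.transpose i (i + Suc (Suc d))"
      by (auto simp: fun_eq_iff Transposition.transpose_def)
    ultimately show ?case by simp
  qed
  have trans: "P (Transposition.transpose i j) (\<lambda>_. 1)" if "i \<in> {1..N}" "j \<in> {1..N}" for i j
  proof (cases i j rule: linorder_cases)
    case less
    then show ?thesis using trans_add[of i "j - i - 1"] that by simp
  next
    case equal
    then show ?thesis using one by (simp add: id_def[symmetric])
  next
    case greater
    then show ?thesis using trans_add[of j "i - j - 1"] that by (simp add: transpose_commute)
  qed
  have perm: "P \<pi> (\<lambda>_. 1)" if "\<pi> permutes {1..N}" for \<pi>
    using that finite_atLeastAtMost[of 1 N]
  proof (induction rule: permutes_induct)
    case id
    show ?case by (rule one)
  next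
    case (swap i j p)
    then show ?case using mult1[OF _ tp _ trans] by blast
  qed
  have conj: "P id (\<lambda>k. \<epsilon> (\<pi> k))" if "P id \<epsilon>" "\<pi> permutes {1..N}" for \<epsilon> \<pi>
  proof -
    have inv: "inv_into UNIV \<pi> permutes {1..N}" using that(2) by (rule permutes_inv)
    have "P (inv_into UNIV \<pi> \<circ> id) (\<lambda>k. \<epsilon> k * 1)"
      by (rule mult[OF permutes_id inv that(1) perm[OF inv]])
    then have "P ((inv_into UNIV \<pi> \<circ> id) \<circ> \<pi>) (\<lambda>k. 1 * (\<epsilon> (\<pi> k) * 1))"
      using mult[OF that(2) _ perm[OF that(2)]] inv by simp
    then show ?thesis using permutes_inv_o(2)[OF that(2)] by simp
  qed
  have join: "P id (\<lambda>k. \<epsilon> k * \<delta> k)" if "P id \<epsilon>" "P id \<delta>" for \<epsilon> \<delta>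
    using mult[OF permutes_id permutes_id that] by simp
  have flip_un: "P id (flip (S \<union> T))" if "P id (flip S)" "P id (flip T)" "S \<inter> T = {}" for S T
    by (rule cong[OF join[OF that(1,2)]]) (use that(3) in \<open>auto simp: flip_def\<close>)
  define S where "S = {k\<in>{1..N}. \<epsilon> k = -1}"
  have finS: "finite S" "S \<subseteq> {1..N}" by (auto simp: S_def)
  have \<epsilon>S: "\<epsilon> k = flip S k" if "k \<in> {1..N}" for k
    using \<epsilon> that by (auto simp: type_signs_def sign_vectors_def S_def flip_def)
  have flips: "P id (flip S)" if X: "X = TypeB \<or> X = TypeC"
  proof -
    have single: "P id (flip {k})" if "k \<in> {1..N}" for k
    proof -
      have t: "Transposition.transpose 1 k permutes {1..N}" using that N by (intro tp) auto
      have "(\<lambda>l. flip {1} (Transposition.transpose 1 k l)) = flip {k}"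
        by (auto simp: fun_eq_iff flip_def Transposition.transpose_def)
      then show ?thesis using conj[OF bc[OF X] t] by simp
    qed
    show ?thesis
      using finS
    proof (induction rule: finite_induct)
      case empty
      have "flip {} = (\<lambda>_. 1)" by (auto simp: flip_def)
      then show ?case using one by metis
    next
      case (insert k S)
      then have "P id (flip {k})" "P id (flip S)" "{k} \<inter> S = {}" using single[of k] by blast+
      then have "P id (flip ({k} \<union> S))" by (rule flip_un)
      then show ?case by (metis insert_is_Un)
    qed
  qed
  have "P id (flip S)"
  proof (cases X)
    case TypeA
    then have "S = {}" using \<epsilon> by (auto simp: type_signs_def S_def)
    then have "flip S = (\<lambda>_. 1)" by (auto simp: flip_def)
    then show ?thesis using one by simp
  next
    case TypeD
    have two: "P id (flip {1, 2})"
    proof -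
      have "Transposition.transpose 1 2 permutes {1..N}" using N by (intro tp) auto
      moreover have "P (Transposition.transpose 1 2) (\<lambda>_. 1)" using N by (intro trans) auto
      ultimately have "P (Transposition.transpose 1 2 \<circ> Transposition.transpose 1 2) (\<lambda>k. flip {1, 2} k * 1)"
        using mult[OF _ _ d[OF TypeD]] by blast
      then show ?thesis by simp
    qed
    have pair: "P id (flip {i, j})" if "i \<in> {1..N}" "j \<in> {1..N}" "i \<noteq> j" for i j
    proof -
      have "inj_on (\<lambda>k. if k = 1 then i else j) {1::nat, 2}" "inj_on (\<lambda>k. k) {1::nat, 2}"
        "(\<lambda>k. if k = 1 then i else j) ` {1::nat, 2} \<subseteq> {1..N}" "(\<lambda>k. k) ` {1::nat, 2} \<subseteq> {1..N}"
        using that N by (auto simp: inj_on_def)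
      then obtain \<pi> where \<pi>: "\<pi> permutes {1..N}" "\<And>k. k \<in> {1::nat, 2} \<Longrightarrow> \<pi> (if k = 1 then i else j) = k"
        by (rule extend_injections[OF finite_atLeastAtMost]) blast
      have ij: "\<pi> i = 1" "\<pi> j = 2" using \<pi>(2)[of 1] \<pi>(2)[of 2] by simp_all
      then have "(\<lambda>k. flip {1, 2} (\<pi> k)) = flip {i, j}"
        using permutes_inj[OF \<pi>(1)] by (auto simp: fun_eq_iff flip_def inj_def)
      then show ?thesis using conj[OF two \<pi>(1)] by simp
    qed
    have "(\<Prod>k=1..N. \<epsilon> k) = (-1) ^ card S"
    proof -
      have "(\<Prod>k=1..N. \<epsilon> k) = (\<Prod>k=1..N. if k \<in> S then -1 else 1)"
        using \<epsilon>S by (intro prod.cong) (auto simp: flip_def)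
      also have "\<dots> = (-1) ^ card S" using finS by (simp add: prod.If_cases Int_absorb1)
      finally show ?thesis .
    qed
    moreover have "(\<Prod>k=1..N. \<epsilon> k) = 1" using \<epsilon> TypeD by (simp add: type_signs_def)
    ultimately have "even (card S)" by (metis (no_types, lifting) minus_one_power_iff one_neq_neg_one)
    then show ?thesis
      using finS
    proof (induction "card S" arbitrary: S rule: less_induct)
      case less
      show ?case
      proof (cases "S = {}")
        case True
        then have "flip S = (\<lambda>_. 1)" by (auto simp: flip_def)
        then show ?thesis using one by simp
      next
        case False
        then obtain i where i: "i \<in> S" by blast
        have "S \<noteq> {i}" using less.prems(1) by auto
        then obtain j where j: "j \<in> S" "j \<noteq> i" using i by blast
        have card: "card (S - {i, j}) = card S - 2" using i j less.prems(2) by (simp add: card_Diff_subset)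
        moreover have "card S \<ge> 2" using i j less.prems(2) card_mono[of S "{i, j}"] by simp
        ultimately have "P id (flip (S - {i, j}))"
          using less.prems by (intro less.hyps) auto
        moreover have "P id (flip {i, j})" using i j less.prems(3) by (intro pair) auto
        ultimately have "P id (flip ((S - {i, j}) \<union> {i, j}))" by (rule flip_un) auto
        moreover have "(S - {i, j}) \<union> {i, j} = S" using i j by auto
        ultimately show ?thesis by simp
      qed
    qed
  qed (use flips in simp_all)
  then have "P id \<epsilon>" by (rule cong) (simp add: \<epsilon>S)
  then have "P (\<pi> \<circ> id) (\<lambda>k. \<epsilon> k * 1)" by (rule mult[OF permutes_id \<pi> _ perm[OF \<pi>]])
  then show ?thesis by simp
qed

section \<open>Standard coordinates\<close>

text \<open>
  The inner product of the simple root \<open>\<alpha>\<^sub>i\<close> with the vector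
  \<open>y\<close>, in closed form.
\<close>

definition std_pair :: "classical_type \<Rightarrow> nat \<Rightarrow> (nat \<Rightarrow> real) \<Rightarrow> real" where
  "std_pair X i y = (case X of TypeA \<Rightarrow> y (i + 1) - y i
     | TypeB \<Rightarrow> if i = 1 then y 1 else y i - y (i - 1)
     | TypeC \<Rightarrow> if i = 1 then 2 * y 1 else y i - y (i - 1)
     | TypeD \<Rightarrow> if i = 1 then y 1 + y 2 else y i - y (i - 1))"

lemma admissible_ge: "admissible_rank X r \<Longrightarrow> r \<ge> 1 \<and> num_coords X r \<ge> 2 \<and> (X = TypeD \<longrightarrow> r \<ge> 4)"
  by (cases X) (auto simp: num_coords_def)

lemma sum_of_bool_mult: "finite A \<Longrightarrow> (\<Sum>k\<in>A. of_bool (k = i) * y k) = (if i \<in> A then y i else (0::real))"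
  by (simp add: of_bool_def if_distrib[of "\<lambda>x. x * _"] cong: if_cong)

lemma sum_std_simple:
  assumes "admissible_rank X r" "i \<in> {1..r}"
  shows "(\<Sum>k=1..num_coords X r. std_simple X i k * y k) = std_pair X i y"
proof -
  have N: "r \<ge> 1" "X = TypeD \<longrightarrow> r \<ge> 4" "num_coords X r \<ge> 2" using admissible_ge[OF assms(1)] by auto
  have e: "(Suc k = i) = (k = i - 1)" if "i \<noteq> 1" "i \<ge> 1" for k using that by auto
  have i1: "1 \<le> i" "i \<le> r" using assms(2) by auto
  have int: "i \<noteq> Suc 0 \<Longrightarrow> {Suc 0..r} \<inter> {i - Suc 0} = {i - Suc 0}" using i1 by auto
  show ?thesis
  proof (cases X)
    case TypeA
    then show ?thesis using i1
      by (simp add: std_pair_def left_diff_distrib sum_subtractf sum_of_bool_mult num_coords_def)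
  next
    case TypeB
    then show ?thesis using i1 N
      by (cases "i = 1") (simp_all add: std_pair_def left_diff_distrib sum_subtractf sum_of_bool_mult num_coords_def e int)
  next
    case TypeC
    then show ?thesis using i1 N
      by (cases "i = 1") (simp_all add: std_pair_def left_diff_distrib sum_subtractf sum_of_bool_mult num_coords_def e int
          mult.assoc sum_distrib_left[symmetric])
  next
    case TypeD
    then show ?thesis using i1 N
      by (cases "i = 1") (simp_all add: std_pair_def left_diff_distrib distrib_right sum.distrib sum_subtractf
          sum_of_bool_mult num_coords_def e int)
  qed
qed

text \<open>The squared length of the simple root \<open>\<alpha>\<^sub>i\<close>.\<close>

definition std_norm :: "classical_type \<Rightarrow> nat \<Rightarrow> real" where
  "std_norm X i = (if i = 1 \<and> X = TypeB then 1 else if i = 1 \<and> X = TypeC then 4 else 2)"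

lemma std_norm: "i \<ge> 1 \<Longrightarrow> std_pair X i (std_simple X i) = std_norm X i"
  by (cases X) (auto simp: std_pair_def std_norm_def)

lemma std_cartan_eq:
  assumes "admissible_rank X r" "i \<in> {1..r}"
  shows "std_cartan X r i j = 2 * std_pair X i (std_simple X j) / std_norm X i"
  using assms(2) std_norm[of i X] by (simp only: std_cartan_def sum_std_simple[OF assms]) simp

lemma std_cartan_nonpos:
  assumes "admissible_rank X r" "i \<in> {1..r}" "j \<in> {1..r}" "i \<noteq> j"
  shows "std_cartan X r i j \<le> 0"
proof -
  have "std_pair X i (std_simple X j) \<le> 0"
    using assms(2-4) by (cases X) (auto simp: std_pair_def)
  then show ?thesis
    using std_cartan_eq[OF assms(1,2)] by (simp add: std_norm_def divide_nonpos_pos)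
qed

text \<open>
  The simple roots of type \<open>X\<^sub>r\<close> are a basis of the dual space, so that coroots
  can be recovered from Cartan integers.
\<close>

lemma std_nondegenerate:
  assumes "admissible_rank X r" "\<And>i. i \<in> {1..r} \<Longrightarrow> std_pair X i y = 0"
    "X = TypeA \<Longrightarrow> (\<Sum>k=1..num_coords X r. y k) = 0" "k \<in> {1..num_coords X r}"
  shows "y k = 0"
proof -
  have r: "r \<ge> 1" "X = TypeD \<longrightarrow> r \<ge> 4" using admissible_ge[OF assms(1)] by auto
  show ?thesis
  proof (cases "X = TypeA")
    case True
    have c: "y (Suc k) = y 1" if "k \<le> r" for k
      using that
    proof (induction k)
      case (Suc k)
      then show ?case using assms(2)[of "Suc k"] True by (simp add: std_pair_def)
    qed simp
    have c': "y k = y 1" if k: "k \<in> {1..r + 1}" for k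
    proof -
      obtain l where "k = Suc l" "l \<le> r" using k by (cases k) auto
      then show ?thesis using c by blast
    qed
    have "(\<Sum>k=1..r + 1. y k) = (\<Sum>k=1..r + 1. y 1)" by (rule sum.cong[OF refl c'])
    moreover have "(\<Sum>k=1..r + 1. y k) = 0"
      using assms(3)[OF True] True by (simp only: num_coords_def refl if_True)
    moreover have "(\<Sum>k=1..r + 1. y 1) = real (r + 1) * y 1" by simp
    ultimately have "real (r + 1) * y 1 = 0" by linarith
    then have "y 1 = 0" by simp
    moreover have "k \<in> {1..r + 1}" using assms(4) True by (simp add: num_coords_def)
    ultimately show ?thesis using c'[of k] by linarith
  next
    case False
    have y1: "y 1 = 0"
    proof (cases "X = TypeD")
      case True
      then show ?thesis using assms(2)[of 1] assms(2)[of 2] r by (simp add: std_pair_def)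
    next
      case False
      then show ?thesis using assms(2)[of 1] r \<open>X \<noteq> TypeA\<close> by (cases X) (auto simp: std_pair_def)
    qed
    have "y (Suc k) = 0" if "Suc k \<le> r" for k
      using that
    proof (induction k)
      case 0
      then show ?case using y1 by simp
    next
      case (Suc k)
      then show ?case using assms(2)[of "Suc (Suc k)"] False by (cases X) (auto simp: std_pair_def)
    qed
    from this[of "k - 1"] show ?thesis using assms(4) False by (cases k) (auto simp: num_coords_def)
  qed
qed

definition has_root_system :: "('x, 'v::euclidean_space) symm_space \<Rightarrow> 'v set \<Rightarrow> bool" where
  "has_root_system M a \<longleftrightarrow> (\<exists>Q. root_system a (restricted_roots M a) (coroot M a) Q)"

lemma has_root_system_half:
  assumes "has_root_system M a"
  obtains Q where "root_system a (half_roots M a) (coroot M a) Q"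
  using assms root_system.half_root_system unfolding has_root_system_def half_roots_def by blast

lemma weyl_group_generated:
  "weyl_group M a = generated_group a ((\<lambda>\<alpha>. reflection a \<alpha> (coroot M a \<alpha>)) ` restricted_roots M a)"
    (is "_ = generated_group a ?G")
proof -
  have eq: "root_reflection M a \<alpha> = reflection a \<alpha> (coroot M a \<alpha>)" for \<alpha>
    by (simp add: root_reflection_def reflection_def)
  show ?thesis
  proof
    show "weyl_group M a \<subseteq> generated_group a ?G"
    proof
      fix w assume "w \<in> weyl_group M a"
      then show "w \<in> generated_group a ?G"
      proof induction
        case 1
        show ?case by (rule generated_group.intros)
      next
        case (2 w \<alpha>)
        then show ?case unfolding eq by (intro generated_group.intros) auto
      qed
    qed
    show "generated_group a ?G \<subseteq> weyl_group M a"
    proof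
      fix w assume "w \<in> generated_group a ?G"
      then show "w \<in> weyl_group M a"
      proof induction
        case generated_id
        show ?case by (rule weyl_group.intros)
      next
        case (generated_step w s)
        then obtain \<alpha> where "\<alpha> \<in> restricted_roots M a" "s = root_reflection M a \<alpha>" by (auto simp: eq)
        then show ?case using generated_step by (auto intro: weyl_group.intros)
      qed
    qed
  qed
qed

lemma weyl_group_half:
  assumes "has_root_system M a"
  shows "weyl_group M a = generated_group a ((\<lambda>\<alpha>. reflection a \<alpha> (coroot M a \<alpha>)) ` half_roots M a)"
proof -
  obtain Q where "root_system a (restricted_roots M a) (coroot M a) Q"
    using assms by (auto simp: has_root_system_def)
  then interpret root_system a "restricted_roots M a" "coroot M a" Q .
  show ?thesis
    unfolding weyl_group_generated
    using reflections_half unfolding reflections_def half_roots_def by simp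
qed

lemma functional_sum:
  assumes "\<alpha> \<in> functionals a" "subspace a" "\<And>i. i \<in> I \<Longrightarrow> v i \<in> a"
  shows "\<alpha> (\<Sum>i\<in>I. t i *\<^sub>R v i) = (\<Sum>i\<in>I. t i * \<alpha> (v i))"
  using assms(3)
proof (induction I rule: infinite_finite_induct)
  case (insert i I)
  then have "(\<Sum>i\<in>I. t i *\<^sub>R v i) \<in> a" using assms(2) by (intro subspace_sum) (auto intro: subspace_scale)
  then show ?case
    using insert assms(1,2) by (simp add: functional_add functional_scale subspace_scale)
qed (use assms functional_zero in auto)

lemma std_pair_diff: "std_pair X j (\<lambda>k. u k - t * v k) = std_pair X j u - t * std_pair X j v"
  by (cases X) (auto simp: std_pair_def algebra_simps)

text \<open>The permutation and the signs by which the reflection in a standard simple root acts.\<close>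

definition std_perm :: "classical_type \<Rightarrow> nat \<Rightarrow> nat \<Rightarrow> nat" where
  "std_perm X i = (if X = TypeA then Transposition.transpose i (i + 1)
     else if i \<noteq> 1 then Transposition.transpose (i - 1) i
     else if X = TypeD then Transposition.transpose 1 2 else id)"

definition std_sign :: "classical_type \<Rightarrow> nat \<Rightarrow> nat \<Rightarrow> real" where
  "std_sign X i = (if X = TypeA \<or> i \<noteq> 1 then (\<lambda>_. 1) else if X = TypeD then flip {1, 2} else flip {1})"

lemma std_reflection:
  assumes "i \<ge> 1"
  shows "y k - std_pair X i y * (2 / std_norm X i * std_simple X i k) = std_sign X i k * y (std_perm X i k)"
proof (cases X)
  case TypeA
  then show ?thesis
    by (auto simp: std_pair_def std_norm_def std_sign_def std_perm_def Transposition.transpose_def)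
next
  case TypeB
  then show ?thesis using assms
    by (cases "i = 1") (auto simp: std_pair_def std_norm_def std_sign_def std_perm_def Transposition.transpose_def flip_def)
next
  case TypeC
  then show ?thesis using assms
    by (cases "i = 1") (auto simp: std_pair_def std_norm_def std_sign_def std_perm_def Transposition.transpose_def flip_def)
next
  case TypeD
  then show ?thesis using assms
    by (cases "i = 1") (auto simp: std_pair_def std_norm_def std_sign_def std_perm_def Transposition.transpose_def flip_def)
qed

lemma std_perm_permutes:
  assumes "admissible_rank X r" "i \<in> {1..r}"
  shows "std_perm X i permutes {1..num_coords X r}"
proof -
  have "r \<ge> 1" "X = TypeD \<Longrightarrow> r \<ge> 4" using admissible_ge[OF assms(1)] by auto
  then show ?thesis
    using assms(2) unfolding std_perm_def num_coords_def
    by (auto simp del: One_nat_def intro!: permutes_swap_id permutes_id)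
qed

lemma prod_flip: "finite S \<Longrightarrow> S \<subseteq> {1..N} \<Longrightarrow> (\<Prod>k=1..N. flip S k) = (-1) ^ card S"
  unfolding flip_def by (simp add: prod.If_cases Int_absorb1)

lemma std_sign_type:
  assumes "admissible_rank X r" "i \<in> {1..r}"
  shows "std_sign X i \<in> type_signs X (num_coords X r)"
proof -
  have "(\<Prod>k=1..num_coords X r. std_sign X i k) = 1" if "X = TypeD"
  proof -
    have "r \<ge> 4" using that assms(1) admissible_ge by blast
    then have "(\<Prod>k=1..r. flip {1, 2} k) = 1" by (subst prod_flip) auto
    then show ?thesis using that by (simp add: std_sign_def num_coords_def)
  qed
  moreover have "std_sign X i k = 1 \<or> std_sign X i k = -1" for k by (simp add: std_sign_def flip_def)
  ultimately show ?thesis by (auto simp: type_signs_def sign_vectors_def std_sign_def)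
qed

text \<open>
  The Cartan integers determine the coordinates of the simple coroots and with them the action of
  the simple reflections, which generate the Weyl group. Simple coroots also yield the vectors
  that show the coordinates to be independent.
\<close>

theorem standard_weyl_group:
  assumes M: "has_root_system M a" and std: "standard_coordinates X r M a f"
  defines "N \<equiv> num_coords X r"
  shows "coordinate_system (X = TypeA) a N f"
    and "weyl_group M a = signed_permutations a N f (type_signs X N)"
proof -
  define \<alpha> where "\<alpha> i = (\<lambda>x\<in>a. \<Sum>k=1..N. std_simple X i k * f k x)" for i
  have f: "f k \<in> functionals a" if "k \<in> {1..N}" for k
    using std that by (simp add: standard_coordinates_def N_def)
  have zero: "(\<Sum>k=1..N. f k x) = 0" if "X = TypeA" "x \<in> a" for x
    using std that by (simp add: standard_coordinates_def N_def)
  have dyn: "dynkin_numbering X r M a \<alpha>"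
    using std unfolding standard_coordinates_def \<alpha>_def[abs_def] N_def by blast
  then have adm: "admissible_rank X r" by (simp add: dynkin_numbering_def)
  obtain H\<^sub>0 where H0: "regular_element (half_roots M a) a H\<^sub>0"
      and bij: "bij_betw \<alpha> {1..r} (simple_roots (half_roots M a) a H\<^sub>0)"
    using dyn by (auto simp: dynkin_numbering_def)
  define c where "c i = coroot M a (\<alpha> i)" for i
  have cartan: "\<alpha> j (c i) = std_cartan X r i j" if "i \<in> {1..r}" "j \<in> {1..r}" for i j
    using dyn that by (simp add: dynkin_numbering_def c_def)
  obtain Q where "root_system a (half_roots M a) (coroot M a) Q"
    using has_root_system_half[OF M] by blast
  then interpret hr: root_system a "half_roots M a" "coroot M a" Q .
  interpret sr: simple_root_system a "half_roots M a" "coroot M a" Q H\<^sub>0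
  proof
    show "regular_element (half_roots M a) a H\<^sub>0" by (rule H0)
    fix \<sigma> \<tau> assume st: "\<sigma> \<in> simple_roots (half_roots M a) a H\<^sub>0" "\<tau> \<in> simple_roots (half_roots M a) a H\<^sub>0" "\<sigma> \<noteq> \<tau>"
    then have "\<sigma> \<in> \<alpha> ` {1..r}" "\<tau> \<in> \<alpha> ` {1..r}" using bij by (simp_all add: bij_betw_def)
    then obtain i j where "i \<in> {1..r}" "j \<in> {1..r}" "\<sigma> = \<alpha> i" "\<tau> = \<alpha> j" by blast
    then show "\<tau> (coroot M a \<sigma>) \<le> 0"
      using cartan[of i j] std_cartan_nonpos[OF adm, of i j] st(3) by (auto simp: c_def)
  qed
  have S: "sr.S = \<alpha> ` {1..r}" using bij by (simp add: bij_betw_def)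
  have \<alpha>R: "\<alpha> i \<in> half_roots M a" if "i \<in> {1..r}" for i using sr.S_R S that by blast
  have ca: "c i \<in> a" if "i \<in> {1..r}" for i using hr.c_a \<alpha>R[OF that] by (simp add: c_def)
  have \<alpha>x: "\<alpha> i x = std_pair X i (\<lambda>k. f k x)" if "i \<in> {1..r}" "x \<in> a" for i x
    using that sum_std_simple[OF adm that(1)] by (simp add: \<alpha>_def N_def)
  have fc: "f k (c i) = 2 / std_norm X i * std_simple X i k" if i: "i \<in> {1..r}" and k: "k \<in> {1..N}" for i k
  proof -
    define y where "y k = f k (c i) - 2 / std_norm X i * std_simple X i k" for k
    have "y k = 0"
    proof (rule std_nondegenerate[OF adm])
      show "k \<in> {1..num_coords X r}" using k by (simp add: N_def)
      show "std_pair X j y = 0" if j: "j \<in> {1..r}" for j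
      proof -
        have "std_pair X j (std_simple X i) = (\<Sum>k=1..N. std_simple X j k * std_simple X i k)"
          using sum_std_simple[OF adm j] by (simp add: N_def)
        also have "\<dots> = (\<Sum>k=1..N. std_simple X i k * std_simple X j k)" by (simp add: mult.commute)
        also have "\<dots> = std_pair X i (std_simple X j)"
          using sum_std_simple[OF adm i] by (simp add: N_def)
        finally have sym: "std_pair X j (std_simple X i) = std_pair X i (std_simple X j)" .
        have "std_pair X j (\<lambda>k. f k (c i)) = std_cartan X r i j"
          using \<alpha>x[OF j ca[OF i]] cartan[OF i j] by simp
        then show ?thesis
          unfolding y_def std_pair_diff sym std_cartan_eq[OF adm i] by simp
      qed
      show "(\<Sum>k=1..num_coords X r. y k) = 0" if A: "X = TypeA"
      proof -
        have "(\<Sum>k=1..N. std_simple X i k) = 0"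
          using sum_std_simple[OF adm i, of "\<lambda>_. 1"] A by (simp add: N_def std_pair_def)
        moreover have "(\<Sum>k=1..N. y k) = (\<Sum>k=1..N. f k (c i)) - 2 / std_norm X i * (\<Sum>k=1..N. std_simple X i k)"
          unfolding y_def by (simp only: sum_subtractf sum_distrib_left)
        ultimately show ?thesis using zero[OF A ca[OF i]] by (simp flip: N_def)
      qed
    qed
    then show ?thesis by (simp add: y_def)
  qed
  have sep: "x = 0" if x: "x \<in> a" "\<And>k. k \<in> {1..N} \<Longrightarrow> f k x = 0" for x
  proof (rule sr.simple_separate[OF x(1)])
    fix \<sigma> assume "\<sigma> \<in> sr.S"
    then obtain i where "i \<in> {1..r}" "\<sigma> = \<alpha> i" using S by blast
    then show "\<sigma> x = 0" using x by (simp add: \<alpha>_def)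
  qed
  have sub: "subspace a" by (rule hr.subspace_a)
  have basis: "\<exists>b\<in>a. \<forall>j\<in>{1..N}. f j b = of_bool (j = k) - (if X = TypeA then of_bool (j = 1) else 0)"
    if "k \<in> {1..N}" for k
  proof -
    have N: "r \<ge> 1" "X = TypeD \<Longrightarrow> r \<ge> 4" using admissible_ge[OF adm] by auto
    have "k \<le> N \<Longrightarrow> \<exists>b\<in>a. \<forall>j\<in>{1..N}. f j b = of_bool (j = k) - (if X = TypeA then of_bool (j = 1) else 0)"
      if "1 \<le> k"
      using that
    proof (induction k rule: dec_induct)
      case base
      have i1: "1 \<in> {1..r}" using N by simp
      show ?case
      proof (cases X)
        case TypeA
        have "f j 0 = 0" if "j \<in> {1..N}" for j by (rule functional_zero[OF f[OF that] sub])
        then show ?thesis using TypeA sub by (intro bexI[of _ 0]) (auto simp: subspace_0)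
      next
        case TypeB
        have "(1/2) *\<^sub>R c 1 \<in> a" using ca[OF i1] sub by (simp add: subspace_scale)
        moreover have "f j ((1/2) *\<^sub>R c 1) = of_bool (j = 1)" if "j \<in> {1..N}" for j
          using functional_scale[OF f[OF that] sub ca[OF i1]] fc[OF i1 that] TypeB by (simp add: std_norm_def)
        ultimately show ?thesis using TypeB by (intro bexI[of _ "(1/2) *\<^sub>R c 1"]) auto
      next
        case TypeC
        have "f j (c 1) = of_bool (j = 1)" if "j \<in> {1..N}" for j
          using fc[OF i1 that] TypeC by (simp add: std_norm_def)
        then show ?thesis using TypeC ca[OF i1] by (intro bexI[of _ "c 1"]) auto
      next
        case TypeD
        have i2: "2 \<in> {1..r}" using N TypeD by simp
        have "(1/2) *\<^sub>R (c 1 - c 2) \<in> a" using ca[OF i1] ca[OF i2] sub by (simp add: subspace_scale subspace_diff)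
        moreover have "f j ((1/2) *\<^sub>R (c 1 - c 2)) = of_bool (j = 1)" if "j \<in> {1..N}" for j
          using functional_scale[OF f[OF that] sub subspace_diff[OF sub ca[OF i1] ca[OF i2]], of "1/2"]
            functional_diff[OF f[OF that] sub ca[OF i1] ca[OF i2]] fc[OF i1 that] fc[OF i2 that] TypeD that
          by (auto simp: std_norm_def)
        ultimately show ?thesis using TypeD by (intro bexI[of _ "(1/2) *\<^sub>R (c 1 - c 2)"]) auto
      qed
    next
      case (step k)
      then obtain b where b: "b \<in> a" "\<forall>j\<in>{1..N}. f j b = of_bool (j = k) - (if X = TypeA then of_bool (j = 1) else 0)"
        by auto
      define i where "i = (if X = TypeA then k else Suc k)"
      have i: "i \<in> {1..r}" using step by (auto simp: i_def N_def num_coords_def split: if_splits)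
      have "b + c i \<in> a" using b(1) ca[OF i] sub by (simp add: subspace_add)
      moreover have "f j (b + c i) = of_bool (j = Suc k) - (if X = TypeA then of_bool (j = 1) else 0)"
        if j: "j \<in> {1..N}" for j
        using functional_add[OF f[OF j] sub b(1) ca[OF i]] b(2) fc[OF i j] step(1) j
        by (cases X) (auto simp: i_def std_norm_def)
      ultimately show ?case by blast
    qed
    then show ?thesis using that by simp
  qed
  then obtain b where b: "\<And>k. k \<in> {1..N} \<Longrightarrow> b k \<in> a"
    "\<And>k j. k \<in> {1..N} \<Longrightarrow> j \<in> {1..N} \<Longrightarrow> f j (b k) = of_bool (j = k) - (if X = TypeA then of_bool (j = 1) else 0)"
    by metis
  have surj: "\<exists>x\<in>a. \<forall>k\<in>{1..N}. f k x = y k" if y: "X = TypeA \<Longrightarrow> (\<Sum>k=1..N. y k) = 0" for y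
  proof (intro bexI[of _ "\<Sum>k\<in>{1..N}. y k *\<^sub>R b k"] ballI)
    show "(\<Sum>k\<in>{1..N}. y k *\<^sub>R b k) \<in> a" using b(1) sub by (intro subspace_sum) (auto intro: subspace_scale)
    fix j assume j: "j \<in> {1..N}"
    have "f j (\<Sum>k\<in>{1..N}. y k *\<^sub>R b k) = (\<Sum>k\<in>{1..N}. y k * f j (b k))"
      using b(1) by (intro functional_sum[OF f[OF j] sub]) blast
    also have "\<dots> = (\<Sum>k\<in>{1..N}. of_bool (k = j) * y k - y k * (if X = TypeA then of_bool (j = 1) else 0))"
    proof (rule sum.cong[OF refl])
      fix k assume k: "k \<in> {1..N}"
      show "y k * f j (b k) = of_bool (k = j) * y k - y k * (if X = TypeA then of_bool (j = 1) else 0)"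
        unfolding b(2)[OF k j] by (simp only: right_diff_distrib eq_commute[of j k] mult.commute)
    qed
    also have "\<dots> = y j - (\<Sum>k\<in>{1..N}. y k) * (if X = TypeA then of_bool (j = 1) else 0)"
      using sum_of_bool_mult[of "{1..N}" j y] j by (simp only: sum_subtractf sum_distrib_right finite_atLeastAtMost if_True)
    also have "\<dots> = y j" using y by auto
    finally show "f j (\<Sum>k\<in>{1..N}. y k *\<^sub>R b k) = y j" .
  qed
  show cs: "coordinate_system (X = TypeA) a N f"
    unfolding coordinate_system_def using sub f zero sep surj by blast
  define s where "s i = reflection a (\<alpha> i) (c i)" for i
  have s_acts: "acts_as a N f (s i) (std_perm X i) (std_sign X i)" if i: "i \<in> {1..r}" for i
    unfolding acts_as_def
  proof (intro ballI)
    fix x k assume x: "x \<in> a" and k: "k \<in> {1..N}"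
    have "f k (s i x) = f k x - \<alpha> i x * f k (c i)"
      using x ca[OF i] sub
      by (simp add: s_def reflection_def functional_diff[OF f[OF k] sub] functional_scale[OF f[OF k] sub] subspace_scale)
    also have "\<dots> = std_sign X i k * f (std_perm X i k) x"
      unfolding \<alpha>x[OF i x] fc[OF i k] using std_reflection[of i "\<lambda>k. f k x" k X] i by simp
    finally show "f k (s i x) = std_sign X i k * f (std_perm X i k) x" .
  qed
  have sa: "s i \<in> a \<rightarrow>\<^sub>E a" if "i \<in> {1..r}" for i
    using hr.reflection_a[OF \<alpha>R[OF that]] by (auto simp: s_def c_def reflection_def)
  have W: "weyl_group M a = generated_group a (s ` {1..r})"
    unfolding weyl_group_half[OF M]
    using sr.simple_reflections_generate unfolding hr.reflections_def S
    by (simp add: s_def c_def image_image)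
  have sG: "s ` {1..r} \<subseteq> a \<rightarrow> a" using sa unfolding PiE_def by blast
  show "weyl_group M a = signed_permutations a N f (type_signs X N)"
  proof
    show "weyl_group M a \<subseteq> signed_permutations a N f (type_signs X N)"
    proof
      fix w assume "w \<in> weyl_group M a"
      then have "w \<in> generated_group a (s ` {1..r})" using W by simp
      then show "w \<in> signed_permutations a N f (type_signs X N)"
      proof induction
        case generated_id
        have "acts_as a N f (\<lambda>x\<in>a. x) id (\<lambda>_. 1)" by (simp add: acts_as_def)
        moreover have "(\<lambda>_. 1) \<in> type_signs X N" by (simp add: type_signs_def sign_vectors_def)
        ultimately show ?case unfolding signed_permutations_def using permutes_id by fastforce
      next
        case (generated_step w t)
        then obtain i where i: "i \<in> {1..r}" "t = s i" by blast
        obtain \<pi> \<epsilon> where w: "w \<in> a \<rightarrow>\<^sub>E a" "\<pi> permutes {1..N}" "\<epsilon> \<in> type_signs X N" "acts_as a N f w \<pi> \<epsilon>"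
          using generated_step by (auto simp: signed_permutations_def)
        note p = std_perm_permutes[OF adm i(1), folded N_def]
        have "acts_as a N f (compose a t w) (\<pi> \<circ> std_perm X i) (\<lambda>k. std_sign X i k * \<epsilon> (std_perm X i k))"
          unfolding i(2) using w(1) by (intro acts_as_compose[OF s_acts[OF i(1)] w(4) _ p]) auto
        moreover have "(\<lambda>k. std_sign X i k * \<epsilon> (std_perm X i k)) \<in> type_signs X N"
          by (rule type_signs_mult[OF p _ w(3)]) (use std_sign_type[OF adm i(1)] in \<open>simp add: N_def\<close>)
        moreover have "\<pi> \<circ> std_perm X i permutes {1..N}" using p w(2) by (rule permutes_compose)
        moreover have "compose a t w \<in> a \<rightarrow>\<^sub>E a"
          using PiE_mem[OF sa[OF i(1)] PiE_mem[OF w(1)]] i(2) by (auto simp: compose_def)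
        ultimately show ?case unfolding signed_permutations_def by blast
      qed
    qed
    show "signed_permutations a N f (type_signs X N) \<subseteq> weyl_group M a"
    proof
      fix w assume "w \<in> signed_permutations a N f (type_signs X N)"
      then obtain \<pi> \<epsilon> where w: "w \<in> a \<rightarrow>\<^sub>E a" "\<pi> permutes {1..N}" "\<epsilon> \<in> type_signs X N" "acts_as a N f w \<pi> \<epsilon>"
        by (auto simp: signed_permutations_def)
      define P where "P \<pi> \<epsilon> \<longleftrightarrow> (\<exists>v\<in>weyl_group M a. acts_as a N f v \<pi> \<epsilon>)" for \<pi> \<epsilon>
      have sW: "s i \<in> weyl_group M a" if "i \<in> {1..r}" for i
        unfolding W using that by (intro generated_group_generator) (auto simp: s_def reflection_def)
      have Ps: "P (std_perm X i) (std_sign X i)" if "i \<in> {1..r}" for i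
        using s_acts[OF that] sW[OF that] by (auto simp: P_def)
      have N: "r \<ge> 1" "X = TypeD \<Longrightarrow> r \<ge> 4" "N \<ge> 2" using admissible_ge[OF adm] by (auto simp: N_def)
      have "P \<pi> \<epsilon>"
      proof (rule signed_permutation_generation[where P = P and N = N and X = X])
        show "P \<pi> \<delta>" if "P \<pi> \<epsilon>" "\<And>k. k \<in> {1..N} \<Longrightarrow> \<epsilon> k = \<delta> k" for \<pi> \<epsilon> \<delta>
          using that by (simp add: P_def acts_as_def)
        show "P id (\<lambda>_. 1)"
          unfolding P_def by (intro bexI[of _ "\<lambda>H\<in>a. H"] weyl_group.intros(1)) (simp add: acts_as_def)
        show "P (\<rho> \<circ> \<pi>) (\<lambda>k. \<epsilon> k * \<delta> (\<pi> k))"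
          if p: "\<pi> permutes {1..N}" "\<rho> permutes {1..N}" "P \<pi> \<epsilon>" "P \<rho> \<delta>" for \<pi> \<epsilon> \<rho> \<delta>
        proof -
          obtain u v where uv: "u \<in> weyl_group M a" "acts_as a N f u \<pi> \<epsilon>" "v \<in> weyl_group M a" "acts_as a N f v \<rho> \<delta>"
            using p(3,4) by (auto simp: P_def)
          have "v \<in> a \<rightarrow> a" using generated_group_maps[OF sG] uv(3) W by blast
          then have "acts_as a N f (compose a u v) (\<rho> \<circ> \<pi>) (\<lambda>k. \<epsilon> k * \<delta> (\<pi> k))"
            by (rule acts_as_compose[OF uv(2,4) _ p(1)])
          moreover have "compose a u v \<in> weyl_group M a"
            using uv(1,3) generated_group_compose[OF sG] W by blast
          ultimately show ?thesis by (auto simp: P_def)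
        qed
        show "P (Transposition.transpose i (i + 1)) (\<lambda>_. 1)" if i: "1 \<le> i" "i + 1 \<le> N" for i
        proof (cases "X = TypeA")
          case True
          then show ?thesis using Ps[of i] i by (simp add: std_perm_def std_sign_def N_def num_coords_def)
        next
          case False
          then show ?thesis using Ps[of "i + 1"] i by (simp add: std_perm_def std_sign_def N_def num_coords_def)
        qed
        show "P id (flip {1})" if "X = TypeB \<or> X = TypeC"
          using Ps[of 1] that N(1) by (auto simp: std_perm_def std_sign_def)
        show "P (Transposition.transpose 1 2) (flip {1, 2})" if "X = TypeD"
          using Ps[of 1] that N(1) by (auto simp: std_perm_def std_sign_def)
      qed (use N w in auto)
      then obtain v where v: "v \<in> weyl_group M a" "acts_as a N f v \<pi> \<epsilon>" by (auto simp: P_def)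
      have "v \<in> a \<rightarrow>\<^sub>E a"
        using generated_group_maps[OF sG] generated_group_extensional v(1) W by (auto simp: PiE_def)
      then have "v = w" using acts_as_unique[OF cs v(2) w(4)] w(1) by blast
      then show "w \<in> weyl_group M a" using v(1) by simp
    qed
  qed
qed

lemma coordinate_surj:
  assumes "coordinate_system Z a N f" "Z \<Longrightarrow> (\<Sum>k=1..N. y k) = 0"
  shows "\<exists>x\<in>a. \<forall>k\<in>{1..N}. f k x = y k"
  using assms unfolding coordinate_system_def by blast

lemma signed_permutation_exists:
  assumes cs: "coordinate_system Z a N f" and \<pi>: "\<pi> permutes {1..N}"
    and Z: "Z \<Longrightarrow> \<forall>k\<in>{1..N}. \<epsilon> k = 1"
  obtains w where "w \<in> a \<rightarrow>\<^sub>E a" "acts_as a N f w \<pi> \<epsilon>"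
proof -
  have ex: "\<forall>x\<in>a. \<exists>y. y \<in> a \<and> (\<forall>k\<in>{1..N}. f k y = \<epsilon> k * f (\<pi> k) x)"
  proof
    fix x assume x: "x \<in> a"
    have sum0: "(\<Sum>k=1..N. \<epsilon> k * f (\<pi> k) x) = 0" if z: Z
    proof -
      have "(\<Sum>k=1..N. \<epsilon> k * f (\<pi> k) x) = (\<Sum>k=1..N. f (\<pi> k) x)" using Z[OF z] by (intro sum.cong) auto
      also have "\<dots> = (\<Sum>k=1..N. f k x)" by (rule sum.permute[OF \<pi>, symmetric, unfolded comp_def])
      also have "\<dots> = 0" using coordinate_sum[of a N f x] cs z x by simp
      finally show ?thesis .
    qed
    show "\<exists>y. y \<in> a \<and> (\<forall>k\<in>{1..N}. f k y = \<epsilon> k * f (\<pi> k) x)"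
      using coordinate_surj[OF cs sum0] by blast
  qed
  obtain w where w: "\<forall>x\<in>a. w x \<in> a \<and> (\<forall>k\<in>{1..N}. f k (w x) = \<epsilon> k * f (\<pi> k) x)"
    using bchoice[OF ex] by blast
  show ?thesis
  proof (rule that)
    show "restrict w a \<in> a \<rightarrow>\<^sub>E a" using w by auto
    show "acts_as a N f (restrict w a) \<pi> \<epsilon>" using w by (simp add: acts_as_def)
  qed
qed

lemma signed_permutation_onto:
  assumes cs: "coordinate_system (X = TypeA) a N f" and w: "w \<in> signed_permutations a N f (type_signs X N)"
  shows "w ` a = a"
proof
  obtain \<pi> \<epsilon> where w: "w \<in> a \<rightarrow>\<^sub>E a" "\<pi> permutes {1..N}" "\<epsilon> \<in> type_signs X N" "acts_as a N f w \<pi> \<epsilon>"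
    using w by (auto simp: signed_permutations_def)
  show "w ` a \<subseteq> a" using w(1) by auto
  show "a \<subseteq> w ` a"
  proof
    fix y assume y: "y \<in> a"
    define \<rho> where "\<rho> = inv_into UNIV \<pi>"
    have \<rho>: "\<rho> permutes {1..N}" unfolding \<rho>_def by (rule permutes_inv[OF w(2)])
    have \<rho>\<pi>: "\<rho> (\<pi> k) = k" for k unfolding \<rho>_def by (rule permutes_inverses(2)[OF w(2)])
    have one: "\<forall>k\<in>{1..N}. \<epsilon> (\<rho> k) = 1" if "X = TypeA"
      using w(3) that permutes_range[OF \<rho>] unfolding type_signs_def by blast
    obtain v where v: "v \<in> a \<rightarrow>\<^sub>E a" "acts_as a N f v \<rho> (\<lambda>k. \<epsilon> (\<rho> k))"
      by (rule signed_permutation_exists[OF cs \<rho> one])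
    have vy: "v y \<in> a" using v(1) y by auto
    have "w (v y) = y"
    proof (rule coordinate_unique[OF cs])
      show "w (v y) \<in> a" using w(1) vy by auto
      fix k assume k: "k \<in> {1..N}"
      then have "\<epsilon> k * \<epsilon> k = 1" using w(3) unfolding type_signs_def sign_vectors_def by force
      moreover have "f k (w (v y)) = \<epsilon> k * (\<epsilon> (\<rho> (\<pi> k)) * f (\<rho> (\<pi> k)) y)"
        using w(4) v(2) vy y k permutes_range[OF w(2) k] by (simp add: acts_as_def)
      ultimately show "f k (w (v y)) = f k y" by (simp add: \<rho>\<pi> mult.assoc[symmetric])
    qed (rule y)
    then show "y \<in> w ` a" using vy by (metis imageI)
  qed
qed

lemma coordinate_nonzero:
  assumes cs: "coordinate_system Z a N f" and "N \<ge> 2" "j \<in> {1..N}"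
  obtains x where "x \<in> a" "f j x \<noteq> 0"
proof -
  define i :: nat where "i = (if j = 1 then 2 else 1)"
  have i: "i \<in> {1..N}" "i \<noteq> j" using assms(2) by (auto simp: i_def)
  have sum0: "(\<Sum>k=1..N. of_bool (k = j) * 1 - of_bool (k = i) * 1) = (0::real)"
    using sum_of_bool_mult[of "{1..N}" j "\<lambda>_. 1"] sum_of_bool_mult[of "{1..N}" i "\<lambda>_. 1"] i(1) assms(3)
    by (simp only: sum_subtractf finite_atLeastAtMost if_True diff_self)
  obtain x where "x \<in> a" "\<And>k. k \<in> {1..N} \<Longrightarrow> f k x = of_bool (k = j) * 1 - of_bool (k = i) * 1"
    using coordinate_surj[OF cs sum0] by blast
  then show ?thesis using that[of x] i assms(3) by simp
qed

text \<open>
  The embedding \<open>x \<mapsto> (0, \<dots>, 0, x)\<close>: as coordinates are numbered from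
  the right, the zeros fill the positions above \<open>Nn\<close>.
\<close>

locale coordinate_inclusion =
  fixes X :: classical_type and ak :: "'v::euclidean_space set" and Nk and fk :: "nat \<Rightarrow> 'v \<Rightarrow> real"
    and an :: "'v set" and Nn and fn :: "nat \<Rightarrow> 'v \<Rightarrow> real"
  assumes cs_k: "coordinate_system (X = TypeA) ak Nk fk"
    and cs_n: "coordinate_system (X = TypeA) an Nn fn"
    and le: "Nn \<le> Nk" and two: "2 \<le> Nn" and sub: "an \<subseteq> ak"
    and low: "x \<in> an \<Longrightarrow> k \<in> {1..Nn} \<Longrightarrow> fk k x = fn k x"
    and high: "x \<in> an \<Longrightarrow> k \<in> {Nn<..Nk} \<Longrightarrow> fk k x = 0"
begin

text \<open>
  The signs at the positions above \<open>Nn\<close> have no effect on \<open>an\<close>. In type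
  \<open>D\<close> this leaves the freedom to make the number of minus signs even.
\<close>

lemma extend_signed_permutation:
  assumes w: "w \<in> an \<rightarrow>\<^sub>E an" "\<pi> permutes {1..Nn}" "acts_as an Nn fn w \<pi> \<epsilon>" "w ` an = an"
    and \<epsilon>: "\<epsilon> \<in> type_signs X Nk"
  obtains v where "v \<in> signed_permutations ak Nk fk (type_signs X Nk)" "v ` an = an" "restrict v an = w"
proof -
  have \<pi>: "\<pi> permutes {1..Nk}" using le by (intro permutes_subset[OF w(2)]) auto
  have "\<forall>k\<in>{1..Nk}. \<epsilon> k = 1" if "X = TypeA" using \<epsilon> that by (simp add: type_signs_def)
  then obtain v where v: "v \<in> ak \<rightarrow>\<^sub>E ak" "acts_as ak Nk fk v \<pi> \<epsilon>"
    using signed_permutation_exists[OF cs_k \<pi>] by metis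
  have vw: "v x = w x" if x: "x \<in> an" for x
  proof (rule coordinate_unique[OF cs_k])
    have wx: "w x \<in> an" using w(1) x by auto
    then show "v x \<in> ak" "w x \<in> ak" using v(1) sub x by auto
    fix k assume k: "k \<in> {1..Nk}"
    have "fk k (v x) = \<epsilon> k * fk (\<pi> k) x" using v(2) x sub k by (auto simp: acts_as_def)
    also have "\<dots> = fk k (w x)"
    proof (cases "k \<le> Nn")
      case True
      then have k1: "k \<in> {1..Nn}" using k by simp
      then have "\<epsilon> k * fn (\<pi> k) x = fn k (w x)" using w(3) x by (simp add: acts_as_def)
      then show ?thesis using low[OF x permutes_range[OF w(2) k1]] low[OF wx k1] by simp
    next
      case False
      then have k1: "k \<in> {Nn<..Nk}" using k by simp
      then have "\<pi> k = k" by (intro permutes_not_in[OF w(2)]) auto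
      then show ?thesis using high[OF x k1] high[OF wx k1] by simp
    qed
    finally show "fk k (v x) = fk k (w x)" .
  qed
  then have "v ` an = an" using w(4) by (metis (no_types, lifting) image_cong)
  moreover have "restrict v an = w"
    using vw w(1) by (auto simp: fun_eq_iff PiE_def extensional_def)
  moreover have "v \<in> signed_permutations ak Nk fk (type_signs X Nk)"
    unfolding signed_permutations_def using v \<pi> \<epsilon> by blast
  ultimately show ?thesis using that by blast
qed

lemma restrict_signed_permutations:
  "signed_permutations an Nn fn (type_signs X Nn) \<subseteq>
     restrictions an (stabiliser (signed_permutations ak Nk fk (type_signs X Nk)) an)"
proof
  fix w assume w: "w \<in> signed_permutations an Nn fn (type_signs X Nn)"
  then obtain \<pi> \<epsilon> where *: "w \<in> an \<rightarrow>\<^sub>E an" "\<pi> permutes {1..Nn}" "\<epsilon> \<in> type_signs X Nn" "acts_as an Nn fn w \<pi> \<epsilon>"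
    by (auto simp: signed_permutations_def)
  define \<epsilon>' where "\<epsilon>' k = (if k \<le> Nn then \<epsilon> k else 1)" for k
  have "(\<Prod>k=1..Nk. \<epsilon>' k) = (\<Prod>k=1..Nn. \<epsilon> k)"
    using le by (intro prod.mono_neutral_cong_right) (auto simp: \<epsilon>'_def)
  then have "\<epsilon>' \<in> type_signs X Nk"
    using *(3) unfolding type_signs_def sign_vectors_def \<epsilon>'_def by auto
  moreover have "acts_as an Nn fn w \<pi> \<epsilon>'" using *(4) by (simp add: acts_as_def \<epsilon>'_def)
  ultimately obtain v where "v \<in> signed_permutations ak Nk fk (type_signs X Nk)" "v ` an = an" "restrict v an = w"
    using extend_signed_permutation[OF *(1,2) _ signed_permutation_onto[OF cs_n w]] by metis
  then show "w \<in> restrictions an (stabiliser (signed_permutations ak Nk fk (type_signs X Nk)) an)"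
    by (auto simp: restrictions_def stabiliser_def)
qed

text \<open>
  The positions above \<open>Nn\<close> are those at which all of \<open>an\<close> vanishes. A
  map preserving \<open>an\<close> permutes them among themselves, hence also the positions up to
  \<open>Nn\<close>. In type \<open>D\<close> the number of minus signs at the latter need not be
  even.
\<close>

lemma stabiliser_signed_permutations:
  assumes "X \<noteq> TypeD"
  shows "restrictions an (stabiliser (signed_permutations ak Nk fk (type_signs X Nk)) an) =
    signed_permutations an Nn fn (type_signs X Nn)"
proof
  show "restrictions an (stabiliser (signed_permutations ak Nk fk (type_signs X Nk)) an) \<subseteq>
    signed_permutations an Nn fn (type_signs X Nn)"
  proof
    fix w assume "w \<in> restrictions an (stabiliser (signed_permutations ak Nk fk (type_signs X Nk)) an)"
    then obtain v where v: "v \<in> signed_permutations ak Nk fk (type_signs X Nk)" "v ` an = an" "w = restrict v an"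
      by (auto simp: restrictions_def stabiliser_def)
    obtain \<pi> \<epsilon> where *: "v \<in> ak \<rightarrow>\<^sub>E ak" "\<pi> permutes {1..Nk}" "\<epsilon> \<in> type_signs X Nk" "acts_as ak Nk fk v \<pi> \<epsilon>"
      using v(1) by (auto simp: signed_permutations_def)
    have van: "v x \<in> an" if "x \<in> an" for x using v(2) that by blast
    have fv: "fk k (v x) = \<epsilon> k * fk (\<pi> k) x" if "x \<in> an" "k \<in> {1..Nk}" for x k
      using *(4) sub that by (auto simp: acts_as_def)
    have ne: "\<epsilon> k \<noteq> 0" if "k \<in> {1..Nk}" for k
      using *(3) that unfolding type_signs_def sign_vectors_def by force
    have "\<pi> ` {Nn<..Nk} \<subseteq> {Nn<..Nk}"
    proof
      fix j assume "j \<in> \<pi> ` {Nn<..Nk}"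
      then obtain k where k: "k \<in> {Nn<..Nk}" "j = \<pi> k" by blast
      then have k1: "k \<in> {1..Nk}" by auto
      then have j: "j \<in> {1..Nk}" using permutes_range[OF *(2)] k(2) by simp
      have "\<not> j \<le> Nn"
      proof
        assume "j \<le> Nn"
        then have j': "j \<in> {1..Nn}" using j by simp
        obtain x where x: "x \<in> an" "fn j x \<noteq> 0" using coordinate_nonzero[OF cs_n two j'] by blast
        have "fk k (v x) = 0" using high[OF van[OF x(1)] k(1)] .
        then have "fk j x = 0" using fv[OF x(1) k1] ne[OF k1] k(2) by simp
        then show False using x low[OF x(1) j'] by simp
      qed
      then show "j \<in> {Nn<..Nk}" using j by simp
    qed
    then have high': "\<pi> ` {Nn<..Nk} = {Nn<..Nk}"
      using permutes_inj_on[OF *(2)] by (intro endo_inj_surj) auto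
    have "{1..Nk} = {1..Nn} \<union> {Nn<..Nk}" using le by auto
    then have "{1..Nn} = {1..Nk} - {Nn<..Nk}" by auto
    then have "\<pi> ` {1..Nn} = {1..Nn}"
      using image_set_diff[OF permutes_inj[OF *(2)], of "{1..Nk}" "{Nn<..Nk}"] permutes_image[OF *(2)] high' by simp
    then have bij: "bij_betw \<pi> {1..Nn} {1..Nn}"
      using permutes_inj_on[OF *(2)] by (simp add: bij_betw_def)
    define \<rho> where "\<rho> k = (if k \<in> {1..Nn} then \<pi> k else k)" for k
    have \<rho>: "\<rho> permutes {1..Nn}"
    proof (rule bij_imp_permutes)
      show "bij_betw \<rho> {1..Nn} {1..Nn}"
        using bij bij_betw_cong[of "{1..Nn}" \<rho> \<pi>] by (simp add: \<rho>_def)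
      show "\<rho> k = k" if "k \<notin> {1..Nn}" for k
        using that unfolding \<rho>_def by (rule if_not_P)
    qed
    have "acts_as an Nn fn w \<rho> \<epsilon>"
      unfolding acts_as_def
    proof (intro ballI)
      fix x k assume x: "x \<in> an" and k: "k \<in> {1..Nn}"
      have k1: "k \<in> {1..Nk}" using k le by auto
      have "\<rho> k = \<pi> k" using k by (simp add: \<rho>_def)
      then show "fn k (w x) = \<epsilon> k * fn (\<rho> k) x"
        using fv[OF x k1] low[OF van[OF x] k] low[OF x permutes_range[OF \<rho> k]] x v(3) by simp
    qed
    moreover have "\<epsilon> \<in> type_signs X Nn"
      using *(3) assms le unfolding type_signs_def sign_vectors_def by auto
    moreover have "w \<in> an \<rightarrow>\<^sub>E an" using van v(3) by auto
    ultimately show "w \<in> signed_permutations an Nn fn (type_signs X Nn)"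
      using \<rho> by (auto simp: signed_permutations_def)
  qed
qed (rule restrict_signed_permutations)

end

section \<open>Extension of invariants\<close>

text \<open>
  The extension operator \<open>q \<mapsto> (\<Sum>i. t i * q \<circ> L i)\<close> is the same for
  all invariant functions \<open>q\<close> and consists of linear substitutions. So it preserves
  polynomials, and in a direct sum it can be applied in one component while the others are kept
  fixed. The values of \<open>q\<close> may be vectors, in particular complex numbers; the indices
  will be sets of coordinates.
\<close>

definition extends_invariants ::
  "'c::real_vector itself \<Rightarrow> ('v::euclidean_space \<Rightarrow> 'v) set \<Rightarrow> 'v set \<Rightarrow> ('v \<Rightarrow> 'v) set \<Rightarrow> 'v set \<Rightarrow> bool" where
  "extends_invariants T W A V B \<longleftrightarrow> (\<exists>(I::nat set set) t L. finite I \<and>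
     (\<forall>i\<in>I. linear (L i) \<and> L i ` A \<subseteq> B) \<and>
     (\<forall>q::'v \<Rightarrow> 'c. (\<forall>v\<in>V. \<forall>x\<in>B. q (v x) = q x) \<longrightarrow>
        (\<forall>w\<in>W. \<forall>x\<in>A. (\<Sum>i\<in>I. t i *\<^sub>R q (L i (w x))) = (\<Sum>i\<in>I. t i *\<^sub>R q (L i x))) \<and>
        (\<forall>x\<in>B. (\<Sum>i\<in>I. t i *\<^sub>R q (L i x)) = q x)))"

lemma extends_invariants_same: "extends_invariants T W A W A"
  unfolding extends_invariants_def
  by (rule exI[of _ "{{}}"], rule exI[of _ "\<lambda>_. 1"], rule exI[of _ "\<lambda>_ x. x"]) (auto simp: linear_ident)

lemma extends_invariants_zero:
  assumes "\<And>v. v \<in> V \<Longrightarrow> v 0 = 0"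
  shows "extends_invariants T W A V {0}"
  unfolding extends_invariants_def
  by (rule exI[of _ "{{}}"], rule exI[of _ "\<lambda>_. 1"], rule exI[of _ "\<lambda>_ x. 0"]) (auto simp: linear_zero)

text \<open>
  Adding an element to \<open>F\<close> replaces \<open>t s\<close> by \<open>t s + t (s +
  1)\<close> in the sum. Hence the weights for the larger set solve a recursion that starts from
  zero above \<open>n\<close> and runs downwards.
\<close>

lemma alternating_weights:
  assumes "finite F"
  obtains t :: "nat \<Rightarrow> real" where "\<And>s. s > n \<Longrightarrow> t s = 0"
    "\<And>m. (\<Sum>U\<in>Pow F. t (m + card U)) = of_bool (m = n)"
proof -
  have "\<exists>t::nat \<Rightarrow> real. (\<forall>s>n. t s = 0) \<and> (\<forall>m. (\<Sum>U\<in>Pow F. t (m + card U)) = of_bool (m = n))"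
    using assms
  proof (induction F rule: finite_induct)
    case empty
    show ?case by (intro exI[of _ "\<lambda>s. of_bool (s = n)"]) auto
  next
    case (insert y F)
    then obtain t :: "nat \<Rightarrow> real" where t: "\<forall>s>n. t s = 0" "\<forall>m. (\<Sum>U\<in>Pow F. t (m + card U)) = of_bool (m = n)"
      by blast
    \<comment> \<open>the solution of \<open>u s + u (s + 1) = t s\<close> that vanishes above \<open>n\<close>\<close>
    define u where "u s = (\<Sum>j\<in>{s..n}. (-1) ^ (j - s) * t j)" for s
    have u: "u s + u (Suc s) = t s" for s
    proof (cases "s \<le> n")
      case True
      have "u s = t s + (\<Sum>j\<in>{Suc s..n}. (-1) ^ (j - s) * t j)"
        using True by (simp add: u_def sum.atLeast_Suc_atMost)
      also have "(\<Sum>j\<in>{Suc s..n}. (-1) ^ (j - s) * t j) = - u (Suc s)"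
        unfolding u_def sum_negf[symmetric]
      proof (rule sum.cong[OF refl])
        fix j assume "j \<in> {Suc s..n}"
        then have "j - s = Suc (j - Suc s)" by auto
        then show "(-1) ^ (j - s) * t j = - ((-1) ^ (j - Suc s) * t j)" by simp
      qed
      finally show ?thesis by simp
    next
      case False
      then show ?thesis using t(1) by (simp add: u_def)
    qed
    have "(\<Sum>U\<in>Pow (insert y F). u (m + card U)) = of_bool (m = n)" for m
    proof -
      have inj: "inj_on (insert y) (Pow F)" using insert.hyps(2) by (auto simp: inj_on_def)
      have "(\<Sum>U\<in>Pow (insert y F). u (m + card U)) =
          (\<Sum>U\<in>Pow F. u (m + card U)) + (\<Sum>U\<in>insert y ` Pow F. u (m + card U))"
        unfolding Pow_insert using insert.hyps by (intro sum.union_disjoint) auto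
      also have "(\<Sum>U\<in>insert y ` Pow F. u (m + card U)) = (\<Sum>U\<in>Pow F. u (m + card (insert y U)))"
        by (simp add: sum.reindex[OF inj])
      also have "\<dots> = (\<Sum>U\<in>Pow F. u (Suc (m + card U)))"
      proof (rule sum.cong[OF refl])
        fix U assume "U \<in> Pow F"
        then have "finite U" "y \<notin> U" using insert.hyps finite_subset by auto
        then show "u (m + card (insert y U)) = u (Suc (m + card U))" by simp
      qed
      also have "(\<Sum>U\<in>Pow F. u (m + card U)) + (\<Sum>U\<in>Pow F. u (Suc (m + card U))) = (\<Sum>U\<in>Pow F. t (m + card U))"
        by (simp only: sum.distrib[symmetric] u)
      finally show ?thesis using t(2) by simp
    qed
    moreover have "\<forall>s>n. u s = 0" by (simp add: u_def)
    ultimately show ?case by blast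
  qed
  then show ?thesis using that by blast
qed

lemma sum_Pow_Un:
  fixes g :: "'b set \<Rightarrow> 'c::comm_monoid_add"
  assumes "A \<inter> B = {}"
  shows "(\<Sum>S\<in>Pow (A \<union> B). g S) = (\<Sum>T\<in>Pow A. \<Sum>U\<in>Pow B. g (T \<union> U))"
proof -
  have "bij_betw (\<lambda>(T, U). T \<union> U) (Pow A \<times> Pow B) (Pow (A \<union> B))"
  proof (rule bij_betw_byWitness[where f' = "\<lambda>S. (S \<inter> A, S \<inter> B)"])
    show "\<forall>p\<in>Pow A \<times> Pow B. (\<lambda>S. (S \<inter> A, S \<inter> B)) ((\<lambda>(T, U). T \<union> U) p) = p" using assms by blast
  qed auto
  then have "(\<Sum>S\<in>Pow (A \<union> B). g S) = (\<Sum>p\<in>Pow A \<times> Pow B. g ((\<lambda>(T, U). T \<union> U) p))"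
    by (rule sum.reindex_bij_betw[symmetric])
  then show ?thesis by (simp add: sum.cartesian_product case_prod_beta)
qed

context coordinate_inclusion
begin

text \<open>
  The sum runs over the sets \<open>S\<close> of at most \<open>Nn\<close> coordinates, and
  \<open>L S\<close> places these coordinates, in some order, in \<open>an\<close>. A signed
  permutation of \<open>ak\<close> permutes the sets \<open>S\<close>; the resulting changes of
  order and of signs are absorbed by the invariance of \<open>q\<close>. This requires individual
  sign changes, which type \<open>D\<close> does not allow.
\<close>

theorem extends_invariants_signed_permutations:
  assumes XD: "X \<noteq> TypeD"
  shows "extends_invariants TYPE('c::real_vector)
    (signed_permutations ak Nk fk (type_signs X Nk)) ak (signed_permutations an Nn fn (type_signs X Nn)) an"
    (is "extends_invariants _ ?W ak ?V an")
proof -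
  have suban: "subspace an" and fnf: "\<And>k. k \<in> {1..Nn} \<Longrightarrow> fn k \<in> functionals an"
    using cs_n by (auto simp: coordinate_system_def)
  have fkf: "fk k \<in> functionals ak" if "k \<in> {1..Nk}" for k
    using cs_k that by (auto simp: coordinate_system_def)
  \<comment> \<open>the vectors \<open>b k\<close> are the unit vectors of \<open>an\<close>, in type \<open>A\<close> projected to the hyperplane\<close>
  define \<mu> where "\<mu> = (if X = TypeA then 1 / real Nn else 0)"
  have "\<exists>b. b \<in> an \<and> (\<forall>j\<in>{1..Nn}. fn j b = of_bool (j = k) - \<mu>)" if k: "k \<in> {1..Nn}" for k
  proof -
    have "(\<Sum>j=1..Nn. of_bool (j = k) - \<mu>) = 0" if "X = TypeA"
      using sum_of_bool_mult[of "{1..Nn}" k "\<lambda>_. 1"] k that two by (simp add: sum_subtractf \<mu>_def)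
    from coordinate_surj[OF cs_n this] show ?thesis by blast
  qed
  then obtain b where b: "\<And>k. k \<in> {1..Nn} \<Longrightarrow> b k \<in> an"
    "\<And>k j. k \<in> {1..Nn} \<Longrightarrow> j \<in> {1..Nn} \<Longrightarrow> fn j (b k) = of_bool (j = k) - \<mu>" by metis
  have "\<exists>h. linear h \<and> (\<forall>x\<in>ak. fk k x = h x)" if "k \<in> {1..Nk}" for k
    using functional_linear[OF fkf[OF that]] by (metis restrict_apply)
  then obtain F where F: "\<And>k. k \<in> {1..Nk} \<Longrightarrow> linear (F k)"
    "\<And>k x. k \<in> {1..Nk} \<Longrightarrow> x \<in> ak \<Longrightarrow> F k x = fk k x" by metis
  \<comment> \<open>positions for the coordinates in \<open>S\<close>, chosen arbitrarily\<close>
  define J where "J S = (SOME j. inj_on j S \<and> j ` S \<subseteq> {1..Nn})" for S :: "nat set"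
  have J: "inj_on (J S) S \<and> J S ` S \<subseteq> {1..Nn}" if S: "finite S" "card S \<le> Nn" for S
  proof -
    have "\<exists>j. inj_on j S \<and> j ` S \<subseteq> {1..Nn}"
      using card_le_inj[OF S(1), of "{1..Nn}"] S(2) by auto
    then show ?thesis unfolding J_def by (rule someI_ex)
  qed
  define I where "I = {S \<in> Pow {1..Nk}. card S \<le> Nn}"
  define L where "L S x = (\<Sum>k\<in>S. F k x *\<^sub>R b (J S k))" for S x
  obtain t :: "nat \<Rightarrow> real" where t: "\<And>s. s > Nn \<Longrightarrow> t s = 0"
    "\<And>m. (\<Sum>U\<in>Pow {Nn<..Nk}. t (m + card U)) = of_bool (m = Nn)"
    using alternating_weights[OF finite_greaterThanAtMost] by metis
  have IS: "finite S" "card S \<le> Nn" "S \<subseteq> {1..Nk}" if "S \<in> I" for S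
    using that finite_subset[of S "{1..Nk}"] by (auto simp: I_def)
  have comb: "(\<Sum>k\<in>S. y k *\<^sub>R b (j k)) \<in> an"
      "i \<in> {1..Nn} \<Longrightarrow> fn i (\<Sum>k\<in>S. y k *\<^sub>R b (j k)) = (\<Sum>k\<in>S. y k * (of_bool (i = j k) - \<mu>))"
    if j: "j ` S \<subseteq> {1..Nn}" for S y j i
  proof -
    have bj: "b (j k) \<in> an" if "k \<in> S" for k using b(1) j that by blast
    then show "(\<Sum>k\<in>S. y k *\<^sub>R b (j k)) \<in> an" using suban by (intro subspace_sum) (auto intro: subspace_scale)
    assume i: "i \<in> {1..Nn}"
    have "fn i (\<Sum>k\<in>S. y k *\<^sub>R b (j k)) = (\<Sum>k\<in>S. y k * fn i (b (j k)))"
      by (rule functional_sum[OF fnf[OF i] suban bj])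
    also have "\<dots> = (\<Sum>k\<in>S. y k * (of_bool (i = j k) - \<mu>))"
      using b(2) i j by (intro sum.cong refl) (simp add: image_subset_iff)
    finally show "fn i (\<Sum>k\<in>S. y k *\<^sub>R b (j k)) = (\<Sum>k\<in>S. y k * (of_bool (i = j k) - \<mu>))" .
  qed
  have I: "finite I" by (simp add: I_def)
  have lin: "linear (L S) \<and> L S ` ak \<subseteq> an" if S: "S \<in> I" for S
  proof
    have "\<forall>k\<in>S. linear (\<lambda>x. F k x *\<^sub>R b (J S k))"
    proof
      fix k assume "k \<in> S"
      then have "linear (F k)" using F(1) IS(3)[OF S] by blast
      then show "linear (\<lambda>x. F k x *\<^sub>R b (J S k))"
        by (intro linearI) (simp_all add: linear_add linear_scale scaleR_add_left)
    qed
    then show "linear (L S)" unfolding L_def[abs_def] by (rule linear_compose_sum)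
    have "L S x \<in> an" for x unfolding L_def by (rule comb(1)) (use J IS[OF S] in blast)
    then show "L S ` ak \<subseteq> an" by blast
  qed
  have main: "(\<forall>w\<in>?W. \<forall>x\<in>ak. (\<Sum>S\<in>I. t (card S) *\<^sub>R q (L S (w x))) = (\<Sum>S\<in>I. t (card S) *\<^sub>R q (L S x))) \<and>
      (\<forall>x\<in>an. (\<Sum>S\<in>I. t (card S) *\<^sub>R q (L S x)) = q x)"
    if q: "\<forall>v\<in>?V. \<forall>x\<in>an. q (v x) = q x" for q :: "'v \<Rightarrow> 'c"
  proof -
    \<comment> \<open>the value of \<open>q\<close> at a point with prescribed coordinates does not depend on their order and signs\<close>
    have indep: "q (\<Sum>k\<in>S. (\<epsilon> k * y k) *\<^sub>R b (j k)) = q (\<Sum>k\<in>S. y k *\<^sub>R b (j' k))"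
      if S: "finite S" and j: "inj_on j S" "j ` S \<subseteq> {1..Nn}" and j': "inj_on j' S" "j' ` S \<subseteq> {1..Nn}"
        and \<epsilon>: "\<And>k. k \<in> S \<Longrightarrow> \<epsilon> k = 1 \<or> \<epsilon> k = -1" "\<And>k. X = TypeA \<Longrightarrow> k \<in> S \<Longrightarrow> \<epsilon> k = 1" for S \<epsilon> y j j'
    proof -
      obtain \<pi> where \<pi>: "\<pi> permutes {1..Nn}" "\<And>k. k \<in> S \<Longrightarrow> \<pi> (j k) = j' k"
        using extend_injections[OF finite_atLeastAtMost j(1) j'(1) j(2) j'(2)] by metis
      define \<delta> where "\<delta> i = (if i \<in> j ` S then \<epsilon> (inv_into S j i) else 1)" for i
      have \<delta>j: "\<delta> (j k) = \<epsilon> k" if "k \<in> S" for k using that j(1) by (simp add: \<delta>_def)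
      have \<delta>: "\<delta> i = 1 \<or> \<delta> i = -1" "X = TypeA \<Longrightarrow> \<delta> i = 1" for i
        using \<epsilon> inv_into_into[of i j S] by (auto simp: \<delta>_def)
      then have \<delta>T: "\<delta> \<in> type_signs X Nn" using XD unfolding type_signs_def sign_vectors_def by blast
      have "\<forall>k\<in>{1..Nn}. \<delta> k = 1" if "X = TypeA" using \<delta>(2)[OF that] by blast
      then obtain w where w: "w \<in> an \<rightarrow>\<^sub>E an" "acts_as an Nn fn w \<pi> \<delta>"
        using signed_permutation_exists[OF cs_n \<pi>(1)] by metis
      have wV: "w \<in> ?V" using w \<pi>(1) \<delta>T by (auto simp: signed_permutations_def)
      let ?z = "\<Sum>k\<in>S. y k *\<^sub>R b (j' k)"
      have z: "?z \<in> an" by (rule comb(1)[OF j'(2)])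
      have "w ?z = (\<Sum>k\<in>S. (\<epsilon> k * y k) *\<^sub>R b (j k))"
      proof (rule coordinate_unique[OF cs_n])
        show "w ?z \<in> an" using w(1) z by auto
        show "(\<Sum>k\<in>S. (\<epsilon> k * y k) *\<^sub>R b (j k)) \<in> an" by (rule comb(1)[OF j(2)])
        fix i assume i: "i \<in> {1..Nn}"
        have "fn i (w ?z) = \<delta> i * fn (\<pi> i) ?z" using w(2) z i by (simp add: acts_as_def)
        also have "\<dots> = \<delta> i * (\<Sum>k\<in>S. y k * (of_bool (\<pi> i = j' k) - \<mu>))"
          by (simp only: comb(2)[OF j'(2) permutes_range[OF \<pi>(1) i]])
        also have "\<dots> = (\<Sum>k\<in>S. (\<epsilon> k * y k) * (of_bool (i = j k) - \<mu>))"
          unfolding sum_distrib_left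
        proof (rule sum.cong[OF refl])
          fix k assume k: "k \<in> S"
          have "\<pi> i = j' k \<longleftrightarrow> i = j k" using \<pi>(2)[OF k] permutes_inj[OF \<pi>(1)] by (metis injD)
          moreover have "\<delta> i * of_bool (i = j k) = \<epsilon> k * of_bool (i = j k)" using \<delta>j[OF k] by auto
          moreover have "\<delta> i * \<mu> = \<epsilon> k * \<mu>" using \<delta>(2)[of i] \<epsilon>(2)[of k] k by (auto simp: \<mu>_def)
          ultimately have "\<delta> i * (of_bool (\<pi> i = j' k) - \<mu>) = \<epsilon> k * (of_bool (i = j k) - \<mu>)"
            by (simp only: right_diff_distrib)
          then show "\<delta> i * (y k * (of_bool (\<pi> i = j' k) - \<mu>)) = \<epsilon> k * y k * (of_bool (i = j k) - \<mu>)"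
            by (metis (no_types, opaque_lifting) mult.assoc mult.left_commute)
        qed
        also have "\<dots> = fn i (\<Sum>k\<in>S. (\<epsilon> k * y k) *\<^sub>R b (j k))" by (rule comb(2)[OF j(2) i, symmetric])
        finally show "fn i (w ?z) = fn i (\<Sum>k\<in>S. (\<epsilon> k * y k) *\<^sub>R b (j k))" .
      qed
      then show ?thesis using q wV z by metis
    qed
    show ?thesis
    proof (intro conjI ballI)
      fix w x assume w: "w \<in> ?W" and x: "x \<in> ak"
      obtain \<pi> \<epsilon> where *: "w \<in> ak \<rightarrow>\<^sub>E ak" "\<pi> permutes {1..Nk}" "\<epsilon> \<in> type_signs X Nk" "acts_as ak Nk fk w \<pi> \<epsilon>"
        using w by (auto simp: signed_permutations_def)
      have wx: "w x \<in> ak" using *(1) x by auto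
      have inj\<pi>: "inj_on \<pi> S" for S by (rule permutes_inj_on[OF *(2)])
      have \<pi>I: "\<pi> ` S \<in> I" if "S \<in> I" for S
        using that permutes_range[OF *(2)] by (auto simp: I_def card_image[OF inj\<pi>])
      have step: "q (L S (w x)) = q (L (\<pi> ` S) x)" if S: "S \<in> I" for S
      proof -
        note S' = IS[OF S] and T = IS[OF \<pi>I[OF S]]
        have "L S (w x) = (\<Sum>k\<in>S. (\<epsilon> k * F (\<pi> k) x) *\<^sub>R b (J S k))"
          unfolding L_def
        proof (rule sum.cong[OF refl])
          fix k assume "k \<in> S"
          then have k: "k \<in> {1..Nk}" using S'(3) by blast
          then have "F k (w x) = \<epsilon> k * F (\<pi> k) x"
            using *(4) x wx F(2) permutes_range[OF *(2) k] by (simp add: acts_as_def)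
          then show "F k (w x) *\<^sub>R b (J S k) = (\<epsilon> k * F (\<pi> k) x) *\<^sub>R b (J S k)" by simp
        qed
        also have "q \<dots> = q (\<Sum>k\<in>S. F (\<pi> k) x *\<^sub>R b ((J (\<pi> ` S) \<circ> \<pi>) k))"
        proof (rule indep[OF S'(1)])
          show "inj_on (J S) S" "J S ` S \<subseteq> {1..Nn}" using J[OF S'(1,2)] by simp_all
          show "inj_on (J (\<pi> ` S) \<circ> \<pi>) S" using J[OF T(1,2)] inj\<pi> by (intro comp_inj_on) auto
          show "(J (\<pi> ` S) \<circ> \<pi>) ` S \<subseteq> {1..Nn}" unfolding image_comp[symmetric] using J[OF T(1,2)] by blast
          show "\<epsilon> k = 1 \<or> \<epsilon> k = -1" if "k \<in> S" for k
            using *(3) S'(3) that unfolding type_signs_def sign_vectors_def by blast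
          show "\<epsilon> k = 1" if "X = TypeA" "k \<in> S" for k
            using *(3) S'(3) that unfolding type_signs_def by blast
        qed
        also have "(\<Sum>k\<in>S. F (\<pi> k) x *\<^sub>R b ((J (\<pi> ` S) \<circ> \<pi>) k)) = L (\<pi> ` S) x"
          unfolding L_def by (simp add: sum.reindex[OF inj\<pi>])
        finally show ?thesis .
      qed
      have "inj_on ((`) \<pi>) I" using permutes_inj[OF *(2)] by (auto simp: inj_on_def inj_image_eq_iff)
      then have bij: "bij_betw ((`) \<pi>) I I"
        using \<pi>I I by (simp add: bij_betw_def endo_inj_surj image_subset_iff)
      have "(\<Sum>S\<in>I. t (card S) *\<^sub>R q (L S (w x))) = (\<Sum>S\<in>I. t (card (\<pi> ` S)) *\<^sub>R q (L (\<pi> ` S) x))"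
        using step by (intro sum.cong refl) (simp add: card_image[OF inj\<pi>])
      also have "\<dots> = (\<Sum>S\<in>I. t (card S) *\<^sub>R q (L S x))"
        by (rule sum.reindex_bij_betw[OF bij])
      finally show "(\<Sum>S\<in>I. t (card S) *\<^sub>R q (L S (w x))) = (\<Sum>S\<in>I. t (card S) *\<^sub>R q (L S x))" .
    next
      fix x assume x: "x \<in> an"
      then have xk: "x \<in> ak" using sub by blast
      define v where "v T = q (\<Sum>k\<in>T. fn k x *\<^sub>R b (J T k))" for T
      have qL: "q (L S x) = v (S \<inter> {1..Nn})" if S: "S \<in> I" for S
      proof -
        note S' = IS[OF S]
        let ?T = "S \<inter> {1..Nn}"
        have T: "finite ?T" "card ?T \<le> Nn"
          using S' card_mono[OF S'(1), of ?T] by auto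
        have "L S x = (\<Sum>k\<in>?T. fn k x *\<^sub>R b (J S k))"
          unfolding L_def
        proof (rule sum.mono_neutral_cong_right)
          show "\<forall>k\<in>S - ?T. F k x *\<^sub>R b (J S k) = 0"
          proof
            fix k assume "k \<in> S - ?T"
            then have "k \<in> {1..Nk}" "k \<in> {Nn<..Nk}" using S'(3) by auto
            then show "F k x *\<^sub>R b (J S k) = 0" using F(2)[OF _ xk] high[OF x] by simp
          qed
          show "F k x *\<^sub>R b (J S k) = fn k x *\<^sub>R b (J S k)" if "k \<in> ?T" for k
          proof -
            have "k \<in> {1..Nk}" "k \<in> {1..Nn}" using that S'(3) by auto
            then show ?thesis using F(2)[OF _ xk] low[OF x] by simp
          qed
        qed (use S' in auto)
        also have "\<dots> = (\<Sum>k\<in>?T. (1 * fn k x) *\<^sub>R b (J S k))" by simp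
        also have "q \<dots> = v ?T"
          unfolding v_def
        proof (rule indep[OF T(1)])
          show "inj_on (J S) ?T" "J S ` ?T \<subseteq> {1..Nn}"
            using J[OF S'(1,2)] inj_on_subset[of "J S" S ?T] by auto
          show "inj_on (J ?T) ?T" "J ?T ` ?T \<subseteq> {1..Nn}" using J[OF T] by simp_all
        qed auto
        finally show ?thesis .
      qed
      have "(\<Sum>S\<in>I. t (card S) *\<^sub>R q (L S x)) = (\<Sum>S\<in>I. t (card S) *\<^sub>R v (S \<inter> {1..Nn}))"
        using qL by simp
      \<comment> \<open>the weights of the sets with more than \<open>Nn\<close> elements vanish\<close>
      also have "\<dots> = (\<Sum>S\<in>Pow {1..Nk}. t (card S) *\<^sub>R v (S \<inter> {1..Nn}))"
      proof (rule sum.mono_neutral_left)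
        show "\<forall>S\<in>Pow {1..Nk} - I. t (card S) *\<^sub>R v (S \<inter> {1..Nn}) = 0"
        proof
          fix S assume "S \<in> Pow {1..Nk} - I"
          then have "card S > Nn" by (auto simp: I_def)
          then show "t (card S) *\<^sub>R v (S \<inter> {1..Nn}) = 0" using t(1) by simp
        qed
      qed (auto simp: I_def)
      also have "\<dots> = (\<Sum>S\<in>Pow ({1..Nn} \<union> {Nn<..Nk}). t (card S) *\<^sub>R v (S \<inter> {1..Nn}))"
        using le by (intro arg_cong[where f = "sum _"] arg_cong[where f = Pow]) auto
      also have "\<dots> = (\<Sum>T\<in>Pow {1..Nn}. \<Sum>U\<in>Pow {Nn<..Nk}. t (card (T \<union> U)) *\<^sub>R v ((T \<union> U) \<inter> {1..Nn}))"
        by (rule sum_Pow_Un) auto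
      also have "\<dots> = (\<Sum>T\<in>Pow {1..Nn}. \<Sum>U\<in>Pow {Nn<..Nk}. t (card T + card U) *\<^sub>R v T)"
      proof (intro sum.cong refl)
        fix T U assume "T \<in> Pow {1..Nn}" "U \<in> Pow {Nn<..Nk}"
        then have TU: "T \<subseteq> {1..Nn}" "U \<subseteq> {Nn<..Nk}" by blast+
        moreover have "{1..Nn} \<inter> {Nn<..Nk} = {}" by auto
        ultimately have "T \<inter> U = {}" "(T \<union> U) \<inter> {1..Nn} = T" by blast+
        moreover have "finite T" "finite U" using TU finite_subset by blast+
        ultimately show "t (card (T \<union> U)) *\<^sub>R v ((T \<union> U) \<inter> {1..Nn}) = t (card T + card U) *\<^sub>R v T"
          by (simp add: card_Un_disjoint)
      qed
      also have "\<dots> = (\<Sum>T\<in>Pow {1..Nn}. of_bool (card T = Nn) *\<^sub>R v T)"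
        by (simp only: scaleR_sum_left[symmetric] t(2))
      also have "\<dots> = (\<Sum>T\<in>{{1..Nn}}. of_bool (card T = Nn) *\<^sub>R v T)"
      proof (rule sum.mono_neutral_right)
        show "\<forall>T\<in>Pow {1..Nn} - {{1..Nn}}. of_bool (card T = Nn) *\<^sub>R v T = 0"
          using card_subset_eq[of "{1..Nn}"] by auto
      qed auto
      also have "\<dots> = v {1..Nn}" by simp
      also have "\<dots> = q (\<Sum>k\<in>{1..Nn}. (1 * fn k x) *\<^sub>R b k)"
      proof -
        have "q (\<Sum>k\<in>{1..Nn}. (1 * fn k x) *\<^sub>R b k) = v {1..Nn}"
          unfolding v_def
          by (rule indep) (use J[of "{1..Nn}"] in auto)
        then show ?thesis by simp
      qed
      also have "(\<Sum>k\<in>{1..Nn}. (1 * fn k x) *\<^sub>R b k) = x"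
      proof (rule coordinate_unique[OF cs_n])
        show "(\<Sum>k\<in>{1..Nn}. (1 * fn k x) *\<^sub>R b k) \<in> an" using comb(1)[of "\<lambda>k. k"] by simp
        fix i assume i: "i \<in> {1..Nn}"
        have "fn i (\<Sum>k\<in>{1..Nn}. fn k x *\<^sub>R b k) = (\<Sum>k\<in>{1..Nn}. fn k x * (of_bool (i = k) - \<mu>))"
          using comb(2)[of "\<lambda>k. k" "{1..Nn}" i "\<lambda>k. fn k x"] i by simp
        also have "\<dots> = (\<Sum>k\<in>{1..Nn}. of_bool (k = i) * fn k x) - (\<Sum>k\<in>{1..Nn}. fn k x) * \<mu>"
          unfolding sum_distrib_right sum_subtractf[symmetric]
          by (intro sum.cong refl) (simp only: right_diff_distrib mult.commute eq_commute[of i])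
        also have "\<dots> = fn i x"
          using sum_of_bool_mult[of "{1..Nn}" i "\<lambda>k. fn k x"] i coordinate_sum[of an Nn fn x] cs_n x
          by (auto simp: \<mu>_def)
        finally show "fn i (\<Sum>k\<in>{1..Nn}. (1 * fn k x) *\<^sub>R b k) = fn i x" by simp
      qed (rule x)
      finally show "(\<Sum>S\<in>I. t (card S) *\<^sub>R q (L S x)) = q x" .
    qed
  qed
  show ?thesis
    unfolding extends_invariants_def
    using I lin main by (intro exI[of _ I] exI[of _ "\<lambda>S. t (card S)"] exI[of _ L]) blast
qed

end

section \<open>Propagation of irreducible spaces\<close>

lemma coordinate_rank_le:
  assumes "coordinate_system False a N f" "coordinate_system Z a N' f"
  shows "N \<le> N'"
proof (rule ccontr)
  assume "\<not> N \<le> N'"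
  then have N: "N \<in> {1..N}" "N' < N" by auto
  obtain x where x: "x \<in> a" "\<forall>k\<in>{1..N}. f k x = of_bool (k = N)"
    using coordinate_surj[OF assms(1), of "\<lambda>k. of_bool (k = N)"] by blast
  have "\<forall>k\<in>{1..N'}. f k x = 0" using x(2) N by auto
  then have "x = 0" using assms(2) x(1) by (simp add: coordinate_system_def)
  moreover have "f N 0 = 0"
    using assms(1) N functional_zero unfolding coordinate_system_def by blast
  ultimately show False using x(2) N by auto
qed

text \<open>
  Evaluate the product of the coordinates of \<open>w x\<close> at the vector \<open>x\<close>
  with all coordinates \<open>1\<close>.
\<close>

lemma sign_product_unique:
  assumes cs: "coordinate_system False a N f" and "\<pi> permutes {1..N}" "\<rho> permutes {1..N}"
    and "acts_as a N f w \<pi> \<epsilon>" "acts_as a N f w \<rho> \<delta>"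
  shows "(\<Prod>k=1..N. \<epsilon> k) = (\<Prod>k=1..N. \<delta> k)"
proof -
  obtain x where x: "x \<in> a" "\<forall>k\<in>{1..N}. f k x = 1"
    using coordinate_surj[OF cs, of "\<lambda>k. 1"] by blast
  have "(\<Prod>k=1..N. \<epsilon> k) = (\<Prod>k=1..N. f k (w x))" if "\<pi> permutes {1..N}" "acts_as a N f w \<pi> \<epsilon>" for \<pi> \<epsilon>
    using that x permutes_range[OF that(1)] by (intro prod.cong refl) (simp add: acts_as_def)
  then show ?thesis using assms by metis
qed

text \<open>
  The same functionals cannot be standard coordinates of another type as well. In types
  \<open>B\<close> and \<open>C\<close> the Weyl group would contain a single sign change. In type
  \<open>A\<close> it would contain the exchange of \<open>f\<^sub>1\<close> with the last
  coordinate, which is minus the sum of the others and hence not plus or minus one of them.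
\<close>

lemma type_D_exclusive:
  assumes M: "has_root_system M a" and X: "standard_coordinates X r M a f"
    and D: "standard_coordinates TypeD r' M a f"
  shows "X = TypeD \<and> r = r'"
proof -
  let ?N = "num_coords X r"
  have cX: "coordinate_system (X = TypeA) a ?N f"
    and WX: "weyl_group M a = signed_permutations a ?N f (type_signs X ?N)"
    using standard_weyl_group[OF M X] by blast+
  have cD: "coordinate_system False a r' f"
    and WD: "weyl_group M a = signed_permutations a r' f (type_signs TypeD r')"
    using standard_weyl_group[OF M D] by (simp_all add: num_coords_def)
  have r': "r' \<ge> 4" and N: "?N \<ge> 2" and r1: "r \<ge> 1"
    using D X admissible_ge by (auto simp: standard_coordinates_def dynkin_numbering_def)
  have le: "r' \<le> ?N" by (rule coordinate_rank_le[OF cD cX])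
  show ?thesis
  proof (cases "X = TypeA")
    case True
    then have NA: "?N = r + 1" by (simp add: num_coords_def)
    have cA: "coordinate_system True a (r + 1) f" using cX True NA by simp
    have ne: "r' \<noteq> r + 1"
    proof
      assume "r' = r + 1"
      obtain x where x: "x \<in> a" "\<forall>k\<in>{1..r'}. f k x = 1"
        using coordinate_surj[OF cD, of "\<lambda>k. 1"] by blast
      have "(\<Sum>k=1..r + 1. f k x) = (\<Sum>k=1..r + 1. 1)" using x(2) \<open>r' = r + 1\<close> by (intro sum.cong) auto
      then show False using coordinate_sum[OF cA x(1)] by simp
    qed
    have "\<not> r' < r"
    proof
      assume lt: "r' < r"
      have "(\<Sum>k=1..r + 1. of_bool (k = r) * 1 - of_bool (k = r + 1) * 1) = (0::real)"
        using sum_of_bool_mult[of "{1..r + 1}" r "\<lambda>_. 1"] sum_of_bool_mult[of "{1..r + 1}" "r + 1" "\<lambda>_. 1"] r1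
        unfolding sum_subtractf by auto
      from coordinate_surj[OF cA this] obtain x
        where x: "x \<in> a" "\<forall>k\<in>{1..r + 1}. f k x = of_bool (k = r) * 1 - of_bool (k = r + 1) * 1" by blast
      have "\<forall>k\<in>{1..r'}. f k x = 0" using x(2) lt by auto
      then have "x = 0" using cD x(1) by (simp add: coordinate_system_def)
      moreover have "f r 0 = 0" using cA r1 functional_zero[of "f r" a] by (auto simp: coordinate_system_def)
      ultimately show False using x(2) r1 by auto
    qed
    then have rr: "r' = r" using le ne NA by simp
    have tp: "Transposition.transpose 1 (r + 1) permutes {1..r + 1}" by (intro permutes_swap_id) auto
    obtain w where w: "w \<in> a \<rightarrow>\<^sub>E a" "acts_as a (r + 1) f w (Transposition.transpose 1 (r + 1)) (\<lambda>_. 1)"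
      using signed_permutation_exists[OF cA tp, of "\<lambda>_. 1"] by blast
    have "(\<lambda>_. 1) \<in> type_signs TypeA (r + 1)" by (simp add: type_signs_def sign_vectors_def)
    then have "w \<in> weyl_group M a" unfolding WX True NA[unfolded True] signed_permutations_def using w tp by blast
    then obtain \<pi> \<epsilon> where p: "\<pi> permutes {1..r}" "\<epsilon> \<in> type_signs TypeD r" "acts_as a r f w \<pi> \<epsilon>"
      unfolding WD rr signed_permutations_def by blast
    obtain x where x: "x \<in> a" "\<forall>k\<in>{1..r}. f k x = 1"
      using coordinate_surj[OF cD, of "\<lambda>k. 1"] rr by blast
    have i1: "1 \<in> {1..r}" "1 \<in> {1..r + 1}" using r1 by auto
    have "f 1 (w x) = f (r + 1) x"
      using w(2) x(1) i1(2) unfolding acts_as_def by fastforce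
    moreover have "f 1 (w x) = \<epsilon> 1 * f (\<pi> 1) x" using p(3) x(1) i1(1) unfolding acts_as_def by blast
    moreover have "f (\<pi> 1) x = 1" using x(2) permutes_range[OF p(1) i1(1)] by blast
    moreover have "\<epsilon> 1 = 1 \<or> \<epsilon> 1 = -1" using p(2) i1(1) unfolding type_signs_def sign_vectors_def by blast
    moreover have "f (r + 1) x = - real r"
    proof -
      have "(\<Sum>k=1..r + 1. f k x) = (\<Sum>k=1..r. f k x) + f (r + 1) x" using r1 by simp
      moreover have "(\<Sum>k=1..r. f k x) = (\<Sum>k=1..r. 1)" using x(2) by (intro sum.cong) auto
      ultimately show ?thesis using coordinate_sum[OF cA x(1)] by simp
    qed
    ultimately have "real r = 1 \<or> real r = - 1" by auto
    then show ?thesis using r' rr by simp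
  next
    case False
    then have NX: "?N = r" by (simp add: num_coords_def)
    have cB: "coordinate_system False a r f" using cX False NX by simp
    have rr: "r' = r" using le NX coordinate_rank_le[OF cB cD] by simp
    have "X = TypeD"
    proof (rule ccontr)
      assume "X \<noteq> TypeD"
      obtain w where w: "w \<in> a \<rightarrow>\<^sub>E a" "acts_as a r f w id (flip {1})"
        using signed_permutation_exists[OF cB permutes_id, of "flip {1}"] by blast
      have "flip {1} \<in> type_signs X r"
        using False \<open>X \<noteq> TypeD\<close> by (simp add: type_signs_def sign_vectors_def flip_def)
      then have "w \<in> weyl_group M a" unfolding WX NX signed_permutations_def using w permutes_id by blast
      then obtain \<pi> \<epsilon> where p: "\<pi> permutes {1..r}" "\<epsilon> \<in> type_signs TypeD r" "acts_as a r f w \<pi> \<epsilon>"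
        unfolding WD rr signed_permutations_def by blast
      have "(\<Prod>k=1..r. flip {1} k) = (\<Prod>k=1..r. \<epsilon> k)"
        by (rule sign_product_unique[OF cB permutes_id p(1) w(2) p(3)])
      moreover have "(\<Prod>k=1..r. flip {1} k) = -1" using r1 by (subst prod_flip) auto
      ultimately show False using p(2) by (simp add: type_signs_def)
    qed
    then show ?thesis using rr by simp
  qed
qed

lemma standard_has_type: "standard_coordinates X r M a f \<Longrightarrow> has_type X r M a"
  unfolding standard_coordinates_def has_type_def by blast

lemma type_signs_B: "type_signs TypeB N = sign_vectors N"
  by (auto simp: type_signs_def)

lemma ext_weyl_factor_D:
  assumes M: "has_root_system M a" and D: "coordinates_for_D M a f" "has_type TypeD r M a"
  shows "standard_coordinates TypeD r M a f"
    and "ext_weyl_factor M a f = signed_permutations a r f (type_signs TypeB r)"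
proof -
  show std: "standard_coordinates TypeD r M a f" using D by (simp add: coordinates_for_D_def)
  have "r' = r" if "has_type TypeD r' M a" for r'
    using type_D_exclusive[OF M std, of r'] D(1) that by (simp add: coordinates_for_D_def)
  then have "has_type TypeD r' M a \<longleftrightarrow> r' = r" for r' using D(2) by blast
  then show "ext_weyl_factor M a f = signed_permutations a r f (type_signs TypeB r)"
    unfolding ext_weyl_factor_def signed_permutations_def acts_as_def type_signs_B sign_vectors_def by auto
qed

lemma ext_weyl_factor_not_D:
  "(\<And>r. \<not> has_type TypeD r M a) \<Longrightarrow> ext_weyl_factor M a f = weyl_group M a"
  by (simp add: ext_weyl_factor_def)

text \<open>
  Coroots of half roots are determined by the half roots (\<open>coroot_unique\<close>), and the
  Weyl group is generated by the reflections in half roots.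
\<close>

lemma half_roots_determine:
  assumes M: "has_root_system M a" and M': "has_root_system M' a" and eq: "half_roots M a = half_roots M' a"
  shows "\<alpha> \<in> half_roots M a \<Longrightarrow> coroot M a \<alpha> = coroot M' a \<alpha>"
    and "weyl_group M a = weyl_group M' a"
    and "has_type X r M a \<longleftrightarrow> has_type X r M' a"
proof -
  obtain Q Q' where "root_system a (half_roots M a) (coroot M a) Q" "root_system a (half_roots M' a) (coroot M' a) Q'"
    using has_root_system_half M M' by metis
  then interpret r: root_system a "half_roots M a" "coroot M a" Q + r': root_system a "half_roots M' a" "coroot M' a" Q' .
  have co: "coroot M a \<alpha> = coroot M' a \<alpha>" if "\<alpha> \<in> half_roots M a" for \<alpha>
    using that r.c_a r.c_two r.R_reflect eq by (intro r'.coroot_unique) simp_all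
  then show "\<alpha> \<in> half_roots M a \<Longrightarrow> coroot M a \<alpha> = coroot M' a \<alpha>" .
  have "(\<lambda>\<alpha>. reflection a \<alpha> (coroot M a \<alpha>)) ` half_roots M a = (\<lambda>\<alpha>. reflection a \<alpha> (coroot M' a \<alpha>)) ` half_roots M' a"
    unfolding eq[symmetric] by (rule image_cong[OF refl]) (simp add: co)
  then show "weyl_group M a = weyl_group M' a" by (simp add: weyl_group_half[OF M] weyl_group_half[OF M'])
  have "\<alpha> j (coroot M a (\<alpha> i)) = \<alpha> j (coroot M' a (\<alpha> i))"
    if "bij_betw \<alpha> {1..r} (simple_roots (half_roots M a) a H)" "i \<in> {1..r}" for \<alpha> i j H
  proof -
    have "\<alpha> i \<in> simple_roots (half_roots M a) a H" using that bij_betwE by blast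
    then have "\<alpha> i \<in> half_roots M a" by (simp add: simple_roots_def positive_roots_def)
    then show ?thesis by (simp add: co)
  qed
  then show "has_type X r M a \<longleftrightarrow> has_type X r M' a"
    unfolding has_type_def dynkin_numbering_def eq[symmetric] by metis
qed

lemma weyl_group_linear:
  assumes "has_root_system M a" "w \<in> weyl_group M a"
  shows "w \<in> a \<rightarrow>\<^sub>E a" "w ` a = a" "\<exists>h. linear h \<and> w = restrict h a"
proof -
  obtain Q where "root_system a (half_roots M a) (coroot M a) Q" using has_root_system_half[OF assms(1)] .
  then interpret root_system a "half_roots M a" "coroot M a" Q .
  have "w \<in> generated_group a (reflections (half_roots M a))"
    using assms(2) unfolding weyl_group_half[OF assms(1)] reflections_def .
  then have "w \<in> a \<rightarrow>\<^sub>E a \<and> w ` a = a \<and> (\<exists>h. linear h \<and> w = restrict h a)"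
  proof induction
    case generated_id
    have "linear (\<lambda>x::'b. x)" by (rule linear_ident)
    then show ?case by auto
  next
    case (generated_step w s)
    then obtain \<alpha> where \<alpha>: "\<alpha> \<in> half_roots M a" "s = reflection a \<alpha> (coroot M a \<alpha>)" by (auto simp: reflections_def)
    have sa: "s x \<in> a" "s (s x) = x" if "x \<in> a" for x
      using reflection_a[OF \<alpha>(1) that] reflection_reflection[OF \<alpha>(1) that] by (simp_all add: \<alpha>(2))
    have wa: "w \<in> a \<rightarrow>\<^sub>E a" "w ` a = a" using generated_step.IH by simp_all
    obtain h where h: "linear h" "w = restrict h a" using generated_step.IH by blast
    obtain l where l: "linear l" "\<alpha> = restrict l a" using functional_linear[OF R_functional[OF \<alpha>(1)]] .
    have "s ` a = a" using sa by (metis image_eqI subsetI subset_antisym image_subsetI)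
    have im: "compose a s w ` a = a"
    proof -
      have "compose a s w ` a = s ` (w ` a)" by (auto simp: compose_def)
      then show ?thesis using wa(2) \<open>s ` a = a\<close> by simp
    qed
    have "linear (\<lambda>x. h x - l (h x) *\<^sub>R coroot M a \<alpha>)"
      using h(1) l(1) by (intro linearI) (simp_all add: linear_add linear_scale algebra_simps)
    moreover have "compose a s w = restrict (\<lambda>x. h x - l (h x) *\<^sub>R coroot M a \<alpha>) a"
    proof (rule ext)
      fix x
      show "compose a s w x = restrict (\<lambda>x. h x - l (h x) *\<^sub>R coroot M a \<alpha>) a x"
      proof (cases "x \<in> a")
        case True
        then have "h x \<in> a" using PiE_mem[OF wa(1) True] h(2) by simp
        then show ?thesis using True h(2) l(2) by (simp add: compose_def \<alpha>(2) reflection_def)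
      qed (simp add: compose_def)
    qed
    moreover have "compose a s w \<in> a \<rightarrow>\<^sub>E a" using im by (auto simp: PiE_def compose_def)
    ultimately show ?case using im by blast
  qed
  then show "w \<in> a \<rightarrow>\<^sub>E a" "w ` a = a" "\<exists>h. linear h \<and> w = restrict h a" by blast+
qed

lemma signed_permutations_linear:
  assumes cs: "coordinate_system Z a N f" and w: "w \<in> signed_permutations a N f E"
  shows "\<exists>h. linear h \<and> w = restrict h a"
proof -
  obtain \<pi> \<epsilon> where w: "w \<in> a \<rightarrow>\<^sub>E a" "\<pi> permutes {1..N}" "acts_as a N f w \<pi> \<epsilon>"
    using w by (auto simp: signed_permutations_def)
  have sub: "subspace a" and f: "\<And>k. k \<in> {1..N} \<Longrightarrow> f k \<in> functionals a"
    using cs by (auto simp: coordinate_system_def)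
  have wa: "w x \<in> a" if "x \<in> a" for x using w(1) that by (rule PiE_mem)
  have fw: "f k (w x) = \<epsilon> k * f (\<pi> k) x" if "x \<in> a" "k \<in> {1..N}" for x k
    using w(3) that by (simp add: acts_as_def)
  have add: "w (x + y) = w x + w y" if x: "x \<in> a" and y: "y \<in> a" for x y
  proof (rule coordinate_unique[OF cs])
    fix k assume k: "k \<in> {1..N}"
    note k' = permutes_range[OF w(2) k]
    show "f k (w (x + y)) = f k (w x + w y)"
      using functional_add[OF f[OF k] sub wa[OF x] wa[OF y]] functional_add[OF f[OF k'] sub x y]
        fw[OF x k] fw[OF y k] fw[OF subspace_add[OF sub x y] k] by (simp add: distrib_left)
  qed (use x y wa sub in \<open>auto intro: subspace_add\<close>)
  have scale: "w (c *\<^sub>R x) = c *\<^sub>R w x" if x: "x \<in> a" for x c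
  proof (rule coordinate_unique[OF cs])
    fix k assume k: "k \<in> {1..N}"
    note k' = permutes_range[OF w(2) k]
    show "f k (w (c *\<^sub>R x)) = f k (c *\<^sub>R w x)"
      using functional_scale[OF f[OF k] sub wa[OF x]] functional_scale[OF f[OF k'] sub x]
        fw[OF x k] fw[OF subspace_scale[OF sub x] k] by simp
  qed (use x wa sub in \<open>auto intro: subspace_scale\<close>)
  obtain p where p: "linear p" "\<And>x. p x \<in> a" "\<And>x. x \<in> a \<Longrightarrow> p x = x"
    using subspace_projection_exists[OF sub] by blast
  have "linear (\<lambda>x. w (p x))"
    using p by (intro linearI) (simp_all add: linear_add linear_scale add scale)
  moreover have "w = restrict (\<lambda>x. w (p x)) a"
    using p(3) w(1) by (auto simp: fun_eq_iff PiE_def extensional_def)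
  ultimately show ?thesis by blast
qed

lemma standard_num_coords_ge: "standard_coordinates X r M a f \<Longrightarrow> num_coords X r \<ge> 2"
  using admissible_ge by (auto simp: standard_coordinates_def dynkin_numbering_def)

lemma ext_weyl_factor_linear:
  assumes M: "has_root_system M a" and D: "coordinates_for_D M a f" and w: "w \<in> ext_weyl_factor M a f"
  shows "w \<in> a \<rightarrow>\<^sub>E a \<and> w ` a = a \<and> (\<exists>h. linear h \<and> w = restrict h a)"
proof (cases "\<exists>r. has_type TypeD r M a")
  case True
  then obtain r where r: "has_type TypeD r M a" by blast
  note e = ext_weyl_factor_D[OF M D r]
  have cs: "coordinate_system (TypeB = TypeA) a r f"
    using standard_weyl_group(1)[OF M e(1)] by (simp add: num_coords_def)
  have wp: "w \<in> signed_permutations a r f (type_signs TypeB r)" using w e(2) by simp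
  then have "w \<in> a \<rightarrow>\<^sub>E a" by (simp add: signed_permutations_def)
  then show ?thesis using signed_permutation_onto[OF cs wp] signed_permutations_linear[OF cs wp] by blast
next
  case False
  then show ?thesis using weyl_group_linear[OF M] w ext_weyl_factor_not_D[of M a f] by simp
qed

lemma stabiliser_whole:
  assumes "\<And>w. w \<in> W \<Longrightarrow> w \<in> a \<rightarrow>\<^sub>E a \<and> w ` a = a"
  shows "restrictions a (stabiliser W a) = W"
proof -
  have "stabiliser W a = W" using assms by (auto simp: stabiliser_def)
  moreover have "restrict w a = w" if "w \<in> W" for w
    using assms[OF that] by (auto simp: fun_eq_iff PiE_def extensional_def)
  ultimately show ?thesis by (simp add: restrictions_def)
qed

lemma propagates_irreducible_cases:
  assumes Mk: "has_root_system Mk ak" and Mn: "has_root_system Mn an"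
    and P: "propagates_irreducible Mk ak fk Mn an fn"
  obtains (same) "an = ak" "half_roots Mn an = half_roots Mk ak"
      "\<And>r k x. has_type TypeD r Mn an \<Longrightarrow> k \<in> {1..r} \<Longrightarrow> x \<in> an \<Longrightarrow> fk k x = fn k x"
    | (larger) X rk rn where "standard_coordinates X rk Mk ak fk" "standard_coordinates X rn Mn an fn"
      "coordinate_inclusion X ak (num_coords X rk) fk an (num_coords X rn) fn"
proof -
  have sub: "an \<subseteq> ak" using P by (simp add: propagates_irreducible_def)
  consider "an = ak \<and> half_roots Mn an = half_roots Mk ak \<and>
        (\<forall>r. has_type TypeD r Mn an \<longrightarrow> (\<forall>k\<in>{1..r}. \<forall>x\<in>an. fk k x = fn k x))"
    | "\<exists>X rk rn. rn \<le> rk \<and>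
        standard_coordinates X rk Mk ak fk \<and> standard_coordinates X rn Mn an fn \<and>
        (\<forall>x\<in>an. (\<forall>k\<in>{1..num_coords X rn}. fk k x = fn k x) \<and>
                 (\<forall>k\<in>{num_coords X rn<..num_coords X rk}. fk k x = 0))"
    using P unfolding propagates_irreducible_def by blast
  then show ?thesis
  proof cases
    case 1
    then show ?thesis using same by blast
  next
    case 2
    then obtain X rk rn where *: "rn \<le> rk" "standard_coordinates X rk Mk ak fk" "standard_coordinates X rn Mn an fn"
      "\<forall>x\<in>an. (\<forall>k\<in>{1..num_coords X rn}. fk k x = fn k x) \<and> (\<forall>k\<in>{num_coords X rn<..num_coords X rk}. fk k x = 0)"
      by blast
    have "coordinate_inclusion X ak (num_coords X rk) fk an (num_coords X rn) fn"
      using standard_weyl_group(1)[OF Mk *(2)] standard_weyl_group(1)[OF Mn *(3)] * sub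
        standard_num_coords_ge[OF *(3)]
      by (intro coordinate_inclusion.intro) (auto simp: num_coords_def)
    then show ?thesis using larger * by blast
  qed
qed

text \<open>
  The extended group in type \<open>D\<close> is the signed permutation group of type
  \<open>B\<close>, for which stabilisers restrict well and invariants extend.
\<close>

lemma propagates_irreducible_ext:
  assumes Mk: "has_root_system Mk ak" and Mn: "has_root_system Mn an"
    and Dk: "coordinates_for_D Mk ak fk" and Dn: "coordinates_for_D Mn an fn"
    and P: "propagates_irreducible Mk ak fk Mn an fn"
  defines "Wk \<equiv> ext_weyl_factor Mk ak fk" and "Wn \<equiv> ext_weyl_factor Mn an fn"
  shows "restrictions an (stabiliser Wk an) = Wn \<and> extends_invariants TYPE('c::real_vector) Wk ak Wn an"
  using Mk Mn P
proof (cases rule: propagates_irreducible_cases)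
  case same
  note M' = Mk[folded same(1)]
  note eq = half_roots_determine[OF Mn M' same(2)[folded same(1)]]
  have "Wk = Wn"
  proof (cases "\<exists>r. has_type TypeD r Mn an")
    case True
    then obtain r where r: "has_type TypeD r Mn an" by blast
    then have rk: "has_type TypeD r Mk ak" using eq(3) same(1) by simp
    have "signed_permutations an r fk E = signed_permutations an r fn E" for E
      unfolding signed_permutations_def
    proof (intro Collect_cong conj_cong refl ex_cong1)
      fix w \<pi> \<epsilon> assume w: "w \<in> an \<rightarrow>\<^sub>E an" "\<pi> permutes {1..r}"
      show "acts_as an r fk w \<pi> \<epsilon> \<longleftrightarrow> acts_as an r fn w \<pi> \<epsilon>"
        unfolding acts_as_def using same(3)[OF r] PiE_mem[OF w(1)] permutes_range[OF w(2)]
        by (intro ball_cong refl) simp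
    qed
    then show ?thesis
      unfolding Wk_def Wn_def ext_weyl_factor_D(2)[OF Mk Dk rk] ext_weyl_factor_D(2)[OF Mn Dn r]
      by (simp add: same(1)[symmetric])
  next
    case False
    then have "\<not> has_type TypeD r Mk ak" for r using eq(3) same(1) by simp
    then show ?thesis
      unfolding Wk_def Wn_def using ext_weyl_factor_not_D False eq(2) same(1) by metis
  qed
  moreover have "restrictions an (stabiliser Wn an) = Wn"
    by (rule stabiliser_whole) (use ext_weyl_factor_linear[OF Mn Dn] in \<open>auto simp: Wn_def\<close>)
  ultimately show ?thesis using extends_invariants_same same(1) by metis
next
  case (larger X rk rn)
  define Y where "Y = (if X = TypeD then TypeB else X)"
  have Y: "(Y = TypeA) = (X = TypeA)" "Y \<noteq> TypeD" by (auto simp: Y_def)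
  have ext: "ext_weyl_factor M a f = signed_permutations a (num_coords X r) f (type_signs Y (num_coords X r))"
    if M: "has_root_system M a" and D: "coordinates_for_D M a f" and std: "standard_coordinates X r M a f" for M a f r
  proof (cases "X = TypeD")
    case True
    then show ?thesis
      using ext_weyl_factor_D(2)[OF M D] standard_has_type[OF std] by (simp add: Y_def num_coords_def)
  next
    case False
    have "\<not> has_type TypeD r' M a" for r'
      using type_D_exclusive[OF M std] ext_weyl_factor_D(1)[OF M D] False by blast
    then show ?thesis
      using ext_weyl_factor_not_D standard_weyl_group(2)[OF M std] False by (metis Y_def)
  qed
  interpret coordinate_inclusion Y ak "num_coords X rk" fk an "num_coords X rn" fn
    using larger(3) Y(1) by (simp add: coordinate_inclusion_def)
  show ?thesis
    unfolding Wk_def Wn_def ext[OF Mk Dk larger(1)] ext[OF Mn Dn larger(2)]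
    using stabiliser_signed_permutations[OF Y(2)] extends_invariants_signed_permutations[OF Y(2)] by blast
qed

lemma propagates_irreducible_weyl:
  assumes Mk: "has_root_system Mk ak" and Mn: "has_root_system Mn an"
    and P: "propagates_irreducible Mk ak fk Mn an fn"
  shows "weyl_group Mn an \<subseteq> restrictions an (stabiliser (weyl_group Mk ak) an)"
    and "(\<And>r. \<not> has_type TypeD r Mn an) \<Longrightarrow>
      restrictions an (stabiliser (weyl_group Mk ak) an) = weyl_group Mn an \<and>
      extends_invariants TYPE('c::real_vector) (weyl_group Mk ak) ak (weyl_group Mn an) an"
proof -
  have "weyl_group Mn an \<subseteq> restrictions an (stabiliser (weyl_group Mk ak) an) \<and>
    ((\<forall>r. \<not> has_type TypeD r Mn an) \<longrightarrow>
      restrictions an (stabiliser (weyl_group Mk ak) an) = weyl_group Mn an \<and>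
      extends_invariants TYPE('c::real_vector) (weyl_group Mk ak) ak (weyl_group Mn an) an)"
    using Mk Mn P
  proof (cases rule: propagates_irreducible_cases)
    case same
    note M' = Mk[folded same(1)]
    have "weyl_group Mn an = weyl_group Mk ak"
      using half_roots_determine(2)[OF Mn M' same(2)[folded same(1)]] same(1) by simp
    moreover have "restrictions an (stabiliser (weyl_group Mn an) an) = weyl_group Mn an"
      by (rule stabiliser_whole) (use weyl_group_linear[OF Mn] in blast)
    ultimately show ?thesis using extends_invariants_same same(1) by (metis order.refl)
  next
    case (larger X rk rn)
    interpret coordinate_inclusion X ak "num_coords X rk" fk an "num_coords X rn" fn by (rule larger(3))
    have "X \<noteq> TypeD" if "\<forall>r. \<not> has_type TypeD r Mn an" using standard_has_type[OF larger(2)] that by blast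
    then show ?thesis
      unfolding standard_weyl_group(2)[OF Mk larger(1)] standard_weyl_group(2)[OF Mn larger(2)]
      using restrict_signed_permutations stabiliser_signed_permutations extends_invariants_signed_permutations by blast
  qed
  then show "weyl_group Mn an \<subseteq> restrictions an (stabiliser (weyl_group Mk ak) an)"
    "(\<And>r. \<not> has_type TypeD r Mn an) \<Longrightarrow>
      restrictions an (stabiliser (weyl_group Mk ak) an) = weyl_group Mn an \<and>
      extends_invariants TYPE('c::real_vector) (weyl_group Mk ak) ak (weyl_group Mn an) an" by blast+
qed

text \<open>
  The invariant is the product of the coordinates of \<open>an\<close>. Every signed permutation
  multiplies it by the product of its signs.
\<close>

lemma propagates_irreducible_strict:
  assumes Mk: "has_root_system Mk ak" and Mn: "has_root_system Mn an"
    and Dn: "coordinates_for_D Mn an fn" and D: "has_type TypeD r Mn an"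
    and P: "propagates_irreducible Mk ak fk Mn an fn" and ne: "an \<noteq> ak"
  obtains p :: "'v::euclidean_space \<Rightarrow> 'c::{real_normed_field, euclidean_space}" and v x
  where "polynomial_function p" "\<And>w x. w \<in> weyl_group Mn an \<Longrightarrow> x \<in> an \<Longrightarrow> p (w x) = p x"
    "v \<in> stabiliser (weyl_group Mk ak) an" "x \<in> an" "p (v x) \<noteq> p x"
  using Mk Mn P
proof (cases rule: propagates_irreducible_cases)
  case same
  then show ?thesis using ne by blast
next
  case (larger X rk rn)
  have "X = TypeD" using type_D_exclusive[OF Mn larger(2) ext_weyl_factor_D(1)[OF Mn Dn D]] by blast
  note larger = larger[unfolded this]
  have N: "num_coords TypeD r = r" for r by (simp add: num_coords_def)
  interpret coordinate_inclusion TypeD ak rk fk an rn fn using larger(3) by (simp add: N)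
  have csn: "coordinate_system False an rn fn" and csk: "coordinate_system False ak rk fk"
    using cs_n cs_k by simp_all
  have lt: "rn < rk"
  proof (rule ccontr)
    assume "\<not> rn < rk"
    then have "rk = rn" using le by simp
    have "ak \<subseteq> an"
    proof
      fix x assume x: "x \<in> ak"
      obtain y where y: "y \<in> an" "\<forall>k\<in>{1..rn}. fn k y = fk k x"
        using coordinate_surj[OF csn, of "\<lambda>k. fk k x"] by blast
      have "y = x"
        using y sub x low[OF y(1)] \<open>rk = rn\<close> by (intro coordinate_unique[OF csk]) auto
      then show "x \<in> an" using y(1) by simp
    qed
    then show False using ne sub by blast
  qed
  have rn1: "rn \<ge> 1" using two by simp
  have fnf: "fn k \<in> functionals an" if "k \<in> {1..rn}" for k using csn that by (simp add: coordinate_system_def)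
  have "\<forall>k\<in>{1..rn}. \<exists>h. linear h \<and> (\<forall>x\<in>an. fn k x = h x)"
    using functional_linear[OF fnf] by (metis restrict_apply)
  then obtain F where F: "\<forall>k\<in>{1..rn}. linear (F k) \<and> (\<forall>x\<in>an. fn k x = F k x)" by (rule bchoice[THEN exE])
  define p :: "'v \<Rightarrow> 'c" where "p x = (\<Prod>k=1..rn. F k x) *\<^sub>R 1" for x
  have pf: "p x = (\<Prod>k=1..rn. fn k x) *\<^sub>R 1" if "x \<in> an" for x
  proof -
    have "(\<Prod>k=1..rn. F k x) = (\<Prod>k=1..rn. fn k x)" using F that by (intro prod.cong) auto
    then show ?thesis by (simp add: p_def)
  qed
  have act: "p (w x) = (\<Prod>k=1..rn. \<epsilon> k) *\<^sub>R p x"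
    if "w x \<in> an" "x \<in> an" "\<pi> permutes {1..rn}" "acts_as an rn fn w \<pi> \<epsilon>" for w x \<pi> \<epsilon>
  proof -
    have "(\<Prod>k=1..rn. fn k (w x)) = (\<Prod>k=1..rn. \<epsilon> k * fn (\<pi> k) x)"
      using that(2,4) by (intro prod.cong refl) (simp add: acts_as_def)
    also have "\<dots> = (\<Prod>k=1..rn. \<epsilon> k) * (\<Prod>k=1..rn. fn k x)"
      unfolding prod.distrib using prod.permute[OF that(3), of "\<lambda>k. fn k x"] by (simp add: comp_def)
    finally show ?thesis using pf that(1,2) by simp
  qed
  have Wn: "weyl_group Mn an = signed_permutations an rn fn (type_signs TypeD rn)"
    using standard_weyl_group(2)[OF Mn larger(2)] by (simp add: N)
  have Wk: "weyl_group Mk ak = signed_permutations ak rk fk (type_signs TypeD rk)"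
    using standard_weyl_group(2)[OF Mk larger(1)] by (simp add: N)
  have poly: "polynomial_function p"
  proof -
    have "real_polynomial_function (\<lambda>x. \<Prod>k=1..rn. F k x)"
    proof (rule real_polynomial_function_prod)
      fix k assume "k \<in> {1..rn}"
      then have "bounded_linear (F k)" using F by (simp add: linear_conv_bounded_linear)
      then show "real_polynomial_function (F k)"
        by (simp add: real_polynomial_function_eq polynomial_function_bounded_linear)
    qed simp
    then have "polynomial_function (\<lambda>x. \<Prod>k=1..rn. F k x)" by (simp add: real_polynomial_function_eq)
    then show ?thesis unfolding p_def[abs_def] by (rule polynomial_function_mult[OF _ polynomial_function_const])
  qed
  have inv: "p (w x) = p x" if w: "w \<in> weyl_group Mn an" and x: "x \<in> an" for w x
  proof -
    obtain \<pi> \<epsilon> where "w \<in> an \<rightarrow>\<^sub>E an" "\<pi> permutes {1..rn}" "\<epsilon> \<in> type_signs TypeD rn" "acts_as an rn fn w \<pi> \<epsilon>"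
      using w unfolding Wn signed_permutations_def by blast
    then show ?thesis using act[of w x \<pi> \<epsilon>] x PiE_mem[of w an "\<lambda>_. an" x] by (simp add: type_signs_def)
  qed
  \<comment> \<open>a sign change in a coordinate of \<open>an\<close>, compensated by one in a coordinate that vanishes on \<open>an\<close>\<close>
  define \<epsilon> where "\<epsilon> = flip {1, rk}"
  have "\<epsilon> \<in> type_signs TypeD rk"
  proof -
    have "(\<Prod>k=1..rk. \<epsilon> k) = 1" unfolding \<epsilon>_def using lt rn1 by (subst prod_flip) auto
    then show ?thesis by (auto simp: type_signs_def sign_vectors_def \<epsilon>_def flip_def)
  qed
  obtain w where w: "w \<in> an \<rightarrow>\<^sub>E an" "acts_as an rn fn w id \<epsilon>"
    using signed_permutation_exists[OF csn permutes_id, of \<epsilon>] by blast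
  have "\<epsilon> \<in> type_signs TypeB rn" by (auto simp: type_signs_def sign_vectors_def \<epsilon>_def flip_def)
  then have wB: "w \<in> signed_permutations an rn fn (type_signs TypeB rn)"
    unfolding signed_permutations_def using w permutes_id by blast
  have "coordinate_system (TypeB = TypeA) an rn fn" using csn by simp
  from signed_permutation_onto[OF this wB] have won: "w ` an = an" .
  obtain v where v: "v \<in> weyl_group Mk ak" "v ` an = an" "restrict v an = w"
    using extend_signed_permutation[OF w(1) permutes_id w(2) won \<open>\<epsilon> \<in> type_signs TypeD rk\<close>] unfolding Wk by metis
  obtain x where x: "x \<in> an" "\<forall>k\<in>{1..rn}. fn k x = 1"
    using coordinate_surj[OF csn, of "\<lambda>k. 1"] by blast
  have "v x = w x" using v(3) x(1) by (metis restrict_apply')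
  moreover have "p (w x) = (\<Prod>k=1..rn. \<epsilon> k) *\<^sub>R p x"
    using x(1) w by (intro act[OF _ _ permutes_id]) auto
  moreover have "(\<Prod>k=1..rn. \<epsilon> k) = -1"
  proof -
    have "(\<Prod>k=1..rn. \<epsilon> k) = (\<Prod>k=1..rn. flip {1} k)"
      using lt by (intro prod.cong refl) (auto simp: \<epsilon>_def flip_def)
    also have "\<dots> = -1" using rn1 by (subst prod_flip) auto
    finally show ?thesis .
  qed
  moreover have "p x = 1" using pf[OF x(1)] x(2) by simp
  ultimately have "p (v x) \<noteq> p x" by simp
  show ?thesis
  proof (rule that[of p v x])
    show "p (w y) = p y" if "w \<in> weyl_group Mn an" "y \<in> an" for w y using that by (rule inv)
    show "v \<in> stabiliser (weyl_group Mk ak) an" using v by (simp add: stabiliser_def)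
  qed (fact poly x(1) \<open>p (v x) \<noteq> p x\<close>)+
qed

section \<open>Direct sums and products of groups\<close>

definition direct_sum :: "'v::euclidean_space set \<Rightarrow> (nat \<Rightarrow> 'v set) \<Rightarrow> nat \<Rightarrow> bool" where
  "direct_sum a A m \<longleftrightarrow> subspace a \<and> (\<forall>s<m. subspace (A s) \<and> A s \<subseteq> a) \<and>
     (\<forall>x\<in>a. \<exists>y. (\<forall>s<m. y s \<in> A s) \<and> x = (\<Sum>s<m. y s)) \<and>
     (\<forall>y. (\<forall>s<m. y s \<in> A s) \<and> (\<Sum>s<m. y s) = 0 \<longrightarrow> (\<forall>s<m. y s = 0))"

text \<open>
  The elements are maps of the whole space and not tuples. Linearity makes them determined by
  their restrictions to the summands.
\<close>

definition product_group ::
  "'v::euclidean_space set \<Rightarrow> (nat \<Rightarrow> 'v set) \<Rightarrow> nat \<Rightarrow> (nat \<Rightarrow> ('v \<Rightarrow> 'v) set) \<Rightarrow> ('v \<Rightarrow> 'v) set" where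
  "product_group a A m W = {restrict h a | h. linear h \<and> h ` a \<subseteq> a \<and> (\<forall>s<m. restrict h (A s) \<in> W s)}"

lemma direct_sum_unique:
  assumes "direct_sum a A m" "\<forall>s<m. y s \<in> A s" "\<forall>s<m. z s \<in> A s" "(\<Sum>s<m. y s) = (\<Sum>s<m. z s)" "s < m"
  shows "y s = z s"
proof -
  have "\<forall>s<m. y s - z s \<in> A s" using assms(1-3) by (simp add: direct_sum_def subspace_diff)
  moreover have "(\<Sum>s<m. y s - z s) = 0" using assms(4) by (simp add: sum_subtractf)
  ultimately have "y s - z s = 0"
    using assms(1,5) unfolding direct_sum_def by (elim conjE) (erule allE[of _ "\<lambda>s. y s - z s"], blast)
  then show ?thesis by simp
qed

lemma direct_sum_mem: "direct_sum a A m \<Longrightarrow> \<forall>s<m. y s \<in> A s \<Longrightarrow> (\<Sum>s<m. y s) \<in> a"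
  unfolding direct_sum_def by (intro subspace_sum) auto

lemma direct_sum_obtain:
  assumes "direct_sum a A m" "x \<in> a"
  obtains y where "\<forall>s<m. y s \<in> A s" "x = (\<Sum>s<m. y s)"
  using assms unfolding direct_sum_def by blast

lemma direct_sum_single:
  assumes "direct_sum a A m" "s < m" "x \<in> A s"
  shows "\<forall>t<m. (if t = s then x else 0) \<in> A t" "(\<Sum>t<m. if t = s then x else 0) = x"
  using assms by (auto simp: direct_sum_def subspace_0)

lemma direct_sum_projections:
  assumes ds: "direct_sum a A m"
  obtains P where "\<And>s. s < m \<Longrightarrow> linear (P s)"
    "\<And>s y. s < m \<Longrightarrow> \<forall>t<m. y t \<in> A t \<Longrightarrow> P s (\<Sum>t<m. y t) = y s"
proof -
  have sub: "subspace a" using ds by (simp add: direct_sum_def)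
  obtain p where p: "linear p" "\<And>x. p x \<in> a" "\<And>x. x \<in> a \<Longrightarrow> p x = x"
    using subspace_projection_exists[OF sub] by blast
  have "\<forall>x\<in>a. \<exists>y. (\<forall>s<m. y s \<in> A s) \<and> x = (\<Sum>s<m. y s)" using ds by (simp add: direct_sum_def)
  then obtain c where "\<forall>x\<in>a. (\<forall>s<m. c x s \<in> A s) \<and> x = (\<Sum>s<m. c x s)" by (rule bchoice[THEN exE])
  then have c: "\<forall>s<m. c x s \<in> A s" "x = (\<Sum>s<m. c x s)" if "x \<in> a" for x using that by blast+
  have cu: "c (\<Sum>t<m. y t) s = y s" if y: "\<forall>t<m. y t \<in> A t" and s: "s < m" for y s
    using direct_sum_unique[OF ds c(1)[OF direct_sum_mem[OF ds y]] y] c(2)[OF direct_sum_mem[OF ds y]] s by metis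
  have subA: "subspace (A t)" if "t < m" for t using ds that by (simp add: direct_sum_def)
  have "linear (\<lambda>x. c (p x) s)" if s: "s < m" for s
  proof (rule linearI)
    fix x y
    have "p (x + y) = (\<Sum>t<m. c (p x) t + c (p y) t)"
      using c(2)[OF p(2)[of x]] c(2)[OF p(2)[of y]] by (simp only: linear_add[OF p(1)] sum.distrib)
    moreover have "\<forall>t<m. c (p x) t + c (p y) t \<in> A t" using c(1)[OF p(2)] subA by (simp add: subspace_add)
    ultimately show "c (p (x + y)) s = c (p x) s + c (p y) s" using cu[of "\<lambda>t. c (p x) t + c (p y) t"] s by metis
  next
    fix r x
    have "p (r *\<^sub>R x) = (\<Sum>t<m. r *\<^sub>R c (p x) t)"
      using c(2)[OF p(2)[of x]] by (simp only: linear_scale[OF p(1)] scaleR_sum_right[symmetric])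
    moreover have "\<forall>t<m. r *\<^sub>R c (p x) t \<in> A t" using c(1)[OF p(2)] subA by (simp add: subspace_scale)
    ultimately show "c (p (r *\<^sub>R x)) s = r *\<^sub>R c (p x) s" using cu[of "\<lambda>t. r *\<^sub>R c (p x) t"] s by metis
  qed
  moreover have "c (p (\<Sum>t<m. y t)) s = y s" if "s < m" "\<forall>t<m. y t \<in> A t" for s y
    using that cu p(3) direct_sum_mem[OF ds] by simp
  ultimately show ?thesis using that[of "\<lambda>s x. c (p x) s"] by blast
qed

definition linear_maps :: "'v::euclidean_space set \<Rightarrow> ('v \<Rightarrow> 'v) set" where
  "linear_maps a = {w \<in> a \<rightarrow>\<^sub>E a. \<exists>h. linear h \<and> w = restrict h a}"

lemma product_group_sum:
  assumes ds: "direct_sum a A m" and g: "g \<in> product_group a A m W" and W: "\<forall>s<m. W s \<subseteq> linear_maps (A s)"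
    and y: "\<forall>s<m. y s \<in> A s"
  shows "g (\<Sum>s<m. y s) = (\<Sum>s<m. g (y s))" "s < m \<Longrightarrow> g (y s) \<in> A s" "s < m \<Longrightarrow> restrict g (A s) \<in> W s"
proof -
  obtain h where h: "linear h" "g = restrict h a" "h ` a \<subseteq> a" "\<forall>s<m. restrict h (A s) \<in> W s"
    using g by (auto simp: product_group_def)
  have Aa: "A s \<subseteq> a" if "s < m" for s using ds that by (simp add: direct_sum_def)
  have ya: "y s \<in> a" if "s < m" for s using Aa y that by blast
  have "g (\<Sum>s<m. y s) = h (\<Sum>s<m. y s)" using direct_sum_mem[OF ds y] h(2) by simp
  also have "\<dots> = (\<Sum>s<m. g (y s))" using h(2) ya by (simp add: linear_sum[OF h(1)])
  finally show "g (\<Sum>s<m. y s) = (\<Sum>s<m. g (y s))" .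
  assume s: "s < m"
  have "restrict g (A s) = restrict h (A s)" using Aa[OF s] h(2) by (auto simp: fun_eq_iff)
  then show gW: "restrict g (A s) \<in> W s" using h(4) s by simp
  then have "restrict g (A s) \<in> linear_maps (A s)" using W s by blast
  then have "restrict g (A s) \<in> A s \<rightarrow>\<^sub>E A s" unfolding linear_maps_def by blast
  then have "restrict g (A s) (y s) \<in> A s"
    by (rule PiE_mem) (use y s in blast)
  then show "g (y s) \<in> A s" using y s by simp
qed

lemma product_group_tuple:
  assumes ds: "direct_sum a A m" and W: "\<forall>s<m. W s \<subseteq> linear_maps (A s)"
    and w: "\<forall>s<m. w s \<in> W s"
  shows "\<exists>g\<in>product_group a A m W. \<forall>y. (\<forall>s<m. y s \<in> A s) \<longrightarrow> g (\<Sum>s<m. y s) = (\<Sum>s<m. w s (y s))"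
proof -
  obtain P where P: "\<And>s. s < m \<Longrightarrow> linear (P s)"
    "\<And>s y. s < m \<Longrightarrow> \<forall>t<m. y t \<in> A t \<Longrightarrow> P s (\<Sum>t<m. y t) = y s"
    using direct_sum_projections[OF ds] by metis
  have wl: "w s \<in> A s \<rightarrow>\<^sub>E A s" "\<exists>h. linear h \<and> w s = restrict h (A s)" if "s < m" for s
  proof -
    have "w s \<in> linear_maps (A s)" using W w that by blast
    then show "w s \<in> A s \<rightarrow>\<^sub>E A s" "\<exists>h. linear h \<and> w s = restrict h (A s)" unfolding linear_maps_def by blast+
  qed
  have "\<forall>s\<in>{..<m}. \<exists>h. linear h \<and> w s = restrict h (A s)" using wl(2) by simp
  then obtain h where h: "\<forall>s\<in>{..<m}. linear (h s) \<and> w s = restrict (h s) (A s)" by (rule bchoice[THEN exE])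
  define H where "H x = (\<Sum>s<m. h s (P s x))" for x
  have Hlin: "linear H"
    unfolding H_def[abs_def]
  proof (rule linear_compose_sum, rule ballI)
    fix s assume "s \<in> {..<m}"
    then show "linear (\<lambda>x. h s (P s x))" using linear_compose[of "P s" "h s"] P(1) h by (simp add: comp_def)
  qed
  have Hy: "H (\<Sum>s<m. y s) = (\<Sum>s<m. w s (y s))" if y: "\<forall>s<m. y s \<in> A s" for y
    unfolding H_def using P(2)[OF _ y] h y by (intro sum.cong) auto
  have wA: "w s x \<in> A s" if "s < m" "x \<in> A s" for s x using wl(1)[OF that(1)] that(2) by (rule PiE_mem)
  have "H ` a \<subseteq> a"
  proof
    fix z assume "z \<in> H ` a"
    then obtain x where x: "x \<in> a" "z = H x" by blast
    obtain y where y: "\<forall>s<m. y s \<in> A s" "x = (\<Sum>s<m. y s)" using direct_sum_obtain[OF ds x(1)] .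
    have "(\<Sum>s<m. w s (y s)) \<in> a" using wA y(1) by (intro direct_sum_mem[OF ds]) simp
    then show "z \<in> a" using x(2) y Hy by simp
  qed
  moreover have "restrict H (A s) = w s" if s: "s < m" for s
  proof (rule ext)
    fix x
    show "restrict H (A s) x = w s x"
    proof (cases "x \<in> A s")
      case True
      note e = direct_sum_single[OF ds s True]
      have w0: "w t 0 = 0" if "t < m" for t
        using h that ds by (simp add: direct_sum_def subspace_0 linear_0)
      have "H x = (\<Sum>t<m. w t (if t = s then x else 0))" using Hy[OF e(1)] e(2) by simp
      also have "\<dots> = (\<Sum>t<m. if t = s then w s x else 0)" using w0 by (intro sum.cong) auto
      finally show ?thesis using True s by simp
    next
      case False
      then show ?thesis using wl(1)[OF s] by (auto simp: PiE_def extensional_def)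
    qed
  qed
  ultimately have "restrict H a \<in> product_group a A m W"
    unfolding product_group_def using Hlin w by auto
  moreover have "restrict H a (\<Sum>s<m. y s) = (\<Sum>s<m. w s (y s))" if "\<forall>s<m. y s \<in> A s" for y
    using Hy[OF that] direct_sum_mem[OF ds that] by simp
  ultimately show ?thesis by blast
qed

lemma direct_sum_ext:
  assumes "direct_sum a A m" "f \<in> extensional a" "g \<in> extensional a"
    "\<And>y. \<forall>s<m. y s \<in> A s \<Longrightarrow> f (\<Sum>s<m. y s) = g (\<Sum>s<m. y s)"
  shows "f = g"
proof (rule extensionalityI[OF assms(2,3)])
  fix x assume "x \<in> a"
  then obtain y where "\<forall>s<m. y s \<in> A s" "x = (\<Sum>s<m. y s)" using direct_sum_obtain[OF assms(1)] by metis
  then show "f x = g x" using assms(4) by simp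
qed

lemma product_group_extensional: "g \<in> product_group a A m W \<Longrightarrow> g \<in> extensional a"
  by (auto simp: product_group_def)

locale direct_sum_inclusion =
  fixes a A m b B
  assumes ds_a: "direct_sum a A m" and ds_b: "direct_sum b B m"
    and BA: "s < m \<Longrightarrow> B s \<subseteq> A s"
begin

lemma lift_tuple: "\<forall>s<m. y s \<in> B s \<Longrightarrow> \<forall>s<m. y s \<in> A s"
  using BA by blast

lemma b_a: "b \<subseteq> a"
  using direct_sum_obtain[OF ds_b] direct_sum_mem[OF ds_a] lift_tuple by (metis subsetI)

lemma product_group_restrict_superset:
  assumes W: "\<forall>s<m. W s \<subseteq> linear_maps (A s)" and V: "\<forall>s<m. V s \<subseteq> linear_maps (B s)"
    and sub: "\<And>s. s < m \<Longrightarrow> V s \<subseteq> restrictions (B s) (stabiliser (W s) (B s))"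
  shows "product_group b B m V \<subseteq> restrictions b (stabiliser (product_group a A m W) b)"
proof
  fix g assume g: "g \<in> product_group b B m V"
  note gs = product_group_sum[OF ds_b g V]
  have zero: "\<forall>s<m. 0 \<in> B s" using ds_b by (simp add: direct_sum_def subspace_0)
  have "\<forall>s\<in>{..<m}. \<exists>w. w \<in> W s \<and> w ` B s = B s \<and> restrict w (B s) = restrict g (B s)"
  proof
    fix s assume s: "s \<in> {..<m}"
    have "restrict g (B s) \<in> V s" using gs(3)[of "\<lambda>_. 0"] zero s by simp
    then have "restrict g (B s) \<in> restrictions (B s) (stabiliser (W s) (B s))" using sub[of s] s by blast
    then obtain w where "w \<in> stabiliser (W s) (B s)" "restrict g (B s) = restrict w (B s)"
      unfolding restrictions_def by blast
    then show "\<exists>w. w \<in> W s \<and> w ` B s = B s \<and> restrict w (B s) = restrict g (B s)"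
      by (intro exI[of _ w]) (simp add: stabiliser_def)
  qed
  then obtain w where w: "\<forall>s\<in>{..<m}. w s \<in> W s \<and> w s ` B s = B s \<and> restrict (w s) (B s) = restrict g (B s)"
    by (rule bchoice[THEN exE])
  obtain G where G: "G \<in> product_group a A m W"
    "\<And>y. \<forall>s<m. y s \<in> A s \<Longrightarrow> G (\<Sum>s<m. y s) = (\<Sum>s<m. w s (y s))"
    using product_group_tuple[OF ds_a W, of w] w by (auto simp: Ball_def Bex_def)
  have wg: "w s x = g x" if "s < m" "x \<in> B s" for s x using w that by (metis lessThan_iff restrict_apply')
  have Gy: "G (\<Sum>s<m. y s) = (\<Sum>s<m. w s (y s))" if "\<forall>s<m. y s \<in> B s" for y
    using G(2)[OF lift_tuple[OF that]] .
  have "restrict G b = g"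
  proof (rule direct_sum_ext[OF ds_b])
    show "g \<in> extensional b" using g by (rule product_group_extensional)
    fix y assume y: "\<forall>s<m. y s \<in> B s"
    have "(\<Sum>s<m. w s (y s)) = (\<Sum>s<m. g (y s))" using wg y by (intro sum.cong) auto
    then show "restrict G b (\<Sum>s<m. y s) = g (\<Sum>s<m. y s)"
      using Gy[OF y] gs(1)[OF y] direct_sum_mem[OF ds_b y] by simp
  qed simp
  moreover have "G ` b = b"
  proof
    show "G ` b \<subseteq> b"
    proof
      fix z assume "z \<in> G ` b"
      then obtain x where x: "x \<in> b" "z = G x" by blast
      obtain y where y: "\<forall>s<m. y s \<in> B s" "x = (\<Sum>s<m. y s)" using direct_sum_obtain[OF ds_b x(1)] .
      have "\<forall>s<m. w s (y s) \<in> B s" using w y(1) by (metis image_eqI lessThan_iff)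
      then show "z \<in> b" using direct_sum_mem[OF ds_b] Gy[OF y(1)] x(2) y(2) by simp
    qed
    show "b \<subseteq> G ` b"
    proof
      fix z assume "z \<in> b"
      then obtain y where y: "\<forall>s<m. y s \<in> B s" "z = (\<Sum>s<m. y s)" using direct_sum_obtain[OF ds_b] by metis
      have "\<forall>s\<in>{..<m}. \<exists>x. x \<in> B s \<and> w s x = y s" using w y(1) by (metis image_iff lessThan_iff)
      then obtain u where u: "\<forall>s\<in>{..<m}. u s \<in> B s \<and> w s (u s) = y s" by (rule bchoice[THEN exE])
      then have "\<forall>s<m. u s \<in> B s" by simp
      then have "G (\<Sum>s<m. u s) = z" "(\<Sum>s<m. u s) \<in> b"
        using Gy u y(2) direct_sum_mem[OF ds_b] by simp_all
      then show "z \<in> G ` b" by blast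
    qed
  qed
  ultimately show "g \<in> restrictions b (stabiliser (product_group a A m W) b)"
    using G(1) by (auto simp: restrictions_def stabiliser_def)
qed

text \<open>
  A map that preserves \<open>b\<close> and all summands \<open>A s\<close> preserves the summands
  \<open>B s\<close> of \<open>b\<close>, because components are unique. Its restrictions can then
  be compared in each summand.
\<close>

lemma product_group_restrict:
  assumes W: "\<forall>s<m. W s \<subseteq> linear_maps (A s)" and V: "\<forall>s<m. V s \<subseteq> linear_maps (B s)"
    and eq: "\<And>s. s < m \<Longrightarrow> restrictions (B s) (stabiliser (W s) (B s)) = V s"
  shows "restrictions b (stabiliser (product_group a A m W) b) = product_group b B m V"
proof
  show "restrictions b (stabiliser (product_group a A m W) b) \<subseteq> product_group b B m V"
  proof
    fix g assume "g \<in> restrictions b (stabiliser (product_group a A m W) b)"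
    then obtain G where G: "G \<in> product_group a A m W" "G ` b = b" "g = restrict G b"
      by (auto simp: restrictions_def stabiliser_def)
    obtain h where h: "linear h" "G = restrict h a" using G(1) by (auto simp: product_group_def)
    have gh: "g = restrict h b" using G(3) h(2) b_a by (auto simp: fun_eq_iff)
    have hb: "h ` b \<subseteq> b" using G(2) h(2) b_a by auto
    note Gs = product_group_sum[OF ds_a G(1) W]
    have comp: "\<forall>s<m. G (y s) \<in> B s" if y: "\<forall>s<m. y s \<in> B s" for y
    proof -
      have "G (\<Sum>s<m. y s) \<in> b" using G(2) direct_sum_mem[OF ds_b y] by blast
      then obtain z where z: "\<forall>s<m. z s \<in> B s" "G (\<Sum>s<m. y s) = (\<Sum>s<m. z s)"
        using direct_sum_obtain[OF ds_b] by metis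
      have Gy: "\<forall>s<m. G (y s) \<in> A s" using Gs(2)[OF lift_tuple[OF y]] by blast
      have "G (y s) = z s" if "s < m" for s
        using direct_sum_unique[OF ds_a Gy lift_tuple[OF z(1)] _ that] Gs(1)[OF lift_tuple[OF y]] z(2) by simp
      then show ?thesis using z(1) by simp
    qed
    have "restrict h (B s) \<in> V s" if s: "s < m" for s
    proof -
      have zero: "\<forall>s<m. 0 \<in> A s" using ds_a by (simp add: direct_sum_def subspace_0)
      define w where "w = restrict G (A s)"
      have wW: "w \<in> W s" unfolding w_def using Gs(3)[OF zero s] .
      have Ba: "B s \<subseteq> a" using BA[OF s] ds_a s by (auto simp: direct_sum_def)
      have "w ` B s = B s"
      proof
        show "w ` B s \<subseteq> B s"
        proof
          fix z assume "z \<in> w ` B s"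
          then obtain x where x: "x \<in> B s" "z = w x" by blast
          have "G (if s = s then x else 0) \<in> B s" using comp[OF direct_sum_single(1)[OF ds_b s x(1)]] s by blast
          then show "z \<in> B s" using x BA[OF s] by (auto simp: w_def)
        qed
        show "B s \<subseteq> w ` B s"
        proof
          fix z assume z: "z \<in> B s"
          note e = direct_sum_single[OF ds_b s z]
          have "z \<in> b" using direct_sum_mem[OF ds_b e(1)] e(2) by simp
          then have "z \<in> G ` b" using G(2) by simp
          then obtain x where x: "x \<in> b" "G x = z" by (elim imageE) simp
          obtain y where y: "\<forall>s<m. y s \<in> B s" "x = (\<Sum>s<m. y s)" using direct_sum_obtain[OF ds_b x(1)] .
          have "(\<Sum>t<m. G (y t)) = (\<Sum>t<m. if t = s then z else 0)"
            using Gs(1)[OF lift_tuple[OF y(1)]] x(2) y(2) e(2) by simp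
          from direct_sum_unique[OF ds_b comp[OF y(1)] e(1) this s] have "G (y s) = z" by simp
          then have "w (y s) = z" "y s \<in> B s" using y(1) s BA[OF s] by (auto simp: w_def)
          then show "z \<in> w ` B s" by blast
        qed
      qed
      then have "w \<in> stabiliser (W s) (B s)" using wW by (simp add: stabiliser_def)
      then have "restrict w (B s) \<in> V s" using eq[OF s] unfolding restrictions_def by blast
      moreover have "restrict w (B s) = restrict h (B s)"
        using BA[OF s] Ba h(2) by (auto simp: fun_eq_iff w_def)
      ultimately show ?thesis by simp
    qed
    then show "g \<in> product_group b B m V" unfolding product_group_def using gh h(1) hb by blast
  qed
  show "product_group b B m V \<subseteq> restrictions b (stabiliser (product_group a A m W) b)"
    by (rule product_group_restrict_superset[OF W V]) (use eq in auto)
qed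

text \<open>
  Invariant polynomials are extended one factor at a time: after \<open>s\<close> steps the polynomial is invariant
  under the groups of the first \<open>s\<close> large and the remaining small factors.
\<close>

theorem product_invariants_extend:
  fixes V W :: "nat \<Rightarrow> ('a \<Rightarrow> 'a) set"
  assumes W: "\<forall>s<m. W s \<subseteq> linear_maps (A s)" and V: "\<forall>s<m. V s \<subseteq> linear_maps (B s)"
    and one: "\<And>s. s < m \<Longrightarrow> (\<lambda>x\<in>B s. x) \<in> V s"
    and ext: "\<And>s. s < m \<Longrightarrow> extends_invariants TYPE('c::{real_normed_field, euclidean_space}) (W s) (A s) (V s) (B s)"
  shows "(inv_polys (product_group b B m V) b :: ('a \<Rightarrow> 'c) set) \<subseteq> restrictions b (inv_polys (product_group a A m W) a)"
proof
  fix q0 assume "q0 \<in> (inv_polys (product_group b B m V) b :: ('a \<Rightarrow> 'c) set)"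
  then obtain p0 where p0: "polynomial_function p0" "q0 = restrict p0 b"
    "\<forall>g\<in>product_group b B m V. \<forall>x\<in>b. p0 (g x) = p0 x" by (auto simp: inv_polys_def)
  obtain P where P: "\<And>s. s < m \<Longrightarrow> linear (P s)"
    "\<And>s y. s < m \<Longrightarrow> \<forall>t<m. y t \<in> A t \<Longrightarrow> P s (\<Sum>t<m. y t) = y s"
    using direct_sum_projections[OF ds_a] by metis
  define D where "D s r = (if r < s then A r else B r)" for s r :: nat
  define G where "G s r = (if r < s then W r else V r)" for s r :: nat
  have upd: "(\<Sum>r<m. (y(t := u)) r) = (\<Sum>r<m. y r) - y t + u" if "t < m" for y :: "nat \<Rightarrow> 'a" and t u
  proof -
    have "(\<Sum>r\<in>{..<m} - {t}. (y(t := u)) r) = (\<Sum>r\<in>{..<m} - {t}. y r)" by (rule sum.cong) auto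
    then show ?thesis using that by (simp add: sum.remove[of "{..<m}" t])
  qed
  have "\<exists>q::'a \<Rightarrow> 'c. polynomial_function q \<and>
      (\<forall>y t w. (\<forall>r<m. y r \<in> D s r) \<longrightarrow> t < m \<longrightarrow> w \<in> G s t \<longrightarrow> q (\<Sum>r<m. (y(t := w (y t))) r) = q (\<Sum>r<m. y r)) \<and>
      (\<forall>x\<in>b. q x = p0 x)" if "s \<le> m" for s
    using that
  proof (induction s)
    case 0
    have "p0 (\<Sum>r<m. (y(t := w (y t))) r) = p0 (\<Sum>r<m. y r)"
      if y: "\<forall>r<m. y r \<in> D 0 r" and t: "t < m" and w: "w \<in> G 0 t" for y t w
    proof -
      have yB: "\<forall>r<m. y r \<in> B r" using y by (simp add: D_def)
      have tup: "\<forall>s<m. (if s = t then w else (\<lambda>x\<in>B s. x)) \<in> V s" using w one by (simp add: G_def)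
      obtain g where g: "g \<in> product_group b B m V"
        "\<And>y. \<forall>s<m. y s \<in> B s \<Longrightarrow> g (\<Sum>s<m. y s) = (\<Sum>s<m. (if s = t then w else (\<lambda>x\<in>B s. x)) (y s))"
        using product_group_tuple[OF ds_b V tup] by (elim bexE) blast
      have "g (\<Sum>r<m. y r) = (\<Sum>r<m. (y(t := w (y t))) r)"
        unfolding g(2)[OF yB] using yB by (intro sum.cong) auto
      then show ?thesis using p0(3) g(1) direct_sum_mem[OF ds_b yB] by metis
    qed
    then show ?case using p0(1) by blast
  next
    case (Suc s)
    then have s: "s < m" by simp
    obtain q :: "'a \<Rightarrow> 'c" where q: "polynomial_function q"
      "\<And>y t w. \<forall>r<m. y r \<in> D s r \<Longrightarrow> t < m \<Longrightarrow> w \<in> G s t \<Longrightarrow> q (\<Sum>r<m. (y(t := w (y t))) r) = q (\<Sum>r<m. y r)"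
      "\<And>x. x \<in> b \<Longrightarrow> q x = p0 x" using Suc by auto
    obtain I :: "nat set set" and c L where E0: "finite I \<and> (\<forall>i\<in>I. linear (L i) \<and> L i ` A s \<subseteq> B s) \<and>
      (\<forall>Q::'a \<Rightarrow> 'c. (\<forall>v\<in>V s. \<forall>x\<in>B s. Q (v x) = Q x) \<longrightarrow>
        (\<forall>w\<in>W s. \<forall>x\<in>A s. (\<Sum>i\<in>I. c i *\<^sub>R Q (L i (w x))) = (\<Sum>i\<in>I. c i *\<^sub>R Q (L i x))) \<and>
        (\<forall>x\<in>B s. (\<Sum>i\<in>I. c i *\<^sub>R Q (L i x)) = Q x))"
      using ext[OF s] unfolding extends_invariants_def by (elim exE) (rule that)
    then have E: "finite I" "\<And>i. i \<in> I \<Longrightarrow> linear (L i)" "\<And>i. i \<in> I \<Longrightarrow> L i ` A s \<subseteq> B s"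
      by simp_all
    have E4: "(\<forall>w\<in>W s. \<forall>x\<in>A s. (\<Sum>i\<in>I. c i *\<^sub>R Q (L i (w x))) = (\<Sum>i\<in>I. c i *\<^sub>R Q (L i x))) \<and>
        (\<forall>x\<in>B s. (\<Sum>i\<in>I. c i *\<^sub>R Q (L i x)) = Q x)"
      if "\<forall>v\<in>V s. \<forall>x\<in>B s. Q (v x) = Q x" for Q :: "'a \<Rightarrow> 'c"
      using E0 that by simp
    define q' where "q' z = (\<Sum>i\<in>I. c i *\<^sub>R q (z - P s z + L i (P s z)))" for z
    have poly: "polynomial_function q'"
      unfolding q'_def[abs_def]
    proof (intro polynomial_function_sum polynomial_function_cmul E(1))
      fix i assume i: "i \<in> I"
      have "linear (\<lambda>z. z - P s z + L i (P s z))"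
        using P(1)[OF s] E(2)[OF i] by (intro linearI) (simp_all add: linear_add linear_scale algebra_simps)
      then have "polynomial_function (\<lambda>z. z - P s z + L i (P s z))"
        by (intro polynomial_function_bounded_linear) (simp add: linear_conv_bounded_linear)
      from polynomial_function_compose[OF this q(1)] show "polynomial_function (\<lambda>z. q (z - P s z + L i (P s z)))"
        by (simp add: comp_def)
    qed
    have DA: "D r t \<subseteq> A t" if "t < m" for r t using BA[OF that] by (simp add: D_def)
    have q'y: "q' (\<Sum>r<m. y r) = (\<Sum>i\<in>I. c i *\<^sub>R q (\<Sum>r<m. (y(s := L i (y s))) r))"
      if y: "\<forall>r<m. y r \<in> D (Suc s) r" for y
    proof -
      have "\<forall>r<m. y r \<in> A r" using y DA by blast
      then have "P s (\<Sum>r<m. y r) = y s" by (rule P(2)[OF s])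
      then show ?thesis unfolding q'_def upd[OF s] by simp
    qed
    have DsL: "\<forall>r<m. (y(s := u)) r \<in> D s r" if "\<forall>r<m. y r \<in> D (Suc s) r" "u \<in> B s" for y u
      using that by (auto simp: D_def less_Suc_eq)
    have inv: "\<forall>v\<in>V s. \<forall>u\<in>B s. q (\<Sum>r<m. (y(s := v u)) r) = q (\<Sum>r<m. (y(s := u)) r)"
      if y: "\<forall>r<m. y r \<in> D (Suc s) r" for y
    proof (intro ballI)
      fix v u assume "v \<in> V s" "u \<in> B s"
      moreover have e: "(y(s := u))(s := v ((y(s := u)) s)) = y(s := v u)" by simp
      moreover have "G s s = V s" by (simp add: G_def)
      ultimately show "q (\<Sum>r<m. (y(s := v u)) r) = q (\<Sum>r<m. (y(s := u)) r)"
        using q(2)[OF DsL[OF y], of u s v] s by metis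
    qed
    note Es = E4[OF inv]
    have "q' (\<Sum>r<m. (y(t := w (y t))) r) = q' (\<Sum>r<m. y r)"
      if y: "\<forall>r<m. y r \<in> D (Suc s) r" and t: "t < m" and w: "w \<in> G (Suc s) t" for y t w
    proof -
      have Gl: "G (Suc s) t \<subseteq> linear_maps (D (Suc s) t)" using W V t by (auto simp: G_def D_def)
      have "w (y t) \<in> D (Suc s) t"
      proof -
        have "w \<in> D (Suc s) t \<rightarrow>\<^sub>E D (Suc s) t" using w Gl unfolding linear_maps_def by blast
        then show ?thesis by (rule PiE_mem) (use y t in blast)
      qed
      then have y': "\<forall>r<m. (y(t := w (y t))) r \<in> D (Suc s) r" using y by simp
      have "y s \<in> D (Suc s) s" using y s by blast
      then have ys: "y s \<in> A s" by (simp add: D_def)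
      show ?thesis
      proof (cases "t = s")
        case True
        then have "w \<in> W s" using w by (simp add: G_def)
        then have "(\<Sum>i\<in>I. c i *\<^sub>R q (\<Sum>r<m. (y(s := L i (w (y s)))) r)) =
            (\<Sum>i\<in>I. c i *\<^sub>R q (\<Sum>r<m. (y(s := L i (y s))) r))"
          using Es[OF y] ys by blast
        then show ?thesis unfolding q'y[OF y] q'y[OF y'] using True by simp
      next
        case False
        have "q (\<Sum>r<m. (y(t := w (y t), s := L i ((y(t := w (y t))) s))) r) = q (\<Sum>r<m. (y(s := L i (y s))) r)"
          if i: "i \<in> I" for i
        proof -
          have LB: "L i (y s) \<in> B s" using E(3)[OF i] ys by blast
          have wG: "w \<in> G s t" using w False by (auto simp: G_def less_Suc_eq)
          have e: "y(t := w (y t), s := L i ((y(t := w (y t))) s)) =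
              (y(s := L i (y s)))(t := w ((y(s := L i (y s))) t))"
            using False by (auto simp: fun_eq_iff)
          show ?thesis unfolding e by (rule q(2)[OF DsL[OF y LB] t wG])
        qed
        then show ?thesis unfolding q'y[OF y] q'y[OF y'] by (intro sum.cong) auto
      qed
    qed
    moreover have "q' x = p0 x" if x: "x \<in> b" for x
    proof -
      obtain y where y: "\<forall>s<m. y s \<in> B s" "x = (\<Sum>s<m. y s)" using direct_sum_obtain[OF ds_b x] .
      have yD: "\<forall>r<m. y r \<in> D (Suc s) r" using y(1) BA by (auto simp: D_def)
      have "(\<Sum>i\<in>I. c i *\<^sub>R q (\<Sum>r<m. (y(s := L i (y s))) r)) = q (\<Sum>r<m. (y(s := y s)) r)"
        using Es[OF yD] y(1) s by blast
      then show ?thesis using q'y[OF yD] q(3)[OF x] y(2) by simp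
    qed
    ultimately show ?case using poly by blast
  qed
  from this[of m] obtain q :: "'a \<Rightarrow> 'c" where q: "polynomial_function q"
    "\<And>y t w. \<forall>r<m. y r \<in> A r \<Longrightarrow> t < m \<Longrightarrow> w \<in> W t \<Longrightarrow> q (\<Sum>r<m. (y(t := w (y t))) r) = q (\<Sum>r<m. y r)"
    "\<And>x. x \<in> b \<Longrightarrow> q x = p0 x" by (auto simp: D_def G_def)
  have "q (g x) = q x" if g: "g \<in> product_group a A m W" and x: "x \<in> a" for g x
  proof -
    obtain y where y: "\<forall>s<m. y s \<in> A s" "x = (\<Sum>s<m. y s)" using direct_sum_obtain[OF ds_a x] .
    note gs = product_group_sum[OF ds_a g W y(1)]
    define z where "z n r = (if r < n then g (y r) else y r)" for n r :: nat
    have "q (\<Sum>r<m. z n r) = q x" if "n \<le> m" for n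
      using that
    proof (induction n)
      case 0
      then show ?case using y(2) by (simp add: z_def)
    next
      case (Suc n)
      then have n: "n < m" by simp
      have zA: "\<forall>r<m. z n r \<in> A r" using gs(2) y(1) by (simp add: z_def)
      have "z (Suc n) = (z n)(n := restrict g (A n) (z n n))"
        using y(1) n by (auto simp: fun_eq_iff z_def less_Suc_eq)
      then have "q (\<Sum>r<m. z (Suc n) r) = q (\<Sum>r<m. z n r)" using q(2)[OF zA n gs(3)[OF n]] by simp
      then show ?case using Suc by simp
    qed
    from this[of m] have "q (\<Sum>r<m. z m r) = q x" by simp
    moreover have "(\<Sum>r<m. z m r) = g x" unfolding y(2) gs(1) by (intro sum.cong) (auto simp: z_def)
    ultimately show ?thesis by simp
  qed
  then have "restrict q a \<in> inv_polys (product_group a A m W) a"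
    unfolding inv_polys_def using q(1) by blast
  moreover have "restrict (restrict q a) b = q0"
    using p0(2) q(3) b_a by (auto simp: fun_eq_iff)
  ultimately show "q0 \<in> restrictions b (inv_polys (product_group a A m W) a)"
    unfolding restrictions_def by (metis image_eqI)
qed

end

lemma inv_polys_restrict:
  assumes "V \<subseteq> restrictions b (stabiliser W b)" "b \<subseteq> a"
  shows "restrictions b (inv_polys W a) \<subseteq> inv_polys V b"
proof
  fix q assume "q \<in> restrictions b (inv_polys W a)"
  then obtain p where p: "polynomial_function p" "\<forall>w\<in>W. \<forall>x\<in>a. p (w x) = p x" "q = restrict (restrict p a) b"
    by (auto simp: restrictions_def inv_polys_def)
  have "p (v x) = p x" if v: "v \<in> V" and x: "x \<in> b" for v x
  proof -
    obtain w where w: "w \<in> W" "v = restrict w b" using assms(1) v by (auto simp: restrictions_def stabiliser_def)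
    then show ?thesis using p(2) assms(2) x by auto
  qed
  moreover have "q = restrict p b" using p(3) assms(2) by (auto simp: fun_eq_iff)
  ultimately show "q \<in> inv_polys V b" unfolding inv_polys_def using p(1) by blast
qed

section \<open>The irreducible factors\<close>

lemma direct_sum_of_dim:
  fixes V :: "nat \<Rightarrow> 'v::euclidean_space set"
  assumes sub: "\<And>s. s < n \<Longrightarrow> subspace (V s)"
    and g: "span (\<Union>s<n. V s) = g" and dim: "dim g = (\<Sum>s<n. dim (V s))"
  shows "direct_sum g V n"
proof -
  define U where "U k = {\<Sum>s<k. y s | y. \<forall>s<k. y s \<in> V s}" for k
  have subU: "subspace (U k)" if "k \<le> n" for k
  proof (rule subspaceI)
    show "0 \<in> U k" unfolding U_def using subspace_0[OF sub] that by (intro CollectI exI[of _ "\<lambda>_. 0"]) simp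
    fix x y c assume "x \<in> U k" "y \<in> U k"
    then obtain u v where u: "\<forall>s<k. u s \<in> V s" "x = (\<Sum>s<k. u s)" and v: "\<forall>s<k. v s \<in> V s" "y = (\<Sum>s<k. v s)"
      by (auto simp: U_def)
    have "\<forall>s<k. u s + v s \<in> V s" "\<forall>s<k. c *\<^sub>R u s \<in> V s"
      using u(1) v(1) sub that by (simp_all add: subspace_add subspace_scale)
    moreover have "x + y = (\<Sum>s<k. u s + v s)" "c *\<^sub>R x = (\<Sum>s<k. c *\<^sub>R u s)"
      using u(2) v(2) by (simp_all add: sum.distrib scaleR_sum_right)
    ultimately show "x + y \<in> U k" "c *\<^sub>R x \<in> U k" unfolding U_def by blast+
  qed
  have US: "U (Suc k) = {x + y | x y. x \<in> U k \<and> y \<in> V k}" for k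
  proof
    show "U (Suc k) \<subseteq> {x + y | x y. x \<in> U k \<and> y \<in> V k}"
    proof
      fix z assume "z \<in> U (Suc k)"
      then obtain u where u: "\<forall>s<Suc k. u s \<in> V s" "z = (\<Sum>s<Suc k. u s)" by (auto simp: U_def)
      then have "(\<Sum>s<k. u s) \<in> U k" "u k \<in> V k" "z = (\<Sum>s<k. u s) + u k" by (auto simp: U_def)
      then show "z \<in> {x + y | x y. x \<in> U k \<and> y \<in> V k}" by blast
    qed
    show "{x + y | x y. x \<in> U k \<and> y \<in> V k} \<subseteq> U (Suc k)"
    proof
      fix z assume "z \<in> {x + y | x y. x \<in> U k \<and> y \<in> V k}"
      then obtain u y where u: "\<forall>s<k. u s \<in> V s" "y \<in> V k" "z = (\<Sum>s<k. u s) + y" by (auto simp: U_def)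
      have "(\<Sum>s<Suc k. (u(k := y)) s) = (\<Sum>s<k. u s) + y" by simp
      moreover have "\<forall>s<Suc k. (u(k := y)) s \<in> V s" using u by (simp add: less_Suc_eq)
      ultimately show "z \<in> U (Suc k)" unfolding U_def using u(3) by (intro CollectI exI[of _ "u(k := y)"]) simp
    qed
  qed
  have dimU: "dim (U (Suc k)) + dim (U k \<inter> V k) = dim (U k) + dim (V k)" if "k < n" for k
    unfolding US by (rule dim_sums_Int) (use subU sub that in auto)
  have le: "dim (U k) \<le> (\<Sum>s<k. dim (V s))" if "k \<le> n" for k
    using that
  proof (induction k)
    case 0
    then show ?case by (simp add: U_def)
  next
    case (Suc k)
    then show ?case using dimU[of k] by simp
  qed
  have ind: "dim (U k) = (\<Sum>s<k. dim (V s)) \<Longrightarrow> (\<forall>s<k. y s \<in> V s) \<Longrightarrow> (\<Sum>s<k. y s) = 0 \<Longrightarrow> \<forall>s<k. y s = 0"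
    if "k \<le> n" for k y
    using that
  proof (induction k)
    case (Suc k)
    then have k: "k < n" by simp
    have d: "dim (U k \<inter> V k) = 0" "dim (U k) = (\<Sum>s<k. dim (V s))"
      using dimU[OF k] le[of k] Suc.prems(1) k by (simp_all del: dim_eq_0)
    then have "U k \<inter> V k \<subseteq> {0}" by (simp add: dim_eq_0)
    moreover have "(\<Sum>s<k. y s) \<in> U k" using Suc.prems(2) by (auto simp: U_def)
    moreover have "(\<Sum>s<k. y s) = - y k" using Suc.prems(3) by (simp add: add_eq_0_iff2)
    then have "(\<Sum>s<k. y s) \<in> V k" using Suc.prems(2) sub[OF k] by (simp add: subspace_neg)
    ultimately have z: "(\<Sum>s<k. y s) = 0" by blast
    then have "y k = 0" using Suc.prems(3) by simp
    moreover have "\<forall>s<k. y s = 0" using Suc.IH[OF d(2) _ z] Suc.prems(2) k by simp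
    ultimately show ?case by (simp add: less_Suc_eq)
  qed simp
  have VU: "V s \<subseteq> U n" if s: "s < n" for s
  proof
    fix x assume x: "x \<in> V s"
    have "\<forall>t<n. (if t = s then x else 0) \<in> V t" using x sub subspace_0 by auto
    moreover have "(\<Sum>t<n. if t = s then x else 0) = x" using s by simp
    ultimately show "x \<in> U n" unfolding U_def
      by (intro CollectI exI[of _ "\<lambda>t. if t = s then x else 0"]) simp
  qed
  have "g = U n"
  proof
    show "g \<subseteq> U n" unfolding g[symmetric] using VU subU by (intro span_minimal) auto
    show "U n \<subseteq> g"
    proof
      fix x assume "x \<in> U n"
      then obtain y where y: "\<forall>s<n. y s \<in> V s" "x = (\<Sum>s<n. y s)" by (auto simp: U_def)
      have "y s \<in> span (\<Union>s<n. V s)" if "s < n" for s by (rule span_base) (use y(1) that in blast)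
      then show "x \<in> g" unfolding g[symmetric] y(2) by (intro span_sum) simp
    qed
  qed
  then show ?thesis
    unfolding direct_sum_def using subU[of n] sub VU ind[of n] dim
    by (auto simp: U_def)
qed

text \<open>
  For noncompact type both members of the pair are root vectors for \<open>\<alpha>\<close>. This
  form lets both types be treated by the same computation.
\<close>

lemma restricted_roots_alt:
  "\<alpha> \<in> restricted_roots M a \<longleftrightarrow> \<alpha> \<in> functionals a \<and> (\<exists>H\<in>a. \<alpha> H \<noteq> 0) \<and>
    (\<exists>X\<in>lalg M. \<exists>Y\<in>lalg M. (X, Y) \<noteq> (0, 0) \<and>
      (\<forall>H\<in>a. lbracket M H X = \<alpha> H *\<^sub>R (if compact_type M then - Y else X) \<and>
               lbracket M H Y = \<alpha> H *\<^sub>R (if compact_type M then X else Y)))"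
proof (cases "compact_type M")
  case True
  then show ?thesis by (simp add: restricted_roots_def)
next
  case False
  have "(\<exists>X\<in>lalg M. X \<noteq> 0 \<and> (\<forall>H\<in>a. lbracket M H X = \<alpha> H *\<^sub>R X)) \<longleftrightarrow>
    (\<exists>X\<in>lalg M. \<exists>Y\<in>lalg M. (X, Y) \<noteq> (0, 0) \<and> (\<forall>H\<in>a. lbracket M H X = \<alpha> H *\<^sub>R X \<and> lbracket M H Y = \<alpha> H *\<^sub>R Y))"
    by auto
  then show ?thesis using False by (simp add: restricted_roots_def)
qed

text \<open>The data of a decomposition into irreducible factors that matter for Weyl groups.\<close>

definition root_decomposition ::
  "('x, 'v::euclidean_space) symm_space \<Rightarrow> 'v set \<Rightarrow> ('x, 'v) symm_space list \<Rightarrow> bool" where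
  "root_decomposition M a Fs \<longleftrightarrow>
     has_root_system M a \<and>
     direct_sum a (\<lambda>s. a \<inter> lalg (Fs ! s)) (length Fs) \<and>
     (\<forall>s<length Fs. has_root_system (Fs ! s) (a \<inter> lalg (Fs ! s)) \<and> a \<inter> lalg (Fs ! s) \<noteq> {0}) \<and>
     (\<forall>\<alpha>\<in>restricted_roots M a. \<exists>s<length Fs. \<exists>\<beta>\<in>restricted_roots (Fs ! s) (a \<inter> lalg (Fs ! s)).
        \<forall>y. (\<forall>t<length Fs. y t \<in> a \<inter> lalg (Fs ! t)) \<longrightarrow> \<alpha> (\<Sum>t<length Fs. y t) = \<beta> (y s)) \<and>
     (\<forall>s<length Fs. \<forall>\<beta>\<in>restricted_roots (Fs ! s) (a \<inter> lalg (Fs ! s)). \<exists>\<alpha>\<in>restricted_roots M a.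
        \<forall>y. (\<forall>t<length Fs. y t \<in> a \<inter> lalg (Fs ! t)) \<longrightarrow> \<alpha> (\<Sum>t<length Fs. y t) = \<beta> (y s))"

lemma maximal_abelian_nonzero:
  assumes "maximal_abelian M a" "spart M \<noteq> {0}" "0 \<in> spart M" "\<And>X. X \<in> spart M \<Longrightarrow> lbracket M 0 X = 0"
  shows "a \<noteq> {0}"
proof
  assume "a = {0}"
  then have "X \<in> a" if "X \<in> spart M" for X
    using assms(1,4) that by (auto simp: maximal_abelian_def)
  then show False using assms(2,3) \<open>a = {0}\<close> by blast
qed

text \<open>
  Different ideals of the decomposition commute. By maximality, the components of an element of
  \<open>a\<close> are again in \<open>a\<close>, and the component in the ideal contained in
  \<open>k\<close> vanishes. A root vector has a nonzero component in some factor; only the part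
  of \<open>a\<close> in this factor acts on it, so the root vanishes on the other parts.
\<close>

theorem irreducible_factors_root_decomposition:
  fixes M :: "('x, 'v::euclidean_space) symm_space"
  assumes M: "symmetric_space M" and type: "compact_type M \<or> noncompact_type M"
    and a: "maximal_abelian M a" and Fs: "irreducible_factors M Fs"
  shows "root_decomposition M a Fs"
proof -
  have hrs: "has_root_system S b"
    if "symmetric_space S" "compact_type S \<or> noncompact_type S" "maximal_abelian S b" for S :: "('x, 'v) symm_space" and b
    using restricted_root_system[OF that] unfolding has_root_system_def by blast
  obtain br th where alg: "involutive_lie_algebra (lalg M) br th \<and> (\<forall>X\<in>lalg M. th X = theta M X) \<and>
    (\<forall>X\<in>lalg M. \<forall>Y\<in>lalg M. br X Y = lbracket M X Y)"
    using symmetric_space_algebra[OF M] by (elim exE) (rule that)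
  then interpret L: involutive_lie_algebra "lalg M" br th by blast
  have thM: "theta M X = th X" if "X \<in> lalg M" for X using alg that by simp
  have brM: "lbracket M X Y = br X Y" if "X \<in> lalg M" "Y \<in> lalg M" for X Y using alg that by simp
  have sp: "subspace (lalg M)" by (rule L.subspace_g)
  have a': "subspace a" "a \<subseteq> spart M" "\<forall>H\<in>a. \<forall>H'\<in>a. lbracket M H H' = 0"
    "\<And>X. X \<in> spart M \<Longrightarrow> (\<forall>H\<in>a. lbracket M H X = 0) \<Longrightarrow> X \<in> a"
    using a by (auto simp: maximal_abelian_def)
  have ag: "H \<in> lalg M" if "H \<in> a" for H using a'(2) that by (auto simp: spart_def)
  have zero_s: "0 \<in> spart M" using subspace_0[OF sp] thM[OF subspace_0[OF sp]] by (simp add: spart_def L.th_simps)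
  have zero_br: "lbracket M 0 X = 0" if "X \<in> lalg M" for X
    using brM[OF subspace_0[OF sp] that] by (simp add: L.br_simps)
  consider (one) "irreducible_space M" "Fs = [M]" | (many) "universal_cover_factors M Fs"
    using Fs unfolding irreducible_factors_def by blast
  then show ?thesis
  proof cases
    case one
    have al: "a \<inter> lalg M = a" using ag by blast
    have "spart M \<noteq> {0}" using one(1) by (simp add: irreducible_space_def)
    then have "a \<noteq> {0}"
      using maximal_abelian_nonzero[OF a _ zero_s] zero_br by (auto simp: spart_def)
    moreover have "direct_sum a (\<lambda>s. a \<inter> lalg (Fs ! s)) (length Fs)"
      using a'(1) one(2) al by (auto simp: direct_sum_def)
    ultimately show ?thesis
      using hrs[OF M type a] one(2) al unfolding root_decomposition_def by (auto simp: lessThan_Suc)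
  next
    case many
    define m where "m = length Fs"
    define S where "S s = Fs ! s" for s
    define g where "g s = lalg (S s)" for s
    have Sset: "S s \<in> set Fs" if "s < m" for s using that by (simp add: S_def m_def)
    have F: "symmetric_space (S s)" "irreducible_space (S s)" "lie_ideal M (g s)"
        "X \<in> g s \<Longrightarrow> Y \<in> g s \<Longrightarrow> lbracket (S s) X Y = lbracket M X Y"
        "X \<in> g s \<Longrightarrow> theta (S s) X = theta M X"
      if "s < m" for s X Y
      using many Sset[OF that] unfolding universal_cover_factors_def g_def by blast+
    obtain I where I: "lie_ideal M I" "I \<subseteq> kpart M" "span (I \<union> (\<Union>T\<in>set Fs. lalg T)) = lalg M"
      "dim (lalg M) = dim I + (\<Sum>s<m. dim (g s))"
      using many unfolding universal_cover_factors_def m_def g_def S_def by blast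
    define V where "V s = (if s < m then g s else I)" for s
    have Vid: "lie_ideal M (V s)" for s using F(3) I(1) by (simp add: V_def)
    have ds: "direct_sum (lalg M) V (Suc m)"
    proof (rule direct_sum_of_dim)
      show "subspace (V s)" for s using Vid by (simp add: lie_ideal_def)
      have "(\<Union>T\<in>set Fs. lalg T) = (\<Union>s<m. g s)"
        unfolding g_def S_def m_def set_conv_nth by blast
      moreover have "(\<Union>s<Suc m. V s) = I \<union> (\<Union>s<m. g s)" by (auto simp: V_def lessThan_Suc)
      ultimately show "span (\<Union>s<Suc m. V s) = lalg M" using I(3) by simp
      show "dim (lalg M) = (\<Sum>s<Suc m. dim (V s))" using I(4) by (simp add: V_def)
    qed
    have Vg: "X \<in> lalg M" if "X \<in> V s" for X s using Vid[of s] that by (auto simp: lie_ideal_def)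
    have V0: "subspace (V s)" for s using Vid[of s] by (simp add: lie_ideal_def)
    have brV: "br X Y \<in> V s" "br Y X \<in> V s" if "X \<in> lalg M" "Y \<in> V s" for X Y s
    proof -
      have "lbracket M X Y \<in> V s" using Vid[of s] that unfolding lie_ideal_def by blast
      then show *: "br X Y \<in> V s" unfolding brM[OF that(1) Vg[OF that(2)]] .
      show "br Y X \<in> V s" using subspace_neg[OF V0 *] L.br_skew[of X Y] by simp
    qed
    have brVV: "br X Y = 0" if "X \<in> V s" "Y \<in> V t" "s \<noteq> t" "s < Suc m" "t < Suc m" for X Y s t
    proof -
      have "br X Y \<in> V s" "br X Y \<in> V t" using brV Vg that(1,2) by blast+
      then have "\<forall>r<Suc m. (if r = s then br X Y else 0) \<in> V r" "\<forall>r<Suc m. (if r = t then br X Y else 0) \<in> V r"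
        using V0 subspace_0 by auto
      moreover have "(\<Sum>r<Suc m. if r = s then br X Y else 0) = (\<Sum>r<Suc m. if r = t then br X Y else 0)"
        using that(4,5) by (simp del: sum.lessThan_Suc)
      ultimately have "(if s = s then br X Y else 0) = (if s = t then br X Y else 0)"
        by (rule direct_sum_unique[OF ds _ _ _ that(4)])
      then show ?thesis using that(3) by simp
    qed
    have thV: "th X \<in> V s" if "X \<in> V s" "s < Suc m" for X s
    proof (cases "s < m")
      case True
      then have X: "X \<in> g s" using that by (simp add: V_def)
      have "theta (S s) X \<in> g s" using F(1)[OF True] X by (simp add: symmetric_space_def g_def)
      then show ?thesis using F(5)[OF True X] thM[OF Vg[OF that(1)]] True by (simp add: V_def)
    next
      case False
      then have "X \<in> I" using that by (simp add: V_def)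
      then show ?thesis using I(2) thM[OF Vg[OF that(1)]] that(1) by (auto simp: kpart_def)
    qed
    have Sk: "theta M X = X" if "X \<in> I" for X using that I(2) by (auto simp: kpart_def)
    have gV: "g s = V s" if "s < m" for s using that by (simp add: V_def)
    have spS: "spart (S s) = spart M \<inter> g s" if "s < m" for s
      using F(5)[OF that] Vg gV[OF that] by (auto simp: spart_def g_def)
    \<comment> \<open>the components of an element of the flat subspace lie in the flat subspace\<close>
    have comp: "\<exists>y. (\<forall>s<m. y s \<in> a \<inter> g s) \<and> H = (\<Sum>s<m. y s)" if H: "H \<in> a" for H
    proof -
      obtain y where y: "\<forall>s<Suc m. y s \<in> V s" "H = (\<Sum>s<Suc m. y s)"
        using direct_sum_obtain[OF ds ag[OF H]] .
      have yg: "y s \<in> lalg M" if "s < Suc m" for s using y(1) Vg that by blast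
      have thy: "th (y s) = - y s" if s: "s < Suc m" for s
      proof (rule direct_sum_unique[OF ds _ _ _ s])
        show "\<forall>s<Suc m. th (y s) \<in> V s" using y(1) thV by blast
        show "\<forall>s<Suc m. - y s \<in> V s" using y(1) V0 subspace_neg by blast
        have "th H = - H" using H a'(2) thM[OF ag[OF H]] by (auto simp: spart_def)
        then show "(\<Sum>s<Suc m. th (y s)) = (\<Sum>s<Suc m. - y s)"
          unfolding y(2) by (simp only: linear_sum[OF L.linear_th] sum_negf)
      qed
      have ym: "y m = 0"
      proof -
        have "y m \<in> V m" using y(1) by blast
        then have "y m \<in> I" by (simp add: V_def)
        then have "th (y m) = y m" using Sk thM[OF yg[of m]] by simp
        then have "y m = - y m" using thy[of m] by simp
        then have "2 *\<^sub>R y m = 0" by (metis add.left_inverse scaleR_2)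
        then show ?thesis by simp
      qed
      have "y s \<in> a" if s: "s < m" for s
      proof (rule a'(4))
        have s': "s < Suc m" using s by simp
        show "y s \<in> spart M" using thy[OF s'] yg[OF s'] thM by (simp add: spart_def)
        show "\<forall>H'\<in>a. lbracket M H' (y s) = 0"
        proof
          fix H' assume H': "H' \<in> a"
          have "br H' H = 0" using a'(3) H H' brM[OF ag[OF H'] ag[OF H]] by simp
          then have "(\<Sum>t<Suc m. br H' (y t)) = (\<Sum>t<Suc m. 0)"
            unfolding y(2) by (simp only: linear_sum[OF L.linear_ad] sum.neutral_const)
          moreover have "\<forall>t<Suc m. br H' (y t) \<in> V t" using brV(1)[OF ag[OF H']] y(1) by blast
          moreover have "\<forall>t<Suc m. (\<lambda>_. 0) t \<in> V t" using V0 subspace_0 by blast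
          ultimately have "br H' (y s) = 0"
            using direct_sum_unique[where y = "\<lambda>t. br H' (y t)" and z = "\<lambda>_. 0", OF ds _ _ _ s'] by blast
          then show "lbracket M H' (y s) = 0" using brM[OF ag[OF H'] yg[OF s']] by simp
        qed
      qed
      moreover have "y s \<in> g s" if "s < m" for s using y(1) gV[OF that] that by simp
      moreover have "H = (\<Sum>s<m. y s)" using y(2) ym by simp
      ultimately show ?thesis by (intro exI[of _ y]) auto
    qed
    have dsa: "direct_sum a (\<lambda>s. a \<inter> g s) m"
      unfolding direct_sum_def
    proof (intro conjI allI impI ballI)
      show "subspace a" by (rule a'(1))
      show "subspace (a \<inter> g s)" if "s < m" for s using subspace_inter[OF a'(1) V0[of s]] gV[OF that] by simp
      show "\<exists>y. (\<forall>s<m. y s \<in> a \<inter> g s) \<and> x = (\<Sum>s<m. y s)" if "x \<in> a" for x using comp[OF that] .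
      fix y s assume y: "(\<forall>s<m. y s \<in> a \<inter> g s) \<and> (\<Sum>s<m. y s) = 0" and s: "s < m"
      define z where "z t = (if t < m then y t else 0)" for t
      have "z t \<in> V t" for t using y subspace_0[OF V0[of t]] gV[of t] by (cases "t < m") (auto simp: z_def)
      then have "\<forall>t<Suc m. z t \<in> V t" by blast
      moreover have "(\<Sum>t<Suc m. z t) = 0" using y by (simp add: z_def)
      ultimately have "\<forall>t<Suc m. z t = 0" using ds unfolding direct_sum_def by blast
      then have "z s = 0" using s by (meson less_SucI)
      then show "y s = 0" using s by (simp add: z_def)
    qed auto
    \<comment> \<open>on a root vector in a factor only the component in that factor acts\<close>
    have brsum: "br (\<Sum>t<m. y t) X = br (y s) X"
      if y: "\<forall>t<m. y t \<in> a \<inter> g t" and X: "X \<in> V s" and s: "s < m" for y X s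
    proof -
      have "br (\<Sum>t<m. y t) X = (\<Sum>t<m. br (y t) X)"
        using linear_sum[of "\<lambda>Z. br Z X"] L.bilinear_br by (simp add: bilinear_def)
      also have "\<dots> = (\<Sum>t<m. if t = s then br (y s) X else 0)"
      proof (intro sum.cong refl)
        fix t assume t: "t \<in> {..<m}"
        then have "y t \<in> V t" using y gV[of t] t by blast
        then show "br (y t) X = (if t = s then br (y s) X else 0)" using brVV[of "y t" t X s] X s t by simp
      qed
      finally show ?thesis using s by simp
    qed
    have brsumI: "br (\<Sum>t<m. y t) X = 0" if y: "\<forall>t<m. y t \<in> a \<inter> g t" and X: "X \<in> V m" for y X
    proof -
      have "br (\<Sum>t<m. y t) X = (\<Sum>t<m. br (y t) X)"
        using linear_sum[of "\<lambda>Z. br Z X"] L.bilinear_br by (simp add: bilinear_def)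
      also have "\<dots> = 0"
      proof (intro sum.neutral ballI)
        fix t assume t: "t \<in> {..<m}"
        then have "y t \<in> V t" using y gV[of t] t by blast
        then show "br (y t) X = 0" using brVV[of "y t" t X m] X t by simp
      qed
      finally show ?thesis .
    qed
    have maxS: "maximal_abelian (S s) (a \<inter> g s)" if s: "s < m" for s
      unfolding maximal_abelian_def
    proof (intro conjI ballI impI)
      show "subspace (a \<inter> g s)" using dsa s by (simp add: direct_sum_def)
      show "a \<inter> g s \<subseteq> spart (S s)" using a'(2) spS[OF s] by blast
      show "lbracket (S s) H H' = 0" if "H \<in> a \<inter> g s" "H' \<in> a \<inter> g s" for H H'
        using that F(4)[OF s] a'(3) by simp
      fix X assume X: "X \<in> spart (S s)" and X0: "\<forall>H\<in>a \<inter> g s. lbracket (S s) H X = 0"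
      have Xs: "X \<in> spart M" "X \<in> g s" using X spS[OF s] by auto
      have "lbracket M H X = 0" if H: "H \<in> a" for H
      proof -
        obtain y where y: "\<forall>s<m. y s \<in> a \<inter> g s" "H = (\<Sum>s<m. y s)" using comp[OF H] by blast
        have XV: "X \<in> V s" using Xs(2) gV[OF s] by simp
        have "br H X = br (y s) X" unfolding y(2) by (rule brsum[OF y(1) XV s])
        also have "\<dots> = lbracket (S s) (y s) X"
          using y(1) s F(4)[OF s _ Xs(2)] brM[OF ag Vg[OF XV]] by simp
        also have "\<dots> = 0" using X0 y(1) s by blast
        finally show ?thesis using brM[OF ag[OF H] Vg[OF XV]] by simp
      qed
      then show "X \<in> a \<inter> g s" using a'(4)[OF Xs(1)] Xs(2) by blast
    qed
    have kil: "killing (S s) X Y = killing M X Y" if s: "s < m" and X: "X \<in> g s" and Y: "Y \<in> g s" for s X Y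
    proof -
      have XV: "X \<in> V s" "Y \<in> V s" using X Y gV[OF s] by simp_all
      have "killing M X Y = trace_on (lalg M) (\<lambda>Z. br X (br Y Z))"
        unfolding killing_def using Vg XV L.br_closed by (intro trace_on_cong[OF sp]) (simp add: brM)
      also have "\<dots> = trace_on (g s) (\<lambda>Z. br X (br Y Z))"
      proof (rule trace_on_subspace[OF sp])
        show "subspace (g s)" using V0[of s] gV[OF s] by simp
        show "g s \<subseteq> lalg M" using Vg gV[OF s] by blast
        show "linear (\<lambda>Z. br X (br Y Z))" by (rule L.linear_ad2)
        show "(\<lambda>Z. br X (br Y Z)) ` lalg M \<subseteq> g s" using brV(2)[OF L.br_closed XV(1)] gV[OF s] by auto
      qed
      also have "\<dots> = killing (S s) X Y"
        unfolding killing_def g_def[symmetric]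
      proof (rule trace_on_cong)
        show "subspace (g s)" using V0[of s] gV[OF s] by simp
        fix Z assume Z: "Z \<in> g s"
        have 1: "lbracket (S s) Y Z = br Y Z" using F(4)[OF s Y Z] brM Vg XV(2) Z gV[OF s] by simp
        have "br Y Z \<in> g s" using brV(1)[of Y Z s] Vg[OF XV(2)] Z gV[OF s] by simp
        then show "br X (br Y Z) = lbracket (S s) X (lbracket (S s) Y Z)"
          using F(4)[OF s X] brM[OF Vg[OF XV(1)] L.br_closed] 1 by simp
      qed
      finally show ?thesis by simp
    qed
    have typeS: "compact_type (S s) \<longleftrightarrow> compact_type M" "compact_type (S s) \<or> noncompact_type (S s)" if s: "s < m" for s
    proof -
      have gM: "g s \<subseteq> lalg M" using Vg gV[OF s] by blast
      have c: "compact_type (S s)" if "compact_type M"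
        using that kil[OF s] gM unfolding compact_type_def g_def[symmetric] by auto
      have n: "noncompact_type (S s)" if "noncompact_type M"
      proof -
        have "X \<in> kpart M \<and> X \<in> g s" if "X \<in> kpart (S s)" for X
          using that F(5)[OF s] gM unfolding kpart_def g_def[symmetric] by auto
        moreover have "X \<in> spart M \<and> X \<in> g s" if "X \<in> spart (S s)" for X using that spS[OF s] by auto
        ultimately show ?thesis
          using \<open>noncompact_type M\<close> kil[OF s] unfolding noncompact_type_def by metis
      qed
      have nc: "\<not> compact_type (S s)" if "noncompact_type (S s)"
      proof
        assume "compact_type (S s)"
        moreover have "0 \<in> spart (S s)" using spS[OF s] zero_s V0[of s] subspace_0 gV[OF s] by auto
        then obtain X where X: "X \<in> spart (S s)" "X \<noteq> 0"
          using F(2)[OF s] unfolding irreducible_space_def by blast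
        moreover have "X \<in> lalg (S s)" using X(1) by (simp add: spart_def)
        ultimately show False using that unfolding compact_type_def noncompact_type_def by force
      qed
      show "compact_type (S s) \<longleftrightarrow> compact_type M" "compact_type (S s) \<or> noncompact_type (S s)"
        using c n nc type by blast+
    qed
    have ne: "a \<inter> g s \<noteq> {0}" if s: "s < m" for s
    proof (rule maximal_abelian_nonzero[OF maxS[OF s]])
      show "spart (S s) \<noteq> {0}" using F(2)[OF s] by (simp add: irreducible_space_def)
      have 0: "0 \<in> g s" using V0[of s] subspace_0 gV[OF s] by auto
      show "0 \<in> spart (S s)" using spS[OF s] zero_s 0 by auto
      show "lbracket (S s) 0 X = 0" if "X \<in> spart (S s)" for X
        using that spS[OF s] F(4)[OF s 0] zero_br by (force simp: spart_def)
    qed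
    obtain P where P: "\<And>s. s < m \<Longrightarrow> linear (P s)"
      "\<And>s y. s < m \<Longrightarrow> \<forall>t<m. y t \<in> a \<inter> g t \<Longrightarrow> P s (\<Sum>t<m. y t) = y s"
      using direct_sum_projections[OF dsa] by metis
    have rootsA: "\<exists>s<m. \<exists>\<beta>\<in>restricted_roots (S s) (a \<inter> g s).
        \<forall>y. (\<forall>t<m. y t \<in> a \<inter> g t) \<longrightarrow> \<alpha> (\<Sum>t<m. y t) = \<beta> (y s)" if \<alpha>: "\<alpha> \<in> restricted_roots M a" for \<alpha>
    proof -
      obtain X Y where XY: "X \<in> lalg M" "Y \<in> lalg M" "(X, Y) \<noteq> (0, 0)"
        "\<And>H. H \<in> a \<Longrightarrow> lbracket M H X = \<alpha> H *\<^sub>R (if compact_type M then - Y else X)"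
        "\<And>H. H \<in> a \<Longrightarrow> lbracket M H Y = \<alpha> H *\<^sub>R (if compact_type M then X else Y)"
        and \<alpha>f: "\<alpha> \<in> functionals a" and \<alpha>n: "\<exists>H\<in>a. \<alpha> H \<noteq> 0"
        using \<alpha> unfolding restricted_roots_alt by blast
      obtain x where x: "\<forall>s<Suc m. x s \<in> V s" "X = (\<Sum>s<Suc m. x s)" using direct_sum_obtain[OF ds XY(1)] .
      obtain y where y: "\<forall>s<Suc m. y s \<in> V s" "Y = (\<Sum>s<Suc m. y s)" using direct_sum_obtain[OF ds XY(2)] .
      have cs: "br H (x s) = \<alpha> H *\<^sub>R (if compact_type M then - y s else x s)"
        "br H (y s) = \<alpha> H *\<^sub>R (if compact_type M then x s else y s)" if H: "H \<in> a" and s: "s < Suc m" for H s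
      proof -
        have 1: "\<forall>t<Suc m. br H (x t) \<in> V t" "\<forall>t<Suc m. br H (y t) \<in> V t"
          using brV(1)[OF ag[OF H]] x(1) y(1) by blast+
        have 2: "\<forall>t<Suc m. \<alpha> H *\<^sub>R (if compact_type M then - y t else x t) \<in> V t"
          "\<forall>t<Suc m. \<alpha> H *\<^sub>R (if compact_type M then x t else y t) \<in> V t"
          using x(1) y(1) V0 by (auto intro!: subspace_scale subspace_neg)
        have "(\<Sum>t<Suc m. br H (x t)) = br H X" "(\<Sum>t<Suc m. br H (y t)) = br H Y"
          unfolding x(2) y(2) by (simp_all only: linear_sum[OF L.linear_ad])
        moreover have "br H X = \<alpha> H *\<^sub>R (if compact_type M then - Y else X)"
          "br H Y = \<alpha> H *\<^sub>R (if compact_type M then X else Y)"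
          using XY(4,5)[OF H] brM[OF ag[OF H] XY(1)] brM[OF ag[OF H] XY(2)] by simp_all
        moreover have "\<alpha> H *\<^sub>R (if compact_type M then - Y else X) =
            (\<Sum>t<Suc m. \<alpha> H *\<^sub>R (if compact_type M then - y t else x t))"
          "\<alpha> H *\<^sub>R (if compact_type M then X else Y) = (\<Sum>t<Suc m. \<alpha> H *\<^sub>R (if compact_type M then x t else y t))"
          unfolding x(2) y(2) by (cases "compact_type M"; simp only: if_True if_False scaleR_sum_right sum_negf scaleR_minus_right)+
        ultimately have 3: "(\<Sum>t<Suc m. br H (x t)) = (\<Sum>t<Suc m. \<alpha> H *\<^sub>R (if compact_type M then - y t else x t))"
          "(\<Sum>t<Suc m. br H (y t)) = (\<Sum>t<Suc m. \<alpha> H *\<^sub>R (if compact_type M then x t else y t))"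
          by (simp_all only:)
        show "br H (x s) = \<alpha> H *\<^sub>R (if compact_type M then - y s else x s)"
          by (rule direct_sum_unique[OF ds 1(1) 2(1) 3(1) s])
        show "br H (y s) = \<alpha> H *\<^sub>R (if compact_type M then x s else y s)"
          by (rule direct_sum_unique[OF ds 1(2) 2(2) 3(2) s])
      qed
      have "x m = 0 \<and> y m = 0"
      proof -
        obtain H where H: "H \<in> a" "\<alpha> H \<noteq> 0" using \<alpha>n by blast
        obtain u where u: "\<forall>s<m. u s \<in> a \<inter> g s" "H = (\<Sum>s<m. u s)" using comp[OF H(1)] by blast
        have "br H (x m) = 0" "br H (y m) = 0" unfolding u(2) using brsumI[OF u(1)] x(1) y(1) by simp_all
        then show ?thesis using cs[OF H(1), of m] H(2) by (simp split: if_splits)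
      qed
      then have "\<exists>s<m. (x s, y s) \<noteq> (0, 0)"
      proof -
        have "X = 0 \<and> Y = 0" if "\<forall>s<m. x s = 0 \<and> y s = 0"
          using that \<open>x m = 0 \<and> y m = 0\<close> x(2) y(2) by simp
        then show ?thesis using XY(3) by auto
      qed
      then obtain s where s: "s < m" "(x s, y s) \<noteq> (0, 0)" by blast
      have xs: "x s \<in> V s" "y s \<in> V s" using x(1) y(1) s(1) by simp_all
      have \<alpha>s: "\<alpha> (\<Sum>t<m. u t) = \<alpha> (u s)" if u: "\<forall>t<m. u t \<in> a \<inter> g t" for u
      proof -
        have H: "(\<Sum>t<m. u t) \<in> a" using direct_sum_mem[OF dsa u] .
        have us: "u s \<in> a" using u s(1) by blast
        have "br (\<Sum>t<m. u t) (x s) = br (u s) (x s)" "br (\<Sum>t<m. u t) (y s) = br (u s) (y s)"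
          using brsum[OF u _ s(1)] xs by simp_all
        then have "\<alpha> (\<Sum>t<m. u t) *\<^sub>R (if compact_type M then - y s else x s) = \<alpha> (u s) *\<^sub>R (if compact_type M then - y s else x s)"
          "\<alpha> (\<Sum>t<m. u t) *\<^sub>R (if compact_type M then x s else y s) = \<alpha> (u s) *\<^sub>R (if compact_type M then x s else y s)"
          using cs[OF H less_SucI[OF s(1)]] cs[OF us less_SucI[OF s(1)]] by simp_all
        then show ?thesis using s(2) by (cases "compact_type M") auto
      qed
      define \<beta> where "\<beta> = restrict \<alpha> (a \<inter> g s)"
      have \<beta>f: "\<beta> \<in> functionals (a \<inter> g s)"
      proof -
        obtain h where "linear h" "\<alpha> = restrict h a" using functional_linear[OF \<alpha>f] .
        then show ?thesis by (intro functionalI[of h]) (auto simp: \<beta>_def)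
      qed
      have \<beta>n: "\<exists>H\<in>a \<inter> g s. \<beta> H \<noteq> 0"
      proof -
        obtain H where H: "H \<in> a" "\<alpha> H \<noteq> 0" using \<alpha>n by blast
        obtain u where u: "\<forall>s<m. u s \<in> a \<inter> g s" "H = (\<Sum>s<m. u s)" using comp[OF H(1)] by blast
        have "u s \<in> a \<inter> g s" "\<beta> (u s) \<noteq> 0" using u s(1) H(2) \<alpha>s[OF u(1)] by (auto simp: \<beta>_def)
        then show ?thesis by blast
      qed
      have xg: "x s \<in> g s" "y s \<in> g s" using xs gV[OF s(1)] by simp_all
      have "lbracket (S s) H (x s) = \<beta> H *\<^sub>R (if compact_type (S s) then - y s else x s) \<and>
          lbracket (S s) H (y s) = \<beta> H *\<^sub>R (if compact_type (S s) then x s else y s)"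
        if H: "H \<in> a \<inter> g s" for H
      proof -
        have "H \<in> a" "H \<in> g s" using H by simp_all
        then have "lbracket (S s) H (x s) = br H (x s)" "lbracket (S s) H (y s) = br H (y s)"
          using F(4)[OF s(1) _ xg(1)] F(4)[OF s(1) _ xg(2)] brM[OF ag Vg[OF xs(1)]] brM[OF ag Vg[OF xs(2)]] by simp_all
        then show ?thesis
          using cs[OF \<open>H \<in> a\<close> less_SucI[OF s(1)]] H typeS(1)[OF s(1)] by (simp add: \<beta>_def)
      qed
      then have "\<beta> \<in> restricted_roots (S s) (a \<inter> g s)"
        unfolding restricted_roots_alt g_def[symmetric] using \<beta>f \<beta>n xg s(2) by blast
      moreover have "\<alpha> (\<Sum>t<m. u t) = \<beta> (u s)" if "\<forall>t<m. u t \<in> a \<inter> g t" for u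
        using \<alpha>s[OF that] that s(1) by (simp add: \<beta>_def)
      ultimately show ?thesis using s(1) by blast
    qed
    have rootsB: "\<exists>\<alpha>\<in>restricted_roots M a.
        \<forall>y. (\<forall>t<m. y t \<in> a \<inter> g t) \<longrightarrow> \<alpha> (\<Sum>t<m. y t) = \<beta> (y s)"
      if s: "s < m" and \<beta>: "\<beta> \<in> restricted_roots (S s) (a \<inter> g s)" for s \<beta>
    proof -
      obtain X Y where XY: "X \<in> g s" "Y \<in> g s" "(X, Y) \<noteq> (0, 0)"
        "\<And>H. H \<in> a \<inter> g s \<Longrightarrow> lbracket (S s) H X = \<beta> H *\<^sub>R (if compact_type (S s) then - Y else X)"
        "\<And>H. H \<in> a \<inter> g s \<Longrightarrow> lbracket (S s) H Y = \<beta> H *\<^sub>R (if compact_type (S s) then X else Y)"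
        and \<beta>f: "\<beta> \<in> functionals (a \<inter> g s)" and \<beta>n: "\<exists>H\<in>a \<inter> g s. \<beta> H \<noteq> 0"
        using \<beta> unfolding restricted_roots_alt g_def[symmetric] by blast
      have XV: "X \<in> V s" "Y \<in> V s" using XY(1,2) gV[OF s] by simp_all
      define \<alpha> where "\<alpha> = (\<lambda>x\<in>a. \<beta> (P s x))"
      have \<alpha>y: "\<alpha> (\<Sum>t<m. y t) = \<beta> (y s)" if "\<forall>t<m. y t \<in> a \<inter> g t" for y
        using P(2)[OF s that] direct_sum_mem[OF dsa that] by (simp add: \<alpha>_def)
      obtain h where h: "linear h" "\<beta> = restrict h (a \<inter> g s)" using functional_linear[OF \<beta>f] .
      have \<alpha>f: "\<alpha> \<in> functionals a"
      proof (rule functionalI)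
        show "linear (\<lambda>x. h (P s x))" using linear_compose[OF P(1)[OF s] h(1)] by (simp add: comp_def)
        fix x assume x: "x \<in> a"
        obtain y where y: "\<forall>s<m. y s \<in> a \<inter> g s" "x = (\<Sum>s<m. y s)" using comp[OF x] by blast
        have "P s x \<in> a \<inter> g s" using P(2)[OF s y(1)] y s by simp
        then show "\<alpha> x = h (P s x)" using x h(2) by (simp add: \<alpha>_def)
      qed (simp add: \<alpha>_def)
      obtain H where H: "H \<in> a \<inter> g s" "\<beta> H \<noteq> 0" using \<beta>n by blast
      note e = direct_sum_single[OF dsa s H(1)]
      have "\<alpha> H = \<beta> H" using \<alpha>y[OF e(1)] e(2) by simp
      then have \<alpha>n: "\<exists>H\<in>a. \<alpha> H \<noteq> 0" using H by (intro bexI[of _ H]) auto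
      have XM: "X \<in> lalg M" "Y \<in> lalg M" using XV Vg by blast+
      have "lbracket M H X = \<alpha> H *\<^sub>R (if compact_type M then - Y else X) \<and>
          lbracket M H Y = \<alpha> H *\<^sub>R (if compact_type M then X else Y)" if H: "H \<in> a" for H
      proof -
        obtain y where y: "\<forall>s<m. y s \<in> a \<inter> g s" "H = (\<Sum>s<m. y s)" using comp[OF H] by blast
        have ys: "y s \<in> a \<inter> g s" using y(1) s by blast
        have "lbracket M H Z = lbracket (S s) (y s) Z" if "Z \<in> g s" for Z
        proof -
          have Z: "Z \<in> V s" using that gV[OF s] by simp
          have "lbracket M H Z = br H Z" using brM[OF ag[OF H] Vg[OF Z]] .
          also have "\<dots> = br (y s) Z" unfolding y(2) by (rule brsum[OF y(1) Z s])
          also have "\<dots> = lbracket M (y s) Z" using brM[OF ag Vg[OF Z]] ys by simp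
          finally show ?thesis using F(4)[OF s _ that] ys by simp
        qed
        then show ?thesis
          using XY(1,2) XY(4,5)[OF ys] \<alpha>y[OF y(1)] y(2) typeS(1)[OF s] by simp
      qed
      then have "\<alpha> \<in> restricted_roots M a"
        unfolding restricted_roots_alt using \<alpha>f \<alpha>n XM XY(3) by blast
      then show ?thesis using \<alpha>y by blast
    qed
    have "has_root_system (S s) (a \<inter> g s)" if "s < m" for s
      using hrs[OF F(1)[OF that] typeS(2)[OF that] maxS[OF that]] .
    then show ?thesis
      unfolding root_decomposition_def m_def[symmetric] S_def[symmetric] g_def[symmetric]
      using hrs[OF M type a] dsa ne rootsA rootsB by blast
  qed
qed

locale root_decomposition_locale =
  fixes M :: "('x, 'v::euclidean_space) symm_space" and a :: "'v set" and Fs :: "('x, 'v) symm_space list"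
  assumes rd: "root_decomposition M a Fs"
begin

definition m :: nat where "m = length Fs"
definition A :: "nat \<Rightarrow> 'v set" where "A s = a \<inter> lalg (Fs ! s)"
definition R :: "nat \<Rightarrow> ('v \<Rightarrow> real) set" where "R s = restricted_roots (Fs ! s) (A s)"
definition c :: "nat \<Rightarrow> ('v \<Rightarrow> real) \<Rightarrow> 'v" where "c s = coroot (Fs ! s) (A s)"
definition W :: "nat \<Rightarrow> ('v \<Rightarrow> 'v) set" where "W s = weyl_group (Fs ! s) (A s)"

text \<open>
  The root \<open>\<alpha>\<close> of \<open>M\<close> is the root \<open>\<beta>\<close> of the
  factor \<open>s\<close>, composed with the projection to this factor.
\<close>

definition link :: "nat \<Rightarrow> ('v \<Rightarrow> real) \<Rightarrow> ('v \<Rightarrow> real) \<Rightarrow> bool" where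
  "link s \<alpha> \<beta> \<longleftrightarrow> (\<forall>y. (\<forall>t<m. y t \<in> A t) \<longrightarrow> \<alpha> (\<Sum>t<m. y t) = \<beta> (y s))"

lemma root_system_M: "has_root_system M a"
  and ds: "direct_sum a A m"
  and root_system_s: "s < m \<Longrightarrow> has_root_system (Fs ! s) (A s)"
  and A_nonzero: "s < m \<Longrightarrow> A s \<noteq> {0}"
  and roots_A: "\<alpha> \<in> restricted_roots M a \<Longrightarrow> \<exists>s<m. \<exists>\<beta>\<in>R s. link s \<alpha> \<beta>"
  and roots_B: "s < m \<Longrightarrow> \<beta> \<in> R s \<Longrightarrow> \<exists>\<alpha>\<in>restricted_roots M a. link s \<alpha> \<beta>"
  using rd unfolding root_decomposition_def link_def R_def A_def[abs_def] m_def by blast+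

lemma A_a: "s < m \<Longrightarrow> x \<in> A s \<Longrightarrow> x \<in> a"
  by (simp add: A_def)

lemma link_single:
  assumes "link s \<alpha> \<beta>" "s < m" "x \<in> A s"
  shows "\<alpha> x = \<beta> x"
  using direct_sum_single[OF ds assms(2,3)] assms(1) unfolding link_def by fastforce

lemma link_other:
  assumes "link s \<alpha> \<beta>" "s < m" "t < m" "t \<noteq> s" "x \<in> A t" "\<beta> \<in> R s"
  shows "\<alpha> x = 0"
proof -
  have "\<alpha> (\<Sum>r<m. if r = t then x else 0) = \<beta> (if s = t then x else 0)"
    using assms(1)[unfolded link_def, rule_format, of "\<lambda>r. if r = t then x else 0"]
      direct_sum_single(1)[OF ds assms(3,5)] by simp
  moreover have "\<beta> 0 = 0"
    using functional_zero[of \<beta> "A s"] assms(2,6) ds by (auto simp: R_def restricted_roots_def direct_sum_def)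
  ultimately show ?thesis using direct_sum_single(2)[OF ds assms(3,5)] assms(4) by simp
qed

text \<open>
  The reflection of the factor, extended by the identity, permutes the roots of \<open>M\<close>;
  so its coroot is the coroot of \<open>M\<close> by \<open>coroot_unique\<close>.
\<close>

lemma coroot_link:
  assumes \<alpha>: "\<alpha> \<in> restricted_roots M a" and s: "s < m" and \<beta>: "\<beta> \<in> R s" and l: "link s \<alpha> \<beta>"
  shows "coroot M a \<alpha> = c s \<beta>"
proof -
  obtain Q where "root_system a (restricted_roots M a) (coroot M a) Q"
    using root_system_M by (auto simp: has_root_system_def)
  then interpret r: root_system a "restricted_roots M a" "coroot M a" Q .
  obtain Q' where "root_system (A s) (R s) (c s) Q'"
    using root_system_s[OF s] by (auto simp: has_root_system_def R_def c_def)
  then interpret rs: root_system "A s" "R s" "c s" Q' .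
  have dA: "c s \<beta> \<in> A s" by (rule rs.c_a[OF \<beta>])
  have "c s \<beta> = coroot M a \<alpha>"
  proof (rule r.coroot_unique[OF \<alpha>])
    show "c s \<beta> \<in> a" by (rule A_a[OF s dA])
    show "\<alpha> (c s \<beta>) = 2" using link_single[OF l s dA] rs.c_two[OF \<beta>] by simp
    fix \<gamma> assume \<gamma>: "\<gamma> \<in> restricted_roots M a"
    obtain t \<delta> where t: "t < m" and \<delta>: "\<delta> \<in> R t" and l': "link t \<gamma> \<delta>" using roots_A[OF \<gamma>] by blast
    have ext: "(\<lambda>H\<in>a. \<gamma> H - \<gamma> (c s \<beta>) * \<alpha> H) = \<gamma>'"
      if "\<gamma>' \<in> restricted_roots M a"
        "\<And>y. \<forall>t<m. y t \<in> A t \<Longrightarrow> \<gamma> (\<Sum>t<m. y t) - \<gamma> (c s \<beta>) * \<alpha> (\<Sum>t<m. y t) = \<gamma>' (\<Sum>t<m. y t)" for \<gamma>'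
    proof (rule direct_sum_ext[OF ds])
      show "\<gamma>' \<in> extensional a" using r.R_functional[OF that(1)] by (auto simp: functionals_def)
      show "(\<lambda>H\<in>a. \<gamma> H - \<gamma> (c s \<beta>) * \<alpha> H) (\<Sum>t<m. y t) = \<gamma>' (\<Sum>t<m. y t)" if "\<forall>t<m. y t \<in> A t" for y
        using \<open>\<And>y. \<forall>t<m. y t \<in> A t \<Longrightarrow> \<gamma> (\<Sum>t<m. y t) - \<gamma> (c s \<beta>) * \<alpha> (\<Sum>t<m. y t) = \<gamma>' (\<Sum>t<m. y t)\<close>[OF that]
          direct_sum_mem[OF ds that] by simp
    qed simp
    show "(\<lambda>H\<in>a. \<gamma> H - \<gamma> (c s \<beta>) * \<alpha> H) \<in> restricted_roots M a"
    proof (cases "t = s")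
      case True
      define \<delta>' where "\<delta>' = (\<lambda>H\<in>A s. \<delta> H - \<delta> (c s \<beta>) * \<beta> H)"
      have "\<delta>' \<in> R s" unfolding \<delta>'_def using rs.R_reflect[OF \<beta>] \<delta> True by blast
      then obtain \<gamma>' where \<gamma>': "\<gamma>' \<in> restricted_roots M a" "link s \<gamma>' \<delta>'" using roots_B[OF s] by blast
      have "\<gamma> (\<Sum>t<m. y t) - \<gamma> (c s \<beta>) * \<alpha> (\<Sum>t<m. y t) = \<gamma>' (\<Sum>t<m. y t)" if y: "\<forall>t<m. y t \<in> A t" for y
      proof -
        have "\<gamma> (\<Sum>t<m. y t) = \<delta> (y s)" "\<alpha> (\<Sum>t<m. y t) = \<beta> (y s)" "\<gamma>' (\<Sum>t<m. y t) = \<delta>' (y s)"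
          using l l' \<gamma>'(2) True y unfolding link_def by blast+
        moreover have "\<gamma> (c s \<beta>) = \<delta> (c s \<beta>)" using link_single[OF l'[unfolded True] s dA] .
        moreover have "y s \<in> A s" using y s by blast
        ultimately show ?thesis by (simp add: \<delta>'_def)
      qed
      then show ?thesis using ext[OF \<gamma>'(1)] \<gamma>'(1) by simp
    next
      case False
      have "\<gamma> (c s \<beta>) = 0" using link_other[OF l' t s _ dA \<delta>] False by simp
      then show ?thesis using ext[OF \<gamma>] \<gamma> by simp
    qed
  qed
  then show ?thesis by simp
qed

lemma W_linear: "\<forall>s<m. W s \<subseteq> linear_maps (A s)"
  using weyl_group_linear[OF root_system_s] unfolding W_def linear_maps_def by blast

lemma W_compose: "s < m \<Longrightarrow> u \<in> W s \<Longrightarrow> v \<in> W s \<Longrightarrow> compose (A s) u v \<in> W s"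
proof -
  assume s: "s < m" and u: "u \<in> W s" and v: "v \<in> W s"
  obtain Q' where "root_system (A s) (R s) (c s) Q'"
    using root_system_s[OF s] by (auto simp: has_root_system_def R_def c_def)
  then interpret rs: root_system "A s" "R s" "c s" Q' .
  have "W s = generated_group (A s) (rs.reflections (R s))"
    unfolding W_def weyl_group_generated rs.reflections_def unfolding R_def c_def ..
  then show "compose (A s) u v \<in> W s"
    using generated_group_compose[OF rs.reflections_a[OF order.refl]] u v by simp
qed

lemma W_one: "(\<lambda>x\<in>A s. x) \<in> W s"
  unfolding W_def by (rule weyl_group.intros)

text \<open>
  A reflection acts in one factor only. Conversely, an element of the product is composed of
  elements acting in one factor after the other.
\<close>

theorem weyl_group_product: "weyl_group M a = product_group a A m W"
proof
  obtain Q where "root_system a (restricted_roots M a) (coroot M a) Q"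
    using root_system_M by (auto simp: has_root_system_def)
  then interpret r: root_system a "restricted_roots M a" "coroot M a" Q .
  have WG: "weyl_group M a = generated_group a (r.reflections (restricted_roots M a))"
    unfolding weyl_group_generated r.reflections_def ..
  have refl_y: "reflection a \<alpha> (coroot M a \<alpha>) (\<Sum>t<m. y t) =
      (\<Sum>t<m. (y(s := reflection (A s) \<beta> (c s \<beta>) (y s))) t)"
    if \<alpha>: "\<alpha> \<in> restricted_roots M a" and s: "s < m" and \<beta>: "\<beta> \<in> R s" and l: "link s \<alpha> \<beta>"
      and y: "\<forall>t<m. y t \<in> A t" for \<alpha> s \<beta> y
  proof -
    have "\<alpha> (\<Sum>t<m. y t) = \<beta> (y s)" using l y unfolding link_def by blast
    then have "reflection a \<alpha> (coroot M a \<alpha>) (\<Sum>t<m. y t) = (\<Sum>t<m. y t) - \<beta> (y s) *\<^sub>R c s \<beta>"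
      using direct_sum_mem[OF ds y] coroot_link[OF \<alpha> s \<beta> l] by (simp add: reflection_def)
    also have "\<dots> = (\<Sum>t<m. (y(s := y s - \<beta> (y s) *\<^sub>R c s \<beta>)) t)"
    proof -
      have "(\<Sum>t\<in>{..<m} - {s}. (y(s := y s - \<beta> (y s) *\<^sub>R c s \<beta>)) t) = (\<Sum>t\<in>{..<m} - {s}. y t)"
        by (rule sum.cong) auto
      then show ?thesis using s by (simp add: sum.remove[of "{..<m}" s])
    qed
    finally show ?thesis using y s by (simp add: reflection_def)
  qed
  have upd: "\<forall>t<m. (y(s := u)) t \<in> A t" if "\<forall>t<m. y t \<in> A t" "u \<in> A s" for y s u
    using that by simp
  have WA: "w x \<in> A s" if "s < m" "w \<in> W s" "x \<in> A s" for s w x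
  proof -
    have "w \<in> A s \<rightarrow>\<^sub>E A s" using W_linear that unfolding linear_maps_def by blast
    then show ?thesis using that(3) by (rule PiE_mem)
  qed
  show "weyl_group M a \<subseteq> product_group a A m W"
  proof
    fix w assume "w \<in> weyl_group M a"
    then show "w \<in> product_group a A m W"
    proof induction
      case 1
      have "linear (\<lambda>x::'v. x)" by (rule linear_ident)
      moreover have "\<forall>s<m. restrict (\<lambda>x. x) (A s) \<in> W s" using W_one by simp
      ultimately show ?case unfolding product_group_def by (intro CollectI exI[of _ "\<lambda>x. x"]) auto
    next
      case (2 w \<alpha>)
      obtain s \<beta> where s: "s < m" and \<beta>: "\<beta> \<in> R s" and l: "link s \<alpha> \<beta>" using roots_A[OF 2(2)] by blast
      define \<rho> where "\<rho> = reflection (A s) \<beta> (c s \<beta>)"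
      have \<rho>: "\<rho> \<in> W s"
      proof -
        have "root_reflection (Fs ! s) (A s) \<beta> = \<rho>"
          by (simp add: \<rho>_def c_def root_reflection_def reflection_def)
        moreover have "compose (A s) \<rho> (\<lambda>x\<in>A s. x) \<in> W s"
          using weyl_group.intros(2)[OF weyl_group.intros(1), of \<beta> "Fs ! s" "A s"] \<beta> calculation
          unfolding R_def W_def by simp
        moreover have "compose (A s) \<rho> (\<lambda>x\<in>A s. x) = \<rho>"
          by (auto simp: compose_def \<rho>_def reflection_def fun_eq_iff)
        ultimately show ?thesis by simp
      qed
      note ws = product_group_sum[OF ds 2(3) W_linear]
      have zero: "\<forall>t<m. 0 \<in> A t" using ds by (simp add: direct_sum_def subspace_0)
      define v where "v t = (if t = s then compose (A s) \<rho> (restrict w (A s)) else restrict w (A t))" for t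
      have vW: "\<forall>t<m. v t \<in> W t"
        using ws(3)[OF zero] W_compose[OF s \<rho>] by (simp add: v_def)
      obtain g where g: "g \<in> product_group a A m W"
        "\<And>y. \<forall>t<m. y t \<in> A t \<Longrightarrow> g (\<Sum>t<m. y t) = (\<Sum>t<m. v t (y t))"
        using product_group_tuple[OF ds W_linear vW] by (elim bexE) blast
      have "compose a (root_reflection M a \<alpha>) w = g"
      proof (rule direct_sum_ext[OF ds])
        show "g \<in> extensional a" by (rule product_group_extensional[OF g(1)])
        fix y assume y: "\<forall>t<m. y t \<in> A t"
        have wy: "\<forall>t<m. w (y t) \<in> A t" using ws(2)[OF y] by blast
        have "compose a (root_reflection M a \<alpha>) w (\<Sum>t<m. y t) = reflection a \<alpha> (coroot M a \<alpha>) (\<Sum>t<m. w (y t))"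
          using direct_sum_mem[OF ds y] ws(1)[OF y] by (simp add: compose_def root_reflection_def reflection_def)
        also have "\<dots> = (\<Sum>t<m. ((\<lambda>t. w (y t))(s := \<rho> (w (y s)))) t)"
          unfolding \<rho>_def by (rule refl_y[OF 2(2) s \<beta> l wy])
        also have "\<dots> = (\<Sum>t<m. v t (y t))"
          using y by (intro sum.cong) (auto simp: v_def compose_def)
        finally show "compose a (root_reflection M a \<alpha>) w (\<Sum>t<m. y t) = g (\<Sum>t<m. y t)" using g(2)[OF y] by simp
      qed (simp add: compose_def)
      then show ?case using g(1) by simp
    qed
  qed
  obtain P where P: "\<And>s. s < m \<Longrightarrow> linear (P s)"
    "\<And>s y. s < m \<Longrightarrow> \<forall>t<m. y t \<in> A t \<Longrightarrow> P s (\<Sum>t<m. y t) = y s"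
    using direct_sum_projections[OF ds] by metis
  have embed: "\<exists>g\<in>weyl_group M a. \<forall>y. (\<forall>t<m. y t \<in> A t) \<longrightarrow> g (\<Sum>t<m. y t) = (\<Sum>t<m. (y(s := w (y s))) t)"
    if s: "s < m" and w: "w \<in> W s" for s w
    using w unfolding W_def
  proof induction
    case 1
    have "(\<lambda>H\<in>a. H) (\<Sum>t<m. y t) = (\<Sum>t<m. (y(s := (\<lambda>H\<in>A s. H) (y s))) t)" if y: "\<forall>t<m. y t \<in> A t" for y
      using direct_sum_mem[OF ds y] y s by (simp add: fun_upd_idem)
    then show ?case using weyl_group.intros(1) by blast
  next
    case (2 w \<beta>)
    then obtain g where g: "g \<in> weyl_group M a"
      "\<And>y. \<forall>t<m. y t \<in> A t \<Longrightarrow> g (\<Sum>t<m. y t) = (\<Sum>t<m. (y(s := w (y s))) t)" by blast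
    have \<beta>: "\<beta> \<in> R s" using 2(2) by (simp add: R_def)
    obtain \<alpha> where \<alpha>: "\<alpha> \<in> restricted_roots M a" "link s \<alpha> \<beta>" using roots_B[OF s \<beta>] by blast
    have "compose a (root_reflection M a \<alpha>) g (\<Sum>t<m. y t) =
        (\<Sum>t<m. (y(s := compose (A s) (root_reflection (Fs ! s) (A s) \<beta>) w (y s))) t)"
      if y: "\<forall>t<m. y t \<in> A t" for y
    proof -
      have ys: "y s \<in> A s" using y s by blast
      have "w (y s) \<in> A s" using WA[OF s _ ys] 2(1) by (simp add: W_def)
      then have y': "\<forall>t<m. (y(s := w (y s))) t \<in> A t" using upd[OF y] by blast
      have "compose a (root_reflection M a \<alpha>) g (\<Sum>t<m. y t) =
          reflection a \<alpha> (coroot M a \<alpha>) (\<Sum>t<m. (y(s := w (y s))) t)"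
        using direct_sum_mem[OF ds y] g(2)[OF y] by (simp add: compose_def root_reflection_def reflection_def)
      also have "\<dots> = (\<Sum>t<m. ((y(s := w (y s)))(s := reflection (A s) \<beta> (c s \<beta>) ((y(s := w (y s))) s))) t)"
        by (rule refl_y[OF \<alpha>(1) s \<beta> \<alpha>(2) y'])
      also have "(y(s := w (y s)))(s := reflection (A s) \<beta> (c s \<beta>) ((y(s := w (y s))) s)) =
          y(s := compose (A s) (root_reflection (Fs ! s) (A s) \<beta>) w (y s))"
        using ys by (simp add: compose_def root_reflection_def reflection_def c_def)
      finally show ?thesis .
    qed
    moreover have "compose a (root_reflection M a \<alpha>) g \<in> weyl_group M a"
      by (rule weyl_group.intros(2)[OF g(1) \<alpha>(1)])
    ultimately show ?case by blast
  qed
  show "product_group a A m W \<subseteq> weyl_group M a"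
  proof
    fix g assume g: "g \<in> product_group a A m W"
    note gs = product_group_sum[OF ds g W_linear]
    have "\<exists>h\<in>weyl_group M a. \<forall>y. (\<forall>t<m. y t \<in> A t) \<longrightarrow>
        h (\<Sum>t<m. y t) = (\<Sum>t<m. if t < n then g (y t) else y t)" if "n \<le> m" for n
      using that
    proof (induction n)
      case 0
      have "(\<lambda>H\<in>a. H) (\<Sum>t<m. y t) = (\<Sum>t<m. if t < 0 then g (y t) else y t)" if y: "\<forall>t<m. y t \<in> A t" for y
        using direct_sum_mem[OF ds y] by simp
      then show ?case using weyl_group.intros(1) by blast
    next
      case (Suc n)
      then have n: "n < m" by simp
      obtain h where h: "h \<in> weyl_group M a"
        "\<And>y. \<forall>t<m. y t \<in> A t \<Longrightarrow> h (\<Sum>t<m. y t) = (\<Sum>t<m. if t < n then g (y t) else y t)"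
        using Suc by auto
      have zero: "\<forall>t<m. 0 \<in> A t" using ds by (simp add: direct_sum_def subspace_0)
      obtain e where e: "e \<in> weyl_group M a"
        "\<And>y. \<forall>t<m. y t \<in> A t \<Longrightarrow> e (\<Sum>t<m. y t) = (\<Sum>t<m. (y(n := restrict g (A n) (y n))) t)"
        using embed[OF n gs(3)[OF zero n]] by blast
      have "compose a e h (\<Sum>t<m. y t) = (\<Sum>t<m. if t < Suc n then g (y t) else y t)" if y: "\<forall>t<m. y t \<in> A t" for y
      proof -
        have z: "\<forall>t<m. (if t < n then g (y t) else y t) \<in> A t" using gs(2)[OF y] y by simp
        have "compose a e h (\<Sum>t<m. y t) = e (\<Sum>t<m. if t < n then g (y t) else y t)"
          using direct_sum_mem[OF ds y] h(2)[OF y] by (simp add: compose_def)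
        also have "\<dots> = (\<Sum>t<m. if t < Suc n then g (y t) else y t)"
          unfolding e(2)[OF z] using y n by (intro sum.cong) auto
        finally show ?thesis .
      qed
      moreover have "compose a e h \<in> weyl_group M a"
        using generated_group_compose[OF r.reflections_a[OF order.refl]] e(1) h(1) WG by simp
      ultimately show ?case by blast
    qed
    from this[of m] obtain h where h: "h \<in> weyl_group M a"
      "\<And>y. \<forall>t<m. y t \<in> A t \<Longrightarrow> h (\<Sum>t<m. y t) = (\<Sum>t<m. if t < m then g (y t) else y t)" by auto
    have "h = g"
    proof (rule direct_sum_ext[OF ds])
      show "h \<in> extensional a" using weyl_group_linear(1)[OF root_system_M h(1)] by (simp add: PiE_def)
      show "g \<in> extensional a" by (rule product_group_extensional[OF g])
      fix y assume y: "\<forall>t<m. y t \<in> A t"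
      have "(\<Sum>t<m. if t < m then g (y t) else y t) = (\<Sum>t<m. g (y t))" by (intro sum.cong) auto
      then show "h (\<Sum>t<m. y t) = g (\<Sum>t<m. y t)" using h(2)[OF y] gs(1)[OF y] by simp
    qed
    then show "g \<in> weyl_group M a" using h(1) by simp
  qed
qed

text \<open>The Dynkin diagram \<open>D\<^sub>r\<close> is connected, so a space of type \<open>D\<close> has only one factor.\<close>

lemma type_D_single_factor:
  assumes D: "has_type TypeD r M a"
  shows "length Fs = 1 \<and> a \<inter> lalg (Fs ! 0) = a \<and> has_type TypeD r (Fs ! 0) a \<and> weyl_group (Fs ! 0) a = weyl_group M a"
proof -
  obtain \<alpha> where dyn: "dynkin_numbering TypeD r M a \<alpha>" using D by (auto simp: has_type_def)
  then have adm: "admissible_rank TypeD r" by (simp add: dynkin_numbering_def)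
  then have r: "r \<ge> 4" by simp
  obtain H\<^sub>0 where H0: "regular_element (half_roots M a) a H\<^sub>0"
      and bij: "bij_betw \<alpha> {1..r} (simple_roots (half_roots M a) a H\<^sub>0)"
    using dyn by (auto simp: dynkin_numbering_def)
  obtain Q where "root_system a (half_roots M a) (coroot M a) Q" using has_root_system_half[OF root_system_M] .
  then interpret hr: root_system a "half_roots M a" "coroot M a" Q .
  interpret pr: positive_root_system a "half_roots M a" "coroot M a" Q H\<^sub>0 by unfold_locales (rule H0)
  have S: "pr.S = \<alpha> ` {1..r}" using bij by (simp add: bij_betw_def)
  have \<alpha>R: "\<alpha> i \<in> restricted_roots M a" if "i \<in> {1..r}" for i
  proof -
    have "\<alpha> i \<in> half_roots M a" using pr.S_R S that by blast
    then show ?thesis by (simp add: half_roots_def)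
  qed
  have "\<forall>i\<in>{1..r}. \<exists>p. fst p < m \<and> snd p \<in> R (fst p) \<and> link (fst p) (\<alpha> i) (snd p)"
    using roots_A[OF \<alpha>R] by fastforce
  then obtain p where p: "\<forall>i\<in>{1..r}. fst (p i) < m \<and> snd (p i) \<in> R (fst (p i)) \<and> link (fst (p i)) (\<alpha> i) (snd (p i))"
    by (rule bchoice[THEN exE])
  define f where "f i = fst (p i)" for i
  have fm: "f i < m" and pR: "snd (p i) \<in> R (f i)" and lk: "link (f i) (\<alpha> i) (snd (p i))" if "i \<in> {1..r}" for i
    using p that unfolding f_def by blast+
  have adj: "f i = f j" if i: "i \<in> {1..r}" and j: "j \<in> {1..r}" and ne: "std_cartan TypeD r i j \<noteq> 0" for i j
  proof (rule ccontr)
    assume "f i \<noteq> f j"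
    obtain Q' where "root_system (A (f i)) (R (f i)) (c (f i)) Q'"
      using root_system_s[OF fm[OF i]] by (auto simp: has_root_system_def R_def c_def)
    then interpret rs: root_system "A (f i)" "R (f i)" "c (f i)" Q' .
    have "coroot M a (\<alpha> i) \<in> A (f i)"
      using coroot_link[OF \<alpha>R[OF i] fm[OF i] pR[OF i] lk[OF i]] rs.c_a[OF pR[OF i]] by simp
    then have "\<alpha> j (coroot M a (\<alpha> i)) = 0"
      using link_other[OF lk[OF j] fm[OF j] fm[OF i] _ _ pR[OF j]] \<open>f i \<noteq> f j\<close> by blast
    then show False using ne dyn i j by (simp add: dynkin_numbering_def)
  qed
  have c13: "std_cartan TypeD r 1 3 \<noteq> 0"
    using std_cartan_eq[OF adm, of 1 3] r by (simp add: std_pair_def std_norm_def)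
  have cs: "std_cartan TypeD r i (Suc i) \<noteq> 0" if "2 \<le> i" "i \<le> r" for i
  proof -
    have "i - Suc 0 \<noteq> Suc i" by simp
    then show ?thesis using std_cartan_eq[OF adm, of i "Suc i"] that by (auto simp: std_pair_def std_norm_def)
  qed
  have f2: "f i = f 2" if "2 \<le> i" "i \<le> r" for i
    using that
  proof (induction i rule: dec_induct)
    case (step i)
    then show ?case using adj[of i "Suc i"] cs[of i] by simp
  qed simp
  have "f 1 = f 3" using adj[of 1 3] c13 r by simp
  then have fall: "f i = f 2" if "i \<in> {1..r}" for i
    using f2[of i] f2[of 3] r that by (cases "i = 1") auto
  have only: "t = f 2" if t: "t < m" for t
  proof (rule ccontr)
    assume ne: "t \<noteq> f 2"
    have "0 \<in> A t" using ds t by (simp add: direct_sum_def subspace_0)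
    then obtain x where x: "x \<in> A t" "x \<noteq> 0" using A_nonzero[OF t] by blast
    have "x = 0"
    proof (rule pr.simple_separate)
      show "x \<in> a" by (rule A_a[OF t x(1)])
      fix \<sigma> assume "\<sigma> \<in> pr.S"
      then obtain i where i: "i \<in> {1..r}" "\<sigma> = \<alpha> i" using S by blast
      then show "\<sigma> x = 0" using link_other[OF lk fm t _ x(1) pR] fall ne by metis
    qed
    then show False using x(2) by simp
  qed
  have "f 2 < m" using fm[of 2] r by simp
  then have m1: "m = 1" using only[of 0] only[of 1] by (cases "m \<ge> 2") auto
  have A0: "A 0 = a"
  proof
    show "A 0 \<subseteq> a" by (simp add: A_def)
    show "a \<subseteq> A 0"
    proof
      fix x assume "x \<in> a"
      then obtain y where "\<forall>s<m. y s \<in> A s" "x = (\<Sum>s<m. y s)" using direct_sum_obtain[OF ds] by metis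
      then show "x \<in> A 0" using m1 by simp
    qed
  qed
  have eq: "\<gamma> = \<beta>" if l: "link 0 \<gamma> \<beta>" and \<gamma>: "\<gamma> \<in> functionals a" and \<beta>: "\<beta> \<in> functionals a" for \<gamma> \<beta>
  proof (rule functional_eqI[OF \<gamma> \<beta>])
    fix x assume "x \<in> a"
    then show "\<gamma> x = \<beta> x" using link_single[OF l] m1 A0 by simp
  qed
  have fn: "\<gamma> \<in> functionals a" if "\<gamma> \<in> restricted_roots T a" for \<gamma> and T :: "('x, 'v) symm_space"
    using that by (simp add: restricted_roots_def)
  have R0: "R 0 = restricted_roots (Fs ! 0) a" by (simp add: R_def A0)
  have "restricted_roots M a = restricted_roots (Fs ! 0) a"
  proof
    show "restricted_roots M a \<subseteq> restricted_roots (Fs ! 0) a"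
      using roots_A eq fn R0 m1 by (metis less_one subsetI)
    show "restricted_roots (Fs ! 0) a \<subseteq> restricted_roots M a"
      using roots_B[of 0] eq fn R0 m1 by (metis less_one subsetI)
  qed
  then have h: "half_roots M a = half_roots (Fs ! 0) a" by (simp add: half_roots_def)
  have "has_root_system (Fs ! 0) a" using root_system_s[of 0] m1 A0 by simp
  note t = half_roots_determine[OF root_system_M this h]
  show ?thesis using t(2) t(3)[of TypeD r] D m1 A0 by (simp add: m_def A_def)
qed

end

section \<open>Propagation and restriction\<close>

theorem theorem2p4:
  fixes Mk Mn :: "('x, 'v::euclidean_space) symm_space"
    and ak an :: "'v set"
    and Fk Fn :: "('x, 'v) symm_space list"
    and fk fn :: "nat \<Rightarrow> nat \<Rightarrow> 'v \<Rightarrow> real"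
  assumes "symmetric_space Mk" and "compact_type Mk \<or> noncompact_type Mk"
    and "symmetric_space Mn" and "compact_type Mn \<or> noncompact_type Mn"
    and "propagates Mk ak Fk fk Mn an Fn fn"
  defines "Wk \<equiv> weyl_group Mk ak" and "Wn \<equiv> weyl_group Mn an"
    and "Wk' \<equiv> ext_weyl_group ak Fk fk" and "Wn' \<equiv> ext_weyl_group an Fn fn"
  shows "((\<forall>s<length Fn. \<forall>r. \<not> has_type TypeD r (Fn ! s) (an \<inter> lalg (Fn ! s))) \<longrightarrow>
            restrictions an (stabiliser Wk an) = Wn \<and>
            restrictions an (inv_polys Wk ak) =
              (inv_polys Wn an :: ('v \<Rightarrow> 'c::{real_normed_field, euclidean_space}) set))
       \<and> (\<forall>r. has_type TypeD r Mn an \<longrightarrow>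
            Wn \<subseteq> restrictions an (stabiliser Wk an) \<and>
            restrictions an (inv_polys Wk ak) \<subseteq> (inv_polys Wn an :: ('v \<Rightarrow> 'c) set) \<and>
            (an \<noteq> ak \<inter> lalg (Fk ! 0) \<longrightarrow>
               Wn \<subset> restrictions an (stabiliser Wk an) \<and>
               restrictions an (inv_polys Wk ak) \<subset> (inv_polys Wn an :: ('v \<Rightarrow> 'c) set)) \<and>
            Wn' = restrictions an (stabiliser Wk' an) \<and>
            inv_polys Wn' an = (restrictions an (inv_polys Wk' ak) :: ('v \<Rightarrow> 'c) set))
       \<and> (Wn' = restrictions an (stabiliser Wk' an) \<and>
            restrictions an (inv_polys Wk' ak) = (inv_polys Wn' an :: ('v \<Rightarrow> 'c) set))"
proof -
  note sk = assms(1) and tk = assms(2) and sn = assms(3) and tn = assms(4) and propag = assms(5)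
  note P = propag[unfolded propagates_def]
  have maxk: "maximal_abelian Mk ak" and maxn: "maximal_abelian Mn an"
    and Fk: "irreducible_factors Mk Fk" and Fn: "irreducible_factors Mn Fn" and len: "length Fn \<le> length Fk"
    using P by blast+
  interpret k: root_decomposition_locale Mk ak Fk
    by unfold_locales (rule irreducible_factors_root_decomposition[OF sk tk maxk Fk])
  interpret n: root_decomposition_locale Mn an Fn
    by unfold_locales (rule irreducible_factors_root_decomposition[OF sn tn maxn Fn])
  have mle: "n.m \<le> k.m" using len by (simp add: n.m_def k.m_def)
  have Dk: "coordinates_for_D (Fk ! s) (k.A s) (fk s)" if "s < k.m" for s
    using P that by (simp add: k.A_def k.m_def)
  have Dn: "coordinates_for_D (Fn ! s) (n.A s) (fn s)" if "s < n.m" for s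
    using P that by (simp add: n.A_def n.m_def)
  have pr: "propagates_irreducible (Fk ! s) (k.A s) (fk s) (Fn ! s) (n.A s) (fn s)" if "s < n.m" for s
    using P that by (simp add: n.A_def n.m_def k.A_def)
  \<comment> \<open>factors of \<open>Mk\<close> that propagate no factor of \<open>Mn\<close> restrict to the zero subspace\<close>
  define B where "B s = (if s < n.m then n.A s else {0})" for s
  define V where "V s = (if s < n.m then n.W s else {\<lambda>x\<in>{0}. x})" for s
  define V' where "V' s = (if s < n.m then ext_weyl_factor (Fn ! s) (n.A s) (fn s) else {\<lambda>x\<in>{0}. x})" for s
  define W' where "W' s = ext_weyl_factor (Fk ! s) (k.A s) (fk s)" for s
  have sumB: "(\<Sum>s<k.m. y s) = (\<Sum>s<n.m. y s)" if "\<forall>s<k.m. y s \<in> B s" for y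
    using that mle by (intro sum.mono_neutral_right) (auto simp: B_def)
  have dsB: "direct_sum an B k.m"
    unfolding direct_sum_def
  proof (intro conjI allI impI ballI)
    show "subspace an" using n.ds by (simp add: direct_sum_def)
    then have 0: "0 \<in> an" by (rule subspace_0)
    show "subspace (B s)" "B s \<subseteq> an" for s
      using n.ds 0 subspace_single_0 by (auto simp: B_def direct_sum_def)
    fix x assume "x \<in> an"
    then obtain y where y: "\<forall>s<n.m. y s \<in> n.A s" "x = (\<Sum>s<n.m. y s)" using direct_sum_obtain[OF n.ds] by metis
    define z where "z s = (if s < n.m then y s else 0)" for s
    have z: "\<forall>s<k.m. z s \<in> B s" using y(1) by (simp add: z_def B_def)
    moreover have "x = (\<Sum>s<k.m. z s)" unfolding sumB[OF z] y(2) by (simp add: z_def)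
    ultimately show "\<exists>y. (\<forall>s<k.m. y s \<in> B s) \<and> x = (\<Sum>s<k.m. y s)" by blast
  next
    fix y s assume y: "(\<forall>s<k.m. y s \<in> B s) \<and> (\<Sum>s<k.m. y s) = 0" and s: "s < k.m"
    have "y s \<in> n.A s" if "s < n.m" for s
    proof -
      have "y s \<in> B s" using y mle that by (meson less_le_trans)
      then show ?thesis using that by (simp add: B_def)
    qed
    then have "\<forall>s<n.m. y s \<in> n.A s" by blast
    moreover have "(\<Sum>s<n.m. y s) = 0" using sumB[of y] y by simp
    ultimately have "\<forall>s<n.m. y s = 0" using n.ds unfolding direct_sum_def by blast
    moreover have "y s \<in> B s" using y s by blast
    ultimately show "y s = 0" by (cases "s < n.m") (simp_all add: B_def)
  qed
  have BA: "B s \<subseteq> k.A s" if "s < k.m" for s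
  proof (cases "s < n.m")
    case True
    then show ?thesis using pr[OF True] by (simp add: B_def propagates_irreducible_def)
  next
    case False
    then show ?thesis using k.ds that by (auto simp: B_def direct_sum_def subspace_0)
  qed
  interpret i: direct_sum_inclusion ak k.A k.m an B
    by unfold_locales (use k.ds dsB BA in auto)
  have product_B: "product_group an B k.m U' = product_group an n.A n.m U"
    if "\<And>s. s < n.m \<Longrightarrow> U' s = U s" "\<And>s. s \<ge> n.m \<Longrightarrow> U' s = {\<lambda>x\<in>{0}. x}" for U U' :: "nat \<Rightarrow> ('v \<Rightarrow> 'v) set"
  proof -
    have "(\<forall>s<k.m. restrict h (B s) \<in> U' s) \<longleftrightarrow> (\<forall>s<n.m. restrict h (n.A s) \<in> U s)" if h: "linear h" for h
    proof -
      have z: "restrict h {0} = (\<lambda>x\<in>{0}. x)" using linear_0[OF h] by (auto simp: fun_eq_iff)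
      have "restrict h (B s) \<in> U' s \<longleftrightarrow> (s < n.m \<longrightarrow> restrict h (n.A s) \<in> U s)" for s
        using \<open>\<And>s. s < n.m \<Longrightarrow> U' s = U s\<close>[of s] \<open>\<And>s. s \<ge> n.m \<Longrightarrow> U' s = {\<lambda>x\<in>{0}. x}\<close>[of s] z
        by (cases "s < n.m") (simp_all add: B_def)
      then show ?thesis using mle by auto
    qed
    then show ?thesis unfolding product_group_def by blast
  qed
  have Wn: "Wn = product_group an B k.m V"
    unfolding Wn_def n.weyl_group_product by (rule product_B[symmetric]) (simp_all add: V_def)
  have Wk: "Wk = product_group ak k.A k.m k.W" unfolding Wk_def by (rule k.weyl_group_product)
  have Wn': "Wn' = product_group an B k.m V'"
  proof -
    have "Wn' = product_group an n.A n.m (\<lambda>s. ext_weyl_factor (Fn ! s) (n.A s) (fn s))"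
      unfolding Wn'_def ext_weyl_group_def product_group_def n.A_def n.m_def ..
    also have "\<dots> = product_group an B k.m V'" by (rule product_B[symmetric]) (simp_all add: V'_def)
    finally show ?thesis .
  qed
  have Wk': "Wk' = product_group ak k.A k.m W'"
    unfolding Wk'_def ext_weyl_group_def product_group_def k.A_def k.m_def W'_def ..
  have lin0: "(\<lambda>x\<in>{0}. x) \<in> linear_maps {0::'v}"
    using linear_ident unfolding linear_maps_def by auto
  have linW: "\<forall>s<k.m. k.W s \<subseteq> linear_maps (k.A s)" by (rule k.W_linear)
  have linV: "\<forall>s<k.m. V s \<subseteq> linear_maps (B s)" using n.W_linear lin0 by (auto simp: V_def B_def)
  have linW': "\<forall>s<k.m. W' s \<subseteq> linear_maps (k.A s)"
    using ext_weyl_factor_linear[OF k.root_system_s Dk] unfolding W'_def linear_maps_def by blast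
  have linV': "\<forall>s<k.m. V' s \<subseteq> linear_maps (B s)"
  proof (intro allI impI)
    fix s
    show "V' s \<subseteq> linear_maps (B s)"
    proof (cases "s < n.m")
      case True
      then show ?thesis
        using ext_weyl_factor_linear[OF n.root_system_s[OF True] Dn[OF True]] unfolding V'_def B_def linear_maps_def by auto
    next
      case False
      then show ?thesis using lin0 by (simp add: V'_def B_def)
    qed
  qed
  have stab0: "restrictions {0} (stabiliser U {0}) = {\<lambda>x\<in>{0}. x}"
    if "U \<noteq> {}" "\<And>w. w \<in> U \<Longrightarrow> w 0 = 0" for U :: "('v \<Rightarrow> 'v) set"
  proof -
    have "stabiliser U {0} = U" using that(2) by (auto simp: stabiliser_def)
    moreover have "restrict w {0} = (\<lambda>x\<in>{0}. x)" if "w \<in> U" for w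
      using \<open>\<And>w. w \<in> U \<Longrightarrow> w 0 = 0\<close>[OF that] by (auto simp: fun_eq_iff)
    ultimately show ?thesis using that(1) by (auto simp: restrictions_def)
  qed
  have lin_zero: "w 0 = 0" if "w \<in> linear_maps (k.A s)" "s < k.m" for w s
    using that k.ds by (auto simp: linear_maps_def direct_sum_def subspace_0 linear_0)
  have triv: "restrictions (B s) (stabiliser U (B s)) = {\<lambda>x\<in>{0}. x} \<and>
      extends_invariants TYPE('c) U (k.A s) {\<lambda>x\<in>{0}. x} (B s)"
    if "s < k.m" "\<not> s < n.m" "U \<noteq> {}" "U \<subseteq> linear_maps (k.A s)" for s U
  proof -
    have "B s = {0}" using that(2) by (simp add: B_def)
    moreover have "\<And>w. w \<in> U \<Longrightarrow> w 0 = 0" using lin_zero that(1,4) by blast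
    ultimately show ?thesis using stab0[OF that(3)] extends_invariants_zero[of "{\<lambda>x\<in>{0}. x}"] by auto
  qed
  have one': "(\<lambda>x\<in>a. x) \<in> ext_weyl_factor T a f"
    if T: "has_root_system T a" and D: "coordinates_for_D T a f" for T :: "('x, 'v) symm_space" and a f
  proof (cases "\<exists>r. has_type TypeD r T a")
    case True
    then obtain r where r: "has_type TypeD r T a" by blast
    have "acts_as a r f (\<lambda>x\<in>a. x) id (\<lambda>_. 1)" by (simp add: acts_as_def)
    moreover have "(\<lambda>_. 1) \<in> type_signs TypeB r" by (simp add: type_signs_def sign_vectors_def)
    moreover have "(\<lambda>x\<in>a. x) \<in> a \<rightarrow>\<^sub>E a" by auto
    ultimately show ?thesis
      unfolding ext_weyl_factor_D(2)[OF T D r] signed_permutations_def using permutes_id by blast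
  next
    case False
    then show ?thesis using ext_weyl_factor_not_D[of T a f] weyl_group.intros(1) by simp
  qed
  have ext_s: "restrictions (B s) (stabiliser (W' s) (B s)) = V' s \<and>
      extends_invariants TYPE('c) (W' s) (k.A s) (V' s) (B s)" if s: "s < k.m" for s
  proof (cases "s < n.m")
    case True
    then show ?thesis
      using propagates_irreducible_ext[OF k.root_system_s[OF s] n.root_system_s[OF True] Dk[OF s] Dn[OF True] pr[OF True]]
      by (simp add: W'_def V'_def B_def)
  next
    case False
    have "W' s \<noteq> {}" using one'[OF k.root_system_s[OF s] Dk[OF s]] by (auto simp: W'_def)
    then show ?thesis using triv[OF s False] linW' s False by (simp add: V'_def)
  qed
  have V'_one: "(\<lambda>x\<in>B s. x) \<in> V' s" for s
    using one'[OF n.root_system_s Dn] by (simp add: V'_def B_def)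
  have V_one: "(\<lambda>x\<in>B s. x) \<in> V s" for s using n.W_one by (simp add: V_def B_def)
  have ext_stab: "Wn' = restrictions an (stabiliser Wk' an)"
    unfolding Wn' Wk' by (rule i.product_group_restrict[OF linW' linV', symmetric]) (use ext_s in blast)
  have ext_inv: "restrictions an (inv_polys Wk' ak) = (inv_polys Wn' an :: ('v \<Rightarrow> 'c) set)"
  proof
    show "restrictions an (inv_polys Wk' ak) \<subseteq> (inv_polys Wn' an :: ('v \<Rightarrow> 'c) set)"
      by (rule inv_polys_restrict) (simp_all add: ext_stab i.b_a)
    show "(inv_polys Wn' an :: ('v \<Rightarrow> 'c) set) \<subseteq> restrictions an (inv_polys Wk' ak)"
      unfolding Wn' Wk' by (rule i.product_invariants_extend[OF linW' linV' V'_one]) (use ext_s in blast)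
  qed
  have weyl_s: "V s \<subseteq> restrictions (B s) (stabiliser (k.W s) (B s))" if s: "s < k.m" for s
  proof (cases "s < n.m")
    case True
    then show ?thesis
      using propagates_irreducible_weyl(1)[OF k.root_system_s[OF s] n.root_system_s[OF True] pr[OF True]]
      by (simp add: V_def B_def k.W_def n.W_def)
  next
    case False
    have "k.W s \<noteq> {}" using k.W_one by blast
    then show ?thesis using triv[OF s False] linW s False by (simp add: V_def)
  qed
  have weyl_sub: "Wn \<subseteq> restrictions an (stabiliser Wk an)"
    unfolding Wn Wk by (rule i.product_group_restrict_superset[OF linW linV weyl_s])
  have poly_sub: "restrictions an (inv_polys Wk ak) \<subseteq> (inv_polys Wn an :: ('v \<Rightarrow> 'c) set)"
    by (rule inv_polys_restrict[OF weyl_sub i.b_a])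
  have part1: "restrictions an (stabiliser Wk an) = Wn \<and>
      restrictions an (inv_polys Wk ak) = (inv_polys Wn an :: ('v \<Rightarrow> 'c) set)"
    if noD: "\<forall>s<length Fn. \<forall>r. \<not> has_type TypeD r (Fn ! s) (an \<inter> lalg (Fn ! s))"
  proof -
    have eq_s: "restrictions (B s) (stabiliser (k.W s) (B s)) = V s \<and>
        extends_invariants TYPE('c) (k.W s) (k.A s) (V s) (B s)" if s: "s < k.m" for s
    proof (cases "s < n.m")
      case True
      have nD: "\<And>r. \<not> has_type TypeD r (Fn ! s) (n.A s)" using noD True by (simp add: n.m_def n.A_def)
      show ?thesis
        using propagates_irreducible_weyl(2)[OF k.root_system_s[OF s] n.root_system_s[OF True] pr[OF True] nD] True
        by (simp add: V_def B_def k.W_def n.W_def)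
    next
      case False
      have "k.W s \<noteq> {}" using k.W_one by blast
      then show ?thesis using triv[OF s False] linW s False by (simp add: V_def)
    qed
    have "restrictions an (stabiliser Wk an) = Wn"
      unfolding Wn Wk by (rule i.product_group_restrict[OF linW linV]) (use eq_s in blast)
    moreover have "(inv_polys Wn an :: ('v \<Rightarrow> 'c) set) \<subseteq> restrictions an (inv_polys Wk ak)"
      unfolding Wn Wk by (rule i.product_invariants_extend[OF linW linV V_one]) (use eq_s in blast)
    ultimately show ?thesis using poly_sub by blast
  qed
  have part2: "Wn \<subset> restrictions an (stabiliser Wk an) \<and>
      restrictions an (inv_polys Wk ak) \<subset> (inv_polys Wn an :: ('v \<Rightarrow> 'c) set)"
    if D: "has_type TypeD r Mn an" and ne: "an \<noteq> ak \<inter> lalg (Fk ! 0)" for r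
  proof -
    note single = n.type_D_single_factor[OF D]
    have m0: "0 < n.m" "0 < k.m" and A0: "n.A 0 = an" using single mle by (simp_all add: n.m_def n.A_def)
    have Wn0: "weyl_group (Fn ! 0) (n.A 0) = Wn" using single A0 by (simp add: Wn_def)
    have D0: "has_type TypeD r (Fn ! 0) (n.A 0)" and ne0: "n.A 0 \<noteq> k.A 0"
      using single A0 ne by (simp_all add: k.A_def)
    obtain p :: "'v \<Rightarrow> 'c" and v x where p: "polynomial_function p"
      "\<And>w x. w \<in> weyl_group (Fn ! 0) (n.A 0) \<Longrightarrow> x \<in> n.A 0 \<Longrightarrow> p (w x) = p x"
      "v \<in> stabiliser (weyl_group (Fk ! 0) (k.A 0)) (n.A 0)" "x \<in> n.A 0" "p (v x) \<noteq> p x"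
      by (rule propagates_irreducible_strict[where 'c = 'c, OF k.root_system_s[OF m0(2)] n.root_system_s[OF m0(1)]
            Dn[OF m0(1)] D0 pr[OF m0(1)] ne0]) (rule that)
    \<comment> \<open>the element \<open>v\<close> of the Weyl group of the first factor, extended by the identity\<close>
    define u where "u s = (if s = 0 then v else (\<lambda>x\<in>k.A s. x))" for s
    have vW: "v \<in> k.W 0" "v ` n.A 0 = n.A 0" using p(3) by (simp_all add: stabiliser_def k.W_def)
    have uW: "\<forall>s<k.m. u s \<in> k.W s" using vW(1) k.W_one by (simp add: u_def)
    obtain g where g: "g \<in> Wk" "\<And>y. \<forall>s<k.m. y s \<in> k.A s \<Longrightarrow> g (\<Sum>s<k.m. y s) = (\<Sum>s<k.m. u s (y s))"
      unfolding Wk using product_group_tuple[OF k.ds linW uW] by (elim bexE) blast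
    have gv: "g z = v z" if z: "z \<in> an" for z
    proof -
      have zA: "z \<in> k.A 0" using z BA[OF m0(2)] m0(1) A0 by (auto simp: B_def)
      note e = direct_sum_single[OF k.ds m0(2) zA]
      have "g z = (\<Sum>s<k.m. u s (if s = 0 then z else 0))" using g(2)[OF e(1)] e(2) by simp
      also have "\<dots> = (\<Sum>s<k.m. if s = 0 then v z else 0)"
        using k.ds by (intro sum.cong) (auto simp: u_def direct_sum_def subspace_0)
      finally show ?thesis using m0(2) by simp
    qed
    have "g ` an = an" using gv vW(2) A0 by (metis (no_types, lifting) image_cong)
    then have gst: "g \<in> stabiliser Wk an" using g(1) by (simp add: stabiliser_def)
    have pinv: "p (w z) = p z" if "w \<in> Wn" "z \<in> an" for w z using p(2) that Wn0 A0 by simp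
    have xan: "x \<in> an" using p(4) A0 by simp
    have pg: "p (g x) \<noteq> p x" using gv[OF xan] p(5) by simp
    have "restrict g an \<notin> Wn" using pinv[OF _ xan, of "restrict g an"] pg xan by auto
    moreover have "restrict g an \<in> restrictions an (stabiliser Wk an)" using gst by (auto simp: restrictions_def)
    ultimately have s1: "Wn \<subset> restrictions an (stabiliser Wk an)" using weyl_sub by blast
    have "restrict p an \<in> inv_polys Wn an" unfolding inv_polys_def using p(1) pinv by blast
    moreover have "restrict p an \<notin> restrictions an (inv_polys Wk ak)"
    proof
      assume "restrict p an \<in> restrictions an (inv_polys Wk ak)"
      then obtain q where q: "\<forall>w\<in>Wk. \<forall>x\<in>ak. q (w x) = q x" "restrict p an = restrict (restrict q ak) an"
        unfolding restrictions_def inv_polys_def by blast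
      have pq: "p z = q z" if "z \<in> an" for z
        using fun_cong[OF q(2), of z] that i.b_a by auto
      have "g x \<in> an" using \<open>g ` an = an\<close> xan by blast
      then have "p (g x) = p x" using pq[of "g x"] pq[OF xan] q(1) g(1) xan i.b_a by auto
      then show False using pg by simp
    qed
    ultimately show ?thesis using s1 poly_sub by blast
  qed
  show ?thesis
    using part1 part2 weyl_sub poly_sub ext_stab ext_inv by (intro conjI impI allI) simp_all
qed

end
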